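(* Let $1<k\le n/2$ and $B=B_{k,n}$. Let $I$ be an almost consecutive $k$-subset of $\mathbb{Z}_n$, written $I=\{i,\,j,\,j+1,\dots,j+k-2\}$ (elements modulo $n$) with $\{i\}$ and $\{j,\dots,j+k-2\}$ its two intervals, and let $J$ be the $k$-subset such that $L_J=\Omega(L_I)$. Then there is an Auslander--Reiten sequence in $\mathrm{CM}(B)$ $$L_I\to \frac{L_X}{L_Y}\to L_J,$$ where $X=\{i+1,\,j,\,j+1,\dots,j+k-3,\,j+k-1\}$ and $Y=(I\cup J)\setminus X$ (union and difference taken with multiplicities, i.e. $Y=\{i,\,i+2,\dots,i+k-1,\,j+k-2\}$). The middle term $\frac{L_X}{L_Y}$ is a rigid rank $2$ module, which is indecomposable if and only if $X$ (and $Y$) are almost consecutive.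
   Context: The algebra $B=B_{k,n}$: take the quiver with vertex set $\mathbb{Z}_n$ and, for each $i\in\mathbb{Z}_n$, arrows $x_i\colon i-1\to i$ and $y_i\colon i\to i-1$. $B$ is the completed path algebra over $\mathbb{C}$ (completion with respect to the ideal generated by the arrows) modulo the closure of the ideal generated by the relations $xy=yx$ and $x^k=y^{n-k}$ at every vertex (subscripts determined by the starting vertex). Its center is $Z=\mathbb{C}[[t]]$, $t=\sum_i x_iy_i$. Modules are left modules, i.e. representations of the quiver with relations. $\mathrm{CM}(B)$ is the category of (maximal) Cohen--Macaulay $B$-modules, i.e. finitely generated $B$-modules that are free over $Z$; the rank of such a module $M$ is the $Z$-rank of $e_iM$ (the same for every vertex $i$). For a $k$-subset $I$ of $\mathbb{Z}_n$, $L_I$ is the rank 1 module with $\mathbb{C}[[t]]$ at each vertex, $x_i$ acting by $1$ if $i\in I$ and by $t$ if $i\notin I$, and $y_i$ acting by $t$ if $i\in I$ and by $1$ if $i\notin I$. $\Omega$ denotes the syzygy (kernel of a projective cover). A module $M$ is rigid if $\mathrm{Ext}^1_B(M,M)=0$. The notation $\frac{L_X}{L_Y}$ (also $L_X\mid L_Y$) denotes a rank 2 module filtered by rank 1 modules with submodule $L_Y$ and quotient $L_X$. A $k$-subset of $\mathbb{Z}_n$ is almost consecutive if it is a union of two (disjoint, non-adjacent) cyclic intervals, one of them consisting of a single element. For $I=\{i,j,\dots,j+k-2\}$ almost consecutive one has $\Omega(L_I)=L_J$ with $J=\{i+1,\dots,i+k-1,\,j+k-1\}$, which is also almost consecuti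ve.
   Formalization: The last clause is corrected to: the middle term is indecomposable if and only if X (equivalently Y) is not almost consecutive; as printed it fails, e.g. for k=2, n=4, I={1,3}, where X={2,4} is almost consecutive but the middle term is L_{12}⊕L_{34}. *)

theory Defs
  imports
    "HOL-Algebra.Module"
    "HOL-Algebra.QuotRing"
    "HOL-Computational_Algebra.Formal_Power_Series"
    "HOL-Library.Multiset"
begin

section \<open>Left modules over a (not necessarily commutative) ring\<close>

text \<open>
  The axioms are those of the library locale \<^locale>\<open>module\<close>, with \<^locale>\<open>cring\<close> replaced by
  \<^locale>\<open>ring\<close>.

  Whenever a definition below quantifies over modules, these have the same carrier type as the
  modules it is about. In the application this is \<^typ>\<open>int \<Rightarrow> complex fps\<close>, and nothing is lost:
  a finitely generated module over the algebra B below is finitely generated over the power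
  series ring, hence has an isomorphic copy whose carrier is a set of elements of this type.
\<close>

locale left_module = R?: ring R + M?: abelian_group M
  for R :: "'r ring" (structure) and M :: "('r, 'm) module" (structure) +
  assumes smult_closed:
      "\<lbrakk>a \<in> carrier R; x \<in> carrier M\<rbrakk> \<Longrightarrow> a \<odot>\<^bsub>M\<^esub> x \<in> carrier M"
    and smult_l_distr:
      "\<lbrakk>a \<in> carrier R; b \<in> carrier R; x \<in> carrier M\<rbrakk> \<Longrightarrow>
      (a \<oplus>\<^bsub>R\<^esub> b) \<odot>\<^bsub>M\<^esub> x = a \<odot>\<^bsub>M\<^esub> x \<oplus>\<^bsub>M\<^esub> b \<odot>\<^bsub>M\<^esub> x"
    and smult_r_distr:
      "\<lbrakk>a \<in> carrier R; x \<in> carrier M; y \<in> carrier M\<rbrakk> \<Longrightarrow>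
      a \<odot>\<^bsub>M\<^esub> (x \<oplus>\<^bsub>M\<^esub> y) = a \<odot>\<^bsub>M\<^esub> x \<oplus>\<^bsub>M\<^esub> a \<odot>\<^bsub>M\<^esub> y"
    and smult_assoc1:
      "\<lbrakk>a \<in> carrier R; b \<in> carrier R; x \<in> carrier M\<rbrakk> \<Longrightarrow>
      (a \<otimes>\<^bsub>R\<^esub> b) \<odot>\<^bsub>M\<^esub> x = a \<odot>\<^bsub>M\<^esub> (b \<odot>\<^bsub>M\<^esub> x)"
    and smult_one:
      "x \<in> carrier M \<Longrightarrow> \<one>\<^bsub>R\<^esub> \<odot>\<^bsub>M\<^esub> x = x"

definition mod_hom :: "'r ring \<Rightarrow> ('r, 'm) module \<Rightarrow> ('r, 'm) module \<Rightarrow> ('m \<Rightarrow> 'm) set" where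
  "mod_hom R M N =
    {f \<in> carrier M \<rightarrow> carrier N.
       (\<forall>x\<in>carrier M. \<forall>y\<in>carrier M. f (x \<oplus>\<^bsub>M\<^esub> y) = f x \<oplus>\<^bsub>N\<^esub> f y) \<and>
       (\<forall>a\<in>carrier R. \<forall>x\<in>carrier M. f (a \<odot>\<^bsub>M\<^esub> x) = a \<odot>\<^bsub>N\<^esub> f x)}"

definition finitely_generated :: "'r ring \<Rightarrow> ('r, 'm) module \<Rightarrow> bool" where
  "finitely_generated R M \<longleftrightarrow>
    (\<exists>S. finite S \<and> S \<subseteq> carrier M \<and> (\<forall>H. submodule H R M \<and> S \<subseteq> H \<longrightarrow> H = carrier M))"

definition indecomposable :: "'r ring \<Rightarrow> ('r, 'm) module \<Rightarrow> bool" where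
  "indecomposable R M \<longleftrightarrow>
    carrier M \<noteq> {\<zero>\<^bsub>M\<^esub>} \<and>
    (\<forall>H K. submodule H R M \<and> submodule K R M \<and>
           H <+>\<^bsub>M\<^esub> K = carrier M \<and> H \<inter> K = {\<zero>\<^bsub>M\<^esub>} \<longrightarrow>
           H = {\<zero>\<^bsub>M\<^esub>} \<or> K = {\<zero>\<^bsub>M\<^esub>})"

definition short_exact ::
  "'r ring \<Rightarrow> ('r, 'm) module \<Rightarrow> ('m \<Rightarrow> 'm) \<Rightarrow> ('r, 'm) module \<Rightarrow> ('m \<Rightarrow> 'm) \<Rightarrow> ('r, 'm) module \<Rightarrow> bool"
where
  "short_exact R L f M g N \<longleftrightarrow>
    left_module R L \<and> left_module R M \<and> left_module R N \<and>
    f \<in> mod_hom R L M \<and> g \<in> mod_hom R M N \<and>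
    inj_on f (carrier L) \<and> f ` carrier L = a_kernel M N g \<and> g ` carrier M = carrier N"

definition split_mono :: "'r ring \<Rightarrow> ('r, 'm) module \<Rightarrow> ('m \<Rightarrow> 'm) \<Rightarrow> ('r, 'm) module \<Rightarrow> bool" where
  "split_mono R L f M \<longleftrightarrow> (\<exists>s\<in>mod_hom R M L. \<forall>x\<in>carrier L. s (f x) = x)"

definition split_epi :: "'r ring \<Rightarrow> ('r, 'm) module \<Rightarrow> ('m \<Rightarrow> 'm) \<Rightarrow> ('r, 'm) module \<Rightarrow> bool" where
  "split_epi R M g N \<longleftrightarrow> (\<exists>s\<in>mod_hom R N M. \<forall>x\<in>carrier N. g (s x) = x)"

subsection \<open>Projective covers and syzygies\<close>

definition projective :: "'r ring \<Rightarrow> ('r, 'm) module \<Rightarrow> bool" where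
  "projective R P \<longleftrightarrow>
    left_module R P \<and>
    (\<forall>M N g h. left_module R M \<and> left_module R N \<and>
       g \<in> mod_hom R M N \<and> g ` carrier M = carrier N \<and> h \<in> mod_hom R P N \<longrightarrow>
       (\<exists>u\<in>mod_hom R P M. \<forall>x\<in>carrier P. g (u x) = h x))"

definition projective_cover ::
  "'r ring \<Rightarrow> ('r, 'm) module \<Rightarrow> ('m \<Rightarrow> 'm) \<Rightarrow> ('r, 'm) module \<Rightarrow> bool"
where
  "projective_cover R P p M \<longleftrightarrow>
    projective R P \<and> left_module R M \<and> p \<in> mod_hom R P M \<and> p ` carrier P = carrier M \<and>
    (\<forall>H. submodule H R P \<and> H <+>\<^bsub>P\<^esub> a_kernel P M p = carrier P \<longrightarrow> H = carrier P)"

definition is_syzygy :: "'r ring \<Rightarrow> ('r, 'm) module \<Rightarrow> ('r, 'm) module \<Rightarrow> bool" where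
  "is_syzygy R K M \<longleftrightarrow>
    (\<exists>P p q. projective_cover R P p M \<and> short_exact R K q P p M)"

subsection \<open>Extensions and rigidity\<close>

text \<open>
  Ext is taken in Yoneda's form: the set of equivalence classes of short exact sequences
  \<open>0 \<rightarrow> N \<rightarrow> E \<rightarrow> M \<rightarrow> 0\<close>. As the class of the split sequence is the zero of this group, the
  group vanishes iff the set is a singleton. In the equivalence relation the map \<open>u\<close> is an
  isomorphism by the five lemma.
\<close>

definition extensions ::
  "'r ring \<Rightarrow> ('r, 'm) module \<Rightarrow> ('r, 'm) module \<Rightarrow> (('r, 'm) module \<times> ('m \<Rightarrow> 'm) \<times> ('m \<Rightarrow> 'm)) set"
where
  "extensions R M N = {(E, f, g). short_exact R N f E g M}"

definition ext_equiv ::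
  "'r ring \<Rightarrow> ('r, 'm) module \<Rightarrow> ('r, 'm) module \<Rightarrow>
   (('r, 'm) module \<times> ('m \<Rightarrow> 'm) \<times> ('m \<Rightarrow> 'm)) rel"
where
  "ext_equiv R M N =
    {((E, f, g), (E', f', g')).
       (E, f, g) \<in> extensions R M N \<and> (E', f', g') \<in> extensions R M N \<and>
       (\<exists>u\<in>mod_hom R E E'.
          (\<forall>x\<in>carrier N. u (f x) = f' x) \<and> (\<forall>x\<in>carrier E. g' (u x) = g x))}"

definition Ext1 ::
  "'r ring \<Rightarrow> ('r, 'm) module \<Rightarrow> ('r, 'm) module \<Rightarrow>
   (('r, 'm) module \<times> ('m \<Rightarrow> 'm) \<times> ('m \<Rightarrow> 'm)) set set"
where
  "Ext1 R M N = extensions R M N // ext_equiv R M N"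

definition rigid :: "'r ring \<Rightarrow> ('r, 'm) module \<Rightarrow> bool" where
  "rigid R M \<longleftrightarrow> is_singleton (Ext1 R M M)"

subsection \<open>Auslander--Reiten sequences in a full subcategory\<close>

definition left_almost_split ::
  "'r ring \<Rightarrow> (('r, 'm) module \<Rightarrow> bool) \<Rightarrow> ('r, 'm) module \<Rightarrow> ('m \<Rightarrow> 'm) \<Rightarrow> ('r, 'm) module \<Rightarrow> bool"
where
  "left_almost_split R \<C> L f M \<longleftrightarrow>
    \<not> split_mono R L f M \<and>
    (\<forall>W h. \<C> W \<and> h \<in> mod_hom R L W \<and> \<not> split_mono R L h W \<longrightarrow>
       (\<exists>u\<in>mod_hom R M W. \<forall>x\<in>carrier L. u (f x) = h x))"

definition right_almost_split ::
  "'r ring \<Rightarrow> (('r, 'm) module \<Rightarrow> bool) \<Rightarrow> ('r, 'm) module \<Rightarrow> ('m \<Rightarrow> 'm) \<Rightarrow> ('r, 'm) module \<Rightarrow> bool"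
where
  "right_almost_split R \<C> M g N \<longleftrightarrow>
    \<not> split_epi R M g N \<and>
    (\<forall>W h. \<C> W \<and> h \<in> mod_hom R W N \<and> \<not> split_epi R W h N \<longrightarrow>
       (\<exists>u\<in>mod_hom R W M. \<forall>x\<in>carrier W. g (u x) = h x))"

definition AR_sequence ::
  "'r ring \<Rightarrow> (('r, 'm) module \<Rightarrow> bool) \<Rightarrow>
   ('r, 'm) module \<Rightarrow> ('m \<Rightarrow> 'm) \<Rightarrow> ('r, 'm) module \<Rightarrow> ('m \<Rightarrow> 'm) \<Rightarrow> ('r, 'm) module \<Rightarrow> bool"
where
  "AR_sequence R \<C> L f M g N \<longleftrightarrow>
    \<C> L \<and> \<C> M \<and> \<C> N \<and> short_exact R L f M g N \<and>
    left_almost_split R \<C> L f M \<and> right_almost_split R \<C> M g N"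

section \<open>The algebra B\<close>

text \<open>
  The vertices are the integers \<open>0, \<dots>, n - 1\<close>. Every vertex \<open>i\<close> is the source of exactly two arrows,
  \<open>x\<^sub>i\<^sub>+\<^sub>1 : i \<rightarrow> i + 1\<close> and \<open>y\<^sub>i : i \<rightarrow> i - 1\<close>, so a path is determined by its start vertex and a word
  in the letters \<open>Fwd\<close> (an x-arrow) and \<open>Bwd\<close> (a y-arrow), listed in the order in which the arrows
  are traversed.
\<close>

datatype step = Fwd | Bwd

type_synonym path = "int \<times> step list"

definition vertices :: "nat \<Rightarrow> int set" where
  "vertices n = {0..<int n}"

primrec next_vertex :: "nat \<Rightarrow> int \<Rightarrow> step \<Rightarrow> int" where
  "next_vertex n i Fwd = (i + 1) mod int n"
| "next_vertex n i Bwd = (i - 1) mod int n"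

definition path_target :: "nat \<Rightarrow> int \<Rightarrow> step list \<Rightarrow> int" where
  "path_target n i w = foldl (next_vertex n) i w"

text \<open>
  There are finitely many paths of each length, so the completion of the path algebra at the ideal
  generated by the arrows consists of all functions from paths to the complex numbers (formal,
  possibly infinite, linear combinations of paths). In a product the right factor is traversed
  first, so that left modules are representations of the quiver.
\<close>

definition completed_path_algebra :: "nat \<Rightarrow> (path \<Rightarrow> complex) ring" where
  "completed_path_algebra n =
    \<lparr>carrier = {a. \<forall>i w. i \<notin> vertices n \<longrightarrow> a (i, w) = 0},
     monoid.mult = (\<lambda>a b (i, w). \<Sum>l\<le>length w. a (path_target n i (take l w), drop l w) * b (i, take l w)),
     one = (\<lambda>(i, w). if i \<in> vertices n \<and> w = [] then 1 else 0),
     zero = (\<lambda>_. 0),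
     add = (\<lambda>a b p. a p + b p)\<rparr>"

definition path_elem :: "path \<Rightarrow> path \<Rightarrow> complex" where
  "path_elem p = (\<lambda>q. if q = p then 1 else 0)"

definition relations :: "nat \<Rightarrow> nat \<Rightarrow> (path \<Rightarrow> complex) set" where
  "relations n k =
    (\<Union>i\<in>vertices n.
       {path_elem (i, [Bwd, Fwd]) \<ominus>\<^bsub>completed_path_algebra n\<^esub> path_elem (i, [Fwd, Bwd]),
        path_elem (i, replicate k Fwd)
          \<ominus>\<^bsub>completed_path_algebra n\<^esub> path_elem (i, replicate (n - k) Bwd)})"

text \<open>Closure in the arrow-adic topology: agreement modulo the \<open>N\<close>-th power of the (closed) arrow
  ideal is agreement on all paths of length less than \<open>N\<close>.\<close>

definition arrow_closure :: "nat \<Rightarrow> (path \<Rightarrow> complex) set \<Rightarrow> (path \<Rightarrow> complex) set" where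
  "arrow_closure n S =
    {a \<in> carrier (completed_path_algebra n).
       \<forall>N. \<exists>b\<in>S. \<forall>i w. length w < N \<longrightarrow> a (i, w) = b (i, w)}"

definition rel_ideal :: "nat \<Rightarrow> nat \<Rightarrow> (path \<Rightarrow> complex) set" where
  "rel_ideal n k = arrow_closure n (Idl\<^bsub>completed_path_algebra n\<^esub> (relations n k))"

definition B_alg :: "nat \<Rightarrow> nat \<Rightarrow> (path \<Rightarrow> complex) set ring" where
  "B_alg n k = completed_path_algebra n Quot rel_ideal n k"

definition B_class :: "nat \<Rightarrow> nat \<Rightarrow> (path \<Rightarrow> complex) \<Rightarrow> (path \<Rightarrow> complex) set" where
  "B_class n k a = rel_ideal n k +>\<^bsub>completed_path_algebra n\<^esub> a"

definition vertex_idem :: "nat \<Rightarrow> nat \<Rightarrow> int \<Rightarrow> (path \<Rightarrow> complex) set" where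
  "vertex_idem n k i = B_class n k (path_elem (i, []))"

text \<open>The embedding of the power series ring Z into B, sending the variable to \<open>t = \<Sum>\<^sub>i x\<^sub>i y\<^sub>i\<close>; the
  \<open>m\<close>-th power of \<open>x\<^sub>i y\<^sub>i\<close> is the path that starts at \<open>i\<close> and has the word \<open>(Bwd Fwd)\<^sup>m\<close>.\<close>

definition Z_emb :: "nat \<Rightarrow> nat \<Rightarrow> complex fps \<Rightarrow> (path \<Rightarrow> complex) set" where
  "Z_emb n k c = B_class n k
    (\<lambda>(i, w). if i \<in> vertices n \<and> (\<exists>m. w = concat (replicate m [Bwd, Fwd]))
              then fps_nth c (length w div 2) else 0)"

section \<open>Cohen--Macaulay modules\<close>

type_synonym 'm B_module = "((path \<Rightarrow> complex) set, 'm) module"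

text \<open>\<open>S\<close> is a Z-basis of the Z-submodule \<open>A\<close> of \<open>M\<close>.\<close>

definition Z_basis :: "nat \<Rightarrow> nat \<Rightarrow> 'm B_module \<Rightarrow> 'm set \<Rightarrow> 'm set \<Rightarrow> bool" where
  "Z_basis n k M A S \<longleftrightarrow>
    S \<subseteq> A \<and>
    (\<forall>x\<in>A. \<exists>!c. finite {s. c s \<noteq> 0} \<and> {s. c s \<noteq> 0} \<subseteq> S \<and>
       x = (\<Oplus>\<^bsub>M\<^esub>s\<in>{s. c s \<noteq> 0}. Z_emb n k (c s) \<odot>\<^bsub>M\<^esub> s))"

definition CM :: "nat \<Rightarrow> nat \<Rightarrow> 'm B_module \<Rightarrow> bool" where
  "CM n k M \<longleftrightarrow>
    left_module (B_alg n k) M \<and> finitely_generated (B_alg n k) M \<and>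
    (\<exists>S. Z_basis n k M (carrier M) S)"

definition has_rank :: "nat \<Rightarrow> nat \<Rightarrow> 'm B_module \<Rightarrow> nat \<Rightarrow> bool" where
  "has_rank n k M r \<longleftrightarrow>
    (\<forall>i\<in>vertices n. \<exists>S. Z_basis n k M ((\<lambda>x. vertex_idem n k i \<odot>\<^bsub>M\<^esub> x) ` carrier M) S \<and>
       finite S \<and> card S = r)"

subsection \<open>The rank one modules\<close>

text \<open>The path \<open>(i, w)\<close> acts on the rank one module of \<open>I\<close> by \<open>t\<close> to the power
  \<open>path_weight n I i w\<close>: the step \<open>i \<rightarrow> i + 1\<close> is \<open>x\<^sub>i\<^sub>+\<^sub>1\<close> and the step \<open>i \<rightarrow> i - 1\<close> is \<open>y\<^sub>i\<close>.\<close>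

fun path_weight :: "nat \<Rightarrow> int set \<Rightarrow> int \<Rightarrow> step list \<Rightarrow> nat" where
  "path_weight n I i [] = 0"
| "path_weight n I i (Fwd # w) =
    (if (i + 1) mod int n \<in> I then 0 else 1) + path_weight n I ((i + 1) mod int n) w"
| "path_weight n I i (Bwd # w) =
    (if i \<in> I then 1 else 0) + path_weight n I ((i - 1) mod int n) w"

text \<open>A formal combination \<open>a\<close> of paths acts on \<open>v\<close> by summing \<open>a p * t ^ weight p * v (source p)\<close>
  over all paths \<open>p\<close> ending at a given vertex. Only finitely many paths contribute to each
  coefficient if \<open>I\<close> is neither empty nor the whole vertex set.\<close>

definition series_act ::
  "nat \<Rightarrow> int set \<Rightarrow> (path \<Rightarrow> complex) \<Rightarrow> (int \<Rightarrow> complex fps) \<Rightarrow> int \<Rightarrow> complex fps"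
where
  "series_act n I a v = (\<lambda>j. Abs_fps (\<lambda>m.
     \<Sum>(i, w) \<in> {(i, w). i \<in> vertices n \<and> path_target n i w = j \<and> path_weight n I i w \<le> m}.
       a (i, w) * fps_nth (v i) (m - path_weight n I i w)))"

text \<open>An element of B acts through any of its representatives. The multiplicative fields of the
  module record are not used.\<close>

definition L_mod :: "nat \<Rightarrow> int set \<Rightarrow> (int \<Rightarrow> complex fps) B_module" where
  "L_mod n I =
    \<lparr>carrier = {v. \<forall>j. j \<notin> vertices n \<longrightarrow> v j = 0},
     monoid.mult = undefined, one = undefined,
     zero = (\<lambda>_. 0), add = (\<lambda>u v j. u j + v j),
     smult = (\<lambda>b v. series_act n I (SOME a. a \<in> b) v)\<rparr>"

section \<open>Almost consecutive subsets\<close>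

definition mod_set :: "nat \<Rightarrow> int set \<Rightarrow> int set" where
  "mod_set n S = (\<lambda>a. a mod int n) ` S"

text \<open>The cyclic intervals \<open>{i}\<close> and \<open>{j, \<dots>, j + m - 1}\<close> are disjoint and not adjacent.\<close>

definition separated :: "nat \<Rightarrow> int \<Rightarrow> int \<Rightarrow> nat \<Rightarrow> bool" where
  "separated n i j m \<longleftrightarrow> i mod int n \<notin> mod_set n {j - 1..j + int m}"

definition almost_consecutive :: "nat \<Rightarrow> int set \<Rightarrow> bool" where
  "almost_consecutive n S \<longleftrightarrow>
    (\<exists>i j m. 1 \<le> m \<and> separated n i j m \<and> S = mod_set n ({i} \<union> {j..j + int m - 1}))"

text \<open>
  For \<open>k = 2\<close>, \<open>n = 4\<close> the Auslander--Reiten sequence starting at the module of \<open>{1, 3}\<close> has the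
  decomposable middle term \<open>L {1, 2} \<oplus> L {3, 4}\<close>, and \<open>X = {2, 4}\<close>, \<open>Y = {1, 3}\<close> are almost
  consecutive; for \<open>k = 3\<close>, \<open>n = 6\<close> the one starting at \<open>{1, 2, 4}\<close> has the indecomposable middle
  term with \<open>X = {1, 3, 5}\<close>, \<open>Y = {2, 4, 6}\<close>, which are not almost consecutive. So the
  middle term is indecomposable iff \<open>X\<close>, equivalently \<open>Y\<close>, is \<^emph>\<open>not\<close> almost consecutive.
\<close>

end

theory Submission
  imports Defs
begin

text \<open>
  Every rank one module acts faithfully, and this identifies B with a tiled order over the power
  series ring: the matrix entry from \<open>c\<close> to \<open>d\<close> ranges over the multiples of \<open>X ^ wt T c d\<close>. Inside
  a fixed rank one module \<open>L S\<close> all others become submodules given by the powers of the variable \<open>X\<close>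
  at the vertices. The middle term is the submodule of \<open>L S \<oplus> L S\<close> of the pairs \<open>(a, b)\<close> with
  \<open>X ^ p1 | a\<close>, \<open>X ^ p2 | b\<close> and \<open>X ^ pJ | a + b\<close>, where \<open>p1\<close> and \<open>p2\<close> belong to the projectives that
  form the injective hull of \<open>L I\<close>; the maps are \<open>x \<mapsto> (x, - x)\<close> and \<open>(a, b) \<mapsto> a + b\<close>. Projecting
  to \<open>a - b\<close> instead gives the filtration by \<open>L Y\<close> and \<open>L X\<close>.

  A map \<open>W \<rightarrow> L J\<close> is not a split epimorphism iff it sends every pair of compatible elements at the
  two peaks of \<open>J\<close> to multiples of \<open>X\<close>. These pairs form a pure submodule of \<open>W\<close>, and composing a
  projection onto it with the map and dividing by \<open>X\<close> gives functionals which define the lift. Dually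
  for maps out of \<open>L I\<close>.

  For rigidity, maps into a projective extend along every short exact sequence of Cohen--Macaulay
  modules, because such a map is a functional on one component. Extending \<open>a\<close>, \<open>b\<close> and \<open>a + b\<close> and
  correcting by such maps retracts the sequence. Finally, if \<open>L I\<close> is not contained in \<open>L J\<close>
  inside \<open>L S\<close>, the divisibility conditions force endomorphisms of the middle term to be scalar
  modulo \<open>X\<close>; otherwise it is a direct sum.
\<close>

unbundle fps_syntax

section \<open>Paths, weights and degrees\<close>

text \<open>Let P1 and P2 be the submodules of \<open>L S\<close> with exponents \<open>p1\<close>
  and \<open>p2\<close>. They intersect in \<open>L I\<close>, so P1 + P2 is the cokernel of
  \<open>L I\<close> in its injective hull, and the middle term is the pullback of the sum map from
  P1 x P2 to P1 + P2 along the inclusion of \<open>L J\<close>. That this class is almost split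
  shows in the exponents: at \<open>i\<close> the generator of \<open>L J\<close> lies in P2 and
  misses P1 by exactly one power of the variable, at \<open>v\<close> it lies in P1 and misses P2 by
  one. The injective hull of \<open>L J\<close> consists of two further projectives, which at the
  same time form the projective cover of \<open>L I\<close>; this is where the syzygy enters. As
  \<open>L J\<close> is given only as the kernel of some projective cover, the set \<open>J\<close>
  has to be recovered from the action of paths on such a kernel. The algebra is a completion given
  by relations, and a general module is known only through an abstract action. Both become
  manageable because B is spanned over the power series ring by one shortest path for each pair of
  vertices. Maps are often first built after multiplication by a high power of the variable and then
  divided, which torsion-freeness permits.\<close>

lemma path_target_simps [simp]:
  "path_target n i [] = i"
  "path_target n i (s # w) = path_target n (next_vertex n i s) w"
  "path_target n i (u @ w) = path_target n (path_target n i u) w"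
  by (simp_all add: path_target_def)

lemma path_weight_append:
  "path_weight n T i (u @ w) = path_weight n T i u + path_weight n T (path_target n i u) w"
proof (induction u arbitrary: i)
  case (Cons s u)
  then show ?case by (cases s) simp_all
qed simp

text \<open>Both relations are homogeneous for this degree: each side of xy = yx has degree n, and k
  steps forward cost as much as n - k steps backward, namely k(n - k).\<close>

definition path_degree :: "nat \<Rightarrow> nat \<Rightarrow> step list \<Rightarrow> nat" where
  "path_degree n k w = (n - k) * count_list w Fwd + k * count_list w Bwd"

lemma path_degree_simps [simp]:
  "path_degree n k [] = 0"
  "path_degree n k (Fwd # w) = (n - k) + path_degree n k w"
  "path_degree n k (Bwd # w) = k + path_degree n k w"
  "path_degree n k (u @ w) = path_degree n k u + path_degree n k w"
  by (simp_all add: path_degree_def algebra_simps)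

lemma count_list_replicate: "count_list (replicate m x) y = (if x = y then m else 0)"
  by (induction m) auto

lemma path_degree_replicate [simp]:
  "path_degree n k (replicate m Fwd) = m * (n - k)"
  "path_degree n k (replicate m Bwd) = m * k"
  by (simp_all add: path_degree_def count_list_replicate)

lemma count_list_steps: "count_list w Fwd + count_list w Bwd = length w"
proof (induction w)
  case (Cons s w)
  then show ?case by (cases s) auto
qed simp

lemma finite_bounded_words: "finite {w :: step list. length w \<le> N}"
proof -
  have "(UNIV :: step set) = {Fwd, Bwd}"
    using step.exhaust by blast
  then have "finite (UNIV :: step set)" by (metis finite.emptyI finite_insert)
  from finite_lists_length_le[OF this, of N] show ?thesis by simp
qed

text \<open>The potential of \<open>T\<close> measures how far the weight on the module of \<open>T\<close> deviates from the
  degree, for which the relations are homogeneous.\<close>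

definition potential :: "nat \<Rightarrow> nat \<Rightarrow> int set \<Rightarrow> int \<Rightarrow> int" where
  "potential n k T c = int k * c - int n * int (card (T \<inter> {0..c}))"

text \<open>The entry from \<open>i\<close> to \<open>j\<close> is the series by which
  \<open>a\<close> maps the component at \<open>i\<close> of the module of \<open>T\<close> to the
  component at \<open>j\<close>. For a k-subset \<open>T\<close> the sums are finite by
  \<open>finite_weight_class\<close>.\<close>

definition path_algebra_matrix ::
  "nat \<Rightarrow> int set \<Rightarrow> (path \<Rightarrow> complex) \<Rightarrow> int \<Rightarrow> int \<Rightarrow> complex fps" where
  "path_algebra_matrix n T a i j =
     Abs_fps (\<lambda>m. \<Sum>w | path_target n i w = j \<and> path_weight n T i w = m. a (i, w))"

locale kn =
  fixes n k :: nat
  assumes k_pos: "0 < k" and k_less: "k < n"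
begin

abbreviation "A \<equiv> completed_path_algebra n"
abbreviation "V \<equiv> vertices n"
abbreviation "pt \<equiv> path_target n"
abbreviation "pw \<equiv> path_weight n"
abbreviation "deg \<equiv> path_degree n k"
abbreviation "pot \<equiv> potential n k"
abbreviation "mt \<equiv> path_algebra_matrix n"

definition kset :: "int set \<Rightarrow> bool" where
  "kset T \<longleftrightarrow> T \<subseteq> V \<and> card T = k"

lemma n_pos: "0 < n" using k_pos k_less by simp

lemma next_vertex_in [simp]: "next_vertex n i s \<in> V"
  using n_pos by (cases s) (auto simp: vertices_def)

lemma mod_in_V [simp]: "x mod int n \<in> V"
  using n_pos by (auto simp: vertices_def)

lemma V_mod: "i \<in> V \<Longrightarrow> i mod int n = i"
  by (auto simp: vertices_def)

lemma finite_V [simp]: "finite V" by (simp add: vertices_def)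

lemma pt_in [simp]: "i \<in> V \<Longrightarrow> pt i w \<in> V"
  by (induction w arbitrary: i) simp_all

lemma pt_count: "i \<in> V \<Longrightarrow> pt i w = (i + int (count_list w Fwd) - int (count_list w Bwd)) mod int n"
proof (induction w arbitrary: i)
  case Nil
  then show ?case by (simp add: V_mod)
next
  case (Cons s w)
  have m: "(x mod int n + a - b) mod int n = (x + (a - b)) mod int n" for x a b :: int
    by (metis add_diff_eq mod_add_left_eq)
  have "pt i (s # w) = (next_vertex n i s + int (count_list w Fwd) - int (count_list w Bwd)) mod int n"
    by (simp add: Cons.IH)
  then show ?case
    by (cases s) (simp_all only: m next_vertex.simps, simp_all add: algebra_simps)
qed

lemma length_le_deg: "length w \<le> deg w"
proof -
  have "count_list w Fwd \<le> (n - k) * count_list w Fwd" "count_list w Bwd \<le> k * count_list w Bwd"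
    using k_pos k_less by (simp_all add: Suc_le_eq)
  then show ?thesis
    unfolding path_degree_def count_list_steps[of w, symmetric] by linarith
qed

lemma pot_step:
  assumes "kset T" "c \<in> V"
  shows "pot T ((c + 1) mod int n) = pot T c + int k - (if (c + 1) mod int n \<in> T then int n else 0)"
proof (cases "c + 1 < int n")
  case True
  then have m: "(c + 1) mod int n = c + 1" using assms by (auto simp: vertices_def)
  have f: "finite (T \<inter> {0..c})" by simp
  have "T \<inter> {0..c + 1} = (if c + 1 \<in> T then insert (c + 1) (T \<inter> {0..c}) else T \<inter> {0..c})"
    using assms by (auto simp: vertices_def le_less)
  then have "card (T \<inter> {0..c + 1}) = card (T \<inter> {0..c}) + (if c + 1 \<in> T then 1 else 0)"
    using f by simp
  then show ?thesis unfolding m potential_def by (simp add: algebra_simps)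
next
  case False
  \<comment> \<open>Passing from the last vertex to 0: the full count \<open>card T = k\<close>
    makes the potential equal to - k at the last vertex, so the step rule also holds across
    0.\<close>
  then have c: "c = int n - 1" using assms by (auto simp: vertices_def)
  have "T \<inter> {0..c} = T" using assms(1) c by (auto simp: kset_def vertices_def)
  then have 1: "pot T c = int k * c - int n * int k" using assms(1) by (simp add: potential_def kset_def)
  have "T \<inter> {0..0} = (if 0 \<in> T then {0} else {})" by auto
  then have 2: "pot T 0 = - (if 0 \<in> T then int n else 0)" by (simp add: potential_def)
  have 3: "(c + 1) mod int n = 0" using c by simp
  have "pot T c = - int k" using 1 unfolding c by (simp add: algebra_simps)
  then show ?thesis using 2 3 by simp
qed

text \<open>Each step changes n times the weight minus the degree by the change of potential. For
  fixed end points, weight and degree therefore determine each other, for every k-subset at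
  once.\<close>

lemma weight_degree:
  assumes "kset T" "c \<in> V"
  shows "int n * int (pw T c w) + pot T c = int (deg w) + pot T (pt c w)"
  using assms(2)
proof (induction w arbitrary: c)
  case (Cons s w)
  show ?case
  proof (cases s)
    case Fwd
    have IH: "int n * int (pw T ((c + 1) mod int n) w) + pot T ((c + 1) mod int n)
      = int (deg w) + pot T (pt ((c + 1) mod int n) w)" by (rule Cons.IH) simp
    then show ?thesis using pot_step[OF assms(1) Cons.prems] k_less
      by (auto simp: Fwd of_nat_diff algebra_simps split: if_splits)
  next
    case Bwd
    have IH: "int n * int (pw T ((c - 1) mod int n) w) + pot T ((c - 1) mod int n)
      = int (deg w) + pot T (pt ((c - 1) mod int n) w)" by (rule Cons.IH) simp
    have "((c - 1) mod int n + 1) mod int n = c" using Cons.prems by (simp add: mod_simps V_mod)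
    then show ?thesis using pot_step[OF assms(1), of "(c - 1) mod int n"] IH
      by (auto simp: Bwd algebra_simps split: if_splits)
  qed
qed simp

lemma weight_eq_iff:
  assumes "kset T" "c \<in> V" "pt c w = pt c w'"
  shows "pw T c w = pw T c w' \<longleftrightarrow> deg w = deg w'"
proof -
  have "int n * int (pw T c w) - int (deg w) = int n * int (pw T c w') - int (deg w')"
    using weight_degree[OF assms(1,2), of w] weight_degree[OF assms(1,2), of w'] assms(3) by simp
  then show ?thesis using n_pos by auto
qed

text \<open>A weight and two end points fix the degree, which bounds the length. This is why
  infinite combinations of paths act by power series.\<close>

lemma finite_weight_class:
  assumes "kset T" "i \<in> V"
  shows "finite {w. pt i w = j \<and> pw T i w = m}"
proof -
  have "length w \<le> nat (int n * int m + pot T i - pot T j)" if "pt i w = j" "pw T i w = m" for w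
    using weight_degree[OF assms, of w] that length_le_deg[of w] by simp
  then have "{w. pt i w = j \<and> pw T i w = m} \<subseteq> {w. length w \<le> nat (int n * int m + pot T i - pot T j)}"
    by blast
  then show ?thesis using finite_bounded_words finite_subset by blast
qed

section \<open>The completed path algebra as a ring\<close>

lemma A_simps:
  "a \<in> carrier A \<longleftrightarrow> (\<forall>i w. i \<notin> V \<longrightarrow> a (i, w) = 0)"
  "\<zero>\<^bsub>A\<^esub> = (\<lambda>_. 0)"
  "\<one>\<^bsub>A\<^esub> = (\<lambda>(i, w). if i \<in> V \<and> w = [] then 1 else 0)"
  "a \<oplus>\<^bsub>A\<^esub> b = (\<lambda>p. a p + b p)"
  "(a \<otimes>\<^bsub>A\<^esub> b) (i, w) = (\<Sum>l\<le>length w. a (pt i (take l w), drop l w) * b (i, take l w))"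
  by (simp_all add: completed_path_algebra_def)

lemma A_mult_assoc: "(a \<otimes>\<^bsub>A\<^esub> b) \<otimes>\<^bsub>A\<^esub> c = a \<otimes>\<^bsub>A\<^esub> (b \<otimes>\<^bsub>A\<^esub> c)"
proof (rule ext, clarify)
  fix i :: int and w :: "step list"
  let ?L = "length w"
  let ?F = "\<lambda>(l :: nat) (l' :: nat). a (pt i (take (l + l') w), drop (l + l') w)
    * b (pt i (take l w), take l' (drop l w)) * c (i, take l w)"
  have "((a \<otimes>\<^bsub>A\<^esub> b) \<otimes>\<^bsub>A\<^esub> c) (i, w) = (\<Sum>l\<le>?L. \<Sum>l'\<le>?L - l. ?F l l')"
    unfolding A_simps sum_distrib_right
    by (intro sum.cong refl) (simp_all add: take_add add.commute)
  also have "\<dots> = (\<Sum>(l, l')\<in>{(l, l'). l + l' \<le> ?L}. ?F l l')"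
    by (subst sum.Sigma) (auto intro!: sum.cong)
  also have "\<dots> = (\<Sum>m\<le>?L. \<Sum>l\<le>m. ?F l (m - l))"
    by (rule sum.triangle_reindex_eq)
  also have "\<dots> = (a \<otimes>\<^bsub>A\<^esub> (b \<otimes>\<^bsub>A\<^esub> c)) (i, w)"
  proof -
    have "(\<Sum>l\<le>m. ?F l (m - l)) = (\<Sum>l\<le>length (take m w). a (pt i (take m w), drop m w)
      * (b (pt i (take l (take m w)), drop l (take m w)) * c (i, take l (take m w))))" if "m \<le> ?L" for m
      using that by (intro sum.cong) (auto simp: min_absorb1 min_absorb2 drop_take mult.assoc)
    then show ?thesis unfolding A_simps sum_distrib_left by (rule sum.cong[OF refl]) simp
  qed
  finally show "((a \<otimes>\<^bsub>A\<^esub> b) \<otimes>\<^bsub>A\<^esub> c) (i, w) = (a \<otimes>\<^bsub>A\<^esub> (b \<otimes>\<^bsub>A\<^esub> c)) (i, w)" .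
qed

lemma A_one_mult: "a \<in> carrier A \<Longrightarrow> \<one>\<^bsub>A\<^esub> \<otimes>\<^bsub>A\<^esub> a = a"
proof (rule ext, clarify)
  fix i w assume a: "a \<in> carrier A"
  have "(\<one>\<^bsub>A\<^esub> \<otimes>\<^bsub>A\<^esub> a) (i, w) = (\<Sum>l\<le>length w. if l = length w then (if pt i w \<in> V then a (i, w) else 0) else 0)"
    unfolding A_simps by (intro sum.cong) auto
  also have "\<dots> = a (i, w)"
    using a by (cases "i \<in> V") (auto simp: A_simps)
  finally show "(\<one>\<^bsub>A\<^esub> \<otimes>\<^bsub>A\<^esub> a) (i, w) = a (i, w)" .
qed

lemma A_mult_one: "a \<in> carrier A \<Longrightarrow> a \<otimes>\<^bsub>A\<^esub> \<one>\<^bsub>A\<^esub> = a"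
proof (rule ext, clarify)
  fix i w assume a: "a \<in> carrier A"
  have "(a \<otimes>\<^bsub>A\<^esub> \<one>\<^bsub>A\<^esub>) (i, w) = (\<Sum>l\<le>length w. if l = 0 then (if i \<in> V then a (i, w) else 0) else 0)"
    unfolding A_simps by (intro sum.cong) auto
  also have "\<dots> = a (i, w)"
    using a by (auto simp: A_simps)
  finally show "(a \<otimes>\<^bsub>A\<^esub> \<one>\<^bsub>A\<^esub>) (i, w) = a (i, w)" .
qed

lemma A_mult_closed: "b \<in> carrier A \<Longrightarrow> a \<otimes>\<^bsub>A\<^esub> b \<in> carrier A"
  by (simp add: A_simps)

lemma A_abelian_group: "abelian_group A"
proof (rule abelian_groupI)
  fix x assume "x \<in> carrier A"
  then show "\<exists>y\<in>carrier A. y \<oplus>\<^bsub>A\<^esub> x = \<zero>\<^bsub>A\<^esub>"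
    by (intro bexI[of _ "\<lambda>p. - x p"]) (auto simp: A_simps)
qed (auto simp: A_simps ac_simps)

lemma A_ring: "ring A"
proof (rule ringI)
  show "abelian_group A" by (rule A_abelian_group)
  show "monoid A"
    by (rule monoidI) (auto simp: A_mult_closed A_mult_assoc A_one_mult A_mult_one, auto simp: A_simps)
  show "(x \<oplus>\<^bsub>A\<^esub> y) \<otimes>\<^bsub>A\<^esub> z = x \<otimes>\<^bsub>A\<^esub> z \<oplus>\<^bsub>A\<^esub> y \<otimes>\<^bsub>A\<^esub> z" for x y z
    by (rule ext, clarify) (simp add: A_simps sum.distrib algebra_simps)
  show "z \<otimes>\<^bsub>A\<^esub> (x \<oplus>\<^bsub>A\<^esub> y) = z \<otimes>\<^bsub>A\<^esub> x \<oplus>\<^bsub>A\<^esub> z \<otimes>\<^bsub>A\<^esub> y" for x y z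
    by (rule ext, clarify) (simp add: A_simps sum.distrib algebra_simps)
qed

sublocale A: ring A by (rule A_ring)

lemma A_uminus: "a \<in> carrier A \<Longrightarrow> \<ominus>\<^bsub>A\<^esub> a = (\<lambda>p. - a p)"
  by (rule A.minus_equality) (auto simp: A_simps)

lemma A_minus: "b \<in> carrier A \<Longrightarrow> a \<ominus>\<^bsub>A\<^esub> b = (\<lambda>p. a p - b p)"
  by (simp add: a_minus_def A_uminus) (simp add: A_simps)

lemma path_elem_in [simp]: "i \<in> V \<Longrightarrow> path_elem (i, w) \<in> carrier A"
  by (auto simp: path_elem_def A_simps)

lemma path_elem_mult:
  "path_elem (pt i u, w) \<otimes>\<^bsub>A\<^esub> path_elem (i, u) = path_elem (i, u @ w)"
proof (rule ext, clarify)
  fix j v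
  have "(path_elem (pt i u, w) \<otimes>\<^bsub>A\<^esub> path_elem (i, u)) (j, v)
    = (\<Sum>l\<le>length v. if l = length u \<and> j = i \<and> v = u @ w then 1 else 0)"
    unfolding A_simps
  proof (rule sum.cong[OF refl])
    fix l assume l: "l \<in> {..length v}"
    have "drop l v = w \<and> take l v = u \<longleftrightarrow> l = length u \<and> v = u @ w"
    proof
      assume "drop l v = w \<and> take l v = u"
      then show "l = length u \<and> v = u @ w" using l by (metis append_take_drop_id atMost_iff length_take min.absorb2)
    qed auto
    then show "path_elem (pt i u, w) (pt j (take l v), drop l v) * path_elem (i, u) (j, take l v)
      = (if l = length u \<and> j = i \<and> v = u @ w then 1 else 0)"
      by (auto simp: path_elem_def)
  qed
  also have "\<dots> = path_elem (i, u @ w) (j, v)"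
    by (cases "j = i \<and> v = u @ w") (auto simp: path_elem_def)
  finally show "(path_elem (pt i u, w) \<otimes>\<^bsub>A\<^esub> path_elem (i, u)) (j, v) = path_elem (i, u @ w) (j, v)" .
qed

section \<open>Matrices over the power series ring\<close>

lemma mt_nth: "mt T a i j $ m = (\<Sum>w | pt i w = j \<and> pw T i w = m. a (i, w))"
  by (simp add: path_algebra_matrix_def)

lemma mt_add: "mt T (a \<oplus>\<^bsub>A\<^esub> b) i j = mt T a i j + mt T b i j"
  by (rule fps_ext) (simp add: mt_nth A_simps sum.distrib)

lemma mt_zero: "mt T (\<lambda>_. 0) i j = 0"
  by (rule fps_ext) (simp add: mt_nth)

lemma mt_path_elem:
  assumes "kset T" "i \<in> V"
  shows "mt T (path_elem (c, w)) i j = (if i = c \<and> pt c w = j then fps_X ^ pw T c w else 0)"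
proof (rule fps_ext)
  fix m
  have "mt T (path_elem (c, w)) i j $ m =
    (\<Sum>w' | pt i w' = j \<and> pw T i w' = m. if w' = w then (if i = c then 1 else 0) else 0)"
    unfolding mt_nth by (intro sum.cong refl) (auto simp: path_elem_def)
  also have "\<dots> = (if pt i w = j \<and> pw T i w = m then (if i = c then 1 else 0) else 0)"
    by (subst sum.delta[OF finite_weight_class[OF assms]]) simp
  also have "\<dots> = (if i = c \<and> pt c w = j then fps_X ^ pw T c w else 0) $ m"
    by (auto simp: fps_X_power_iff)
  finally show "mt T (path_elem (c, w)) i j $ m = (if i = c \<and> pt c w = j then fps_X ^ pw T c w else 0) $ m" .
qed

lemma mt_one:
  assumes "kset T" "i \<in> V"
  shows "mt T \<one>\<^bsub>A\<^esub> i j = (if i = j then 1 else 0)"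
proof (rule fps_ext)
  fix m
  have "mt T \<one>\<^bsub>A\<^esub> i j $ m = (\<Sum>w' | pt i w' = j \<and> pw T i w' = m. if w' = [] then 1 else 0)"
    unfolding mt_nth A_simps using assms(2) by (intro sum.cong refl) auto
  also have "\<dots> = (if i = j \<and> m = 0 then 1 else 0)"
    by (subst sum.delta[OF finite_weight_class[OF assms]]) auto
  finally show "mt T \<one>\<^bsub>A\<^esub> i j $ m = (if i = j then 1 else 0) $ m" by auto
qed

text \<open>A word with a marked cutting point is a pair of words. Sorting the pairs by the vertex
  at the cut and by the weight of the second word turns the convolution of paths into a matrix
  product.\<close>

lemma mt_mult:
  assumes T: "kset T" and i: "i \<in> V"
  shows "mt T (a \<otimes>\<^bsub>A\<^esub> b) i j = (\<Sum>u\<in>V. mt T a u j * mt T b i u)"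
proof (rule fps_ext)
  fix m
  let ?W = "\<lambda>i j m. {w. pt i w = j \<and> pw T i w = m}"
  let ?g = "\<lambda>(w1, w2). a (pt i w1, w2) * b (i, w1)"
  let ?P = "{(w1, w2). pt i (w1 @ w2) = j \<and> pw T i (w1 @ w2) = m}"
  have fin: "finite (?W u j m)" if "u \<in> V" for u j m using finite_weight_class[OF T that] .
  have "mt T (a \<otimes>\<^bsub>A\<^esub> b) i j $ m
    = (\<Sum>w\<in>?W i j m. \<Sum>l\<le>length w. a (pt i (take l w), drop l w) * b (i, take l w))"
    by (simp add: mt_nth A_simps)
  also have "\<dots> = (\<Sum>(w, l)\<in>Sigma (?W i j m) (\<lambda>w. {..length w}). a (pt i (take l w), drop l w) * b (i, take l w))"
    by (rule sum.Sigma) (auto intro: fin[OF i])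
  also have "\<dots> = sum ?g ?P"
    by (rule sum.reindex_bij_witness[where i = "\<lambda>(w1, w2). (w1 @ w2, length w1)" and j = "\<lambda>(w, l). (take l w, drop l w)"])
      (auto simp del: path_target_simps(3))
  also have "\<dots> = (\<Sum>((u, q), (w2, w1))\<in>Sigma (V \<times> {0..m}) (\<lambda>(u, q). ?W u j q \<times> ?W i u (m - q)). ?g (w1, w2))"
    using i
    by (intro sum.reindex_bij_witness[where
          i = "\<lambda>((u, q), (w2, w1)). (w1, w2)" and
          j = "\<lambda>(w1, w2). ((pt i w1, pw T (pt i w1) w2), (w2, w1))"])
      (auto simp: path_weight_append)
  also have "\<dots> = (\<Sum>(u, q)\<in>V \<times> {0..m}. \<Sum>(w2, w1)\<in>?W u j q \<times> ?W i u (m - q). ?g (w1, w2))"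
    by (subst sum.Sigma[symmetric]) (auto intro!: fin i sum.cong)
  also have "\<dots> = (\<Sum>u\<in>V. \<Sum>q=0..m. \<Sum>(w2, w1)\<in>?W u j q \<times> ?W i u (m - q). ?g (w1, w2))"
    by (rule sum.cartesian_product[symmetric])
  also have "\<dots> = (\<Sum>u\<in>V. \<Sum>q=0..m. (mt T a u j $ q) * (mt T b i u $ (m - q)))"
  proof (intro sum.cong refl)
    fix u q
    have "(\<Sum>(w2, w1)\<in>?W u j q \<times> ?W i u (m - q). ?g (w1, w2))
        = (\<Sum>(w2, w1)\<in>?W u j q \<times> ?W i u (m - q). a (u, w2) * b (i, w1))"
      by (intro sum.cong refl) auto
    also have "\<dots> = (\<Sum>w2\<in>?W u j q. \<Sum>w1\<in>?W i u (m - q). a (u, w2) * b (i, w1))"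
      by (rule sum.cartesian_product[symmetric])
    also have "\<dots> = (mt T a u j $ q) * (mt T b i u $ (m - q))"
      unfolding mt_nth by (rule sum_product[symmetric])
    finally show "(\<Sum>(w2, w1)\<in>?W u j q \<times> ?W i u (m - q). ?g (w1, w2)) = (mt T a u j $ q) * (mt T b i u $ (m - q))" .
  qed
  also have "\<dots> = (\<Sum>u\<in>V. mt T a u j * mt T b i u) $ m"
    by (simp add: fps_sum_nth fps_mult_nth)
  finally show "mt T (a \<otimes>\<^bsub>A\<^esub> b) i j $ m = (\<Sum>u\<in>V. mt T a u j * mt T b i u) $ m" .
qed

end


context kn
begin

section \<open>The ideal of relations\<close>

lemma kset_std: "kset {0..<int k}"
  using k_less by (auto simp: kset_def vertices_def)

section \<open>Normal forms of paths modulo the relations\<close>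

definition pcong :: "int \<Rightarrow> step list \<Rightarrow> step list \<Rightarrow> bool" where
  "pcong i w w' \<longleftrightarrow> (\<lambda>p. path_elem (i, w) p - path_elem (i, w') p) \<in> Idl\<^bsub>A\<^esub> (relations n k)"

lemma relations_subset: "relations n k \<subseteq> carrier A"
  unfolding relations_def by (auto intro!: A.minus_closed)

lemma Idl_ideal: "ideal (Idl\<^bsub>A\<^esub> (relations n k)) A"
  by (rule A.genideal_ideal[OF relations_subset])

lemmas Idl_zero_closed = additive_subgroup.zero_closed[OF ideal.axioms(1)[OF Idl_ideal]]
  and Idl_a_closed = additive_subgroup.a_closed[OF ideal.axioms(1)[OF Idl_ideal]]
  and Idl_a_inv_closed = additive_subgroup.a_inv_closed[OF ideal.axioms(1)[OF Idl_ideal]]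
  and Idl_carr = ideal.Icarr[OF Idl_ideal]
  and Idl_l_closed = ideal.I_l_closed[OF Idl_ideal]
  and Idl_r_closed = ideal.I_r_closed[OF Idl_ideal]

lemma pcong_refl: "pcong i w w"
  using Idl_zero_closed by (simp add: pcong_def A_simps)

lemma Idl_diff: "f \<in> Idl\<^bsub>A\<^esub> (relations n k) \<Longrightarrow> g \<in> Idl\<^bsub>A\<^esub> (relations n k) \<Longrightarrow>
   (\<lambda>p. f p - g p) \<in> Idl\<^bsub>A\<^esub> (relations n k)"
  using A_minus[OF Idl_carr, of g f] Idl_a_closed[of f "\<ominus>\<^bsub>A\<^esub> g"] Idl_a_inv_closed[of g]
  by (simp add: a_minus_def)

lemma pcong_sym: "pcong i w w' \<Longrightarrow> pcong i w' w"
  unfolding pcong_def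
  using Idl_diff[OF Idl_zero_closed, of "\<lambda>p. path_elem (i, w) p - path_elem (i, w') p"] by (simp add: A_simps)

lemma pcong_trans: "pcong i u v \<Longrightarrow> pcong i v w \<Longrightarrow> pcong i u w"
  unfolding pcong_def
  using Idl_a_closed[of "\<lambda>p. path_elem (i, u) p - path_elem (i, v) p" "\<lambda>p. path_elem (i, v) p - path_elem (i, w) p"]
  by (simp add: A_simps)

lemma pcong_context:
  assumes i: "i \<in> V" and r: "pcong (pt i u) r r'" and t: "pt (pt i u) r = pt (pt i u) r'"
  shows "pcong i (u @ r @ w) (u @ r' @ w)"
proof -
  let ?c = "pt i u"
  let ?d = "path_elem (?c, r) \<ominus>\<^bsub>A\<^esub> path_elem (?c, r')"
  have c: "?c \<in> V" and d: "pt ?c r \<in> V" using i by simp_all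
  have dI: "?d \<in> Idl\<^bsub>A\<^esub> (relations n k)" using r c by (simp add: pcong_def A_minus)
  have "path_elem (pt ?c r, w) \<otimes>\<^bsub>A\<^esub> ?d = path_elem (?c, r @ w) \<ominus>\<^bsub>A\<^esub> path_elem (?c, r' @ w)"
    using path_elem_mult[of ?c r w] path_elem_mult[of ?c r' w] t c d
    by (simp add: A.minus_eq A.r_distr A.r_minus)
  then have "(path_elem (pt ?c r, w) \<otimes>\<^bsub>A\<^esub> ?d) \<otimes>\<^bsub>A\<^esub> path_elem (i, u)
     = path_elem (i, u @ r @ w) \<ominus>\<^bsub>A\<^esub> path_elem (i, u @ r' @ w)"
    using path_elem_mult[of i u] c i by (simp add: A.minus_eq A.l_distr A.l_minus)
  moreover have "(path_elem (pt ?c r, w) \<otimes>\<^bsub>A\<^esub> ?d) \<otimes>\<^bsub>A\<^esub> path_elem (i, u) \<in> Idl\<^bsub>A\<^esub> (relations n k)"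
    by (intro Idl_l_closed Idl_r_closed dI path_elem_in d i)
  ultimately show ?thesis using i by (simp add: pcong_def A_minus)
qed

lemma pt_replicate_Fwd: "i \<in> V \<Longrightarrow> pt i (replicate m Fwd) = (i + int m) mod int n"
  and pt_replicate_Bwd: "i \<in> V \<Longrightarrow> pt i (replicate m Bwd) = (i - int m) mod int n"
  by (simp_all add: pt_count count_list_replicate)

lemma pcong_commute: "i \<in> V \<Longrightarrow> pcong i [Bwd, Fwd] [Fwd, Bwd]"
  using subsetD[OF A.genideal_self[OF relations_subset], of "path_elem (i, [Bwd, Fwd]) \<ominus>\<^bsub>A\<^esub> path_elem (i, [Fwd, Bwd])"]
  unfolding pcong_def by (auto simp: relations_def A_minus)

lemma pcong_power: "i \<in> V \<Longrightarrow> pcong i (replicate k Fwd) (replicate (n - k) Bwd)"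
  using subsetD[OF A.genideal_self[OF relations_subset],
      of "path_elem (i, replicate k Fwd) \<ominus>\<^bsub>A\<^esub> path_elem (i, replicate (n - k) Bwd)"]
  unfolding pcong_def by (auto simp: relations_def A_minus)

lemma pt_commute: "i \<in> V \<Longrightarrow> pt i [Bwd, Fwd] = pt i [Fwd, Bwd]"
  by (simp add: mod_simps)

lemma pt_power: "i \<in> V \<Longrightarrow> pt i (replicate k Fwd) = pt i (replicate (n - k) Bwd)"
proof -
  assume i: "i \<in> V"
  have "(i - int (n - k)) mod int n = ((i + int k) - int n) mod int n" using k_less by (simp add: of_nat_diff algebra_simps)
  also have "\<dots> = (i + int k) mod int n" by simp
  finally show ?thesis using i by (simp only: pt_replicate_Fwd pt_replicate_Bwd)
qed

lemma pt_perm: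
  "i \<in> V \<Longrightarrow> count_list w Fwd = count_list w' Fwd \<Longrightarrow> count_list w Bwd = count_list w' Bwd \<Longrightarrow> pt i w = pt i w'"
  by (simp add: pt_count)

lemma pcong_sort1:
  "i \<in> V \<Longrightarrow> pcong i (Bwd # replicate a Fwd @ w) (replicate a Fwd @ Bwd # w)"
proof (induction a arbitrary: i)
  case 0
  then show ?case by (simp add: pcong_refl)
next
  case (Suc a)
  have 1: "pcong i ([] @ [Bwd, Fwd] @ (replicate a Fwd @ w)) ([] @ [Fwd, Bwd] @ (replicate a Fwd @ w))"
    using pcong_commute[OF Suc.prems] pt_commute[OF Suc.prems] Suc.prems
    by (intro pcong_context) simp_all
  have "pcong (pt i [Fwd]) (Bwd # replicate a Fwd @ w) (replicate a Fwd @ Bwd # w)"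
    by (rule Suc.IH) simp
  then have 2: "pcong i ([Fwd] @ (Bwd # replicate a Fwd @ w) @ []) ([Fwd] @ (replicate a Fwd @ Bwd # w) @ [])"
  proof (rule pcong_context[OF Suc.prems])
    show "pt (pt i [Fwd]) (Bwd # replicate a Fwd @ w) = pt (pt i [Fwd]) (replicate a Fwd @ Bwd # w)"
      by (rule pt_perm[OF pt_in[OF Suc.prems]]) simp_all
  qed
  show ?case using pcong_trans[OF 1[simplified] 2[simplified]] by simp
qed

lemma pcong_sort:
  "i \<in> V \<Longrightarrow> pcong i w (replicate (count_list w Fwd) Fwd @ replicate (count_list w Bwd) Bwd)"
proof (induction w arbitrary: i)
  case Nil
  then show ?case by (simp add: pcong_refl)
next
  case (Cons s w)
  let ?v = "replicate (count_list w Fwd) Fwd @ replicate (count_list w Bwd) Bwd"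
  have "pcong (pt i [s]) w ?v" by (rule Cons.IH) simp
  then have 1: "pcong i ([s] @ w @ []) ([s] @ ?v @ [])"
  proof (rule pcong_context[OF Cons.prems])
    show "pt (pt i [s]) w = pt (pt i [s]) ?v"
      by (rule pt_perm[OF pt_in[OF Cons.prems]]) (simp_all add: count_list_replicate)
  qed
  show ?case
  proof (cases s)
    case Fwd
    then show ?thesis using 1 by simp
  next
    case Bwd
    have "pcong i (Bwd # replicate (count_list w Fwd) Fwd @ replicate (count_list w Bwd) Bwd)
      (replicate (count_list w Fwd) Fwd @ Bwd # replicate (count_list w Bwd) Bwd)"
      by (rule pcong_sort1[OF Cons.prems])
    then show ?thesis using 1 Bwd by (auto intro: pcong_trans)
  qed
qed

text \<open>Trading n - k backward steps for k forward steps preserves end point and degree and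
  lowers \<open>b\<close>, so it stops with fewer than n - k backward steps.\<close>

lemma pcong_reduce:
  assumes i: "i \<in> V"
  shows "\<exists>a' b'. b' < n - k \<and> pcong i (replicate a Fwd @ replicate b Bwd) (replicate a' Fwd @ replicate b' Bwd) \<and>
    pt i (replicate a Fwd @ replicate b Bwd) = pt i (replicate a' Fwd @ replicate b' Bwd) \<and>
    deg (replicate a Fwd @ replicate b Bwd) = deg (replicate a' Fwd @ replicate b' Bwd)"
proof (induction b arbitrary: a rule: less_induct)
  case (less b)
  show ?case
  proof (cases "b < n - k")
    case True
    then show ?thesis using pcong_refl by blast
  next
    case False
    define b0 where "b0 = b - (n - k)"
    have b: "replicate b Bwd = replicate (n - k) Bwd @ replicate b0 Bwd"
      using False by (simp add: b0_def replicate_add[symmetric])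
    have lt: "b0 < b" using False k_less by (simp add: b0_def)
    let ?c = "pt i (replicate a Fwd)"
    have c: "?c \<in> V" using i by simp
    have 1: "pcong i (replicate a Fwd @ replicate b Bwd) (replicate (a + k) Fwd @ replicate b0 Bwd)"
      using pcong_sym[OF pcong_context[OF i pcong_power[OF c] pt_power[OF c], of "replicate b0 Bwd"]]
      by (simp add: b replicate_add)
    have 2: "pt i (replicate a Fwd @ replicate b Bwd) = pt i (replicate (a + k) Fwd @ replicate b0 Bwd)"
      using pt_power[OF c] by (simp add: b replicate_add)
    have 3: "deg (replicate a Fwd @ replicate b Bwd) = deg (replicate (a + k) Fwd @ replicate b0 Bwd)"
      by (simp add: b algebra_simps)
    show ?thesis using less.IH[OF lt, of "a + k"] 1 2 3 by (metis pcong_trans)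
  qed
qed

text \<open>Equal end points give a - a' + b' - b = n s, and equal degrees then force a - a' = k s
  and b' - b = (n - k) s. Since b and b' are both below n - k, s = 0.\<close>

lemma reduced_unique:
  assumes i: "i \<in> V" and b: "b < n - k" "b' < n - k"
    and t: "pt i (replicate a Fwd @ replicate b Bwd) = pt i (replicate a' Fwd @ replicate b' Bwd)"
    and d: "deg (replicate a Fwd @ replicate b Bwd) = deg (replicate a' Fwd @ replicate b' Bwd)"
  shows "a = a' \<and> b = b'"
proof -
  have "(i + int a - int b) mod int n = (i + int a' - int b') mod int n"
    using t pt_count[OF i, of "replicate a Fwd @ replicate b Bwd"]
      pt_count[OF i, of "replicate a' Fwd @ replicate b' Bwd"]
    by (simp add: count_list_replicate)
  then have "int n dvd (int a - int b) - (int a' - int b')"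
    by (simp add: mod_eq_dvd_iff algebra_simps)
  then obtain s where s: "(int a - int a') + (int b' - int b) = int n * s"
    by (auto simp: dvd_def algebra_simps)
  have "int a * (int n - int k) + int b * int k = int a' * (int n - int k) + int b' * int k"
  proof -
    have "int (a * (n - k) + b * k) = int (a' * (n - k) + b' * k)" using d by simp
    then show ?thesis using k_less by (simp add: of_nat_diff)
  qed
  then have "int n * (int a - int a') = int k * (int n * s)"
    unfolding s[symmetric] by (simp add: algebra_simps)
  then have x: "int a - int a' = int k * s" using n_pos by simp
  then have y: "int b' - int b = (int n - int k) * s" using s by (simp add: algebra_simps)
  have lt: "\<bar>int b' - int b\<bar> < int n - int k" using b by linarith
  have "s = 0"
  proof (rule ccontr)
    assume "s \<noteq> 0"
    then have "(int n - int k) * 1 \<le> (int n - int k) * \<bar>s\<bar>" using k_less by (intro mult_left_mono) auto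
    also have "\<dots> = \<bar>int b' - int b\<bar>" unfolding y using k_less by (simp add: abs_mult)
    finally show False using lt by simp
  qed
  then show ?thesis using x y by simp
qed

text \<open>Sorting and trading bring both words to reduced forms, which agree by
  \<open>reduced_unique\<close>. So the relations identify all parallel paths that the degree cannot
  tell apart.\<close>

lemma pcong_of_deg:
  assumes i: "i \<in> V" and t: "pt i w = pt i w'" and d: "deg w = deg w'"
  shows "pcong i w w'"
proof -
  let ?s = "\<lambda>w. replicate (count_list w Fwd) Fwd @ replicate (count_list w Bwd) Bwd"
  have pts: "pt i w = pt i (?s w)" and degs: "deg w = deg (?s w)" for w
    by (rule pt_perm[OF i]) (simp_all add: count_list_replicate path_degree_def)
  obtain a b where ab: "b < n - k" "pcong i (?s w) (replicate a Fwd @ replicate b Bwd)"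
    "pt i (?s w) = pt i (replicate a Fwd @ replicate b Bwd)"
    "deg (?s w) = deg (replicate a Fwd @ replicate b Bwd)"
    using pcong_reduce[OF i] by blast
  obtain a' b' where ab': "b' < n - k" "pcong i (?s w') (replicate a' Fwd @ replicate b' Bwd)"
    "pt i (?s w') = pt i (replicate a' Fwd @ replicate b' Bwd)"
    "deg (?s w') = deg (replicate a' Fwd @ replicate b' Bwd)"
    using pcong_reduce[OF i] by blast
  have "a = a' \<and> b = b'"
    by (rule reduced_unique[OF i ab(1) ab'(1)]) (metis t pts ab(3) ab'(3), metis d degs ab(4) ab'(4))
  then show ?thesis
    using pcong_sort[OF i, of w] pcong_sort[OF i, of w'] ab(2) ab'(2)
    by (metis pcong_sym pcong_trans)
qed

lemma mt_minus:
  assumes "b \<in> carrier A"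
  shows "mt T (a \<ominus>\<^bsub>A\<^esub> b) i j = mt T a i j - mt T b i j"
  by (rule fps_ext) (simp add: mt_nth A_minus[OF assms] sum_subtractf)

section \<open>The ideal of relations as the kernel of a matrix representation\<close>

definition mt_kernel :: "int set \<Rightarrow> (path \<Rightarrow> complex) set" where
  "mt_kernel T = {a \<in> carrier A. \<forall>i\<in>V. \<forall>j\<in>V. mt T a i j = 0}"

lemma mt_kernel_ideal:
  assumes T: "kset T"
  shows "ideal (mt_kernel T) A"
proof (rule idealI[OF A_ring])
  show "subgroup (mt_kernel T) (add_monoid A)"
  proof (rule A.add.subgroupI)
    show "mt_kernel T \<noteq> {}" using A.zero_closed by (auto simp: mt_kernel_def A_simps mt_zero)
    show "\<ominus>\<^bsub>A\<^esub> a \<in> mt_kernel T" if "a \<in> mt_kernel T" for a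
    proof -
      have a: "a \<in> carrier A" using that by (simp add: mt_kernel_def)
      then have "\<ominus>\<^bsub>A\<^esub> a = \<zero>\<^bsub>A\<^esub> \<ominus>\<^bsub>A\<^esub> a" by (simp add: A.minus_eq)
      then show ?thesis using that a A.a_inv_closed[OF a] mt_minus[OF a, of T "\<zero>\<^bsub>A\<^esub>"]
        by (auto simp: mt_kernel_def A_simps(2) mt_zero)
    qed
  qed (auto simp: mt_kernel_def mt_add)
  show "x \<otimes>\<^bsub>A\<^esub> a \<in> mt_kernel T" "a \<otimes>\<^bsub>A\<^esub> x \<in> mt_kernel T"
    if "a \<in> mt_kernel T" "x \<in> carrier A" for a x
    using that by (auto simp: mt_kernel_def mt_mult[OF T])
qed

lemma relations_mt_kernel:
  assumes T: "kset T"
  shows "relations n k \<subseteq> mt_kernel T"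
proof -
  have "mt T (path_elem (i, w) \<ominus>\<^bsub>A\<^esub> path_elem (i, w')) c d = 0"
    if "i \<in> V" "c \<in> V" "pt i w = pt i w'" "deg w = deg w'" for i c d w w'
    using that weight_eq_iff[OF T that(1) that(3)] by (simp add: mt_minus mt_path_elem[OF T])
  moreover have "pt i [Bwd, Fwd] = pt i [Fwd, Bwd]" "deg [Bwd, Fwd] = deg [Fwd, Bwd]"
    "pt i (replicate k Fwd) = pt i (replicate (n - k) Bwd)" "deg (replicate k Fwd) = deg (replicate (n - k) Bwd)"
    if "i \<in> V" for i
    using that pt_power pt_commute by (auto simp del: path_target_simps)
  ultimately show ?thesis using relations_subset
    unfolding relations_def mt_kernel_def by (auto simp del: path_target_simps path_degree_simps path_degree_replicate)
qed

lemma Idl_finite_sum: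
  assumes "finite F" "\<And>x. x \<in> F \<Longrightarrow> f x \<in> Idl\<^bsub>A\<^esub> (relations n k)"
  shows "(\<lambda>p. \<Sum>x\<in>F. f x p) \<in> Idl\<^bsub>A\<^esub> (relations n k)"
  using assms
proof (induction F)
  case empty
  then show ?case using Idl_zero_closed by (simp add: A_simps)
next
  case (insert x F)
  then have "f x \<oplus>\<^bsub>A\<^esub> (\<lambda>p. \<Sum>x\<in>F. f x p) \<in> Idl\<^bsub>A\<^esub> (relations n k)"
    by (intro Idl_a_closed) auto
  then show ?case using insert by (simp add: A_simps)
qed

lemma Idl_scale:
  assumes "f \<in> Idl\<^bsub>A\<^esub> (relations n k)"
  shows "(\<lambda>p. z * f p) \<in> Idl\<^bsub>A\<^esub> (relations n k)"
proof -
  let ?z = "\<lambda>(i, w). if i \<in> V \<and> w = [] then z else 0"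
  have f: "f \<in> carrier A" using Idl_carr[OF assms] .
  have "?z \<otimes>\<^bsub>A\<^esub> f = (\<lambda>p. z * f p)"
  proof (rule ext, clarify)
    fix i w
    have "(?z \<otimes>\<^bsub>A\<^esub> f) (i, w) = (\<Sum>l\<le>length w. if l = length w then (if pt i w \<in> V then z * f (i, w) else 0) else 0)"
      unfolding A_simps by (intro sum.cong) auto
    then show "(?z \<otimes>\<^bsub>A\<^esub> f) (i, w) = z * f (i, w)"
      using f by (cases "i \<in> V") (auto simp: A_simps)
  qed
  moreover have "?z \<otimes>\<^bsub>A\<^esub> f \<in> Idl\<^bsub>A\<^esub> (relations n k)"
    by (rule Idl_l_closed[OF assms]) (simp add: A_simps)
  ultimately show ?thesis by simp
qed

text \<open>A matrix coefficient involves finitely many words, hence vanishes on the closure of the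
  ideal. Conversely, the words that contribute to one coefficient form one congruence class, so for
  \<open>a\<close> in the kernel the coefficients of each class add up to zero, and every truncation
  is matched by a combination of differences of congruent paths. In particular the kernel is the
  same for all \<open>T\<close>.\<close>

lemma rel_ideal_eq:
  assumes T: "kset T"
  shows "rel_ideal n k = mt_kernel T"
proof (intro equalityI subsetI)
  fix a assume "a \<in> rel_ideal n k"
  then have a: "a \<in> carrier A"
    and cl: "\<And>N. \<exists>b\<in>Idl\<^bsub>A\<^esub> (relations n k). \<forall>i w. length w < N \<longrightarrow> a (i, w) = b (i, w)"
    by (auto simp: rel_ideal_def arrow_closure_def)
  have "mt T a i j $ m = 0" if ij: "i \<in> V" "j \<in> V" for i j m
  proof -
    \<comment> \<open>A length beyond all words that contribute to this coefficient, so that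
      agreement below \<open>N\<close> determines it.\<close>
    define N where "N = Suc (\<Sum>w | pt i w = j \<and> pw T i w = m. length w)"
    have N: "length w < N" if "pt i w = j" "pw T i w = m" for w
    proof -
      have "length w \<le> (\<Sum>w | pt i w = j \<and> pw T i w = m. length w)"
        using that by (intro member_le_sum finite_weight_class[OF T ij(1)]) auto
      then show ?thesis by (simp add: N_def)
    qed
    obtain b where b: "b \<in> Idl\<^bsub>A\<^esub> (relations n k)" "\<And>i w. length w < N \<Longrightarrow> a (i, w) = b (i, w)"
      using cl[of N] by blast
    have "b \<in> mt_kernel T"
      using b(1) A.genideal_minimal[OF mt_kernel_ideal[OF T] relations_mt_kernel[OF T]] by blast
    then have "mt T b i j = 0" using ij by (simp add: mt_kernel_def)
    then have "mt T b i j $ m = 0" by simp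
    moreover have "mt T a i j $ m = mt T b i j $ m"
      unfolding mt_nth by (intro sum.cong refl b(2)) (auto intro: N)
    ultimately show ?thesis by simp
  qed
  then show "a \<in> mt_kernel T" using a by (auto simp: mt_kernel_def intro: fps_ext)
next
  fix a assume a: "a \<in> mt_kernel T"
  then have ac: "a \<in> carrier A" by (simp add: mt_kernel_def)
  define cls where "cls = (\<lambda>(i, w). {w'. pt i w' = pt i w \<and> deg w' = deg w})"
  define rep where "rep = (\<lambda>(i, w). (i, SOME w'. w' \<in> cls (i, w)))"
  have fin_cls: "finite (cls p)" for p
  proof -
    have "cls p \<subseteq> {w'. length w' \<le> deg (snd p)}"
      using length_le_deg unfolding cls_def by (auto split: prod.splits simp: length_le_deg dest: sym)
    then show ?thesis by (rule finite_subset[OF _ finite_bounded_words])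
  qed
  have rep_cls: "snd (rep (i, w)) \<in> cls (i, w)" "fst (rep (i, w)) = i" for i w
    unfolding rep_def using someI_ex[of "\<lambda>w'. w' \<in> cls (i, w)"] by (auto simp: cls_def)
  have rep_eq_iff: "rep (i, w') = rep (i, w) \<longleftrightarrow> w' \<in> cls (i, w)" for i w w'
  proof
    assume "rep (i, w') = rep (i, w)"
    then have "snd (rep (i, w)) \<in> cls (i, w')" using rep_cls(1)[of i w'] by simp
    then show "w' \<in> cls (i, w)" using rep_cls(1)[of i w] by (auto simp: cls_def)
  next
    assume "w' \<in> cls (i, w)"
    then have "cls (i, w') = cls (i, w)" by (auto simp: cls_def)
    then show "rep (i, w') = rep (i, w)" by (simp add: rep_def)
  qed
  have class_sum: "(\<Sum>w'\<in>cls (i, w). a (i, w')) = 0" if i: "i \<in> V" for i w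
  proof -
    have "cls (i, w) = {w'. pt i w' = pt i w \<and> pw T i w' = pw T i w}"
      using weight_eq_iff[OF T i] by (auto simp: cls_def)
    then have "(\<Sum>w'\<in>cls (i, w). a (i, w')) = mt T a i (pt i w) $ pw T i w"
      by (simp add: mt_nth)
    then show ?thesis using a i by (simp add: mt_kernel_def)
  qed
  show "a \<in> rel_ideal n k"
    unfolding rel_ideal_def arrow_closure_def
  proof (intro CollectI conjI ac allI)
    fix N
    \<comment> \<open>The words shorter than \<open>N\<close>, closed up under congruence: a class
      may contain longer words, and only over a full class do the coefficients sum to zero.\<close>
    define F where "F = (\<Union>p\<in>V \<times> {w. length w < N}. {fst p} \<times> cls p)"
    have "finite {w :: step list. length w < N}"
      by (rule finite_subset[OF _ finite_bounded_words[of N]]) auto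
    then have finF: "finite F" unfolding F_def using fin_cls by auto
    \<comment> \<open>On \<open>F\<close> this is \<open>a\<close> minus the class sums placed at
      the representatives. The sums vanish, so \<open>b\<close> agrees with \<open>a\<close> below
      length \<open>N\<close>.\<close>
    define b where "b = (\<lambda>q. \<Sum>p\<in>F. a p * (path_elem p q - path_elem (rep p) q))"
    have FV: "fst p \<in> V" if "p \<in> F" for p using that by (auto simp: F_def)
    have F_closed: "(i, w') \<in> F" if "(i, w) \<in> F" "w' \<in> cls (i, w)" for i w w'
      using that by (fastforce simp: F_def cls_def)
    have "b \<in> Idl\<^bsub>A\<^esub> (relations n k)"
      unfolding b_def
    proof (intro Idl_finite_sum[OF finF] Idl_scale)
      fix p assume p: "p \<in> F"
      obtain i w where iw: "p = (i, w)" by (cases p)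
      have "pcong i w (snd (rep p))"
        using rep_cls(1)[of i w] FV[OF p] iw by (intro pcong_of_deg) (auto simp: cls_def)
      then show "(\<lambda>q. path_elem p q - path_elem (rep p) q) \<in> Idl\<^bsub>A\<^esub> (relations n k)"
        using rep_cls(2)[of i w] iw unfolding pcong_def by (cases "rep p") simp
    qed
    moreover have "a (i, w) = b (i, w)" if "length w < N" for i w
    proof (cases "i \<in> V")
      case False
      then have "b (i, w) = 0"
        unfolding b_def
      proof (intro sum.neutral ballI)
        fix p assume p: "p \<in> F"
        have "fst (rep p) = fst p" using rep_cls(2)[of "fst p" "snd p"] by simp
        then have "p \<noteq> (i, w)" "rep p \<noteq> (i, w)" using FV[OF p] False by auto
        then show "a p * (path_elem p (i, w) - path_elem (rep p) (i, w)) = 0"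
          by (simp add: path_elem_def)
      qed
      then show ?thesis using ac False by (simp add: A_simps)
    next
      case True
      have inF: "(i, w) \<in> F" using True that by (auto simp: F_def cls_def)
      have "(\<Sum>p\<in>F. a p * path_elem (rep p) (i, w)) = 0"
      proof (cases "\<exists>p\<in>F. rep p = (i, w)")
        case False
        then show ?thesis by (intro sum.neutral) (auto simp: path_elem_def)
      next
        case True
        then obtain j0 w0 where w0': "(j0, w0) \<in> F" "rep (j0, w0) = (i, w)" by auto
        then have "j0 = i" using rep_cls(2)[of j0 w0] by simp
        with w0' have w0: "(i, w0) \<in> F" "rep (i, w0) = (i, w)" by simp_all
        have "{p \<in> F. rep p = (i, w)} = Pair i ` cls (i, w0)"
        proof (intro equalityI subsetI)
          fix p assume p: "p \<in> {p \<in> F. rep p = (i, w)}"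
          obtain j v where jv: "p = (j, v)" by (cases p)
          have "j = i" using p jv rep_cls(2)[of j v] by simp
          then show "p \<in> Pair i ` cls (i, w0)" using p jv w0(2) rep_eq_iff[of i v w0] by auto
        next
          fix p assume "p \<in> Pair i ` cls (i, w0)"
          then show "p \<in> {p \<in> F. rep p = (i, w)}" using F_closed[OF w0(1)] rep_eq_iff[of i _ w0] w0(2) by auto
        qed
        moreover have "(\<Sum>p\<in>F. a p * path_elem (rep p) (i, w)) = (\<Sum>p\<in>{p \<in> F. rep p = (i, w)}. a p)"
          by (rule sum.mono_neutral_cong_right[OF finF]) (auto simp: path_elem_def)
        ultimately have "(\<Sum>p\<in>F. a p * path_elem (rep p) (i, w)) = (\<Sum>w'\<in>cls (i, w0). a (i, w'))"
          by (simp add: sum.reindex inj_on_def)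
        then show ?thesis using class_sum FV[OF w0(1)] by simp
      qed
      moreover have "(\<Sum>p\<in>F. a p * path_elem p (i, w)) = a (i, w)"
      proof -
        have "(\<Sum>p\<in>F. a p * path_elem p (i, w)) = (\<Sum>p\<in>F. if p = (i, w) then a (i, w) else 0)"
          by (intro sum.cong) (auto simp: path_elem_def)
        then show ?thesis using inF finF by simp
      qed
      ultimately show ?thesis by (simp add: b_def algebra_simps sum_subtractf)
    qed
    ultimately show "\<exists>b\<in>Idl\<^bsub>A\<^esub> (relations n k). \<forall>i w. length w < N \<longrightarrow> a (i, w) = b (i, w)"
      by blast
  qed
qed

end


section \<open>The algebra B as an order in a matrix ring\<close>

lemma fps_X_power_dvd_iff: "fps_X ^ m dvd (f :: 'a :: comm_ring_1 fps) \<longleftrightarrow> (\<forall>i<m. f $ i = 0)"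
proof
  assume "\<forall>i<m. f $ i = 0"
  then have "f = fps_X ^ m * fps_shift m f"
    by (intro fps_ext) (simp add: fps_X_power_mult_nth)
  then show "fps_X ^ m dvd f" by (rule dvdI)
qed (auto simp: dvd_def fps_X_power_mult_nth)

lemma fps_X_power_shift: "fps_X ^ m dvd (f :: 'a :: comm_ring_1 fps) \<Longrightarrow> fps_X ^ m * fps_shift m f = f"
  by (auto simp: dvd_def mult.commute[of "fps_X ^ m"])

text \<open>The choice of the representative does not matter, as the relations act by zero.\<close>

definition B_matrix :: "nat \<Rightarrow> int set \<Rightarrow> (path \<Rightarrow> complex) set \<Rightarrow> int \<Rightarrow> int \<Rightarrow> complex fps" where
  "B_matrix n T b = path_algebra_matrix n T (SOME a. a \<in> b)"

text \<open>The word of least degree: d steps forward cost d(n - k), the n - d steps backward cost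
  (n - d)k, and the two costs agree exactly at d = k.\<close>

definition canonical_word :: "nat \<Rightarrow> nat \<Rightarrow> int \<Rightarrow> int \<Rightarrow> step list" where
  "canonical_word n k c v =
    (let d = nat ((v - c) mod int n) in if d \<le> k then replicate d Fwd else replicate (n - d) Bwd)"

definition canonical_weight :: "nat \<Rightarrow> nat \<Rightarrow> int set \<Rightarrow> int \<Rightarrow> int \<Rightarrow> nat" where
  "canonical_weight n k T c v = path_weight n T c (canonical_word n k c v)"

definition canonical_path :: "nat \<Rightarrow> nat \<Rightarrow> int \<Rightarrow> int \<Rightarrow> (path \<Rightarrow> complex) set" where
  "canonical_path n k c v = B_class n k (path_elem (c, canonical_word n k c v))"

text \<open>The power of the variable by which the detour through \<open>u\<close> exceeds the
  direct shortest path. It is read off from degrees, with t of degree n, so it is the same in all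
  rank one modules.\<close>

definition excess :: "nat \<Rightarrow> nat \<Rightarrow> int \<Rightarrow> int \<Rightarrow> int \<Rightarrow> nat" where
  "excess n k c u v =
    (path_degree n k (canonical_word n k c u) + path_degree n k (canonical_word n k u v)
      - path_degree n k (canonical_word n k c v)) div n"

text \<open>If \<open>p\<close> is a profile of \<open>T\<close> over \<open>S\<close> then the module of \<open>T\<close> is the submodule of the module of
  \<open>S\<close> whose component at \<open>c\<close> is generated by the \<open>p c\<close>-th power of the variable.\<close>

definition profile :: "nat \<Rightarrow> int set \<Rightarrow> int set \<Rightarrow> (int \<Rightarrow> nat) \<Rightarrow> bool" where
  "profile n T S p \<longleftrightarrow> (\<forall>c\<in>vertices n.
     p c + (if c \<in> S then 1 else 0) = p ((c - 1) mod int n) + (if c \<in> T then 1 else 0))"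

context kn
begin

abbreviation "B \<equiv> B_alg n k"
abbreviation "cl \<equiv> B_class n k"
abbreviation "mb \<equiv> B_matrix n"
abbreviation "qword \<equiv> canonical_word n k"
abbreviation "wt \<equiv> canonical_weight n k"
abbreviation "q \<equiv> canonical_path n k"
abbreviation "tri \<equiv> excess n k"
abbreviation "Zb \<equiv> Z_emb n k"
abbreviation "X \<equiv> (fps_X :: complex fps)"

lemma rel_ideal_ideal: "ideal (rel_ideal n k) A"
  using mt_kernel_ideal[OF kset_std] rel_ideal_eq[OF kset_std] by simp

lemma B_ring: "ring B"
  unfolding B_alg_def by (rule ideal.quotient_is_ring[OF rel_ideal_ideal])

lemma cl_hom: "cl \<in> ring_hom A B"
proof -
  have "cl = (+>\<^bsub>A\<^esub>) (rel_ideal n k)" by (rule ext) (simp add: B_class_def)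
  then show ?thesis unfolding B_alg_def using ideal.rcos_ring_hom[OF rel_ideal_ideal] by simp
qed

lemma cl_in [simp]: "a \<in> carrier A \<Longrightarrow> cl a \<in> carrier B"
  using cl_hom by (rule ring_hom_closed)
lemma cl_mult: "a \<in> carrier A \<Longrightarrow> b \<in> carrier A \<Longrightarrow> cl (a \<otimes>\<^bsub>A\<^esub> b) = cl a \<otimes>\<^bsub>B\<^esub> cl b"
  using cl_hom by (rule ring_hom_mult)
lemma cl_add: "a \<in> carrier A \<Longrightarrow> b \<in> carrier A \<Longrightarrow> cl (a \<oplus>\<^bsub>A\<^esub> b) = cl a \<oplus>\<^bsub>B\<^esub> cl b"
  using cl_hom by (rule ring_hom_add)
lemma cl_one: "cl \<one>\<^bsub>A\<^esub> = \<one>\<^bsub>B\<^esub>"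
  using cl_hom by (rule ring_hom_one)
lemma cl_zero: "cl \<zero>\<^bsub>A\<^esub> = \<zero>\<^bsub>B\<^esub>"
  by (rule ring_hom_zero[OF cl_hom A_ring B_ring])

lemma B_cases:
  assumes "b \<in> carrier B"
  obtains a where "a \<in> carrier A" "b = cl a"
  using assms unfolding B_alg_def FactRing_def A_RCOSETS_def' B_class_def by auto

lemma mt_cong_cl:
  assumes T: "kset T" and a: "a \<in> carrier A" "b \<in> carrier A" and e: "a \<in> cl b" and ij: "i \<in> V" "j \<in> V"
  shows "mt T a i j = mt T b i j"
proof -
  obtain h where h: "h \<in> rel_ideal n k" "a = h \<oplus>\<^bsub>A\<^esub> b"
    using e unfolding B_class_def a_r_coset_def' by auto
  then have "mt T h i j = 0" using ij by (simp add: rel_ideal_eq[OF T] mt_kernel_def)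
  then show ?thesis by (simp add: h mt_add)
qed

lemma cl_rep:
  assumes "a \<in> carrier A"
  shows "(SOME a'. a' \<in> cl a) \<in> carrier A" "(SOME a'. a' \<in> cl a) \<in> cl a"
proof -
  have sub: "additive_subgroup (rel_ideal n k) A" using rel_ideal_ideal by (rule ideal.axioms)
  have "a \<in> cl a"
    using additive_subgroup.zero_closed[OF sub] assms unfolding B_class_def a_r_coset_def'
    by (auto intro!: bexI[of _ "\<zero>\<^bsub>A\<^esub>"])
  then show 1: "(SOME a'. a' \<in> cl a) \<in> cl a" by (rule someI[of "\<lambda>a'. a' \<in> cl a"])
  have "cl a \<subseteq> carrier A"
    using additive_subgroup.a_subset[OF sub] assms unfolding B_class_def a_r_coset_def' by (auto intro!: A.add.m_closed)
  then show "(SOME a'. a' \<in> cl a) \<in> carrier A" using 1 by blast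
qed

lemma mb_cl:
  assumes "kset T" "a \<in> carrier A" "i \<in> V" "j \<in> V"
  shows "mb T (cl a) i j = mt T a i j"
  unfolding B_matrix_def by (rule mt_cong_cl[OF assms(1) cl_rep(1) assms(2) cl_rep(2) assms(3,4)]) fact+

lemma mb_mult:
  assumes "kset T" "b \<in> carrier B" "b' \<in> carrier B" "i \<in> V" "j \<in> V"
  shows "mb T (b \<otimes>\<^bsub>B\<^esub> b') i j = (\<Sum>u\<in>V. mb T b u j * mb T b' i u)"
proof -
  obtain a a' where a: "a \<in> carrier A" "b = cl a" "a' \<in> carrier A" "b' = cl a'"
    using assms(2,3) B_cases by metis
  have "mb T (b \<otimes>\<^bsub>B\<^esub> b') i j = mt T (a \<otimes>\<^bsub>A\<^esub> a') i j"
    using a assms by (simp add: cl_mult[symmetric] mb_cl)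
  then show ?thesis using a assms by (simp add: mt_mult mb_cl)
qed

lemma mb_add:
  assumes "kset T" "b \<in> carrier B" "b' \<in> carrier B" "i \<in> V" "j \<in> V"
  shows "mb T (b \<oplus>\<^bsub>B\<^esub> b') i j = mb T b i j + mb T b' i j"
proof -
  obtain a a' where a: "a \<in> carrier A" "b = cl a" "a' \<in> carrier A" "b' = cl a'"
    using assms(2,3) B_cases by metis
  then show ?thesis using assms by (simp add: cl_add[symmetric] mb_cl mt_add)
qed

lemma mb_one: "kset T \<Longrightarrow> i \<in> V \<Longrightarrow> j \<in> V \<Longrightarrow> mb T \<one>\<^bsub>B\<^esub> i j = (if i = j then 1 else 0)"
  by (simp add: cl_one[symmetric] mb_cl mt_one)

text \<open>One rank one module suffices to test equality in B, because the kernel of its matrix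
  representation is exactly the ideal of relations.\<close>

lemma mb_eqI:
  assumes T: "kset T" and b: "b \<in> carrier B" "b' \<in> carrier B"
    and e: "\<And>i j. i \<in> V \<Longrightarrow> j \<in> V \<Longrightarrow> mb T b i j = mb T b' i j"
  shows "b = b'"
proof -
  obtain a a' where a: "a \<in> carrier A" "b = cl a" "a' \<in> carrier A" "b' = cl a'"
    using b B_cases by metis
  have "mt T (a \<ominus>\<^bsub>A\<^esub> a') i j = 0" if "i \<in> V" "j \<in> V" for i j
    using e[OF that] a that T by (simp add: mb_cl mt_minus)
  then have "a \<ominus>\<^bsub>A\<^esub> a' \<in> rel_ideal n k"
    using a by (simp add: rel_ideal_eq[OF T] mt_kernel_def A.minus_closed)
  moreover have "a = (a \<ominus>\<^bsub>A\<^esub> a') \<oplus>\<^bsub>A\<^esub> a'" using a by (simp add: A.minus_eq A.a_assoc A.l_neg)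
  ultimately have "a \<in> cl a'" unfolding B_class_def a_r_coset_def' by auto
  then show ?thesis
    using A.a_repr_independence[OF _ _ additive_subgroup.a_subgroup[OF ideal.axioms(1)[OF rel_ideal_ideal]], of a a'] a
    by (simp add: B_class_def)
qed

section \<open>Shortest paths and their weights\<close>

lemma pt_qword: "c \<in> V \<Longrightarrow> v \<in> V \<Longrightarrow> pt c (qword c v) = v"
proof -
  assume cv: "c \<in> V" "v \<in> V"
  let ?d = "(v - c) mod int n"
  have d: "0 \<le> ?d" "?d < int n" using n_pos by simp_all
  have 1: "(c + ?d) mod int n = v" using cv by (simp add: mod_simps V_mod)
  have 2: "(c - int (n - nat ?d)) mod int n = v"
  proof -
    have "(c - int (n - nat ?d)) mod int n = (c + ?d - int n) mod int n"
      using d by (simp add: of_nat_diff algebra_simps)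
    also have "\<dots> = (c + ?d) mod int n" by (rule minus_mod_self2)
    also have "\<dots> = v" using 1 by simp
    finally show ?thesis .
  qed
  show ?thesis
    using cv d 1 2 by (simp add: canonical_word_def Let_def pt_replicate_Fwd pt_replicate_Bwd)
qed

text \<open>The surplus of forward over backward steps is d + n s. For s >= 0 the word contains at
  least d forward steps, for s < 0 at least n - d backward ones.\<close>

lemma deg_qword_min:
  assumes cv: "c \<in> V" "v \<in> V" and w: "pt c w = v"
  shows "deg (qword c v) \<le> deg w"
proof -
  define d where "d = nat ((v - c) mod int n)"
  have d: "d < n" "int d = (v - c) mod int n" using n_pos by (simp_all add: d_def nat_less_iff)
  let ?a = "count_list w Fwd" and ?b = "count_list w Bwd"
  have "(c + int ?a - int ?b) mod int n = v" using w pt_count[OF cv(1)] by simp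
  then have "(v - c) mod int n = (int ?a - int ?b) mod int n"
    by (metis add_diff_cancel_left' add_diff_eq mod_diff_left_eq)
  then have "int n dvd (int ?a - int ?b) - int d"
    unfolding d(2) by (metis mod_eq_dvd_iff mod_mod_trivial)
  then obtain s where s: "int ?a - int ?b = int d + int n * s" by (auto simp: dvd_def algebra_simps)
  have q: "deg (qword c v) = (if d \<le> k then d * (n - k) else (n - d) * k)"
    by (simp add: canonical_word_def Let_def d_def)
  have "d * (n - k) \<le> deg w \<or> (n - d) * k \<le> deg w"
  proof (cases "0 \<le> s")
    case True
    then have "0 \<le> int n * s" by simp
    then have "d \<le> ?a" using s by linarith
    then have "(n - k) * d \<le> (n - k) * ?a" by (rule mult_le_mono2)
    then show ?thesis unfolding path_degree_def by (metis mult.commute trans_le_add1)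
  next
    case False
    then have "int n * s \<le> int n * (- 1)" by (intro mult_left_mono) auto
    then have "n - d \<le> ?b" using s by linarith
    then have "k * (n - d) \<le> k * ?b" by (rule mult_le_mono2)
    then show ?thesis unfolding path_degree_def by (metis mult.commute trans_le_add2)
  qed
  moreover have "d * (n - k) = d * n - d * k" "(n - d) * k = k * n - d * k"
    by (simp_all add: diff_mult_distrib diff_mult_distrib2 mult.commute)
  moreover have "d * n - d * k \<le> k * n - d * k" if "d \<le> k"
    using that by (intro diff_le_mono mult_le_mono1)
  moreover have "k * n - d * k \<le> d * n - d * k" if "\<not> d \<le> k"
    using that by (intro diff_le_mono mult_le_mono1) simp
  ultimately show ?thesis unfolding q by (auto intro: order_trans)
qed

lemma wt_le:
  assumes T: "kset T" and cv: "c \<in> V" "v \<in> V" and w: "pt c w = v"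
  shows "wt T c v \<le> pw T c w"
proof -
  have "int n * int (wt T c v) - int (deg (qword c v)) = int n * int (pw T c w) - int (deg w)"
    using weight_degree[OF T cv(1), of "qword c v"] weight_degree[OF T cv(1), of w] w pt_qword[OF cv]
    by (simp add: canonical_weight_def)
  then have "int n * int (wt T c v) \<le> int n * int (pw T c w)"
    using deg_qword_min[OF cv w] by linarith
  then show ?thesis using n_pos by simp
qed

lemma wt_tri:
  assumes T: "kset T" and V: "c \<in> V" "u \<in> V" "v \<in> V"
  shows "wt T c u + wt T u v = tri c u v + wt T c v"
proof -
  let ?D = "deg (qword c u) + deg (qword u v) - deg (qword c v)"
  have "deg (qword c v) \<le> deg (qword c u @ qword u v)"
    using V by (intro deg_qword_min) (simp_all add: pt_qword)
  then have "int n * int (wt T c u) + int n * int (wt T u v) - int n * int (wt T c v) = int ?D"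
    using weight_degree[OF T V(1), of "qword c u"] weight_degree[OF T V(2), of "qword u v"]
      weight_degree[OF T V(1), of "qword c v"] V
    by (simp add: pt_qword canonical_weight_def of_nat_diff)
  then have e: "int n * (int (wt T c u) + int (wt T u v) - int (wt T c v)) = int ?D"
    by (simp add: algebra_simps)
  then have "0 \<le> int n * (int (wt T c u) + int (wt T u v) - int (wt T c v))" by simp
  then have le: "wt T c v \<le> wt T c u + wt T u v" using n_pos by (simp add: zero_le_mult_iff)
  then have "int (n * (wt T c u + wt T u v - wt T c v)) = int ?D" using e by (simp add: of_nat_diff)
  then have "n * (wt T c u + wt T u v - wt T c v) = ?D" by (simp only: of_nat_eq_iff)
  then have "tri c u v = wt T c u + wt T u v - wt T c v"
    unfolding excess_def using n_pos by (metis nonzero_mult_div_cancel_left not_gr_zero)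
  then show ?thesis using le by simp
qed

lemma wt_refl [simp]: "c \<in> V \<Longrightarrow> wt T c c = 0"
  by (simp add: canonical_weight_def canonical_word_def)

text \<open>The equation defining a profile compares the weights of one step over \<open>T\<close>
  and over \<open>S\<close>; along a word the differences telescope.\<close>

lemma pw_profile:
  assumes p: "profile n T S p" and c: "c \<in> V"
  shows "pw T c w + p (pt c w) = pw S c w + p c"
  using c
proof (induction w arbitrary: c)
  case (Cons s w)
  show ?case
  proof (cases s)
    case Fwd
    let ?d = "(c + 1) mod int n"
    have "(?d - 1) mod int n = c" using Cons.prems by (simp add: mod_simps V_mod)
    then have "p ?d + (if ?d \<in> S then 1 else 0) = p c + (if ?d \<in> T then 1 else 0)"
      using p unfolding profile_def by (metis mod_in_V)
    then show ?thesis using Cons.IH[of ?d] by (auto simp: Fwd split: if_splits)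
  next
    case Bwd
    let ?d = "(c - 1) mod int n"
    have "p c + (if c \<in> S then 1 else 0) = p ?d + (if c \<in> T then 1 else 0)"
      using p Cons.prems unfolding profile_def by blast
    then show ?thesis using Cons.IH[of ?d] by (auto simp: Bwd split: if_splits)
  qed
qed simp

lemma wt_profile:
  assumes "profile n T S p" "c \<in> V" "v \<in> V"
  shows "wt T c v + p v = wt S c v + p c"
  using pw_profile[OF assms(1,2), of "qword c v"] assms(2,3) by (simp add: canonical_weight_def pt_qword)

lemma mb_dvd:
  assumes T: "kset T" and b: "b \<in> carrier B" and V: "i \<in> V" "j \<in> V"
  shows "X ^ wt T i j dvd mb T b i j"
proof -
  obtain a where a: "a \<in> carrier A" "b = cl a" using b B_cases by metis
  have "mt T a i j $ m = 0" if "m < wt T i j" for m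
  proof -
    have "{w. pt i w = j \<and> pw T i w = m} = {}" using wt_le[OF T V] that by fastforce
    then show ?thesis unfolding mt_nth by (simp del: Collect_empty_eq)
  qed
  then show ?thesis using a T V by (simp add: mb_cl fps_X_power_dvd_iff)
qed

lemma q_in [simp]: "c \<in> V \<Longrightarrow> q c v \<in> carrier B"
  by (simp add: canonical_path_def)

lemma mb_q:
  assumes "kset T" "c \<in> V" "v \<in> V" "i \<in> V" "j \<in> V"
  shows "mb T (q c v) i j = (if i = c \<and> j = v then X ^ wt T c v else 0)"
  using assms by (auto simp: canonical_path_def mb_cl mt_path_elem pt_qword canonical_weight_def)

section \<open>The central power series and the spanning set of shortest paths\<close>

definition Z_lift :: "complex fps \<Rightarrow> path \<Rightarrow> complex" where
  "Z_lift z = (\<lambda>(i, w). if i \<in> V \<and> (\<exists>m. w = concat (replicate m [Bwd, Fwd])) then z $ (length w div 2) else 0)"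

lemma Zb_eq: "Zb z = cl (Z_lift z)"
  by (simp add: Z_emb_def Z_lift_def)

lemma Z_lift_in: "Z_lift z \<in> carrier A"
  by (simp add: Z_lift_def A_simps)

lemma mt_Z:
  assumes T: "kset T" and i: "i \<in> V"
  shows "mt T (Z_lift z) i j = (if i = j then z else 0)"
proof (rule fps_ext)
  fix m
  let ?w = "\<lambda>m. concat (replicate m [Bwd, Fwd])"
  have len: "length (?w m) = 2 * m" for m by (induction m) auto
  have tw: "pt i (?w m) = i \<and> pw T i (?w m) = m" for m
  proof (induction m)
    case (Suc m)
    have "((i - 1) mod int n + 1) mod int n = i" using i by (simp add: mod_simps V_mod)
    then show ?case using Suc by simp
  qed simp
  have "mt T (Z_lift z) i j $ m = (\<Sum>w | pt i w = j \<and> pw T i w = m. if w = ?w m then z $ m else 0)"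
    unfolding mt_nth
  proof (intro sum.cong refl)
    fix w assume w: "w \<in> {w. pt i w = j \<and> pw T i w = m}"
    show "Z_lift z (i, w) = (if w = ?w m then z $ m else 0)"
      using i w tw len by (auto simp: Z_lift_def)
  qed
  also have "\<dots> = (if i = j then z $ m else 0)"
    by (subst sum.delta[OF finite_weight_class[OF T i]]) (use tw in auto)
  finally show "mt T (Z_lift z) i j $ m = (if i = j then z else 0) $ m" by simp
qed

lemma Zb_in [simp]: "Zb z \<in> carrier B"
  by (simp add: Zb_eq Z_lift_in)

lemma mb_Z:
  assumes "kset T" "i \<in> V" "j \<in> V"
  shows "mb T (Zb z) i j = (if i = j then z else 0)"
  using assms by (simp add: Zb_eq mb_cl Z_lift_in mt_Z)

lemma mb_Z_mult:
  assumes "kset T" "b \<in> carrier B" "i \<in> V" "j \<in> V"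
  shows "mb T (Zb z \<otimes>\<^bsub>B\<^esub> b) i j = z * mb T b i j"
    and "mb T (b \<otimes>\<^bsub>B\<^esub> Zb z) i j = z * mb T b i j"
proof -
  have "(\<Sum>u\<in>V. mb T (Zb z) u j * mb T b i u) = (\<Sum>u\<in>V. if u = j then z * mb T b i u else 0)"
    using assms by (intro sum.cong) (auto simp: mb_Z)
  then show "mb T (Zb z \<otimes>\<^bsub>B\<^esub> b) i j = z * mb T b i j" using assms by (simp add: mb_mult)
  have "(\<Sum>u\<in>V. mb T b u j * mb T (Zb z) i u) = (\<Sum>u\<in>V. if i = u then z * mb T b u j else 0)"
    using assms by (intro sum.cong) (auto simp: mb_Z)
  then show "mb T (b \<otimes>\<^bsub>B\<^esub> Zb z) i j = z * mb T b i j" using assms by (simp add: mb_mult)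
qed

lemma mb_q_mult:
  assumes "kset T" "b \<in> carrier B" "c \<in> V" "v \<in> V" "i \<in> V" "j \<in> V"
  shows "mb T (q c v \<otimes>\<^bsub>B\<^esub> b) i j = (if j = v then X ^ wt T c v * mb T b i c else 0)"
    and "mb T (b \<otimes>\<^bsub>B\<^esub> q c v) i j = (if i = c then X ^ wt T c v * mb T b v j else 0)"
proof -
  have "(\<Sum>u\<in>V. mb T (q c v) u j * mb T b i u) = (\<Sum>u\<in>V. if u = c then (if j = v then X ^ wt T c v * mb T b i u else 0) else 0)"
    using assms by (intro sum.cong) (auto simp: mb_q)
  then show "mb T (q c v \<otimes>\<^bsub>B\<^esub> b) i j = (if j = v then X ^ wt T c v * mb T b i c else 0)"
    using assms by (simp add: mb_mult)
  have "(\<Sum>u\<in>V. mb T b u j * mb T (q c v) i u) = (\<Sum>u\<in>V. if u = v then (if i = c then X ^ wt T c v * mb T b u j else 0) else 0)"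
    using assms by (intro sum.cong) (auto simp: mb_q)
  then show "mb T (b \<otimes>\<^bsub>B\<^esub> q c v) i j = (if i = c then X ^ wt T c v * mb T b v j else 0)"
    using assms by (simp add: mb_mult)
qed

sublocale B: ring B by (rule B_ring)

lemma Zb_mult: "Zb y \<otimes>\<^bsub>B\<^esub> Zb z = Zb (y * z)"
  by (rule mb_eqI[OF kset_std]) (auto simp: mb_Z_mult mb_Z kset_std)

lemma Zb_add: "Zb y \<oplus>\<^bsub>B\<^esub> Zb z = Zb (y + z)"
  by (rule mb_eqI[OF kset_std]) (auto simp: mb_add mb_Z kset_std)

lemma Zb_one: "Zb 1 = \<one>\<^bsub>B\<^esub>"
  by (rule mb_eqI[OF kset_std]) (auto simp: mb_one mb_Z kset_std)

lemma Zb_commute: "b \<in> carrier B \<Longrightarrow> Zb z \<otimes>\<^bsub>B\<^esub> b = b \<otimes>\<^bsub>B\<^esub> Zb z"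
  by (rule mb_eqI[OF kset_std]) (auto simp: mb_Z_mult kset_std)

lemma q_mult_q:
  assumes "c \<in> V" "u \<in> V" "v \<in> V"
  shows "q u v \<otimes>\<^bsub>B\<^esub> q c u = Zb (X ^ tri c u v) \<otimes>\<^bsub>B\<^esub> q c v"
proof (rule mb_eqI[OF kset_std])
  fix i j assume ij: "i \<in> V" "j \<in> V"
  have "X ^ wt {0..<int k} u v * X ^ wt {0..<int k} c u = X ^ tri c u v * X ^ wt {0..<int k} c v"
    using wt_tri[OF kset_std assms] by (simp add: power_add[symmetric] add.commute)
  then show "mb {0..<int k} (q u v \<otimes>\<^bsub>B\<^esub> q c u) i j = mb {0..<int k} (Zb (X ^ tri c u v) \<otimes>\<^bsub>B\<^esub> q c v) i j"
    using assms ij by (simp add: mb_q_mult(1)[OF kset_std] mb_Z_mult(1)[OF kset_std] mb_q[OF kset_std])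
qed (use assms in simp_all)

lemma q_mult_q_zero:
  assumes "c \<in> V" "u \<in> V" "u' \<in> V" "v \<in> V" "u \<noteq> u'"
  shows "q u v \<otimes>\<^bsub>B\<^esub> q c u' = \<zero>\<^bsub>B\<^esub>"
proof -
  have "mb {0..<int k} \<zero>\<^bsub>B\<^esub> i j = 0" if "i \<in> V" "j \<in> V" for i j
    using that by (simp add: cl_zero[symmetric] mb_cl[OF kset_std] A_simps(2) mt_zero A.zero_closed[unfolded A_simps(2)])
  then show ?thesis
    by (intro mb_eqI[OF kset_std]) (use assms in \<open>auto simp: mb_q_mult mb_q kset_std\<close>)
qed

text \<open>Every matrix entry is a multiple of the power belonging to the shortest path, so it can
  be cleared by subtracting a central multiple of \<open>q c v\<close>. After finitely many pairs of
  vertices nothing remains: the completion contributes nothing beyond power series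
  coefficients.\<close>

lemma B_induct [consumes 1, case_names zero add gen]:
  assumes b: "b \<in> carrier B"
    and zero: "P \<zero>\<^bsub>B\<^esub>"
    and add: "\<And>b b'. b \<in> carrier B \<Longrightarrow> b' \<in> carrier B \<Longrightarrow> P b \<Longrightarrow> P b' \<Longrightarrow> P (b \<oplus>\<^bsub>B\<^esub> b')"
    and gen: "\<And>z c v. c \<in> V \<Longrightarrow> v \<in> V \<Longrightarrow> P (Zb z \<otimes>\<^bsub>B\<^esub> q c v)"
  shows "P b"
proof -
  let ?T = "{0..<int k}"
  have mb0: "mb ?T \<zero>\<^bsub>B\<^esub> i j = 0" if "i \<in> V" "j \<in> V" for i j
    using that by (simp add: cl_zero[symmetric] mb_cl[OF kset_std] A_simps(2) mt_zero A.zero_closed[unfolded A_simps(2)])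
  have "\<And>b. b \<in> carrier B \<Longrightarrow> (\<forall>c\<in>V. \<forall>v\<in>V. (c, v) \<notin> F \<longrightarrow> mb ?T b c v = 0) \<Longrightarrow> P b" if "finite F" for F
    using that
  proof (induction F)
    case empty
    have "b = \<zero>\<^bsub>B\<^esub>" using empty by (intro mb_eqI[OF kset_std]) (auto simp: mb0)
    then show ?case using zero by simp
  next
    case (insert x F)
    obtain c v where x: "x = (c, v)" by (cases x)
    show ?case
    proof (cases "c \<in> V \<and> v \<in> V")
      case False
      then show ?thesis using insert.prems x by (intro insert.IH) auto
    next
      case True
      obtain z where z: "mb ?T b c v = X ^ wt ?T c v * z"
        using mb_dvd[OF kset_std insert.prems(1), of c v] True by (auto simp: dvd_def)
      let ?g = "\<lambda>z. Zb z \<otimes>\<^bsub>B\<^esub> q c v"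
      have g: "?g z \<in> carrier B" for z using True by simp
      define b' where "b' = b \<oplus>\<^bsub>B\<^esub> ?g (- z)"
      have b'c: "b' \<in> carrier B" using insert.prems g by (simp add: b'_def)
      have bb: "b = b' \<oplus>\<^bsub>B\<^esub> ?g z"
        using insert.prems True g b'c unfolding b'_def
        by (intro mb_eqI[OF kset_std]) (auto simp: mb_add[OF kset_std] mb_Z_mult[OF kset_std])
      have "P b'"
      proof (rule insert.IH[OF b'c], intro ballI impI)
        fix c' v' assume cv: "c' \<in> V" "v' \<in> V" "(c', v') \<notin> F"
        show "mb ?T b' c' v' = 0"
          using cv insert.prems True g z x unfolding b'_def
          by (cases "c' = c \<and> v' = v") (auto simp: mb_add[OF kset_std] mb_Z_mult[OF kset_std] mb_q[OF kset_std])
      qed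
      then show ?thesis using add[OF b'c g _ gen] bb True by metis
    qed
  qed
  from this[of "V \<times> V" b] show ?thesis using b by simp
qed

text \<open>A combination of shortest paths whose coefficients do not depend on \<open>T\<close>, so
  one element of B serves all rank one modules simultaneously.\<close>

lemma B_element:
  fixes z :: "int \<Rightarrow> int \<Rightarrow> complex fps"
  shows "\<exists>b\<in>carrier B. \<forall>T. kset T \<longrightarrow> (\<forall>c\<in>V. \<forall>v\<in>V. mb T b c v = X ^ wt T c v * z c v)"
proof -
  have "\<exists>b\<in>carrier B. \<forall>T. kset T \<longrightarrow> (\<forall>c\<in>V. \<forall>v\<in>V. mb T b c v = (if (c, v) \<in> F then X ^ wt T c v * z c v else 0))"
    if "finite F" "F \<subseteq> V \<times> V" for F
    using that
  proof (induction F)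
    case empty
    have "mb T \<zero>\<^bsub>B\<^esub> i j = 0" if "kset T" "i \<in> V" "j \<in> V" for i j T
      using that by (simp add: cl_zero[symmetric] mb_cl A_simps(2) mt_zero A.zero_closed[unfolded A_simps(2)])
    then show ?case by (intro bexI[of _ "\<zero>\<^bsub>B\<^esub>"]) auto
  next
    case (insert x F)
    obtain c v where x: "x = (c, v)" by (cases x)
    have cv: "c \<in> V" "v \<in> V" using insert.prems x by auto
    obtain b where b: "b \<in> carrier B"
      "\<And>T c v. kset T \<Longrightarrow> c \<in> V \<Longrightarrow> v \<in> V \<Longrightarrow> mb T b c v = (if (c, v) \<in> F then X ^ wt T c v * z c v else 0)"
      using insert by auto
    show ?case
      using b cv insert.hyps x
      by (intro bexI[of _ "b \<oplus>\<^bsub>B\<^esub> (Zb (z c v) \<otimes>\<^bsub>B\<^esub> q c v)"]) (auto simp: mb_add mb_Z_mult mb_q)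
  qed
  from this[of "V \<times> V"] show ?thesis by auto
qed

section \<open>The rank one modules\<close>

text \<open>The action and the matrix use the same chosen representative of \<open>b\<close>, so
  this is only a regrouping of the paths by source and weight.\<close>

lemma L_smult:
  assumes T: "kset T" and b: "b \<in> carrier B"
  shows "b \<odot>\<^bsub>L_mod n T\<^esub> x = (\<lambda>j. if j \<in> V then \<Sum>i\<in>V. mb T b i j * x i else 0)"
proof
  fix j
  define a where "a = (SOME a. a \<in> b)"
  let ?W = "\<lambda>i m. {w. pt i w = j \<and> pw T i w = m}"
  let ?U = "\<lambda>i m. {w. pt i w = j \<and> pw T i w \<le> m}"
  have mb: "mb T b i j = mt T a i j" for i by (simp add: B_matrix_def a_def)
  have UW: "?U i m = (\<Union>q\<in>{..m}. ?W i q)" for i m by auto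
  have finU: "finite (?U i m)" if "i \<in> V" for i m
    unfolding UW using finite_weight_class[OF T that] by auto
  have "(b \<odot>\<^bsub>L_mod n T\<^esub> x) j $ m = (\<Sum>i\<in>V. mb T b i j * x i) $ m" for m
  proof -
    have "(b \<odot>\<^bsub>L_mod n T\<^esub> x) j $ m
      = (\<Sum>(i, w) \<in> Sigma V (\<lambda>i. ?U i m). a (i, w) * x i $ (m - pw T i w))"
      by (simp add: L_mod_def series_act_def a_def) (rule sum.cong, auto)
    also have "\<dots> = (\<Sum>i\<in>V. \<Sum>w\<in>?U i m. a (i, w) * x i $ (m - pw T i w))"
      by (rule sum.Sigma[symmetric]) (auto intro: finU)
    also have "\<dots> = (\<Sum>i\<in>V. \<Sum>q\<le>m. mt T a i j $ q * x i $ (m - q))"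
    proof (rule sum.cong[OF refl])
      fix i assume i: "i \<in> V"
      have "(\<Sum>w\<in>?U i m. a (i, w) * x i $ (m - pw T i w))
        = (\<Sum>q\<in>{..m}. \<Sum>w | w \<in> ?U i m \<and> pw T i w = q. a (i, w) * x i $ (m - pw T i w))"
        by (rule sum.group[symmetric]) (auto intro: finU[OF i])
      also have "\<dots> = (\<Sum>q\<in>{..m}. \<Sum>w\<in>?W i q. a (i, w) * x i $ (m - q))"
        by (intro sum.cong) auto
      finally show "(\<Sum>w\<in>?U i m. a (i, w) * x i $ (m - pw T i w)) = (\<Sum>q\<le>m. mt T a i j $ q * x i $ (m - q))"
        by (simp add: mt_nth sum_distrib_right)
    qed
    also have "\<dots> = (\<Sum>i\<in>V. mb T b i j * x i) $ m"
      by (simp add: fps_sum_nth fps_mult_nth mb atLeast0AtMost)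
    finally show ?thesis .
  qed
  moreover have "(b \<odot>\<^bsub>L_mod n T\<^esub> x) j = 0" if "j \<notin> V"
  proof -
    have e: "{(i, w). i \<in> V \<and> pt i w = j \<and> pw T i w \<le> m} = {}" for m using that by auto
    show ?thesis by (rule fps_ext) (simp add: L_mod_def series_act_def e)
  qed
  ultimately show "(b \<odot>\<^bsub>L_mod n T\<^esub> x) j = (if j \<in> V then \<Sum>i\<in>V. mb T b i j * x i else 0)"
    by (auto intro: fps_ext)
qed

lemma L_simps:
  "x \<in> carrier (L_mod n T) \<longleftrightarrow> (\<forall>j. j \<notin> V \<longrightarrow> x j = 0)"
  "\<zero>\<^bsub>L_mod n T\<^esub> = (\<lambda>_. 0)"
  "x \<oplus>\<^bsub>L_mod n T\<^esub> y = (\<lambda>j. x j + y j)"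
  by (simp_all add: L_mod_def)

lemma L_module:
  assumes T: "kset T"
  shows "left_module B (L_mod n T)"
proof -
  have ag: "abelian_group (L_mod n T)"
  proof (rule abelian_groupI)
    fix x assume "x \<in> carrier (L_mod n T)"
    then show "\<exists>y\<in>carrier (L_mod n T). y \<oplus>\<^bsub>L_mod n T\<^esub> x = \<zero>\<^bsub>L_mod n T\<^esub>"
      by (intro bexI[of _ "\<lambda>p. - x p"]) (auto simp: L_simps)
  qed (auto simp: L_simps ac_simps)
  show ?thesis
  proof (intro left_module.intro B_ring ag left_module_axioms.intro)
    fix a b x assume ab: "a \<in> carrier B" "b \<in> carrier B" and x: "x \<in> carrier (L_mod n T)"
    show "(a \<oplus>\<^bsub>B\<^esub> b) \<odot>\<^bsub>L_mod n T\<^esub> x = a \<odot>\<^bsub>L_mod n T\<^esub> x \<oplus>\<^bsub>L_mod n T\<^esub> b \<odot>\<^bsub>L_mod n T\<^esub> x"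
      using ab by (auto simp: L_simps L_smult[OF T] mb_add[OF T] sum.distrib algebra_simps)
    show "(a \<otimes>\<^bsub>B\<^esub> b) \<odot>\<^bsub>L_mod n T\<^esub> x = a \<odot>\<^bsub>L_mod n T\<^esub> (b \<odot>\<^bsub>L_mod n T\<^esub> x)"
    proof
      fix j
      have "(\<Sum>i\<in>V. (\<Sum>u\<in>V. mb T a u j * mb T b i u) * x i) = (\<Sum>u\<in>V. mb T a u j * (\<Sum>i\<in>V. mb T b i u * x i))"
        unfolding sum_distrib_left sum_distrib_right by (subst sum.swap) (simp add: mult.assoc)
      then show "((a \<otimes>\<^bsub>B\<^esub> b) \<odot>\<^bsub>L_mod n T\<^esub> x) j = (a \<odot>\<^bsub>L_mod n T\<^esub> (b \<odot>\<^bsub>L_mod n T\<^esub> x)) j"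
        using ab by (simp add: L_smult[OF T] mb_mult[OF T])
    qed
  next
    fix x assume x: "x \<in> carrier (L_mod n T)"
    show "\<one>\<^bsub>B\<^esub> \<odot>\<^bsub>L_mod n T\<^esub> x = x"
    proof
      fix j
      have "(\<Sum>i\<in>V. mb T \<one>\<^bsub>B\<^esub> i j * x i) = (\<Sum>i\<in>V. if i = j then x i else 0)" if "j \<in> V"
        using that by (intro sum.cong) (auto simp: mb_one[OF T])
      then show "(\<one>\<^bsub>B\<^esub> \<odot>\<^bsub>L_mod n T\<^esub> x) j = x j"
        using x by (simp add: L_smult[OF T] L_simps)
    qed
  qed (auto simp: L_simps L_smult[OF T] sum.distrib algebra_simps)
qed

lemma L_Zb:
  assumes "kset T" "x \<in> carrier (L_mod n T)"
  shows "Zb z \<odot>\<^bsub>L_mod n T\<^esub> x = (\<lambda>j. z * x j)"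
proof
  fix j
  have "(\<Sum>i\<in>V. mb T (Zb z) i j * x i) = (\<Sum>i\<in>V. if i = j then z * x i else 0)" if "j \<in> V"
    using that by (intro sum.cong) (auto simp: mb_Z[OF assms(1)])
  then show "(Zb z \<odot>\<^bsub>L_mod n T\<^esub> x) j = z * x j"
    using assms by (simp add: L_smult L_simps)
qed

lemma L_q:
  assumes "kset T" "c \<in> V" "v \<in> V"
  shows "q c v \<odot>\<^bsub>L_mod n T\<^esub> x = (\<lambda>j. if j = v then X ^ wt T c v * x c else 0)"
proof
  fix j
  have "(\<Sum>i\<in>V. mb T (q c v) i j * x i) = (\<Sum>i\<in>V. if i = c then (if j = v then X ^ wt T c v * x i else 0) else 0)" if "j \<in> V"
    using that assms by (intro sum.cong) (auto simp: mb_q)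
  then show "(q c v \<odot>\<^bsub>L_mod n T\<^esub> x) j = (if j = v then X ^ wt T c v * x c else 0)"
    using assms by (auto simp: L_smult)
qed

end


section \<open>Modules over B\<close>

definition single :: "int \<Rightarrow> complex fps \<Rightarrow> int \<Rightarrow> complex fps" where
  "single c z = (\<lambda>j. if j = c then z else 0)"

lemma (in abelian_group) minus_eq_zeroD:
  "x \<in> carrier G \<Longrightarrow> y \<in> carrier G \<Longrightarrow> x \<ominus> y = \<zero> \<Longrightarrow> x = y"
  by (metis a_minus_def a_inv_closed minus_equality minus_minus)

context kn
begin

abbreviation "L \<equiv> L_mod n"
abbreviation (input) "zs W z x \<equiv> Zb z \<odot>\<^bsub>W\<^esub> x"
abbreviation (input) "qa W c v x \<equiv> q c v \<odot>\<^bsub>W\<^esub> x"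

lemma smult_zero_right:
  assumes W: "left_module B W" and a: "a \<in> carrier B"
  shows "a \<odot>\<^bsub>W\<^esub> \<zero>\<^bsub>W\<^esub> = \<zero>\<^bsub>W\<^esub>"
proof -
  interpret W: left_module B W by fact
  have "a \<odot>\<^bsub>W\<^esub> \<zero>\<^bsub>W\<^esub> \<oplus>\<^bsub>W\<^esub> a \<odot>\<^bsub>W\<^esub> \<zero>\<^bsub>W\<^esub> = a \<odot>\<^bsub>W\<^esub> \<zero>\<^bsub>W\<^esub> \<oplus>\<^bsub>W\<^esub> \<zero>\<^bsub>W\<^esub>"
    using a by (simp add: W.smult_r_distr[symmetric] W.smult_closed)
  then show ?thesis using a by (simp add: W.smult_closed)
qed

lemma smult_zero_left:
  assumes W: "left_module B W" and x: "x \<in> carrier W"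
  shows "\<zero>\<^bsub>B\<^esub> \<odot>\<^bsub>W\<^esub> x = \<zero>\<^bsub>W\<^esub>"
proof -
  interpret W: left_module B W by fact
  have "\<zero>\<^bsub>B\<^esub> \<odot>\<^bsub>W\<^esub> x \<oplus>\<^bsub>W\<^esub> \<zero>\<^bsub>B\<^esub> \<odot>\<^bsub>W\<^esub> x = \<zero>\<^bsub>B\<^esub> \<odot>\<^bsub>W\<^esub> x \<oplus>\<^bsub>W\<^esub> \<zero>\<^bsub>W\<^esub>"
    using x by (simp add: W.smult_l_distr[symmetric] W.smult_closed)
  then show ?thesis using x by (simp add: W.smult_closed)
qed

lemma smult_minus_right:
  assumes W: "left_module B W" and a: "a \<in> carrier B" and x: "x \<in> carrier W"
  shows "a \<odot>\<^bsub>W\<^esub> (\<ominus>\<^bsub>W\<^esub> x) = \<ominus>\<^bsub>W\<^esub> (a \<odot>\<^bsub>W\<^esub> x)"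
proof -
  interpret W: left_module B W by fact
  have "a \<odot>\<^bsub>W\<^esub> (\<ominus>\<^bsub>W\<^esub> x) \<oplus>\<^bsub>W\<^esub> a \<odot>\<^bsub>W\<^esub> x = \<zero>\<^bsub>W\<^esub>"
    using a x by (simp add: W.smult_r_distr[symmetric] W.l_neg smult_zero_right[OF W])
  then show ?thesis using a x W.minus_equality W.smult_closed by auto
qed

lemma mod_facts:
  assumes W: "left_module B W"
  shows mod_abelian: "abelian_group W"
    and zs_in: "x \<in> carrier W \<Longrightarrow> zs W z x \<in> carrier W"
    and qa_in: "c \<in> V \<Longrightarrow> x \<in> carrier W \<Longrightarrow> qa W c v x \<in> carrier W"
    and zs_zs: "x \<in> carrier W \<Longrightarrow> zs W y (zs W z x) = zs W (y * z) x"
    and zs_one: "x \<in> carrier W \<Longrightarrow> zs W 1 x = x"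
    and zs_add_left: "x \<in> carrier W \<Longrightarrow> zs W (y + z) x = zs W y x \<oplus>\<^bsub>W\<^esub> zs W z x"
    and zs_add: "x \<in> carrier W \<Longrightarrow> x' \<in> carrier W \<Longrightarrow> zs W z (x \<oplus>\<^bsub>W\<^esub> x') = zs W z x \<oplus>\<^bsub>W\<^esub> zs W z x'"
    and zs_zero_right: "zs W z \<zero>\<^bsub>W\<^esub> = \<zero>\<^bsub>W\<^esub>"
    and zs_zero_left: "x \<in> carrier W \<Longrightarrow> zs W 0 x = \<zero>\<^bsub>W\<^esub>"
    and zs_minus: "x \<in> carrier W \<Longrightarrow> zs W (- z) x = \<ominus>\<^bsub>W\<^esub> zs W z x"
    and qa_add: "c \<in> V \<Longrightarrow> x \<in> carrier W \<Longrightarrow> x' \<in> carrier W \<Longrightarrow> qa W c v (x \<oplus>\<^bsub>W\<^esub> x') = qa W c v x \<oplus>\<^bsub>W\<^esub> qa W c v x'"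
    and qa_zero: "c \<in> V \<Longrightarrow> qa W c v \<zero>\<^bsub>W\<^esub> = \<zero>\<^bsub>W\<^esub>"
    and qa_zs: "c \<in> V \<Longrightarrow> x \<in> carrier W \<Longrightarrow> qa W c v (zs W z x) = zs W z (qa W c v x)"
    and qa_qa: "c \<in> V \<Longrightarrow> u \<in> V \<Longrightarrow> v \<in> V \<Longrightarrow> x \<in> carrier W \<Longrightarrow>
       qa W u v (qa W c u x) = zs W (X ^ tri c u v) (qa W c v x)"
    and qa_qa_zero: "c \<in> V \<Longrightarrow> u \<in> V \<Longrightarrow> u' \<in> V \<Longrightarrow> v \<in> V \<Longrightarrow> u \<noteq> u' \<Longrightarrow> x \<in> carrier W \<Longrightarrow>
       qa W u v (qa W c u' x) = \<zero>\<^bsub>W\<^esub>"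
proof -
  interpret W: left_module B W by fact
  show ag: "abelian_group W" by (rule W.abelian_group_axioms)
  show "x \<in> carrier W \<Longrightarrow> zs W z x \<in> carrier W" by (simp add: W.smult_closed)
  show "c \<in> V \<Longrightarrow> x \<in> carrier W \<Longrightarrow> qa W c v x \<in> carrier W" by (simp add: W.smult_closed)
  show "x \<in> carrier W \<Longrightarrow> zs W y (zs W z x) = zs W (y * z) x"
    by (simp add: W.smult_assoc1[symmetric] Zb_mult)
  show "x \<in> carrier W \<Longrightarrow> zs W 1 x = x" by (simp add: Zb_one W.smult_one)
  show add_left: "zs W (y + z) x = zs W y x \<oplus>\<^bsub>W\<^esub> zs W z x" if "x \<in> carrier W" for x y z
    using that by (simp add: Zb_add[symmetric] W.smult_l_distr)
  show "x \<in> carrier W \<Longrightarrow> x' \<in> carrier W \<Longrightarrow> zs W z (x \<oplus>\<^bsub>W\<^esub> x') = zs W z x \<oplus>\<^bsub>W\<^esub> zs W z x'"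
    by (simp add: W.smult_r_distr)
  show "zs W z \<zero>\<^bsub>W\<^esub> = \<zero>\<^bsub>W\<^esub>" by (simp add: smult_zero_right[OF W])
  show zero_left: "zs W 0 x = \<zero>\<^bsub>W\<^esub>" if "x \<in> carrier W" for x
  proof -
    have "zs W 0 x \<oplus>\<^bsub>W\<^esub> zs W 0 x = zs W 0 x \<oplus>\<^bsub>W\<^esub> \<zero>\<^bsub>W\<^esub>"
      using that add_left[OF that, of 0 0] by (simp add: W.smult_closed)
    then show ?thesis using that by (simp add: W.smult_closed)
  qed
  show "zs W (- z) x = \<ominus>\<^bsub>W\<^esub> zs W z x" if "x \<in> carrier W"
    using add_left[OF that, of "- z" z] zero_left[OF that] that W.minus_equality[of "zs W (- z) x" "zs W z x"]
    by (simp add: W.smult_closed)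
  show "c \<in> V \<Longrightarrow> x \<in> carrier W \<Longrightarrow> x' \<in> carrier W \<Longrightarrow> qa W c v (x \<oplus>\<^bsub>W\<^esub> x') = qa W c v x \<oplus>\<^bsub>W\<^esub> qa W c v x'"
    by (simp add: W.smult_r_distr)
  show "c \<in> V \<Longrightarrow> qa W c v \<zero>\<^bsub>W\<^esub> = \<zero>\<^bsub>W\<^esub>" by (simp add: smult_zero_right[OF W])
  show "c \<in> V \<Longrightarrow> x \<in> carrier W \<Longrightarrow> qa W c v (zs W z x) = zs W z (qa W c v x)"
    by (simp add: W.smult_assoc1[symmetric] Zb_commute)
  show "qa W u v (qa W c u x) = zs W (X ^ tri c u v) (qa W c v x)"
    if "c \<in> V" "u \<in> V" "v \<in> V" "x \<in> carrier W"
    using that by (simp add: W.smult_assoc1[symmetric] q_mult_q)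
  show "qa W u v (qa W c u' x) = \<zero>\<^bsub>W\<^esub>"
    if "c \<in> V" "u \<in> V" "u' \<in> V" "v \<in> V" "u \<noteq> u'" "x \<in> carrier W"
    using that smult_zero_left[OF W] by (simp add: W.smult_assoc1[symmetric] q_mult_q_zero)
qed

lemma tri_refl [simp]: "c \<in> V \<Longrightarrow> v \<in> V \<Longrightarrow> tri c c v = 0" "c \<in> V \<Longrightarrow> v \<in> V \<Longrightarrow> tri c v v = 0"
  using wt_tri[OF kset_std, of c c v] wt_tri[OF kset_std, of c v v] by simp_all

lemma qa_idem:
  assumes "left_module B W" "c \<in> V" "v \<in> V" "x \<in> carrier W"
  shows "qa W c v (qa W c c x) = qa W c v x" "qa W v v (qa W c v x) = qa W c v x"
  using qa_qa[OF assms(1), of c c v x] qa_qa[OF assms(1), of c v v x] zs_one[OF assms(1)] qa_in[OF assms(1)] assms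
  by simp_all

text \<open>A shortest path from \<open>c\<close> sees only the component \<open>qa W c c x\<close>.
  Since such paths span B, the unit kills x, without any need to expand it into idempotents.\<close>

lemma mod_zeroI:
  assumes W: "left_module B W" and x: "x \<in> carrier W" and e: "\<And>c. c \<in> V \<Longrightarrow> qa W c c x = \<zero>\<^bsub>W\<^esub>"
  shows "x = \<zero>\<^bsub>W\<^esub>"
proof -
  interpret W: left_module B W by fact
  have "b \<odot>\<^bsub>W\<^esub> x = \<zero>\<^bsub>W\<^esub>" if "b \<in> carrier B" for b
    using that
  proof (induction b rule: B_induct)
    case (gen z c v)
    have "qa W c v x = \<zero>\<^bsub>W\<^esub>"
      using qa_idem(1)[OF W gen x] e[OF gen(1)] qa_zero[OF W gen(1)] by simp
    then show ?case using gen x by (simp add: W.smult_assoc1 zs_zero_right[OF W])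
  qed (simp_all add: smult_zero_left[OF W x] W.smult_l_distr x)
  from this[of "\<one>\<^bsub>B\<^esub>"] show ?thesis using x by (simp add: W.smult_one)
qed

lemma mod_eqI:
  assumes W: "left_module B W" and x: "x \<in> carrier W" "y \<in> carrier W"
    and e: "\<And>c. c \<in> V \<Longrightarrow> qa W c c x = qa W c c y"
  shows "x = y"
proof -
  interpret W: left_module B W by fact
  have "x \<ominus>\<^bsub>W\<^esub> y = \<zero>\<^bsub>W\<^esub>"
  proof (rule mod_zeroI[OF W])
    fix c assume c: "c \<in> V"
    show "qa W c c (x \<ominus>\<^bsub>W\<^esub> y) = \<zero>\<^bsub>W\<^esub>"
      using x c e[OF c] by (simp add: W.minus_eq qa_add[OF W] smult_minus_right[OF W] qa_in[OF W] W.r_neg)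
  qed (use x in simp)
  then show ?thesis using x W.minus_eq_zeroD by simp
qed

lemma mod_divisibleI:
  assumes W: "left_module B W" and x: "x \<in> carrier W"
    and e: "\<And>c. c \<in> V \<Longrightarrow> \<exists>y\<in>carrier W. qa W c c x = zs W z y"
  shows "\<exists>y\<in>carrier W. x = zs W z y"
proof -
  interpret W: left_module B W by fact
  have "\<exists>y\<in>carrier W. b \<odot>\<^bsub>W\<^esub> x = zs W z y" if "b \<in> carrier B" for b
    using that
  proof (induction b rule: B_induct)
    case zero
    then show ?case using smult_zero_left[OF W x] zs_zero_right[OF W] by (intro bexI[of _ "\<zero>\<^bsub>W\<^esub>"]) auto
  next
    case (add b b')
    then obtain y y' where "y \<in> carrier W" "b \<odot>\<^bsub>W\<^esub> x = zs W z y" "y' \<in> carrier W" "b' \<odot>\<^bsub>W\<^esub> x = zs W z y'"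
      by blast
    then show ?case using add x
      by (intro bexI[of _ "y \<oplus>\<^bsub>W\<^esub> y'"]) (auto simp: W.smult_l_distr zs_add[OF W])
  next
    case (gen y c v)
    obtain w where w: "w \<in> carrier W" "qa W c c x = zs W z w" using e[OF gen(1)] by blast
    have "qa W c v x = zs W z (qa W c v w)"
      using qa_idem(1)[OF W gen x] w qa_zs[OF W gen(1) w(1)] by simp
    then have "(Zb y \<otimes>\<^bsub>B\<^esub> q c v) \<odot>\<^bsub>W\<^esub> x = zs W z (zs W y (qa W c v w))"
      using gen x w by (simp add: W.smult_assoc1 zs_zs[OF W] qa_in[OF W] mult.commute)
    then show ?case using w gen by (auto intro: zs_in[OF W] qa_in[OF W])
  qed
  from this[of "\<one>\<^bsub>B\<^esub>"] show ?thesis using x by (simp add: W.smult_one)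
qed

lemma submodule_of_closed:
  assumes W: "left_module B W" and "H \<subseteq> carrier W" "\<zero>\<^bsub>W\<^esub> \<in> H"
    and "\<And>x y. x \<in> H \<Longrightarrow> y \<in> H \<Longrightarrow> x \<oplus>\<^bsub>W\<^esub> y \<in> H"
    and sm: "\<And>b x. b \<in> carrier B \<Longrightarrow> x \<in> H \<Longrightarrow> b \<odot>\<^bsub>W\<^esub> x \<in> H"
  shows "submodule H B W"
proof -
  interpret W: left_module B W by fact
  have "\<ominus>\<^bsub>W\<^esub> x \<in> H" if "x \<in> H" for x
  proof -
    have "zs W (- 1) x = \<ominus>\<^bsub>W\<^esub> x" using zs_minus[OF W, of x 1] zs_one[OF W] that assms(2) by auto
    then show ?thesis using sm[of "Zb (- 1)" x] that by simp
  qed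
  then show ?thesis
    using assms by (intro submodule.intro submodule_axioms.intro W.add.subgroupI) (auto simp: a_inv_def)
qed

lemma submodule_facts:
  assumes "submodule H B W"
  shows "H \<subseteq> carrier W" "\<zero>\<^bsub>W\<^esub> \<in> H" "x \<in> H \<Longrightarrow> y \<in> H \<Longrightarrow> x \<oplus>\<^bsub>W\<^esub> y \<in> H"
    "b \<in> carrier B \<Longrightarrow> x \<in> H \<Longrightarrow> b \<odot>\<^bsub>W\<^esub> x \<in> H"
proof -
  interpret H: submodule H B W by fact
  show "H \<subseteq> carrier W" "\<zero>\<^bsub>W\<^esub> \<in> H" "x \<in> H \<Longrightarrow> y \<in> H \<Longrightarrow> x \<oplus>\<^bsub>W\<^esub> y \<in> H"
    "b \<in> carrier B \<Longrightarrow> x \<in> H \<Longrightarrow> b \<odot>\<^bsub>W\<^esub> x \<in> H"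
    using H.subset H.one_closed H.m_closed by auto
qed

subsection \<open>Homomorphisms\<close>

lemma mod_hom_simps:
  assumes "f \<in> mod_hom B M N"
  shows hom_in: "x \<in> carrier M \<Longrightarrow> f x \<in> carrier N"
    and hom_add: "x \<in> carrier M \<Longrightarrow> y \<in> carrier M \<Longrightarrow> f (x \<oplus>\<^bsub>M\<^esub> y) = f x \<oplus>\<^bsub>N\<^esub> f y"
    and hom_smult: "b \<in> carrier B \<Longrightarrow> x \<in> carrier M \<Longrightarrow> f (b \<odot>\<^bsub>M\<^esub> x) = b \<odot>\<^bsub>N\<^esub> f x"
    and hom_zs: "x \<in> carrier M \<Longrightarrow> f (zs M z x) = zs N z (f x)"
    and hom_qa: "c \<in> V \<Longrightarrow> x \<in> carrier M \<Longrightarrow> f (qa M c v x) = qa N c v (f x)"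
  using assms by (auto simp: mod_hom_def)

text \<open>Scalars and shortest paths generate B, so compatibility with these two kinds of elements
  is enough.\<close>

lemma mod_homI:
  assumes M: "left_module B M" and N: "left_module B N"
    and f: "\<And>x. x \<in> carrier M \<Longrightarrow> f x \<in> carrier N"
    and add: "\<And>x y. x \<in> carrier M \<Longrightarrow> y \<in> carrier M \<Longrightarrow> f (x \<oplus>\<^bsub>M\<^esub> y) = f x \<oplus>\<^bsub>N\<^esub> f y"
    and zs: "\<And>z x. x \<in> carrier M \<Longrightarrow> f (zs M z x) = zs N z (f x)"
    and qa: "\<And>c v x. c \<in> V \<Longrightarrow> v \<in> V \<Longrightarrow> x \<in> carrier M \<Longrightarrow> f (qa M c v x) = qa N c v (f x)"
  shows "f \<in> mod_hom B M N"
proof -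
  interpret M: left_module B M by fact
  interpret N: left_module B N by fact
  have "\<forall>x\<in>carrier M. f (b \<odot>\<^bsub>M\<^esub> x) = b \<odot>\<^bsub>N\<^esub> f x" if "b \<in> carrier B" for b
    using that
  proof (induction b rule: B_induct)
    case zero
    show ?case
    proof
      fix x assume x: "x \<in> carrier M"
      have "f \<zero>\<^bsub>M\<^esub> = \<zero>\<^bsub>N\<^esub>" using zs[of "\<zero>\<^bsub>M\<^esub>" 0] f zs_zero_right[OF M] zs_zero_left[OF N] by simp
      then show "f (\<zero>\<^bsub>B\<^esub> \<odot>\<^bsub>M\<^esub> x) = \<zero>\<^bsub>B\<^esub> \<odot>\<^bsub>N\<^esub> f x" using x f by (simp add: smult_zero_left[OF M] smult_zero_left[OF N])
    qed
  next
    case (add b b')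
    then show ?case using f by (auto simp: M.smult_l_distr N.smult_l_distr M.smult_closed assms(4))
  next
    case (gen z c v)
    then show ?case using f by (auto simp: M.smult_assoc1 N.smult_assoc1 zs qa qa_in[OF M])
  qed
  then show ?thesis using f add by (auto simp: mod_hom_def)
qed

lemma hom_zero:
  assumes "left_module B M" "left_module B N" "f \<in> mod_hom B M N"
  shows "f \<zero>\<^bsub>M\<^esub> = \<zero>\<^bsub>N\<^esub>"
proof -
  interpret M: left_module B M by fact
  show ?thesis
    using hom_zs[OF assms(3), of "\<zero>\<^bsub>M\<^esub>" 0] hom_in[OF assms(3)] zs_zero_right[OF assms(1)] zs_zero_left[OF assms(2)] by simp
qed

lemma hom_minus:
  assumes "left_module B M" "left_module B N" "f \<in> mod_hom B M N" "x \<in> carrier M" "y \<in> carrier M"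
  shows "f (x \<ominus>\<^bsub>M\<^esub> y) = f x \<ominus>\<^bsub>N\<^esub> f y"
proof -
  interpret M: left_module B M by fact
  interpret N: left_module B N by fact
  have "f (\<ominus>\<^bsub>M\<^esub> y) = \<ominus>\<^bsub>N\<^esub> f y"
    using hom_zs[OF assms(3,5), of "- 1"] zs_minus[OF assms(1,5), of 1] zs_one[OF assms(1,5)]
      zs_minus[OF assms(2) hom_in[OF assms(3,5)], of 1] zs_one[OF assms(2) hom_in[OF assms(3,5)]] by simp
  then show ?thesis using assms by (simp add: M.minus_eq N.minus_eq hom_add[OF assms(3)])
qed

lemma hom_comp: "f \<in> mod_hom B M N \<Longrightarrow> g \<in> mod_hom B N P \<Longrightarrow> (\<lambda>x. g (f x)) \<in> mod_hom B M P"
  by (auto simp: mod_hom_def Pi_def)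

lemma hom_id: "(\<lambda>x. x) \<in> mod_hom B M M"
  by (auto simp: mod_hom_def)

lemma hom_zs_comp:
  assumes N: "left_module B N" and f: "f \<in> mod_hom B M N"
  shows "(\<lambda>x. zs N z (f x)) \<in> mod_hom B M N"
proof -
  interpret N: left_module B N by fact
  show ?thesis using f
    by (auto simp: mod_hom_def Pi_def N.smult_closed N.smult_r_distr N.smult_assoc1[symmetric] Zb_commute)
qed

lemma hom_plus:
  assumes N: "left_module B N" and f: "f \<in> mod_hom B M N" and g: "g \<in> mod_hom B M N"
  shows "(\<lambda>x. f x \<oplus>\<^bsub>N\<^esub> g x) \<in> mod_hom B M N"
proof -
  interpret N: left_module B N by fact
  show ?thesis using f g
    by (auto simp: mod_hom_def Pi_def N.smult_r_distr N.a_ac)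
qed

definition tfree :: "'m B_module \<Rightarrow> bool" where
  "tfree W \<longleftrightarrow> (\<forall>x\<in>carrier W. \<forall>z. z \<noteq> 0 \<longrightarrow> zs W z x = \<zero>\<^bsub>W\<^esub> \<longrightarrow> x = \<zero>\<^bsub>W\<^esub>)"

lemma tfree_cancel:
  assumes W: "left_module B W" and t: "tfree W" and x: "x \<in> carrier W" "y \<in> carrier W"
    and z: "z \<noteq> 0" and e: "zs W z x = zs W z y"
  shows "x = y"
proof -
  interpret W: left_module B W by fact
  have "zs W z (x \<ominus>\<^bsub>W\<^esub> y) = \<zero>\<^bsub>W\<^esub>"
    using x e by (simp add: W.minus_eq zs_add[OF W] smult_minus_right[OF W] zs_in[OF W] W.r_neg)
  then have "x \<ominus>\<^bsub>W\<^esub> y = \<zero>\<^bsub>W\<^esub>" using t x z by (simp add: tfree_def)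
  then show ?thesis using x W.minus_eq_zeroD by simp
qed

text \<open>Quotients by \<open>z\<close> are unique in a torsion-free module, so the pointwise
  quotient is again a homomorphism.\<close>

lemma hom_divide_scalar:
  assumes M: "left_module B M" and W: "left_module B W" and t: "tfree W" and h: "h \<in> mod_hom B M W"
    and z: "z \<noteq> 0" and d: "\<And>x. x \<in> carrier M \<Longrightarrow> \<exists>y\<in>carrier W. h x = zs W z y"
  obtains u where "u \<in> mod_hom B M W" "\<And>x. x \<in> carrier M \<Longrightarrow> h x = zs W z (u x)"
proof -
  interpret M: left_module B M by fact
  interpret W: left_module B W by fact
  obtain u where u: "\<And>x. x \<in> carrier M \<Longrightarrow> u x \<in> carrier W \<and> h x = zs W z (u x)"
    using d by metis
  note c = tfree_cancel[OF W t _ _ z]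
  have "u \<in> mod_hom B M W"
  proof (rule mod_homI[OF M W])
    fix x y assume "x \<in> carrier M" "y \<in> carrier M"
    then show "u (x \<oplus>\<^bsub>M\<^esub> y) = u x \<oplus>\<^bsub>W\<^esub> u y"
      using u hom_add[OF h, of x y] by - (rule c, simp_all add: zs_add[OF W])
  next
    fix y x assume "x \<in> carrier M"
    then show "u (zs M y x) = zs W y (u x)"
      using u zs_in[OF M, of x y] hom_zs[OF h, of x y]
      by - (rule c, simp_all add: zs_in[OF W] zs_zs[OF W] mult.commute)
  next
    fix a b x assume "x \<in> carrier M" "a \<in> V" "b \<in> V"
    then show "u (qa M a b x) = qa W a b (u x)"
      using u qa_in[OF M, of a x b] hom_qa[OF h, of a x b]
      by - (rule c, simp_all add: qa_in[OF W] qa_zs[OF W])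
  qed (use u in auto)
  then show ?thesis using u that by blast
qed

subsection \<open>Maps into and out of the rank one modules\<close>

definition zlin :: "'m B_module \<Rightarrow> ('m \<Rightarrow> complex fps) \<Rightarrow> bool" where
  "zlin W l \<longleftrightarrow> (\<forall>x\<in>carrier W. \<forall>y\<in>carrier W. l (x \<oplus>\<^bsub>W\<^esub> y) = l x + l y) \<and> (\<forall>z. \<forall>x\<in>carrier W. l (zs W z x) = z * l x)"

lemma hom_to_L_apply:
  assumes T: "kset T" and M: "left_module B M" and f: "f \<in> mod_hom B M (L T)" and x: "x \<in> carrier M"
  shows "y \<in> carrier M \<Longrightarrow> f (x \<oplus>\<^bsub>M\<^esub> y) c = f x c + f y c"
    and "f (zs M z x) c = z * f x c"
    and "u \<in> V \<Longrightarrow> v \<in> V \<Longrightarrow> f (qa M u v x) c = (if c = v then X ^ wt T u v * f x u else 0)"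
    and "c \<notin> V \<Longrightarrow> f x c = 0"
  using hom_add[OF f x] hom_zs[OF f x] hom_qa[OF f _ x] L_Zb[OF T hom_in[OF f x]] L_q[OF T] hom_in[OF f x]
  by (simp_all add: L_simps)

lemma hom_to_LI:
  assumes T: "kset T" and M: "left_module B M"
    and "\<And>x c. x \<in> carrier M \<Longrightarrow> c \<notin> V \<Longrightarrow> f x c = 0"
    and "\<And>x y c. x \<in> carrier M \<Longrightarrow> y \<in> carrier M \<Longrightarrow> c \<in> V \<Longrightarrow> f (x \<oplus>\<^bsub>M\<^esub> y) c = f x c + f y c"
    and "\<And>x z c. x \<in> carrier M \<Longrightarrow> c \<in> V \<Longrightarrow> f (zs M z x) c = z * f x c"
    and "\<And>x u v c. x \<in> carrier M \<Longrightarrow> u \<in> V \<Longrightarrow> v \<in> V \<Longrightarrow> c \<in> V \<Longrightarrow>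
          f (qa M u v x) c = (if c = v then X ^ wt T u v * f x u else 0)"
  shows "f \<in> mod_hom B M (L T)"
proof -
  interpret M: left_module B M by fact
  have c: "f x \<in> carrier (L T)" if "x \<in> carrier M" for x using assms(3) that by (simp add: L_simps)
  show ?thesis
  proof (rule mod_homI[OF M L_module[OF T] c])
    show "f (x \<oplus>\<^bsub>M\<^esub> y) = f x \<oplus>\<^bsub>L T\<^esub> f y" if "x \<in> carrier M" "y \<in> carrier M" for x y
    proof
      fix c
      show "f (x \<oplus>\<^bsub>M\<^esub> y) c = (f x \<oplus>\<^bsub>L T\<^esub> f y) c"
        using that assms(3)[OF that(1), of c] assms(3)[OF that(2), of c] assms(3)[OF M.a_closed[OF that], of c]
          assms(4)[OF that, of c] by (cases "c \<in> V") (simp_all add: L_simps)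
    qed
    show "f (zs M z x) = zs (L T) z (f x)" if "x \<in> carrier M" for z x
    proof
      fix c'
      show "f (zs M z x) c' = (zs (L T) z (f x)) c'"
        using that assms(3)[OF that, of c'] assms(3)[OF zs_in[OF M that], of c' z]
          assms(5)[OF that, of c' z] by (cases "c' \<in> V") (simp_all add: L_Zb[OF T c])
    qed
    show "f (qa M u v x) = qa (L T) u v (f x)" if "u \<in> V" "v \<in> V" "x \<in> carrier M" for u v x
    proof
      fix c
      show "f (qa M u v x) c = (qa (L T) u v (f x)) c"
        using that assms(3)[OF qa_in[OF M that(1,3)], of c v] assms(6)[OF that(3,1,2), of c]
        by (cases "c \<in> V") (auto simp: L_q[OF T])
    qed
  qed
qed

lemma hom_L_minus:
  assumes T: "kset T" and M: "left_module B M" and f: "f \<in> mod_hom B M (L T)" and g: "g \<in> mod_hom B M (L T)"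
  shows "(\<lambda>x c. f x c - g x c) \<in> mod_hom B M (L T)"
    and "(\<lambda>x c. f x c + g x c) \<in> mod_hom B M (L T)"
    and "(\<lambda>x c. z * f x c) \<in> mod_hom B M (L T)"
  by (rule hom_to_LI[OF T M]; simp add: hom_to_L_apply[OF T M f] hom_to_L_apply[OF T M g] algebra_simps)+

text \<open>The condition on \<open>p\<close> says that all paths into the valley \<open>v\<close>
  have weight zero in the submodule with exponents \<open>p\<close>. A map into it is then
  determined by its \<open>v\<close>-component, and any linear form may be prescribed there.\<close>

lemma functional_hom:
  assumes S: "kset S" and W: "left_module B W" and l: "zlin W l" and v: "v \<in> V"
    and p: "\<And>c. c \<in> V \<Longrightarrow> p c + wt S c v = p v"
  shows "(\<lambda>w c. if c \<in> V then X ^ p c * l (qa W c v w) else 0) \<in> mod_hom B W (L S)"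
proof (rule hom_to_LI[OF S W])
  fix x a b c assume x: "x \<in> carrier W" and V: "a \<in> V" "b \<in> V" "c \<in> V"
  have "p b + tri a b v = wt S a b + p a"
    using p[OF V(1)] p[OF V(2)] wt_tri[OF S V(1,2) v] by simp
  then have "X ^ p b * X ^ tri a b v = X ^ wt S a b * X ^ p a" by (simp add: power_add[symmetric])
  moreover have "l \<zero>\<^bsub>W\<^esub> = 0"
  proof -
    interpret W: left_module B W by fact
    have "l (zs W 0 \<zero>\<^bsub>W\<^esub>) = 0 * l \<zero>\<^bsub>W\<^esub>" using l W.zero_closed unfolding zlin_def by blast
    then show ?thesis using zs_zero_right[OF W] by simp
  qed
  ultimately show "(if c \<in> V then X ^ p c * l (qa W c v (qa W a b x)) else 0)
    = (if c = b then X ^ wt S a b * (if a \<in> V then X ^ p a * l (qa W a v x) else 0) else 0)"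
    using V v x l qa_qa[OF W V(1,2) v x] qa_qa_zero[OF W V(1,3,2) v _ x] qa_in[OF W V(1) x]
    by (auto simp: zlin_def mult.assoc[symmetric])
qed (use l v in \<open>auto simp: zlin_def qa_add[OF W] qa_zs[OF W] qa_in[OF W] algebra_simps\<close>)

lemma profile_incl:
  assumes T: "kset T" and S: "kset S" and p: "profile n T S p"
  shows "(\<lambda>x c. X ^ p c * x c) \<in> mod_hom B (L T) (L S)"
proof (rule hom_to_LI[OF S L_module[OF T]])
  fix x u v c assume x: "x \<in> carrier (L T)" and V: "u \<in> V" "v \<in> V" "c \<in> V"
  have "X ^ p v * X ^ wt T u v = X ^ wt S u v * X ^ p u"
    using wt_profile[OF p V(1,2)] by (simp add: power_add[symmetric] add.commute)
  then show "X ^ p c * (qa (L T) u v x) c = (if c = v then X ^ wt S u v * (X ^ p u * x u) else 0)"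
    using V by (auto simp: L_q[OF T] mult.assoc[symmetric])
qed (auto simp: L_simps L_Zb[OF T] algebra_simps)

lemma profile_divide:
  assumes T: "kset T" and S: "kset S" and p: "profile n T S p" and M: "left_module B M"
    and f: "f \<in> mod_hom B M (L S)" and d: "\<And>x c. x \<in> carrier M \<Longrightarrow> c \<in> V \<Longrightarrow> X ^ p c dvd f x c"
  obtains g where "g \<in> mod_hom B M (L T)" "\<And>x c. x \<in> carrier M \<Longrightarrow> X ^ p c * g x c = f x c"
proof
  let ?g = "\<lambda>x c. fps_shift (p c) (f x c)"
  show e: "X ^ p c * ?g x c = f x c" if "x \<in> carrier M" for x c
    using d[OF that, of c] hom_to_L_apply(4)[OF S M f that, of c] by (cases "c \<in> V") (auto simp: fps_X_power_shift)
  have sh: "fps_shift m (X ^ m * y) = y" for m and y :: "complex fps"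
    by (simp add: mult.commute)
  have canc: "a = b" if "X ^ m * a = X ^ m * b" for m and a b :: "complex fps"
    using that by simp
  show "?g \<in> mod_hom B M (L T)"
  proof (rule hom_to_LI[OF T M])
    fix x c assume "x \<in> carrier M" "c \<notin> V"
    then show "?g x c = 0" by (simp add: hom_to_L_apply(4)[OF S M f])
  next
    interpret M: left_module B M by fact
    fix x y c assume "x \<in> carrier M" "y \<in> carrier M"
    then show "?g (x \<oplus>\<^bsub>M\<^esub> y) c = ?g x c + ?g y c"
      by (simp add: hom_to_L_apply(1)[OF S M f] fps_shift_add)
  next
    fix x z c assume "x \<in> carrier M"
    then show "?g (zs M z x) c = z * ?g x c"
      by - (rule canc[of "p c"], metis e zs_in[OF M] hom_to_L_apply(2)[OF S M f] mult.left_commute)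
  next
    fix x u v c assume x: "x \<in> carrier M" and V: "u \<in> V" "v \<in> V" "c \<in> V"
    have "X ^ p v * X ^ wt T u v = X ^ wt S u v * X ^ p u"
      using wt_profile[OF p V(1,2)] by (simp add: power_add[symmetric] add.commute)
    then have "X ^ p v * (X ^ wt T u v * ?g x u) = X ^ wt S u v * (X ^ p u * ?g x u)"
      by (simp only: mult.assoc[symmetric])
    then show "?g (qa M u v x) c = (if c = v then X ^ wt T u v * ?g x u else 0)"
      using x V e[OF x, of u] sh[of "p v" "X ^ wt T u v * ?g x u"]
      by (simp add: hom_to_L_apply(3)[OF S M f x] mult.commute)
  qed
qed

text \<open>Moving from \<open>c\<close> to the valley multiplies by \<open>X ^ wt S c v\<close>,
  which is exactly the difference between \<open>X ^ p c\<close> and \<open>X ^ p v\<close>. So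
  divisibility has to be checked at the valley only.\<close>

lemma valley_dvd:
  assumes S: "kset S" and M: "left_module B M" and f: "f \<in> mod_hom B M (L S)" and v: "v \<in> V"
    and p: "\<And>c. c \<in> V \<Longrightarrow> p c + wt S c v = p v"
    and d: "\<And>x. x \<in> carrier M \<Longrightarrow> X ^ p v dvd f x v"
    and x: "x \<in> carrier M" and c: "c \<in> V"
  shows "X ^ p c dvd f x c"
proof -
  have "X ^ p v dvd X ^ wt S c v * f x c"
    using d[OF qa_in[OF M c x], of v] hom_to_L_apply(3)[OF S M f x c v, of v] by simp
  moreover have "X ^ p v = X ^ wt S c v * X ^ p c" using p[OF c] by (simp add: power_add[symmetric] add.commute)
  ultimately show ?thesis by (simp add: dvd_mult_cancel_left)
qed

lemma single_in [simp]: "c \<in> V \<Longrightarrow> single c z \<in> carrier (L T)"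
  by (auto simp: L_simps single_def)

lemma L_qa_single:
  assumes "kset T" "c \<in> V" "v \<in> V"
  shows "qa (L T) c v (single u z) = (if u = c then single v (X ^ wt T c v * z) else \<zero>\<^bsub>L T\<^esub>)"
  using assms by (auto simp: L_q single_def L_simps fun_eq_iff)

lemma L_zs_single: "kset T \<Longrightarrow> c \<in> V \<Longrightarrow> zs (L T) y (single c z) = single c (y * z)"
  by (simp add: L_Zb) (auto simp: single_def fun_eq_iff)

lemma L_qa_eq: "kset T \<Longrightarrow> c \<in> V \<Longrightarrow> v \<in> V \<Longrightarrow> qa (L T) c v x = single v (X ^ wt T c v * x c)"
  by (auto simp: L_q single_def fun_eq_iff)

lemma L_tfree: "kset T \<Longrightarrow> tfree (L T)"
  by (auto simp: tfree_def L_Zb, simp add: L_simps fun_eq_iff)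

text \<open>A power of the variable times \<open>single c 1\<close> is the image of
  \<open>single i 1\<close> under a path, and that power can be cancelled in the target.\<close>

lemma hom_from_L_unique:
  assumes T: "kset T" and W: "left_module B W" and t: "tfree W"
    and h: "h \<in> mod_hom B (L T) W" "h' \<in> mod_hom B (L T) W" and i: "i \<in> V"
    and e: "h (single i 1) = h' (single i 1)" and x: "x \<in> carrier (L T)"
  shows "h x = h' x"
proof (rule mod_eqI[OF W])
  note LT = L_module[OF T]
  fix c assume c: "c \<in> V"
  have s: "single c z \<in> carrier (L T)" for z using c by simp
  have *: "zs W (X ^ wt T i c) (g (single c z)) = zs W z (qa W i c (g (single i 1)))"
    if g: "g \<in> mod_hom B (L T) W" for g z
  proof -
    have "zs W (X ^ wt T i c) (g (single c z)) = g (zs (L T) z (qa (L T) i c (single i 1)))"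
      using i c by (simp add: hom_zs[OF g, symmetric] L_qa_single[OF T] L_zs_single[OF T] mult.commute)
    then show ?thesis using i c by (simp add: hom_zs[OF g] hom_qa[OF g] qa_in[OF LT])
  qed
  have "h (single c (x c)) = h' (single c (x c))"
    using *[OF h(1)] *[OF h(2)] e s hom_in[OF h(1)] hom_in[OF h(2)]
    by - (rule tfree_cancel[OF W t, of _ _ "X ^ wt T i c"], auto simp: c)
  then show "qa W c c (h x) = qa W c c (h' x)"
    using c x by (simp add: hom_qa[OF h(1), symmetric] hom_qa[OF h(2), symmetric] L_qa_eq[OF T])
qed (use x hom_in[OF h(1)] hom_in[OF h(2)] in auto)

text \<open>The multiple of the module of \<open>T\<close> by a high power of the variable embeds into the
  projective module of the vertex \<open>i\<close>, so every element of \<open>W\<close> is the image of a multiple of the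
  generator at \<open>i\<close>.\<close>

lemma hom_from_L_exists:
  assumes T: "kset T" and W: "left_module B W" and i: "i \<in> V" and y: "y \<in> carrier W"
    and N: "\<And>u. u \<in> V \<Longrightarrow> wt T i u \<le> N"
  obtains h where "h \<in> mod_hom B (L T) W"
    "\<And>c z. c \<in> V \<Longrightarrow> h (single c z) = zs W (z * X ^ (N - wt T i c)) (qa W i c y)"
proof -
  interpret W: left_module B W by fact
  have "\<exists>b\<in>carrier B. \<forall>c\<in>V. \<forall>u\<in>V. mb T b c u = (if c = i then X ^ N * x u else 0)" for x :: "int \<Rightarrow> complex fps"
  proof -
    obtain b where b: "b \<in> carrier B"
      "\<forall>c\<in>V. \<forall>u\<in>V. mb T b c u = X ^ wt T c u * (if c = i then X ^ (N - wt T i u) * x u else 0)"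
      using B_element[of "\<lambda>c u. if c = i then X ^ (N - wt T i u) * x u else 0"] T by blast
    have "X ^ wt T i u * (X ^ (N - wt T i u) * x u) = X ^ N * x u" if "u \<in> V" for u
      using N[OF that] by (simp add: mult.assoc[symmetric] power_add[symmetric])
    then show ?thesis using b by (intro bexI[of _ b]) auto
  qed
  then obtain P where P: "\<And>x. P x \<in> carrier B"
    "\<And>x c u. c \<in> V \<Longrightarrow> u \<in> V \<Longrightarrow> mb T (P x) c u = (if c = i then X ^ N * x u else 0)"
    by metis
  have P_add: "P (x \<oplus>\<^bsub>L T\<^esub> x') = P x \<oplus>\<^bsub>B\<^esub> P x'" for x x'
    by (rule mb_eqI[OF T]) (auto simp: P mb_add[OF T] L_simps algebra_simps)
  have P_smult: "P (b \<odot>\<^bsub>L T\<^esub> x) = b \<otimes>\<^bsub>B\<^esub> P x" if "b \<in> carrier B" for b x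
    using that by (intro mb_eqI[OF T]) (auto simp: P mb_mult[OF T] L_smult[OF T] sum_distrib_left algebra_simps)
  show ?thesis
  proof
    show "(\<lambda>x. P x \<odot>\<^bsub>W\<^esub> y) \<in> mod_hom B (L T) W"
      using y P(1) by (auto simp: mod_hom_def P_add P_smult W.smult_l_distr W.smult_assoc1 W.smult_closed)
    fix c z assume c: "c \<in> V"
    have "P (single c z) = Zb (z * X ^ (N - wt T i c)) \<otimes>\<^bsub>B\<^esub> q i c"
    proof (rule mb_eqI[OF T P(1)])
      have "X ^ (N - wt T i c) * X ^ wt T i c = X ^ N" using N[OF c] by (simp add: power_add[symmetric])
      then show "mb T (P (single c z)) a b = mb T (Zb (z * X ^ (N - wt T i c)) \<otimes>\<^bsub>B\<^esub> q i c) a b"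
        if "a \<in> V" "b \<in> V" for a b
        using that c i by (auto simp: P mb_Z_mult[OF T] mb_q[OF T] single_def mult.assoc mult.commute)
    qed (use i in simp)
    then show "P (single c z) \<odot>\<^bsub>W\<^esub> y = zs W (z * X ^ (N - wt T i c)) (qa W i c y)"
      using i y by (simp add: W.smult_assoc1)
  qed
qed

end


section \<open>Bases over the power series ring\<close>

context kn
begin

text \<open>A finite basis together with its dual coordinates. The index type is left open: the
  basis of the middle term is indexed by a vertex and a truth value, that of an arbitrary
  Cohen-Macaulay module by its own elements.\<close>

definition zbasis :: "'m B_module \<Rightarrow> 'i set \<Rightarrow> ('i \<Rightarrow> 'm) \<Rightarrow> ('i \<Rightarrow> 'm \<Rightarrow> complex fps) \<Rightarrow> bool" where
  "zbasis W I b \<kappa> \<longleftrightarrow> finite I \<and> (\<forall>i\<in>I. b i \<in> carrier W) \<and> (\<forall>i\<in>I. zlin W (\<kappa> i)) \<and>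
     (\<forall>x\<in>carrier W. x = (\<Oplus>\<^bsub>W\<^esub>i\<in>I. zs W (\<kappa> i x) (b i))) \<and>
     (\<forall>i\<in>I. \<forall>j\<in>I. \<kappa> i (b j) = (if i = j then 1 else 0))"

lemma zs_finsum:
  assumes W: "left_module B W" and "finite F" "\<And>i. i \<in> F \<Longrightarrow> f i \<in> carrier W"
  shows "zs W z (\<Oplus>\<^bsub>W\<^esub>i\<in>F. f i) = (\<Oplus>\<^bsub>W\<^esub>i\<in>F. zs W z (f i))"
proof -
  interpret W: left_module B W by fact
  show ?thesis using assms(2,3)
    by (induction F) (auto simp: zs_zero_right[OF W] zs_add[OF W] zs_in[OF W] W.finsum_insert Pi_def W.finsum_closed)
qed

lemma zlin_zero:
  assumes W: "left_module B W" and "zlin W l"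
  shows "l \<zero>\<^bsub>W\<^esub> = 0"
proof -
  interpret W: left_module B W by fact
  have "l (zs W 0 \<zero>\<^bsub>W\<^esub>) = 0 * l \<zero>\<^bsub>W\<^esub>" using assms(2) W.zero_closed unfolding zlin_def by blast
  then show ?thesis using zs_zero_right[OF W] by simp
qed

lemma zlin_minus:
  assumes W: "left_module B W" and l: "zlin W l" and x: "x \<in> carrier W" "y \<in> carrier W"
  shows "l (x \<ominus>\<^bsub>W\<^esub> y) = l x - l y"
proof -
  interpret W: left_module B W by fact
  have e: "\<ominus>\<^bsub>W\<^esub> y = zs W (- 1) y" using zs_minus[OF W x(2), of 1] zs_one[OF W x(2)] by simp
  show ?thesis using x l zs_in[OF W x(2)] by (simp add: W.minus_eq zlin_def e)
qed

lemma zlin_finsum: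
  assumes W: "left_module B W" and l: "zlin W l" and "finite F" "\<And>i. i \<in> F \<Longrightarrow> f i \<in> carrier W"
  shows "l (\<Oplus>\<^bsub>W\<^esub>i\<in>F. f i) = (\<Sum>i\<in>F. l (f i))"
proof -
  interpret W: left_module B W by fact
  show ?thesis using assms(3,4)
    by (induction F) (use l in \<open>auto simp: zlin_zero[OF W l] W.finsum_insert Pi_def W.finsum_closed zlin_def\<close>)
qed

lemma hom_finsum:
  assumes M: "left_module B M" and N: "left_module B N" and h: "h \<in> mod_hom B M N"
    and "finite F" "\<And>i. i \<in> F \<Longrightarrow> f i \<in> carrier M"
  shows "h (\<Oplus>\<^bsub>M\<^esub>i\<in>F. f i) = (\<Oplus>\<^bsub>N\<^esub>i\<in>F. h (f i))"
proof -
  interpret M: left_module B M by fact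
  interpret N: left_module B N by fact
  show ?thesis using assms(4,5)
    by (induction F) (auto simp: hom_zero[OF M N h] M.finsum_insert N.finsum_insert Pi_def M.finsum_closed
        hom_add[OF h] hom_in[OF h])
qed

lemma zbasis_zeroI:
  assumes W: "left_module B W" and b: "zbasis W I b \<kappa>" and x: "x \<in> carrier W" "\<And>i. i \<in> I \<Longrightarrow> \<kappa> i x = 0"
  shows "x = \<zero>\<^bsub>W\<^esub>"
proof -
  interpret W: left_module B W by fact
  have "x = (\<Oplus>\<^bsub>W\<^esub>i\<in>I. zs W (\<kappa> i x) (b i))" using b x by (simp add: zbasis_def)
  also have "\<dots> = (\<Oplus>\<^bsub>W\<^esub>i\<in>I. \<zero>\<^bsub>W\<^esub>)"
    using b x by (intro W.finsum_cong') (auto simp: zbasis_def zs_zero_left[OF W])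
  finally show ?thesis by simp
qed

lemma zbasis_dvd:
  assumes W: "left_module B W" and b: "zbasis W I b \<kappa>" and x: "x \<in> carrier W" "\<And>i. i \<in> I \<Longrightarrow> z dvd \<kappa> i x"
  shows "\<exists>y\<in>carrier W. x = zs W z y"
proof -
  interpret W: left_module B W by fact
  obtain d where d: "\<And>i. i \<in> I \<Longrightarrow> \<kappa> i x = z * d i" using x(2) unfolding dvd_def by metis
  have bc: "finite I" "\<And>i. i \<in> I \<Longrightarrow> b i \<in> carrier W" using b by (auto simp: zbasis_def)
  have "x = (\<Oplus>\<^bsub>W\<^esub>i\<in>I. zs W (\<kappa> i x) (b i))" using b x by (simp add: zbasis_def)
  also have "\<dots> = (\<Oplus>\<^bsub>W\<^esub>i\<in>I. zs W z (zs W (d i) (b i)))"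
    using bc d by (intro W.finsum_cong') (auto simp: zs_zs[OF W] zs_in[OF W])
  also have "\<dots> = zs W z (\<Oplus>\<^bsub>W\<^esub>i\<in>I. zs W (d i) (b i))"
    using bc by (intro zs_finsum[OF W, symmetric]) (auto simp: zs_in[OF W])
  finally show ?thesis using bc by (intro bexI[of _ "\<Oplus>\<^bsub>W\<^esub>i\<in>I. zs W (d i) (b i)"]) (auto intro!: W.finsum_closed zs_in[OF W])
qed

lemma zbasis_tfree:
  assumes W: "left_module B W" and b: "zbasis W I b \<kappa>"
  shows "tfree W"
  unfolding tfree_def
proof (intro ballI allI impI)
  fix x z assume x: "x \<in> carrier W" and z: "(z :: complex fps) \<noteq> 0" "zs W z x = \<zero>\<^bsub>W\<^esub>"
  show "x = \<zero>\<^bsub>W\<^esub>"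
  proof (rule zbasis_zeroI[OF W b x])
    fix i assume i: "i \<in> I"
    then have l: "zlin W (\<kappa> i)" using b by (simp add: zbasis_def)
    then have "z * \<kappa> i x = \<kappa> i (zs W z x)" using x by (simp add: zlin_def)
    then show "\<kappa> i x = 0" using z zlin_zero[OF W l] by simp
  qed
qed

lemma zbasis_lift:
  assumes W: "left_module B W" and b: "zbasis W I b \<kappa>" and F: "left_module B F"
    and y: "\<And>i. i \<in> I \<Longrightarrow> y i \<in> carrier F" and p: "p \<in> mod_hom B F W" "\<And>i. i \<in> I \<Longrightarrow> p (y i) = b i"
  obtains l where "\<And>x. x \<in> carrier W \<Longrightarrow> l x \<in> carrier F" "\<And>x. x \<in> carrier W \<Longrightarrow> p (l x) = x"
    "\<And>x x'. x \<in> carrier W \<Longrightarrow> x' \<in> carrier W \<Longrightarrow> l (x \<oplus>\<^bsub>W\<^esub> x') = l x \<oplus>\<^bsub>F\<^esub> l x'"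
    "\<And>x z. x \<in> carrier W \<Longrightarrow> l (zs W z x) = zs F z (l x)"
proof -
  interpret W: left_module B W by fact
  interpret F: left_module B F by fact
  have bc: "finite I" "\<And>i. i \<in> I \<Longrightarrow> b i \<in> carrier W" "\<And>i. i \<in> I \<Longrightarrow> zlin W (\<kappa> i)" using b by (auto simp: zbasis_def)
  define l where "l = (\<lambda>x. \<Oplus>\<^bsub>F\<^esub>i\<in>I. zs F (\<kappa> i x) (y i))"
  have c: "(\<lambda>i. zs F (g i) (y i)) \<in> I \<rightarrow> carrier F" for g using y zs_in[OF F] by auto
  have 1: "l x \<in> carrier F" for x
    unfolding l_def using c by (intro F.finsum_closed) auto
  have 2: "p (l x) = x" if "x \<in> carrier W" for x
  proof -
    have "p (l x) = (\<Oplus>\<^bsub>W\<^esub>i\<in>I. p (zs F (\<kappa> i x) (y i)))"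
      unfolding l_def using bc y by (intro hom_finsum[OF F W p(1)]) (auto simp: zs_in[OF F])
    also have "\<dots> = (\<Oplus>\<^bsub>W\<^esub>i\<in>I. zs W (\<kappa> i x) (b i))"
      using y p bc by (intro W.finsum_cong') (auto simp: hom_zs[OF p(1)] zs_in[OF W])
    finally show ?thesis using b that by (simp add: zbasis_def)
  qed
  have 3: "l (x \<oplus>\<^bsub>W\<^esub> x') = l x \<oplus>\<^bsub>F\<^esub> l x'" if "x \<in> carrier W" "x' \<in> carrier W" for x x'
  proof -
    have "l (x \<oplus>\<^bsub>W\<^esub> x') = (\<Oplus>\<^bsub>F\<^esub>i\<in>I. zs F (\<kappa> i x) (y i) \<oplus>\<^bsub>F\<^esub> zs F (\<kappa> i x') (y i))"
      unfolding l_def using bc y that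
      by (intro F.finsum_cong') (auto simp: zlin_def zs_add_left[OF F] zs_in[OF F])
    also have "\<dots> = l x \<oplus>\<^bsub>F\<^esub> l x'"
      unfolding l_def by (rule F.finsum_addf[OF c c])
    finally show ?thesis .
  qed
  have 4: "l (zs W z x) = zs F z (l x)" if "x \<in> carrier W" for x z
  proof -
    have "l (zs W z x) = (\<Oplus>\<^bsub>F\<^esub>i\<in>I. zs F z (zs F (\<kappa> i x) (y i)))"
      unfolding l_def using bc y that
      by (intro F.finsum_cong') (auto simp: zlin_def zs_zs[OF F] zs_in[OF F])
    also have "\<dots> = zs F z (l x)"
      unfolding l_def using bc y by (intro zs_finsum[OF F, symmetric]) (auto simp: zs_in[OF F])
    finally show ?thesis .
  qed
  show ?thesis using that[of l] 1 2 3 4 by blast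
qed

text \<open>A pure submodule contains an element with a coordinate equal to 1, which splits off.\<close>

lemma pure_projection_aux:
  assumes W: "left_module B W" and b: "zbasis W I b \<kappa>"
    and F: "finite F" "F \<subseteq> I"
  shows "N \<subseteq> carrier W \<Longrightarrow> \<zero>\<^bsub>W\<^esub> \<in> N \<Longrightarrow> (\<And>x y. x \<in> N \<Longrightarrow> y \<in> N \<Longrightarrow> x \<oplus>\<^bsub>W\<^esub> y \<in> N) \<Longrightarrow>
     (\<And>z x. x \<in> N \<Longrightarrow> zs W z x \<in> N) \<Longrightarrow> (\<And>x. x \<in> carrier W \<Longrightarrow> zs W X x \<in> N \<Longrightarrow> x \<in> N) \<Longrightarrow>
     (\<And>x i. x \<in> N \<Longrightarrow> i \<in> I - F \<Longrightarrow> \<kappa> i x = 0) \<Longrightarrow>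
     \<exists>\<pi>. (\<forall>x\<in>carrier W. \<pi> x \<in> N) \<and> (\<forall>x\<in>carrier W. \<forall>y\<in>carrier W. \<pi> (x \<oplus>\<^bsub>W\<^esub> y) = \<pi> x \<oplus>\<^bsub>W\<^esub> \<pi> y) \<and>
       (\<forall>z. \<forall>x\<in>carrier W. \<pi> (zs W z x) = zs W z (\<pi> x)) \<and> (\<forall>x\<in>N. \<pi> x = x)"
  using F
proof (induction "card F" arbitrary: F N)
  case 0
  interpret W: left_module B W by fact
  have F0: "F = {}" using 0(1,8) by simp
  have "x = \<zero>\<^bsub>W\<^esub>" if "x \<in> N" for x
  proof (rule zbasis_zeroI[OF W b])
    show "x \<in> carrier W" using that 0(2) by blast
    show "\<kappa> i x = 0" if "i \<in> I" for i using 0(7)[OF \<open>x \<in> N\<close>, of i] that F0 by simp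
  qed
  then have "N = {\<zero>\<^bsub>W\<^esub>}" using 0(3) by blast
  then show ?case by (intro exI[of _ "\<lambda>_. \<zero>\<^bsub>W\<^esub>"]) (simp add: zs_zero_right[OF W])
next
  case (Suc m F N)
  interpret W: left_module B W by fact
  note N = Suc.prems(1-6)
  have lin: "zlin W (\<kappa> i)" if "i \<in> I" for i using b that by (simp add: zbasis_def)
  show ?case
  proof (cases "N = {\<zero>\<^bsub>W\<^esub>}")
    case True
    then show ?thesis by (intro exI[of _ "\<lambda>_. \<zero>\<^bsub>W\<^esub>"]) (simp add: zs_zero_right[OF W])
  next
    case False
    then obtain x where x: "x \<in> N" "x \<noteq> \<zero>\<^bsub>W\<^esub>" using N(2) by blast
    have "\<exists>v\<in>N. \<exists>s\<in>F. \<kappa> s v $ 0 \<noteq> 0"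
    proof -
      have ex: "\<exists>i\<in>F. \<kappa> i x \<noteq> 0" using zbasis_zeroI[OF W b, of x] x N(1) N(6)[OF x(1)] by blast
      \<comment> \<open>The lowest order among the coordinates of \<open>x\<close>. Dividing by
        \<open>X ^ e\<close> makes one coordinate a unit, and purity keeps the quotient in
        \<open>N\<close>.\<close>
      define e where "e = Min (subdegree ` {\<kappa> i x | i. i \<in> F \<and> \<kappa> i x \<noteq> 0})"
      have fin: "finite (subdegree ` {\<kappa> i x | i. i \<in> F \<and> \<kappa> i x \<noteq> 0})"
        using Suc.prems(7) by auto
      have ne: "subdegree ` {\<kappa> i x | i. i \<in> F \<and> \<kappa> i x \<noteq> 0} \<noteq> {}" using ex by auto
      obtain s where s: "s \<in> F" "\<kappa> s x \<noteq> 0" "subdegree (\<kappa> s x) = e"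
        using Min_in[OF fin ne] unfolding e_def[symmetric] by auto
      have "X ^ e dvd \<kappa> i x" if "i \<in> I" for i
      proof (cases "i \<in> F \<and> \<kappa> i x \<noteq> 0")
        case True
        then have "subdegree (\<kappa> i x) \<in> subdegree ` {\<kappa> i x | i. i \<in> F \<and> \<kappa> i x \<noteq> 0}" by blast
        then have le: "e \<le> subdegree (\<kappa> i x)" unfolding e_def by (rule Min_le[OF fin])
        show ?thesis unfolding fps_X_power_dvd_iff
        proof (intro allI impI)
          fix j assume "j < e"
          then have "j < subdegree (\<kappa> i x)" using le by (rule less_le_trans)
          then show "\<kappa> i x $ j = 0" by (rule nth_less_subdegree_zero)
        qed
      next
        case False
        then show ?thesis using N(6)[OF x(1), of i] that by auto
      qed
      then obtain v where v: "v \<in> carrier W" "x = zs W (X ^ e) v"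
        using zbasis_dvd[OF W b, of x "X ^ e"] x N(1) by blast
      have "v \<in> N" if "zs W (X ^ e) v \<in> N" for e
        using that
      proof (induction e)
        case 0
        then show ?case using v(1) by (simp add: zs_one[OF W])
      next
        case (Suc e)
        then have "zs W X (zs W (X ^ e) v) \<in> N" using v(1) by (simp add: zs_zs[OF W])
        then have "zs W (X ^ e) v \<in> N" by (rule N(5)[OF zs_in[OF W v(1)]])
        then show ?case by (rule Suc.IH)
      qed
      then have vN: "v \<in> N" using v x by simp
      have "\<kappa> s x = X ^ e * \<kappa> s v" using v lin[of s] s Suc.prems(8) by (auto simp: zlin_def)
      then have "\<kappa> s v $ 0 = \<kappa> s x $ e" by (simp add: fps_X_power_mult_nth)
      also have "\<dots> \<noteq> 0" using s by (metis nth_subdegree_nonzero)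
      finally show ?thesis using vN s by blast
    qed
    then obtain v0 s where v0: "v0 \<in> N" "s \<in> F" "\<kappa> s v0 $ 0 \<noteq> 0" by blast
    have sI: "s \<in> I" using v0 Suc.prems(8) by blast
    define v where "v = zs W (inverse (\<kappa> s v0)) v0"
    have v: "v \<in> N" "v \<in> carrier W" using v0 N(1,4) by (auto simp: v_def)
    have sv: "\<kappa> s v = 1"
      using lin[OF sI] v0 N(1) inverse_mult_eq_1[of "\<kappa> s v0"] by (auto simp: v_def zlin_def)
    \<comment> \<open>\<open>N\<close> is the direct sum of \<open>N'\<close> and the span of
      \<open>v\<close>; \<open>N'\<close> is pure again and lives on one coordinate less.\<close>
    define N' where "N' = {x \<in> N. \<kappa> s x = 0}"
    have "\<exists>\<pi>. (\<forall>x\<in>carrier W. \<pi> x \<in> N') \<and> (\<forall>x\<in>carrier W. \<forall>y\<in>carrier W. \<pi> (x \<oplus>\<^bsub>W\<^esub> y) = \<pi> x \<oplus>\<^bsub>W\<^esub> \<pi> y) \<and>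
       (\<forall>z. \<forall>x\<in>carrier W. \<pi> (zs W z x) = zs W z (\<pi> x)) \<and> (\<forall>x\<in>N'. \<pi> x = x)"
    proof (rule Suc.hyps(1)[of "F - {s}" N'])
      show "m = card (F - {s})" using Suc.hyps(2) v0(2) Suc.prems(7) by simp
      show "N' \<subseteq> carrier W" "finite (F - {s})" "F - {s} \<subseteq> I" using N(1) Suc.prems(7,8) by (auto simp: N'_def)
      show "\<zero>\<^bsub>W\<^esub> \<in> N'" using N(2) zlin_zero[OF W lin[OF sI]] by (simp add: N'_def)
      show "x \<oplus>\<^bsub>W\<^esub> y \<in> N'" if "x \<in> N'" "y \<in> N'" for x y
        using that N(1,3) lin[OF sI] by (auto simp: N'_def zlin_def subset_iff)
      show "zs W z x \<in> N'" if "x \<in> N'" for z x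
        using that N(1,4) lin[OF sI] by (auto simp: N'_def zlin_def subset_iff)
      show "x \<in> N'" if "x \<in> carrier W" "zs W X x \<in> N'" for x
        using that N(5)[of x] lin[OF sI] by (simp add: N'_def zlin_def)
      show "\<kappa> i x = 0" if "x \<in> N'" "i \<in> I - (F - {s})" for x i
        using that N(6)[of x i] by (auto simp: N'_def)
    qed
    then obtain \<pi> where p: "\<And>x. x \<in> carrier W \<Longrightarrow> \<pi> x \<in> N'"
      "\<And>x y. x \<in> carrier W \<Longrightarrow> y \<in> carrier W \<Longrightarrow> \<pi> (x \<oplus>\<^bsub>W\<^esub> y) = \<pi> x \<oplus>\<^bsub>W\<^esub> \<pi> y"
      "\<And>z x. x \<in> carrier W \<Longrightarrow> \<pi> (zs W z x) = zs W z (\<pi> x)" "\<And>x. x \<in> N' \<Longrightarrow> \<pi> x = x"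
      by blast
    have pc: "\<pi> x \<in> carrier W" if "x \<in> carrier W" for x using p(1)[OF that] N(1) by (auto simp: N'_def)
    define r where "r = (\<lambda>x. x \<oplus>\<^bsub>W\<^esub> zs W (- \<kappa> s x) v)"
    have rc: "r x \<in> carrier W" if "x \<in> carrier W" for x using that v by (simp add: r_def zs_in[OF W])
    have r_add: "r (x \<oplus>\<^bsub>W\<^esub> y) = r x \<oplus>\<^bsub>W\<^esub> r y" if "x \<in> carrier W" "y \<in> carrier W" for x y
      using that v lin[OF sI] zs_add_left[OF W v(2), of "- \<kappa> s x" "- \<kappa> s y"] zs_in[OF W v(2)]
      by (simp add: r_def zlin_def W.a_ac)
    have r_zs: "r (zs W z x) = zs W z (r x)" if "x \<in> carrier W" for x z
      using that v lin[OF sI] zs_in[OF W] by (simp add: r_def zlin_def zs_add[OF W] zs_zs[OF W])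
    have r_N: "r x \<in> N'" if "x \<in> N" for x
    proof -
      have "\<kappa> s (r x) = 0" using that N(1) v lin[OF sI] zs_in[OF W] sv by (auto simp: r_def zlin_def)
      then show ?thesis using that v N(3,4) by (simp add: r_def N'_def)
    qed
    define \<rho> where "\<rho> = (\<lambda>x. zs W (\<kappa> s x) v \<oplus>\<^bsub>W\<^esub> \<pi> (r x))"
    have "\<rho> x \<in> N" if "x \<in> carrier W" for x
      using that p(1)[OF rc[OF that]] v N(3,4) by (simp add: \<rho>_def N'_def)
    moreover have "\<rho> (x \<oplus>\<^bsub>W\<^esub> y) = \<rho> x \<oplus>\<^bsub>W\<^esub> \<rho> y" if "x \<in> carrier W" "y \<in> carrier W" for x y
      using that lin[OF sI] v zs_in[OF W v(2)] rc pc by (simp add: \<rho>_def r_add zlin_def p(2) zs_add_left[OF W] W.a_ac)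
    moreover have "\<rho> (zs W z x) = zs W z (\<rho> x)" if "x \<in> carrier W" for z x
      using that lin[OF sI] v zs_in[OF W v(2)] rc pc by (simp add: \<rho>_def r_zs zlin_def p(3) zs_add[OF W] zs_zs[OF W])
    moreover have "\<rho> x = x" if "x \<in> N" for x
    proof -
      have xc: "x \<in> carrier W" using that N(1) by blast
      have "\<rho> x = zs W (\<kappa> s x) v \<oplus>\<^bsub>W\<^esub> (x \<oplus>\<^bsub>W\<^esub> \<ominus>\<^bsub>W\<^esub> zs W (\<kappa> s x) v)"
        using p(4)[OF r_N[OF that]] v by (simp add: \<rho>_def r_def zs_minus[OF W])
      also have "\<dots> = x" using xc zs_in[OF W v(2)] by (simp add: W.a_lcomm W.r_neg)
      finally show ?thesis .
    qed
    ultimately show ?thesis by (intro exI[of _ \<rho>]) auto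
  qed
qed

lemma pure_projection:
  assumes W: "left_module B W" and b: "zbasis W I b \<kappa>"
    and N: "N \<subseteq> carrier W" "\<zero>\<^bsub>W\<^esub> \<in> N" "\<And>x y. x \<in> N \<Longrightarrow> y \<in> N \<Longrightarrow> x \<oplus>\<^bsub>W\<^esub> y \<in> N"
     "\<And>z x. x \<in> N \<Longrightarrow> zs W z x \<in> N" "\<And>x. x \<in> carrier W \<Longrightarrow> zs W X x \<in> N \<Longrightarrow> x \<in> N"
  obtains \<pi> where "\<And>x. x \<in> carrier W \<Longrightarrow> \<pi> x \<in> N"
    "\<And>x y. x \<in> carrier W \<Longrightarrow> y \<in> carrier W \<Longrightarrow> \<pi> (x \<oplus>\<^bsub>W\<^esub> y) = \<pi> x \<oplus>\<^bsub>W\<^esub> \<pi> y"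
    "\<And>z x. x \<in> carrier W \<Longrightarrow> \<pi> (zs W z x) = zs W z (\<pi> x)" "\<And>x. x \<in> N \<Longrightarrow> \<pi> x = x"
proof -
  have "finite I" using b by (simp add: zbasis_def)
  from pure_projection_aux[OF W b this subset_refl N] show ?thesis using that by blast
qed

subsection \<open>Cohen--Macaulay modules have finite bases\<close>

text \<open>Formulated for the span of a part of the basis, so that it covers the whole module as
  well as its components at the vertices.\<close>

lemma Z_basisI:
  assumes W: "left_module B W" and b: "zbasis W I b \<kappa>" and A: "D \<subseteq> carrier W" and J: "J \<subseteq> I" "b ` J \<subseteq> D"
    and z: "\<And>x i. x \<in> D \<Longrightarrow> i \<in> I - J \<Longrightarrow> \<kappa> i x = 0"
  shows "Z_basis n k W D (b ` J)" "card (b ` J) = card J"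
proof -
  interpret W: left_module B W by fact
  have bc: "finite I" "\<And>i. i \<in> I \<Longrightarrow> b i \<in> carrier W" "\<And>i. i \<in> I \<Longrightarrow> zlin W (\<kappa> i)"
    and rep: "\<And>x. x \<in> carrier W \<Longrightarrow> x = (\<Oplus>\<^bsub>W\<^esub>i\<in>I. zs W (\<kappa> i x) (b i))"
    and dual: "\<And>i j. i \<in> I \<Longrightarrow> j \<in> I \<Longrightarrow> \<kappa> i (b j) = (if i = j then 1 else 0)"
    using b by (auto simp: zbasis_def)
  have inj: "inj_on b I"
  proof (rule inj_onI)
    fix i j assume "i \<in> I" "j \<in> I" "b i = b j"
    then show "i = j" using dual[of i i] dual[of i j] by (simp split: if_splits)
  qed
  then have injJ: "inj_on b J" using J(1) inj_on_subset by blast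
  then show "card (b ` J) = card J" by (rule card_image)
  have uniq: "c (b j) = \<kappa> j x"
    if c: "finite {s. c s \<noteq> 0}" "{s. c s \<noteq> 0} \<subseteq> b ` J" "x = (\<Oplus>\<^bsub>W\<^esub>s\<in>{s. c s \<noteq> 0}. zs W (c s) s)" and j: "j \<in> J" for c x j
  proof -
    have sc: "s \<in> carrier W" if "c s \<noteq> 0" for s using c(2) that bc(2) J(1) by auto
    have jI: "j \<in> I" using j J(1) by blast
    have "\<kappa> j x = (\<Sum>s\<in>{s. c s \<noteq> 0}. \<kappa> j (zs W (c s) s))"
      unfolding c(3) using sc by (intro zlin_finsum[OF W bc(3)[OF jI] c(1)]) (auto simp: zs_in[OF W])
    also have "\<dots> = (\<Sum>s\<in>{s. c s \<noteq> 0}. if s = b j then c s else 0)"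
    proof (rule sum.cong[OF refl])
      fix s assume s: "s \<in> {s. c s \<noteq> 0}"
      then obtain i where i: "i \<in> J" "s = b i" using c(2) by auto
      have iI: "i \<in> I" using i J(1) by blast
      have "(s = b j) = (i = j)" using i j injJ by (auto simp: inj_on_def)
      then show "\<kappa> j (zs W (c s) s) = (if s = b j then c s else 0)"
        using bc(2)[OF iI] bc(3)[OF jI] dual[OF jI iI] i(2) by (auto simp: zlin_def)
    qed
    also have "\<dots> = c (b j)" using c(1) by auto
    finally show ?thesis by simp
  qed
  show "Z_basis n k W D (b ` J)"
    unfolding Z_basis_def
  proof (intro conjI ballI J(2))
    fix x assume x: "x \<in> D"
    then have xc: "x \<in> carrier W" using A by blast
    define c where "c = (\<lambda>s. if s \<in> b ` J then \<kappa> (the_inv_into J b s) x else 0)"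
    have cb: "c (b j) = \<kappa> j x" if "j \<in> J" for j
      using that by (simp add: c_def the_inv_into_f_f[OF injJ])
    have c0: "c s = 0" if "s \<notin> b ` J" for s using that by (simp add: c_def)
    have supp: "{s. c s \<noteq> 0} = b ` {j \<in> J. \<kappa> j x \<noteq> 0}"
    proof (intro equalityI subsetI)
      fix s assume "s \<in> {s. c s \<noteq> 0}"
      moreover from this obtain j where "j \<in> J" "s = b j" using c0[of s] by blast
      ultimately show "s \<in> b ` {j \<in> J. \<kappa> j x \<noteq> 0}" using cb by simp
    next
      fix s assume "s \<in> b ` {j \<in> J. \<kappa> j x \<noteq> 0}"
      then show "s \<in> {s. c s \<noteq> 0}" using cb by auto
    qed
    have finJ: "finite J" using bc(1) J(1) finite_subset by blast
    have "(\<Oplus>\<^bsub>W\<^esub>s\<in>{s. c s \<noteq> 0}. zs W (c s) s) = (\<Oplus>\<^bsub>W\<^esub>j\<in>{j \<in> J. \<kappa> j x \<noteq> 0}. zs W (c (b j)) (b j))"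
      unfolding supp
    proof (rule W.add.finprod_reindex)
      show "(\<lambda>s. zs W (c s) s) \<in> b ` {j \<in> J. \<kappa> j x \<noteq> 0} \<rightarrow> carrier W"
        using bc(2) J(1) zs_in[OF W] by auto
      show "inj_on b {j \<in> J. \<kappa> j x \<noteq> 0}" using injJ by (rule inj_on_subset) auto
    qed
    also have "\<dots> = (\<Oplus>\<^bsub>W\<^esub>i\<in>I. zs W (\<kappa> i x) (b i))"
    proof (rule W.add.finprod_mono_neutral_cong_left[OF bc(1)])
      show "{j \<in> J. \<kappa> j x \<noteq> 0} \<subseteq> I" using J(1) by auto
      show "zs W (\<kappa> i x) (b i) = \<zero>\<^bsub>W\<^esub>" if "i \<in> I - {j \<in> J. \<kappa> j x \<noteq> 0}" for i
      proof -
        have "\<kappa> i x = 0" using that z[OF x, of i] by auto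
        then show ?thesis using bc(2) that by (simp add: zs_zero_left[OF W])
      qed
      show "(\<lambda>i. zs W (\<kappa> i x) (b i)) \<in> I \<rightarrow> carrier W" using bc(2) zs_in[OF W] by auto
    qed (use cb in auto)
    also have "\<dots> = x" using rep[OF xc] by simp
    finally have c: "x = (\<Oplus>\<^bsub>W\<^esub>s\<in>{s. c s \<noteq> 0}. zs W (c s) s)" by simp
    show "\<exists>!c. finite {s. c s \<noteq> 0} \<and> {s. c s \<noteq> 0} \<subseteq> b ` J \<and> x = (\<Oplus>\<^bsub>W\<^esub>s\<in>{s. c s \<noteq> 0}. zs W (c s) s)"
    proof (rule ex1I[of _ c])
      show "finite {s. c s \<noteq> 0} \<and> {s. c s \<noteq> 0} \<subseteq> b ` J \<and> x = (\<Oplus>\<^bsub>W\<^esub>s\<in>{s. c s \<noteq> 0}. zs W (c s) s)"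
        using c finJ supp by auto
      fix d assume d: "finite {s. d s \<noteq> 0} \<and> {s. d s \<noteq> 0} \<subseteq> b ` J \<and> x = (\<Oplus>\<^bsub>W\<^esub>s\<in>{s. d s \<noteq> 0}. zs W (d s) s)"
      show "d = c"
      proof
        fix s show "d s = c s"
        proof (cases "s \<in> b ` J")
          case True
          then obtain j where j: "j \<in> J" "s = b j" by blast
          have "d (b j) = \<kappa> j x" by (rule uniq[OF _ _ _ j(1)]) (use d in blast)+
          then show ?thesis using j cb by simp
        next
          case False
          then have "d s = 0" using d by blast
          then show ?thesis using c0[OF False] by simp
        qed
      qed
    qed
  qed
qed

lemma zbasis_CM:
  fixes W :: "'m B_module" and b :: "'i \<Rightarrow> 'm"
  assumes W: "left_module B W" and b: "zbasis W I b \<kappa>"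
  shows "CM n k W"
  unfolding CM_def
proof (intro conjI W)
  interpret W: left_module B W by fact
  have bc: "finite I" "\<And>i. i \<in> I \<Longrightarrow> b i \<in> carrier W"
    and rep: "\<And>x. x \<in> carrier W \<Longrightarrow> x = (\<Oplus>\<^bsub>W\<^esub>i\<in>I. zs W (\<kappa> i x) (b i))"
    using b by (auto simp: zbasis_def)
  show "\<exists>S. Z_basis n k W (carrier W) S"
    using Z_basisI(1)[OF W b subset_refl subset_refl] bc by auto
  show "finitely_generated B W"
    unfolding finitely_generated_def
  proof (intro exI[of _ "b ` I"] conjI allI impI)
    fix H assume H: "submodule H B W \<and> b ` I \<subseteq> H"
    note Hf = submodule_facts[of H W]
    have fs: "(\<Oplus>\<^bsub>W\<^esub>i\<in>F. f i) \<in> H" if "finite F" "\<And>i. i \<in> F \<Longrightarrow> f i \<in> H" for F and f :: "'i \<Rightarrow> 'm"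
      using that
    proof (induction F)
      case empty
      then show ?case using H Hf by simp
    next
      case (insert a F)
      then have "f \<in> F \<rightarrow> carrier W" "f a \<in> carrier W" using H Hf(1) by auto
      then show ?case using insert H Hf(3) by (simp add: W.finsum_insert)
    qed
    have "x \<in> H" if "x \<in> carrier W" for x
    proof -
      have "(\<Oplus>\<^bsub>W\<^esub>i\<in>I. zs W (\<kappa> i x) (b i)) \<in> H"
        using bc H Hf(4) by (intro fs) auto
      then show ?thesis using rep[OF that] by simp
    qed
    then show "H = carrier W" using H Hf(1) by auto
  qed (use bc in auto)
qed

text \<open>The basis in the definition of \<open>CM\<close> may a priori be infinite. The elements
  \<open>qa W c v g\<close> for finitely many generators \<open>g\<close> involve finitely many
  basis elements, and the rest of the module lies in their span because the paths
  \<open>q c v\<close> span B over the power series ring.\<close>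

lemma CM_zbasis:
  fixes W :: "'m B_module"
  assumes "CM n k W"
  obtains S :: "'m set" and \<kappa> where "zbasis W S (\<lambda>s. s) \<kappa>"
proof -
  have W: "left_module B W" and fg: "finitely_generated B W" using assms by (auto simp: CM_def)
  interpret W: left_module B W by fact
  obtain S0 where S0: "Z_basis n k W (carrier W) S0" using assms by (auto simp: CM_def)
  define P where "P = (\<lambda>x c. finite {s. c s \<noteq> 0} \<and> {s. c s \<noteq> 0} \<subseteq> S0 \<and>
    x = (\<Oplus>\<^bsub>W\<^esub>s\<in>{s. c s \<noteq> (0 :: complex fps)}. zs W (c s) s))"
  have S0c: "S0 \<subseteq> carrier W" using S0 by (simp add: Z_basis_def)
  have ex1: "\<exists>!c. P x c" if "x \<in> carrier W" for x using S0 that unfolding Z_basis_def P_def by blast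
  define C where "C = (\<lambda>x. THE c. P x c)"
  have PC: "P x (C x)" if "x \<in> carrier W" for x unfolding C_def by (rule theI'[OF ex1[OF that]])
  have CI: "C x = c" if xc: "x \<in> carrier W" and Pc: "P x c" for x c 
  proof -
    obtain c0 where c0: "\<And>d. P x d \<Longrightarrow> d = c0" using ex1[OF xc] by (auto elim: ex1E)
    show ?thesis using c0[OF PC[OF xc]] c0[OF Pc] by simp
  qed
  have ext: "(\<Oplus>\<^bsub>W\<^esub>s\<in>{s. c s \<noteq> 0}. zs W (c s) s) = (\<Oplus>\<^bsub>W\<^esub>s\<in>F. zs W (c s) s)"
    if "finite F" "F \<subseteq> S0" "{s. c s \<noteq> 0} \<subseteq> F" for F c
    by (rule W.add.finprod_mono_neutral_cong_left) (use that S0c in \<open>auto simp: zs_zero_left[OF W] zs_in[OF W] subset_iff\<close>)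
  have Padd: "P (x \<oplus>\<^bsub>W\<^esub> y) (\<lambda>s. c s + d s)" if "P x c" "P y d" for x y c d
  proof -
    let ?F = "{s. c s \<noteq> 0} \<union> {s. d s \<noteq> 0}"
    have F: "finite ?F" "?F \<subseteq> S0" "{s. c s \<noteq> 0} \<subseteq> ?F" "{s. d s \<noteq> 0} \<subseteq> ?F" "{s. c s + d s \<noteq> 0} \<subseteq> ?F"
      using that by (auto simp: P_def)
    have fc: "(\<lambda>s. zs W (g s) s) \<in> ?F \<rightarrow> carrier W" for g using F(2) S0c zs_in[OF W] by blast
    have "(\<Oplus>\<^bsub>W\<^esub>s\<in>{s. c s + d s \<noteq> 0}. zs W (c s + d s) s) = (\<Oplus>\<^bsub>W\<^esub>s\<in>?F. zs W (c s + d s) s)"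
      by (rule ext[OF F(1,2,5)])
    also have "\<dots> = (\<Oplus>\<^bsub>W\<^esub>s\<in>?F. zs W (c s) s \<oplus>\<^bsub>W\<^esub> zs W (d s) s)"
      using F(2) S0c by (intro W.finsum_cong') (auto simp: zs_add_left[OF W] zs_in[OF W] subset_iff)
    also have "\<dots> = (\<Oplus>\<^bsub>W\<^esub>s\<in>?F. zs W (c s) s) \<oplus>\<^bsub>W\<^esub> (\<Oplus>\<^bsub>W\<^esub>s\<in>?F. zs W (d s) s)"
      by (rule W.finsum_addf[OF fc fc])
    also have "\<dots> = x \<oplus>\<^bsub>W\<^esub> y" using ext[OF F(1,2,3)] ext[OF F(1,2,4)] that by (simp add: P_def)
    finally show ?thesis using F finite_subset[OF F(5,1)] by (auto simp: P_def)
  qed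
  have Pzs: "P (zs W z x) (\<lambda>s. z * c s)" if "P x c" for z x c
  proof -
    let ?F = "{s. c s \<noteq> 0}"
    have F: "finite ?F" "?F \<subseteq> S0" "{s. z * c s \<noteq> 0} \<subseteq> ?F" using that by (auto simp: P_def)
    have sc: "s \<in> carrier W" if "c s \<noteq> 0" for s using F(2) S0c that by auto
    have "(\<Oplus>\<^bsub>W\<^esub>s\<in>{s. z * c s \<noteq> 0}. zs W (z * c s) s) = (\<Oplus>\<^bsub>W\<^esub>s\<in>?F. zs W (z * c s) s)"
      by (rule ext[OF F])
    also have "\<dots> = (\<Oplus>\<^bsub>W\<^esub>s\<in>?F. zs W z (zs W (c s) s))"
      using sc by (intro W.finsum_cong') (auto simp: zs_zs[OF W] zs_in[OF W])
    also have "\<dots> = zs W z x"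
      using zs_finsum[OF W F(1), of "\<lambda>s. zs W (c s) s"] sc that by (simp add: P_def zs_in[OF W])
    finally show ?thesis using F finite_subset[OF F(3,1)] by (auto simp: P_def)
  qed
  have Czero: "C \<zero>\<^bsub>W\<^esub> = (\<lambda>_. 0)"
    by (rule CI) (auto simp: P_def)
  have Cadd: "C (x \<oplus>\<^bsub>W\<^esub> y) = (\<lambda>s. C x s + C y s)" if "x \<in> carrier W" "y \<in> carrier W" for x y
    using that by (intro CI Padd PC) auto
  have Czs: "C (zs W z x) = (\<lambda>s. z * C x s)" if "x \<in> carrier W" for x z
    using that by (intro CI Pzs PC) (auto simp: zs_in[OF W])
  have Cs: "C s = (\<lambda>s'. if s' = s then 1 else 0)" if "s \<in> S0" for s
  proof (rule CI)
    show sc: "s \<in> carrier W" using that S0c by blast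
    have "{s'. (if s' = s then 1 else (0 :: complex fps)) \<noteq> 0} = {s}" by auto
    moreover have "zs W 1 s = s" using sc by (simp add: zs_one[OF W])
    ultimately show "P s (\<lambda>s'. if s' = s then 1 else 0)"
      using that sc W.finsum_insert[of "{}" s "\<lambda>s'. zs W 1 s'"] by (simp add: P_def)
  qed
  define supp where "supp x = {s. C x s \<noteq> 0}" for x
  have supp: "finite (supp x)" "supp x \<subseteq> S0" if "x \<in> carrier W" for x
    using PC[OF that] by (auto simp: P_def supp_def)
  obtain G where G: "finite G" "G \<subseteq> carrier W" "\<And>H. submodule H B W \<Longrightarrow> G \<subseteq> H \<Longrightarrow> H = carrier W"
    using fg by (auto simp: finitely_generated_def)
  define S where "S = (\<Union>(g, c, v)\<in>G \<times> V \<times> V. supp (qa W c v g))"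
  have finS: "finite S" unfolding S_def
  proof (intro finite_UN_I finite_cartesian_product finite_V G(1), clarify)
    fix g c v assume "g \<in> G" "c \<in> V" "v \<in> V"
    then show "finite (supp (qa W c v g))" using G(2) by (intro supp(1) qa_in[OF W]) blast+
  qed
  have SS0: "S \<subseteq> S0" unfolding S_def
  proof (intro UN_least, clarify)
    fix g c v s assume g: "g \<in> G" "c \<in> V" "v \<in> V" and s: "s \<in> supp (qa W c v g)"
    then have "qa W c v g \<in> carrier W" using G(2) by (intro qa_in[OF W]) blast+
    then show "s \<in> S0" using supp(2) s by blast
  qed
  \<comment> \<open>The condition runs over all B-multiples of \<open>x\<close>, which makes
    \<open>H\<close> a submodule by construction.\<close>
  define H where "H = {x \<in> carrier W. \<forall>b\<in>carrier B. supp (b \<odot>\<^bsub>W\<^esub> x) \<subseteq> S}"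
  have "submodule H B W"
  proof (rule submodule_of_closed[OF W])
    show "H \<subseteq> carrier W" by (auto simp: H_def)
    show "\<zero>\<^bsub>W\<^esub> \<in> H" by (auto simp: H_def smult_zero_right[OF W] supp_def Czero)
    show "x \<oplus>\<^bsub>W\<^esub> y \<in> H" if "x \<in> H" "y \<in> H" for x y
    proof -
      have "supp (b \<odot>\<^bsub>W\<^esub> (x \<oplus>\<^bsub>W\<^esub> y)) \<subseteq> supp (b \<odot>\<^bsub>W\<^esub> x) \<union> supp (b \<odot>\<^bsub>W\<^esub> y)" if "b \<in> carrier B" for b
        using that \<open>x \<in> H\<close> \<open>y \<in> H\<close> by (auto simp: H_def supp_def W.smult_r_distr Cadd W.smult_closed)
      moreover have "supp (b \<odot>\<^bsub>W\<^esub> x) \<union> supp (b \<odot>\<^bsub>W\<^esub> y) \<subseteq> S" if "b \<in> carrier B" for b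
        using that \<open>x \<in> H\<close> \<open>y \<in> H\<close> by (simp add: H_def)
      ultimately have "supp (b \<odot>\<^bsub>W\<^esub> (x \<oplus>\<^bsub>W\<^esub> y)) \<subseteq> S" if "b \<in> carrier B" for b
        using that by blast
      then show ?thesis using that by (simp add: H_def)
    qed
    show "b \<odot>\<^bsub>W\<^esub> x \<in> H" if "b \<in> carrier B" "x \<in> H" for b x
      using that by (auto simp: H_def W.smult_closed W.smult_assoc1[symmetric])
  qed
  moreover have "G \<subseteq> H"
  proof
    fix g assume g: "g \<in> G"
    then have gc: "g \<in> carrier W" using G by blast
    have "supp (b \<odot>\<^bsub>W\<^esub> g) \<subseteq> S" if "b \<in> carrier B" for b
      using that
    proof (induction b rule: B_induct)
      case zero
      then show ?case using gc by (simp add: smult_zero_left[OF W] supp_def Czero)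
    next
      case (add b b')
      have "supp ((b \<oplus>\<^bsub>B\<^esub> b') \<odot>\<^bsub>W\<^esub> g) \<subseteq> supp (b \<odot>\<^bsub>W\<^esub> g) \<union> supp (b' \<odot>\<^bsub>W\<^esub> g)"
        using gc add(1,2) by (auto simp: W.smult_l_distr supp_def Cadd W.smult_closed)
      then show ?case using add(3,4) by blast
    next
      case (gen z c v)
      have "supp ((Zb z \<otimes>\<^bsub>B\<^esub> q c v) \<odot>\<^bsub>W\<^esub> g) \<subseteq> supp (qa W c v g)"
        using gc gen by (auto simp: W.smult_assoc1 supp_def Czs qa_in[OF W])
      also have "\<dots> \<subseteq> S" using g gen by (auto simp: S_def)
      finally show ?case .
    qed
    then show "g \<in> H" using gc by (simp add: H_def)
  qed
  ultimately have "H = carrier W" using G(3) by blast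
  then have suppS: "supp x \<subseteq> S" if "x \<in> carrier W" for x
  proof -
    have "supp (\<one>\<^bsub>B\<^esub> \<odot>\<^bsub>W\<^esub> x) \<subseteq> S" using that \<open>H = carrier W\<close> B.one_closed unfolding H_def by blast
    then show ?thesis using W.smult_one[OF that] by simp
  qed
  have "zbasis W S (\<lambda>s. s) (\<lambda>s x. C x s)"
    unfolding zbasis_def
  proof (intro conjI ballI finS)
    show "x = (\<Oplus>\<^bsub>W\<^esub>s\<in>S. zs W (C x s) s)" if "x \<in> carrier W" for x
      using PC[OF that] ext[OF finS SS0, of "C x"] suppS[OF that] by (simp add: P_def supp_def)
    show "zlin W (\<lambda>x. C x s)" for s by (auto simp: zlin_def Cadd Czs)
    show "s \<in> carrier W" if "s \<in> S" for s using that SS0 S0c by auto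
    show "C j i = (if i = j then 1 else 0)" if "i \<in> S" "j \<in> S" for i j
      using that SS0 Cs[of j] by auto
  qed
  then show ?thesis by (rule that)
qed

lemma zbasis_has_rank:
  assumes W: "left_module B W" and b: "zbasis W I b \<kappa>"
    and vt: "\<And>i. i \<in> I \<Longrightarrow> vt i \<in> V \<and> qa W (vt i) (vt i) (b i) = b i"
    and r: "\<And>c. c \<in> V \<Longrightarrow> card {i \<in> I. vt i = c} = r"
  shows "has_rank n k W r"
  unfolding has_rank_def
proof
  fix c assume c: "c \<in> V"
  interpret W: left_module B W by fact
  have bc: "finite I" "\<And>i. i \<in> I \<Longrightarrow> b i \<in> carrier W" "\<And>i. i \<in> I \<Longrightarrow> zlin W (\<kappa> i)"
    and rep: "\<And>x. x \<in> carrier W \<Longrightarrow> x = (\<Oplus>\<^bsub>W\<^esub>i\<in>I. zs W (\<kappa> i x) (b i))"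
    and dual: "\<And>i j. i \<in> I \<Longrightarrow> j \<in> I \<Longrightarrow> \<kappa> i (b j) = (if i = j then 1 else 0)"
    using b by (auto simp: zbasis_def)
  have e: "vertex_idem n k c = q c c"
    by (simp add: vertex_idem_def canonical_path_def canonical_word_def)
  let ?D = "(\<lambda>x. qa W c c x) ` carrier W"
  let ?J = "{i \<in> I. vt i = c}"
  have hom: "qa W c c (zs W z (b i)) = (if vt i = c then zs W z (b i) else \<zero>\<^bsub>W\<^esub>)" if "i \<in> I" for z i
    using qa_qa_zero[OF W _ c _ c, of "vt i" "vt i" "b i"] vt[OF that] bc(2)[OF that] c
    by (auto simp: qa_zs[OF W] zs_zero_right[OF W])
  have z: "\<kappa> j x = 0" if x: "x \<in> ?D" and j: "j \<in> I - ?J" for x j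
  proof -
    obtain y where y: "y \<in> carrier W" "x = qa W c c y" using x by auto
    have lin: "zlin W (\<lambda>x. \<kappa> j (qa W c c x))"
      using bc(3)[of j] j c by (auto simp: zlin_def qa_add[OF W] qa_zs[OF W] qa_in[OF W])
    have "\<kappa> j (qa W c c y) = (\<Sum>i\<in>I. \<kappa> j (qa W c c (zs W (\<kappa> i y) (b i))))"
      using zlin_finsum[OF W lin bc(1), of "\<lambda>i. zs W (\<kappa> i y) (b i)"] rep[OF y(1)] bc(2) zs_in[OF W] by simp
    also have "\<dots> = 0"
    proof (intro sum.neutral ballI)
      fix i assume i: "i \<in> I"
      have "\<kappa> j (zs W (\<kappa> i y) (b i)) = 0" if "vt i = c"
        using that j dual[of j i] i bc(3)[of j] bc(2)[OF i] by (auto simp: zlin_def)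
      then show "\<kappa> j (qa W c c (zs W (\<kappa> i y) (b i))) = 0"
        using hom[OF i] zlin_zero[OF W bc(3)[of j]] j by auto
    qed
    finally show ?thesis using y(2) by simp
  qed
  have D: "?D \<subseteq> carrier W" using qa_in[OF W c] by blast
  have J: "?J \<subseteq> I" by blast
  have bJ: "b ` ?J \<subseteq> ?D"
  proof clarify
    fix i assume "i \<in> I" "c = vt i"
    then show "b i \<in> (\<lambda>x. qa W (vt i) (vt i) x) ` carrier W" using vt bc(2) by (metis image_eqI)
  qed
  note Z_basisI[OF W b D J bJ z]
  then show "\<exists>S. Z_basis n k W ((\<lambda>x. vertex_idem n k c \<odot>\<^bsub>W\<^esub> x) ` carrier W) S \<and> finite S \<and> card S = r"
    using r[OF c] bc(1) unfolding e by (intro exI[of _ "b ` ?J"]) auto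
qed

lemma L_finsum:
  assumes T: "kset T" and "finite F" "\<And>i. i \<in> F \<Longrightarrow> f i \<in> carrier (L T)"
  shows "(\<Oplus>\<^bsub>L T\<^esub>i\<in>F. f i) = (\<lambda>j. \<Sum>i\<in>F. f i j)"
proof -
  interpret W: left_module B "L T" by (rule L_module[OF T])
  show ?thesis using assms(2,3)
  proof (induction F)
    case (insert a F)
    have "f \<in> F \<rightarrow> carrier (L T)" "f a \<in> carrier (L T)" using insert.prems by auto
    then show ?case using insert by (subst W.finsum_insert) (auto simp: L_simps)
  qed (simp add: L_simps)
qed

lemma L_zbasis:
  assumes T: "kset T"
  shows "zbasis (L T) V (\<lambda>c. single c 1) (\<lambda>c x. x c)"
  unfolding zbasis_def
proof (intro conjI ballI)
  fix x assume x: "x \<in> carrier (L T)"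
  have "(\<Oplus>\<^bsub>L T\<^esub>i\<in>V. zs (L T) (x i) (single i 1)) = (\<lambda>j. \<Sum>i\<in>V. (zs (L T) (x i) (single i 1)) j)"
    by (rule L_finsum[OF T finite_V]) (simp add: L_zs_single[OF T])
  also have "\<dots> = x"
  proof
    fix j
    have "(\<Sum>i\<in>V. (zs (L T) (x i) (single i 1)) j) = (\<Sum>i\<in>V. if i = j then x i else 0)"
      by (rule sum.cong) (simp_all add: L_zs_single[OF T], simp add: single_def)
    then show "(\<Sum>i\<in>V. (zs (L T) (x i) (single i 1)) j) = x j" using x by (simp add: L_simps)
  qed
  finally show "x = (\<Oplus>\<^bsub>L T\<^esub>i\<in>V. zs (L T) (x i) (single i 1))" by simp
qed (auto simp: zlin_def L_simps L_Zb[OF T] single_def)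

lemma L_CM: "kset T \<Longrightarrow> CM n k (L T)"
  using zbasis_CM[OF L_module L_zbasis] .

end


section \<open>Direct sums\<close>

text \<open>All modules have to live on the type \<^typ>\<open>int \<Rightarrow> complex fps\<close>, so pairs are encoded by
  interleaving.\<close>

definition interleave :: "(int \<Rightarrow> 'a) \<Rightarrow> (int \<Rightarrow> 'a) \<Rightarrow> int \<Rightarrow> 'a" where
  "interleave u v = (\<lambda>j. if even j then u (j div 2) else v (j div 2))"

definition even_part :: "(int \<Rightarrow> 'a) \<Rightarrow> int \<Rightarrow> 'a" where
  "even_part x = (\<lambda>j. x (2 * j))"

definition odd_part :: "(int \<Rightarrow> 'a) \<Rightarrow> int \<Rightarrow> 'a" where
  "odd_part x = (\<lambda>j. x (2 * j + 1))"

lemma interleave_simps [simp]: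
  "even_part (interleave u v) = u" "odd_part (interleave u v) = v"
  "interleave (even_part x) (odd_part x) = x"
  by (auto simp: interleave_def even_part_def odd_part_def fun_eq_iff)

lemma interleave_eqI: "even_part x = even_part y \<Longrightarrow> odd_part x = odd_part y \<Longrightarrow> x = y"
  by (metis interleave_simps(3))

definition direct_sum :: "('r, int \<Rightarrow> 'a) module \<Rightarrow> ('r, int \<Rightarrow> 'a) module \<Rightarrow> ('r, int \<Rightarrow> 'a) module" where
  "direct_sum M N =
    \<lparr>carrier = {x. even_part x \<in> carrier M \<and> odd_part x \<in> carrier N},
     monoid.mult = undefined, one = undefined,
     zero = interleave \<zero>\<^bsub>M\<^esub> \<zero>\<^bsub>N\<^esub>,
     add = (\<lambda>x y. interleave (even_part x \<oplus>\<^bsub>M\<^esub> even_part y) (odd_part x \<oplus>\<^bsub>N\<^esub> odd_part y)),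
     smult = (\<lambda>b x. interleave (b \<odot>\<^bsub>M\<^esub> even_part x) (b \<odot>\<^bsub>N\<^esub> odd_part x))\<rparr>"

lemma direct_sum_simps:
  "x \<in> carrier (direct_sum M N) \<longleftrightarrow> even_part x \<in> carrier M \<and> odd_part x \<in> carrier N"
  "\<zero>\<^bsub>direct_sum M N\<^esub> = interleave \<zero>\<^bsub>M\<^esub> \<zero>\<^bsub>N\<^esub>"
  "x \<oplus>\<^bsub>direct_sum M N\<^esub> y = interleave (even_part x \<oplus>\<^bsub>M\<^esub> even_part y) (odd_part x \<oplus>\<^bsub>N\<^esub> odd_part y)"
  "b \<odot>\<^bsub>direct_sum M N\<^esub> x = interleave (b \<odot>\<^bsub>M\<^esub> even_part x) (b \<odot>\<^bsub>N\<^esub> odd_part x)"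
  by (simp_all add: direct_sum_def)

context kn
begin

lemma direct_sum_module:
  assumes M: "left_module B M" and N: "left_module B N"
  shows "left_module B (direct_sum M N)"
proof -
  interpret M: left_module B M by fact
  interpret N: left_module B N by fact
  have "abelian_group (direct_sum M N)"
  proof (rule abelian_groupI)
    fix x assume "x \<in> carrier (direct_sum M N)"
    then show "\<exists>y\<in>carrier (direct_sum M N). y \<oplus>\<^bsub>direct_sum M N\<^esub> x = \<zero>\<^bsub>direct_sum M N\<^esub>"
      by (intro bexI[of _ "interleave (\<ominus>\<^bsub>M\<^esub> even_part x) (\<ominus>\<^bsub>N\<^esub> odd_part x)"])
        (auto simp: direct_sum_simps M.l_neg N.l_neg)
  qed (auto simp: direct_sum_simps M.a_ac N.a_ac)
  then show ?thesis
    by (intro left_module.intro B_ring left_module_axioms.intro)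
      (auto simp: direct_sum_simps M.smult_closed N.smult_closed M.smult_l_distr N.smult_l_distr
        M.smult_r_distr N.smult_r_distr M.smult_assoc1 N.smult_assoc1 M.smult_one N.smult_one)
qed

lemma submodule_module:
  assumes M: "left_module B M" and H: "submodule H B M"
  shows "left_module B (M\<lparr>carrier := H\<rparr>)"
proof -
  interpret M: left_module B M by fact
  note Hf = submodule_facts[OF H]
  have m: "\<ominus>\<^bsub>M\<^esub> x \<in> H" if "x \<in> H" for x
  proof -
    have "x \<in> carrier M" using that Hf(1) by blast
    then have "zs M (- 1) x = \<ominus>\<^bsub>M\<^esub> x" using zs_minus[OF M, of x 1] zs_one[OF M] by simp
    then show ?thesis using Hf(4)[of "Zb (- 1)" x] that by simp
  qed
  have "abelian_group (M\<lparr>carrier := H\<rparr>)"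
  proof (rule abelian_groupI)
    fix x assume "x \<in> carrier (M\<lparr>carrier := H\<rparr>)"
    then show "\<exists>y\<in>carrier (M\<lparr>carrier := H\<rparr>). y \<oplus>\<^bsub>M\<lparr>carrier := H\<rparr>\<^esub> x = \<zero>\<^bsub>M\<lparr>carrier := H\<rparr>\<^esub>"
      using m Hf(1) by (intro bexI[of _ "\<ominus>\<^bsub>M\<^esub> x"]) (auto simp: M.l_neg subset_iff)
  qed (use Hf(1-3) in \<open>auto simp: subset_iff M.a_ac\<close>)
  then show ?thesis
    by (intro left_module.intro B_ring left_module_axioms.intro)
      (use Hf in \<open>auto simp: M.smult_closed M.smult_l_distr M.smult_r_distr M.smult_assoc1 M.smult_one subset_iff\<close>)
qed

end

section \<open>The middle term\<close>

text \<open>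
  \<open>p1, p2, p3, p4\<close> are the profiles over \<open>S\<close> of four indecomposable projective modules, which are
  injective relative to Cohen--Macaulay modules: a map into the one with valley \<open>v\<close> is a linear
  functional on the component at the vertex \<open>v\<close>.
\<close>

locale ar_data = kn +
  fixes S I J :: "int set" and p1 p2 p3 p4 pI pJ :: "int \<Rightarrow> nat" and i v v3 v4 v0 :: int
  assumes kS: "kset S" and kI: "kset I" and kJ: "kset J"
    and profI: "profile n I S pI" and profJ: "profile n J S pJ"
    and iV [simp]: "i \<in> V" and vV [simp]: "v \<in> V" and v3V [simp]: "v3 \<in> V"
    and v4V [simp]: "v4 \<in> V" and v0V [simp]: "v0 \<in> V"
    and val1: "c \<in> V \<Longrightarrow> p1 c + wt S c i = p1 i"
    and val2: "c \<in> V \<Longrightarrow> p2 c + wt S c v = p2 v"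
    and val3: "c \<in> V \<Longrightarrow> p3 c + wt S c v3 = p3 v3"
    and val4: "c \<in> V \<Longrightarrow> p4 c + wt S c v4 = p4 v4"
    and pI_max: "c \<in> V \<Longrightarrow> pI c = max (p1 c) (p2 c)"
    and pJ_max: "c \<in> V \<Longrightarrow> pJ c = max (p3 c) (p4 c)"
    and pJ_min: "c \<in> V \<Longrightarrow> p1 c \<le> pJ c \<or> p2 c \<le> pJ c"
    and at_i: "p1 i = Suc (pJ i)" "p2 i = pJ i" "p3 i = pJ i" "p4 i = pJ i"
    and at_v: "p2 v = Suc (pJ v)" "p1 v \<le> pJ v" "p3 v = pJ v" "p4 v = pJ v"
    and at_v4: "p4 v4 = pJ v4" "pI v4 = pJ v4"
    and at_v0: "p1 v0 = p2 v0" "p1 v0 \<le> pJ v0"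
    and peaks: "c \<in> V \<Longrightarrow> wt J i c = 0 \<or> wt J v c = 0"
begin

definition Ecarrier :: "(int \<Rightarrow> complex fps) set" where
  "Ecarrier = {x. even_part x \<in> carrier (L S) \<and> odd_part x \<in> carrier (L S) \<and>
     (\<forall>c\<in>V. X ^ p1 c dvd even_part x c \<and> X ^ p2 c dvd odd_part x c \<and> X ^ pJ c dvd even_part x c + odd_part x c)}"

definition E :: "(int \<Rightarrow> complex fps) B_module" where
  "E = (direct_sum (L S) (L S))\<lparr>carrier := Ecarrier\<rparr>"

lemma E_carrier: "carrier E = Ecarrier" by (simp add: E_def)

lemma E_ops:
  "\<zero>\<^bsub>E\<^esub> = interleave (\<lambda>_. 0) (\<lambda>_. 0)"
  "x \<oplus>\<^bsub>E\<^esub> y = interleave (\<lambda>c. even_part x c + even_part y c) (\<lambda>c. odd_part x c + odd_part y c)"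
  "b \<odot>\<^bsub>E\<^esub> x = interleave (b \<odot>\<^bsub>L S\<^esub> even_part x) (b \<odot>\<^bsub>L S\<^esub> odd_part x)"
  by (simp_all add: E_def direct_sum_def L_simps)

text \<open>Powers \<open>X ^ p c\<close> at the vertices cut out a submodule of \<open>L S\<close>
  if \<open>p\<close> grows along every path by at most its weight. The profiles of projectives
  inherit this from the triangle rule for weights.\<close>

lemma valley_lipschitz:
  assumes "\<And>c. c \<in> V \<Longrightarrow> p c + wt S c w = p w" "w \<in> V" "c \<in> V" "d \<in> V"
  shows "p d \<le> p c + wt S c d"
  using assms(1)[OF assms(3)] assms(1)[OF assms(4)] wt_tri[OF kS assms(3,4,2)] by linarith

lemma lip1: "c \<in> V \<Longrightarrow> d \<in> V \<Longrightarrow> p1 d \<le> p1 c + wt S c d"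
  by (rule valley_lipschitz[OF val1 iV])
lemma lip2: "c \<in> V \<Longrightarrow> d \<in> V \<Longrightarrow> p2 d \<le> p2 c + wt S c d"
  by (rule valley_lipschitz[OF val2 vV])
lemma lipJ: "c \<in> V \<Longrightarrow> d \<in> V \<Longrightarrow> pJ d \<le> pJ c + wt S c d"
  using wt_profile[OF profJ, of c d] by simp

lemma lipschitz_smult:
  assumes p: "\<And>c d. c \<in> V \<Longrightarrow> d \<in> V \<Longrightarrow> p d \<le> p c + wt S c d" and b: "b \<in> carrier B"
    and x: "\<And>c. c \<in> V \<Longrightarrow> X ^ p c dvd x c" and d: "d \<in> V"
  shows "X ^ p d dvd (b \<odot>\<^bsub>L S\<^esub> x) d"
proof -
  have "X ^ p d dvd mb S b c d * x c" if c: "c \<in> V" for c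
  proof -
    have "X ^ p d dvd X ^ (wt S c d + p c)" using p[OF c d] by (intro le_imp_power_dvd) simp
    also have "X ^ (wt S c d + p c) dvd mb S b c d * x c"
      unfolding power_add by (intro mult_dvd_mono mb_dvd[OF kS b] c d x)
    finally show ?thesis .
  qed
  then show ?thesis using d by (simp add: L_smult[OF kS b] dvd_sum)
qed

lemma E_submodule: "submodule Ecarrier B (direct_sum (L S) (L S))"
proof (rule submodule_of_closed[OF direct_sum_module[OF L_module[OF kS] L_module[OF kS]]])
  interpret LS: left_module B "L S" by (rule L_module[OF kS])
  show "b \<odot>\<^bsub>direct_sum (L S) (L S)\<^esub> x \<in> Ecarrier" if b: "b \<in> carrier B" and x: "x \<in> Ecarrier" for b x
  proof -
    have "(b \<odot>\<^bsub>L S\<^esub> even_part x) c + (b \<odot>\<^bsub>L S\<^esub> odd_part x) c = (b \<odot>\<^bsub>L S\<^esub> (\<lambda>c. even_part x c + odd_part x c)) c" for c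
      using b x by (simp add: L_smult[OF kS b] sum.distrib algebra_simps)
    then show ?thesis
      using x lipschitz_smult[OF lip1 b] lipschitz_smult[OF lip2 b]
        lipschitz_smult[OF lipJ b, of "\<lambda>c. even_part x c + odd_part x c"]
      by (auto simp: Ecarrier_def direct_sum_simps LS.smult_closed[OF b])
  qed
  show "x \<oplus>\<^bsub>direct_sum (L S) (L S)\<^esub> y \<in> Ecarrier" if "x \<in> Ecarrier" "y \<in> Ecarrier" for x y
  proof -
    have "X ^ pJ c dvd even_part x c + even_part y c + (odd_part x c + odd_part y c)" if "c \<in> V" for c
    proof -
      have "X ^ pJ c dvd (even_part x c + odd_part x c) + (even_part y c + odd_part y c)"
        using \<open>x \<in> Ecarrier\<close> \<open>y \<in> Ecarrier\<close> \<open>c \<in> V\<close> by - (rule dvd_add, auto simp: Ecarrier_def)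
      then show ?thesis by (simp add: ac_simps)
    qed
    then show ?thesis using that by (auto simp: Ecarrier_def direct_sum_simps L_simps)
  qed
qed (auto simp: Ecarrier_def direct_sum_simps L_simps)

lemma E_module: "left_module B E"
  unfolding E_def
  by (rule submodule_module[OF direct_sum_module[OF L_module[OF kS] L_module[OF kS]] E_submodule])

sublocale E: left_module B E by (rule E_module)

lemma E_D:
  assumes "x \<in> carrier E"
  shows "even_part x \<in> carrier (L S)" "odd_part x \<in> carrier (L S)"
    "c \<in> V \<Longrightarrow> X ^ p1 c dvd even_part x c" "c \<in> V \<Longrightarrow> X ^ p2 c dvd odd_part x c"
    "c \<in> V \<Longrightarrow> X ^ pJ c dvd even_part x c + odd_part x c"
    "c \<notin> V \<Longrightarrow> even_part x c = 0" "c \<notin> V \<Longrightarrow> odd_part x c = 0"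
  using assms by (auto simp: E_carrier Ecarrier_def L_simps)

lemma E_even: "even_part \<in> mod_hom B E (L S)" and E_odd: "odd_part \<in> mod_hom B E (L S)"
  by (auto simp: mod_hom_def E_carrier Ecarrier_def E_ops L_simps)

lemma E_sum: "(\<lambda>x c. even_part x c + odd_part x c) \<in> mod_hom B E (L S)"
  by (rule hom_L_minus(2)[OF kS E_module E_even E_odd])

lemma hom_to_E:
  assumes "a \<in> mod_hom B W (L S)" "b \<in> mod_hom B W (L S)"
    and "\<And>w c. w \<in> carrier W \<Longrightarrow> c \<in> V \<Longrightarrow> X ^ p1 c dvd a w c"
    and "\<And>w c. w \<in> carrier W \<Longrightarrow> c \<in> V \<Longrightarrow> X ^ p2 c dvd b w c"
    and "\<And>w c. w \<in> carrier W \<Longrightarrow> c \<in> V \<Longrightarrow> X ^ pJ c dvd a w c + b w c"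
  shows "(\<lambda>w. interleave (a w) (b w)) \<in> mod_hom B W E"
  using assms by (auto simp: mod_hom_def E_carrier Ecarrier_def E_ops L_simps Pi_def)

lemma pI_ge: "c \<in> V \<Longrightarrow> p1 c \<le> pI c" "c \<in> V \<Longrightarrow> p2 c \<le> pI c"
  by (simp_all add: pI_max)

lemma dvd_pI: "c \<in> V \<Longrightarrow> X ^ p1 c dvd a \<Longrightarrow> X ^ p2 c dvd a \<Longrightarrow> X ^ pI c dvd a"
  by (simp add: pI_max max_def)

text \<open>Where \<open>p1\<close> does not exceed \<open>pJ\<close>, the condition on the sum
  carries the divisibility of the even entry over to the odd one, which then satisfies the condition
  of \<open>L I\<close>; symmetrically for \<open>p2\<close>. By \<open>pJ_min\<close> one of the
  cases applies at every vertex.\<close>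

lemma E_dvd_pI:
  assumes x: "x \<in> carrier E" and c: "c \<in> V"
  shows "p1 c \<le> pJ c \<Longrightarrow> X ^ pI c dvd odd_part x c" "p2 c \<le> pJ c \<Longrightarrow> X ^ pI c dvd even_part x c"
proof -
  note D = E_D(3-5)[OF x c]
  show "X ^ pI c dvd odd_part x c" if "p1 c \<le> pJ c"
  proof (rule dvd_pI[OF c _ D(2)])
    have "X ^ p1 c dvd even_part x c + odd_part x c" using D(3) le_imp_power_dvd[OF that] by (rule dvd_trans[rotated])
    then show "X ^ p1 c dvd odd_part x c" using D(1) by (simp add: dvd_add_right_iff)
  qed
  show "X ^ pI c dvd even_part x c" if "p2 c \<le> pJ c"
  proof (rule dvd_pI[OF c D(1)])
    have "X ^ p2 c dvd even_part x c + odd_part x c" using D(3) le_imp_power_dvd[OF that] by (rule dvd_trans[rotated])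
    then show "X ^ p2 c dvd even_part x c" using D(2) by (simp add: dvd_add_left_iff)
  qed
qed

section \<open>The short exact sequence and the rank one filtration\<close>

definition fE :: "(int \<Rightarrow> complex fps) \<Rightarrow> int \<Rightarrow> complex fps" where
  "fE x = interleave (\<lambda>c. X ^ pI c * x c) (\<lambda>c. - (X ^ pI c * x c))"

definition gE :: "(int \<Rightarrow> complex fps) \<Rightarrow> int \<Rightarrow> complex fps" where
  "gE x = (\<lambda>c. fps_shift (pJ c) (even_part x c + odd_part x c))"

lemma fE_hom: "fE \<in> mod_hom B (L I) E"
proof -
  note inc = profile_incl[OF kI kS profI]
  have neg: "(\<lambda>x c. - (X ^ pI c * x c)) \<in> mod_hom B (L I) (L S)"
    using hom_L_minus(3)[OF kS L_module[OF kI] inc inc, of "- 1"] by simp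
  show ?thesis unfolding fE_def
    by (rule hom_to_E[OF inc neg]) (auto intro: dvd_mult2 le_imp_power_dvd pI_ge)
qed

lemma gE_hom: "gE \<in> mod_hom B E (L J)"
  and gE_eq: "x \<in> carrier E \<Longrightarrow> X ^ pJ c * gE x c = even_part x c + odd_part x c"
proof -
  obtain g where g: "g \<in> mod_hom B E (L J)"
    "\<And>x c. x \<in> carrier E \<Longrightarrow> X ^ pJ c * g x c = even_part x c + odd_part x c"
    using profile_divide[OF kJ kS profJ E_module E_sum] E_D(5) by metis
  have e: "g x = gE x" if "x \<in> carrier E" for x
  proof
    fix c
    show "g x c = gE x c" unfolding gE_def g(2)[OF that, symmetric] by (simp add: mult.commute)
  qed
  show "x \<in> carrier E \<Longrightarrow> X ^ pJ c * gE x c = even_part x c + odd_part x c"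
    using g(2) e by metis
  have "gE y = g y" if "y \<in> carrier E" for y using e that by simp
  then show "gE \<in> mod_hom B E (L J)"
    using g(1) E.a_closed E.smult_closed by (simp add: mod_hom_def Pi_def)
qed

text \<open>A preimage of \<open>single c z\<close> under \<open>gE\<close>, placed into an entry
  whose own condition it meets; \<open>pJ_min\<close> provides one.\<close>

definition lift_gen :: "int \<Rightarrow> complex fps \<Rightarrow> int \<Rightarrow> complex fps" where
  "lift_gen c z = (if p1 c \<le> pJ c then interleave (single c (X ^ pJ c * z)) (\<lambda>_. 0)
     else interleave (\<lambda>_. 0) (single c (X ^ pJ c * z)))"

lemma lift_gen_in: "c \<in> V \<Longrightarrow> lift_gen c z \<in> carrier E"
  using pJ_min[of c]
  by (auto simp: lift_gen_def E_carrier Ecarrier_def L_simps single_def intro: dvd_mult2 le_imp_power_dvd)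

lemma E_pairI:
  assumes "c \<in> V" "X ^ p1 c dvd a" "X ^ p2 c dvd b" "X ^ pJ c dvd a + b"
  shows "interleave (single c a) (single c b) \<in> carrier E"
  using assms by (auto simp: E_carrier Ecarrier_def L_simps single_def)

lemma E_exact: "short_exact B (L I) fE E gE (L J)"
  unfolding short_exact_def
proof (intro conjI L_module kI kJ E_module fE_hom gE_hom)
  show "inj_on fE (carrier (L I))"
  proof (rule inj_onI)
    fix x y assume "fE x = fE y"
    then have "even_part (fE x) = even_part (fE y)" by simp
    then show "x = y" by (simp add: fE_def fun_eq_iff)
  qed
  show "fE ` carrier (L I) = a_kernel E (L J) gE"
    unfolding a_kernel_def'
  proof (intro equalityI subsetI)
    fix y assume "y \<in> fE ` carrier (L I)"
    then obtain x where x: "x \<in> carrier (L I)" "y = fE x" by blast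
    have yc: "y \<in> carrier E" using hom_in[OF fE_hom x(1)] x(2) by simp
    have "gE y = (\<lambda>_. 0)"
    proof
      fix c
      show "gE y c = 0" using gE_eq[OF yc, of c] by (simp add: x(2) fE_def)
    qed
    then show "y \<in> {x \<in> carrier E. gE x = \<zero>\<^bsub>L J\<^esub>}" using yc by (simp add: L_simps)
  next
    fix y assume "y \<in> {x \<in> carrier E. gE x = \<zero>\<^bsub>L J\<^esub>}"
    then have y: "y \<in> carrier E" "gE y = (\<lambda>_. 0)" by (auto simp: L_simps)
    have s: "odd_part y c = - even_part y c" for c using gE_eq[OF y(1), of c] y(2) by (simp add: add_eq_0_iff)
    define x where "x = (\<lambda>c. fps_shift (pI c) (even_part y c))"
    have "X ^ pI c * x c = even_part y c" for c
    proof (cases "c \<in> V")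
      case True
      then show ?thesis using dvd_pI[OF True] E_D(3,4)[OF y(1) True] s[of c] by (simp add: x_def fps_X_power_shift)
    qed (simp add: x_def E_D(6)[OF y(1)])
    then have "fE x = y" using s by - (rule interleave_eqI; simp add: fE_def fun_eq_iff)
    moreover have "x \<in> carrier (L I)" using E_D(6)[OF y(1)] by (simp add: L_simps x_def)
    ultimately show "y \<in> fE ` carrier (L I)" by blast
  qed
  show "gE ` carrier E = carrier (L J)"
  proof (intro equalityI subsetI)
    fix y assume y: "y \<in> carrier (L J)"
    define x where "x = interleave (\<lambda>c. if p1 c \<le> pJ c then X ^ pJ c * y c else 0)
      (\<lambda>c. if p1 c \<le> pJ c then 0 else X ^ pJ c * y c)"
    have x: "x \<in> carrier E" using y pJ_min
      by (auto simp: x_def E_carrier Ecarrier_def L_simps intro!: dvd_mult2 le_imp_power_dvd)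
    have "X ^ pJ c * gE x c = X ^ pJ c * y c" for c
      unfolding gE_eq[OF x] by (simp add: x_def)
    then have "gE x = y" by (simp add: fun_eq_iff)
    then show "y \<in> gE ` carrier E" using x by blast
  qed (use hom_in[OF gE_hom] in blast)
qed

text \<open>Minimum and maximum of the exponents describe the sum and the intersection of
  \<open>L I\<close> and \<open>L J\<close> inside \<open>L S\<close>. The diagonal embeds the
  intersection and the difference of the entries maps onto the sum; that 2 is invertible enters both
  in the kernel and in the image.\<close>

lemma E_exact_XY:
  assumes kX: "kset Xs" and kY: "kset Ys"
    and profX: "profile n Xs S (\<lambda>c. min (pI c) (pJ c))" and profY: "profile n Ys S (\<lambda>c. max (pI c) (pJ c))"
  shows "\<exists>u w. short_exact B (L Ys) u E w (L Xs)"
proof -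
  let ?pX = "\<lambda>c. min (pI c) (pJ c)" and ?pY = "\<lambda>c. max (pI c) (pJ c)"
  have two: "(2 :: complex fps) dvd 1" by simp
  define u where "u = (\<lambda>x. interleave (\<lambda>c. X ^ ?pY c * x c) (\<lambda>c. X ^ ?pY c * x c))"
  note incY = profile_incl[OF kY kS profY]
  have pY: "p1 c \<le> ?pY c" "p2 c \<le> ?pY c" "pJ c \<le> ?pY c" if "c \<in> V" for c using pI_ge[OF that] by auto
  have u: "u \<in> mod_hom B (L Ys) E"
    unfolding u_def
  proof (rule hom_to_E[OF incY incY])
    fix x :: "int \<Rightarrow> complex fps" and c assume c: "c \<in> V"
    show "X ^ p1 c dvd X ^ ?pY c * x c" by (rule dvd_mult2[OF le_imp_power_dvd[OF pY(1)[OF c]]])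
    show "X ^ p2 c dvd X ^ ?pY c * x c" by (rule dvd_mult2[OF le_imp_power_dvd[OF pY(2)[OF c]]])
    have "X ^ pJ c dvd X ^ ?pY c * x c" by (rule dvd_mult2[OF le_imp_power_dvd[OF pY(3)[OF c]]])
    then show "X ^ pJ c dvd X ^ ?pY c * x c + X ^ ?pY c * x c" by (rule dvd_add) fact
  qed
  have diff: "(\<lambda>x c. even_part x c - odd_part x c) \<in> mod_hom B E (L S)"
    by (rule hom_L_minus(1)[OF kS E_module E_even E_odd])
  have dX: "X ^ ?pX c dvd even_part x c - odd_part x c" if x: "x \<in> carrier E" and c: "c \<in> V" for x c
  proof (cases "p1 c \<le> pJ c")
    case True
    have e: "even_part x c - odd_part x c = (even_part x c + odd_part x c) - 2 * odd_part x c" by simp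
    have "X ^ ?pX c dvd even_part x c + odd_part x c" "X ^ ?pX c dvd odd_part x c"
      by (rule dvd_trans[OF le_imp_power_dvd[OF min.cobounded2] E_D(5)[OF x c]],
          rule dvd_trans[OF le_imp_power_dvd[OF min.cobounded1] E_dvd_pI(1)[OF x c True]])
    then show ?thesis unfolding e by (intro dvd_diff dvd_mult)
  next
    case False
    then have "p2 c \<le> pJ c" using pJ_min[OF c] by simp
    have e: "even_part x c - odd_part x c = 2 * even_part x c - (even_part x c + odd_part x c)" by simp
    have "X ^ ?pX c dvd even_part x c + odd_part x c" "X ^ ?pX c dvd even_part x c"
      by (rule dvd_trans[OF le_imp_power_dvd[OF min.cobounded2] E_D(5)[OF x c]],
          rule dvd_trans[OF le_imp_power_dvd[OF min.cobounded1] E_dvd_pI(2)[OF x c \<open>p2 c \<le> pJ c\<close>]])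
    then show ?thesis unfolding e by (intro dvd_diff dvd_mult)
  qed
  obtain w where w: "w \<in> mod_hom B E (L Xs)"
    "\<And>x c. x \<in> carrier E \<Longrightarrow> X ^ ?pX c * w x c = even_part x c - odd_part x c"
    using profile_divide[OF kX kS profX E_module diff dX] by metis
  have "short_exact B (L Ys) u E w (L Xs)"
    unfolding short_exact_def
  proof (intro conjI L_module kX kY E_module u w(1))
    show "inj_on u (carrier (L Ys))"
    proof (rule inj_onI)
      fix x y assume "u x = u y"
      then have "even_part (u x) = even_part (u y)" by simp
      then show "x = y" by (simp add: u_def fun_eq_iff)
    qed
    show "u ` carrier (L Ys) = a_kernel E (L Xs) w"
      unfolding a_kernel_def'
    proof (intro equalityI subsetI)
      fix y assume "y \<in> u ` carrier (L Ys)"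
      then obtain x where x: "x \<in> carrier (L Ys)" "y = u x" by blast
      have yc: "y \<in> carrier E" using hom_in[OF u x(1)] x(2) by simp
      have "w y = (\<lambda>_. 0)"
      proof
        fix c
        show "w y c = 0" using w(2)[OF yc, of c] by (simp add: x(2) u_def)
      qed
      then show "y \<in> {x \<in> carrier E. w x = \<zero>\<^bsub>L Xs\<^esub>}" using yc by (simp add: L_simps)
    next
      fix y assume "y \<in> {x \<in> carrier E. w x = \<zero>\<^bsub>L Xs\<^esub>}"
      then have y: "y \<in> carrier E" "w y = (\<lambda>_. 0)" by (auto simp: L_simps)
      have s: "odd_part y c = even_part y c" for c using w(2)[OF y(1), of c] y(2) by simp
      define x where "x = (\<lambda>c. fps_shift (?pY c) (even_part y c))"
      have "X ^ ?pY c * x c = even_part y c" for c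
      proof (cases "c \<in> V")
        case True
        have "X ^ pJ c dvd 2 * even_part y c" using E_D(5)[OF y(1) True] unfolding s mult_2 .
        then have "X ^ pJ c dvd even_part y c"
          unfolding dvd_mult_unit_iff'[OF two] .
        then have "X ^ ?pY c dvd even_part y c"
          using dvd_pI[OF True] E_D(3,4)[OF y(1) True] s[of c] by (simp add: max_def)
        then show ?thesis unfolding x_def by (rule fps_X_power_shift)
      qed (simp add: x_def E_D(6)[OF y(1)])
      then have "u x = y" using s by - (rule interleave_eqI; simp add: u_def fun_eq_iff)
      moreover have "x \<in> carrier (L Ys)" using E_D(6)[OF y(1)] by (simp add: L_simps x_def)
      ultimately show "y \<in> u ` carrier (L Ys)" by blast
    qed
    show "w ` carrier E = carrier (L Xs)"
    proof (intro equalityI subsetI)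
      fix z assume z: "z \<in> carrier (L Xs)"
      obtain h :: "complex fps" where h: "2 * h = 1" using two by (auto simp: dvd_def)
      \<comment> \<open>Where \<open>pI c\<close> is at most \<open>pJ c\<close>, the two halves z/2
        and - z/2 have sum zero, so only the exponent \<open>pI\<close> matters. Otherwise all of z
        goes into one entry that admits \<open>X ^ pJ c\<close>.\<close>
      define a where "a = (\<lambda>c. if pI c \<le> pJ c then X ^ pI c * (h * z c) else if p1 c \<le> pJ c then X ^ pJ c * z c else 0)"
      define b where "b = (\<lambda>c. if pI c \<le> pJ c then - (X ^ pI c * (h * z c)) else if p1 c \<le> pJ c then 0 else - (X ^ pJ c * z c))"
      have x: "interleave a b \<in> carrier E"
        unfolding E_carrier Ecarrier_def
      proof (intro CollectI conjI ballI)
        show "even_part (interleave a b) \<in> carrier (L S)" "odd_part (interleave a b) \<in> carrier (L S)"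
          using z by (auto simp: a_def b_def L_simps)
        fix c assume c: "c \<in> V"
        have d: "X ^ e dvd X ^ m * y" if "e \<le> m" for e m y by (rule dvd_mult2[OF le_imp_power_dvd[OF that]])
        show "X ^ p1 c dvd even_part (interleave a b) c" "X ^ p2 c dvd odd_part (interleave a b) c"
          "X ^ pJ c dvd even_part (interleave a b) c + odd_part (interleave a b) c"
          using pI_ge[OF c] pJ_min[OF c] by (auto simp: a_def b_def intro: d)
      qed
      have hh: "h * y + h * y = y" for y
      proof -
        have "h * y + h * y = (2 * h) * y" by (simp only: mult_2 distrib_right)
        then show ?thesis by (simp only: h mult_1)
      qed
      have "a c - b c = X ^ ?pX c * z c" for c
      proof (cases "pI c \<le> pJ c")
        case True
        have "a c - b c = X ^ pI c * (h * z c + h * z c)"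
          using True by (simp only: a_def b_def if_True diff_minus_eq_add distrib_left)
        then show ?thesis using True by (simp only: hh min_absorb1)
      qed (simp add: a_def b_def)
      then have "w (interleave a b) c = z c" for c
        using w(2)[OF x, of c] by simp
      then have "w (interleave a b) = z" by (rule ext)
      then show "z \<in> w ` carrier E" using x by blast
    qed (use hom_in[OF w(1)] in blast)
  qed
  then show ?thesis by blast
qed

section \<open>A basis of the middle term, and its rank\<close>

definition Ebasis :: "int \<times> bool \<Rightarrow> int \<Rightarrow> complex fps" where
  "Ebasis = (\<lambda>(c, l). if l then lift_gen c 1 else fE (single c 1))"

text \<open>For the part in \<open>L I\<close>, the entry is read that the lifted generators at
  \<open>c\<close> leave empty; the sign comes from the sign in \<open>fE\<close>.\<close>

definition Ecoord :: "int \<times> bool \<Rightarrow> (int \<Rightarrow> complex fps) \<Rightarrow> complex fps" where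
  "Ecoord = (\<lambda>(c, l) x. if l then gE x c
     else fps_shift (pI c) (if p1 c \<le> pJ c then - odd_part x c else even_part x c))"

lemma Ecoord_eq:
  assumes "x \<in> carrier E" "c \<in> V"
  shows "X ^ pI c * Ecoord (c, False) x = (if p1 c \<le> pJ c then - odd_part x c else even_part x c)"
proof (cases "p1 c \<le> pJ c")
  case True
  have "X ^ pI c dvd - odd_part x c" using E_dvd_pI(1)[OF assms True] by simp
  then show ?thesis using True fps_X_power_shift[of "pI c" "- odd_part x c"] by (simp add: Ecoord_def)
next
  case False
  then show ?thesis using E_dvd_pI(2)[OF assms] pJ_min[OF assms(2)] fps_X_power_shift
    by (auto simp: Ecoord_def)
qed

lemma fE_single: "fE (single c z) = interleave (single c (X ^ pI c * z)) (single c (- (X ^ pI c * z)))"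
  by (rule interleave_eqI) (auto simp: fE_def single_def)

lemma Ebasis_in: "c \<in> V \<Longrightarrow> Ebasis (c, l) \<in> carrier E"
  using hom_in[OF fE_hom single_in] lift_gen_in by (simp add: Ebasis_def)

lemma Ebasis_parts:
  assumes "c \<in> V"
  shows "even_part (zs E z (Ebasis (c, l))) = single c (z * (if l then (if p1 c \<le> pJ c then X ^ pJ c else 0) else X ^ pI c))"
    and "odd_part (zs E z (Ebasis (c, l))) = single c (z * (if l then (if p1 c \<le> pJ c then 0 else X ^ pJ c) else - (X ^ pI c)))"
proof -
  have z0: "(\<lambda>_. 0) = single c 0" by (auto simp: single_def)
  show "even_part (zs E z (Ebasis (c, l))) = single c (z * (if l then (if p1 c \<le> pJ c then X ^ pJ c else 0) else X ^ pI c))"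
    and "odd_part (zs E z (Ebasis (c, l))) = single c (z * (if l then (if p1 c \<le> pJ c then 0 else X ^ pJ c) else - (X ^ pI c)))"
    using assms unfolding Ebasis_def lift_gen_def fE_single E_ops z0
    by (auto simp: L_zs_single[OF kS])
qed

lemma E_zbasis: "zbasis E (V \<times> UNIV) Ebasis Ecoord"
  unfolding zbasis_def
proof (intro conjI ballI)
  show "finite (V \<times> (UNIV :: bool set))" by simp
  show "Ebasis x \<in> carrier E" if "x \<in> V \<times> UNIV" for x using that Ebasis_in by (cases x) auto
  show "x = (\<Oplus>\<^bsub>E\<^esub>i\<in>V \<times> UNIV. zs E (Ecoord i x) (Ebasis i))" if x: "x \<in> carrier E" for x
  proof (rule interleave_eqI; rule ext)
    fix j
    have sumV: "(\<Sum>(c, l)\<in>V \<times> (UNIV :: bool set). single c (h c l) j) = (if j \<in> V then h j True + h j False else 0)" for h :: "int \<Rightarrow> bool \<Rightarrow> complex fps"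
    proof -
      have "(\<Sum>(c, l)\<in>V \<times> (UNIV :: bool set). single c (h c l) j) = (\<Sum>c\<in>V. \<Sum>l\<in>UNIV. single c (h c l) j)"
        by (rule sum.cartesian_product[symmetric])
      also have "\<dots> = (\<Sum>c\<in>V. if c = j then h c True + h c False else 0)"
        by (rule sum.cong) (auto simp: single_def UNIV_bool)
      also have "\<dots> = (if j \<in> V then h j True + h j False else 0)" by simp
      finally show ?thesis .
    qed
    have fin: "finite (V \<times> (UNIV :: bool set))" by simp
    have c: "zs E (Ecoord i x) (Ebasis i) \<in> carrier E" if "i \<in> V \<times> UNIV" for i
      using that Ebasis_in zs_in[OF E_module] by (cases i) auto
    have ev: "even_part (\<Oplus>\<^bsub>E\<^esub>i\<in>V \<times> UNIV. zs E (Ecoord i x) (Ebasis i)) j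
       = (\<Sum>i\<in>V \<times> UNIV. even_part (zs E (Ecoord i x) (Ebasis i)) j)"
      and od: "odd_part (\<Oplus>\<^bsub>E\<^esub>i\<in>V \<times> UNIV. zs E (Ecoord i x) (Ebasis i)) j
       = (\<Sum>i\<in>V \<times> UNIV. odd_part (zs E (Ecoord i x) (Ebasis i)) j)"
      using c hom_in[OF E_even] hom_in[OF E_odd]
      by (simp_all add: hom_finsum[OF E_module L_module[OF kS] E_even fin]
          hom_finsum[OF E_module L_module[OF kS] E_odd fin] L_finsum[OF kS fin])
    note e = gE_eq[OF x, of j] Ecoord_eq[OF x, of j]
    have "(\<Sum>i\<in>V \<times> UNIV. even_part (zs E (Ecoord i x) (Ebasis i)) j)
      = (\<Sum>(c, l)\<in>V \<times> UNIV. single c (Ecoord (c, l) x * (if l then (if p1 c \<le> pJ c then X ^ pJ c else 0) else X ^ pI c)) j)"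
      by (rule sum.cong[OF refl]) (auto simp: Ebasis_parts)
    also have "\<dots> = even_part x j"
      unfolding sumV using e E_D(6)[OF x, of j]
      by (auto simp: Ecoord_def mult.commute[of _ "X ^ m" for m])
    finally show "even_part x j = even_part (\<Oplus>\<^bsub>E\<^esub>i\<in>V \<times> UNIV. zs E (Ecoord i x) (Ebasis i)) j"
      using ev by simp
    have "(\<Sum>i\<in>V \<times> UNIV. odd_part (zs E (Ecoord i x) (Ebasis i)) j)
      = (\<Sum>(c, l)\<in>V \<times> UNIV. single c (Ecoord (c, l) x * (if l then (if p1 c \<le> pJ c then 0 else X ^ pJ c) else - (X ^ pI c))) j)"
      by (rule sum.cong[OF refl]) (auto simp: Ebasis_parts)
    also have "\<dots> = odd_part x j"
      unfolding sumV using e E_D(7)[OF x, of j]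
      by (auto simp: Ecoord_def mult.commute[of _ "X ^ m" for m])
    finally show "odd_part x j = odd_part (\<Oplus>\<^bsub>E\<^esub>i\<in>V \<times> UNIV. zs E (Ecoord i x) (Ebasis i)) j"
      using od by simp
  qed
  show "zlin E (Ecoord i)" if i0: "i \<in> V \<times> UNIV" for i
  proof -
    obtain c l where i: "i = (c, l)" "c \<in> V" using i0 by (cases i) auto
    have evp: "zlin E (\<lambda>x. even_part x c)" and odp: "zlin E (\<lambda>x. odd_part x c)"
      using hom_to_L_apply(1,2)[OF kS E_module E_even] hom_to_L_apply(1,2)[OF kS E_module E_odd]
      by (auto simp: zlin_def)
    have gz: "zlin E (\<lambda>x. gE x c)"
      using hom_to_L_apply(1,2)[OF kJ E_module gE_hom] by (auto simp: zlin_def)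
    define m :: "(int \<Rightarrow> complex fps) \<Rightarrow> complex fps" where "m = (\<lambda>x. if p1 c \<le> pJ c then - odd_part x c else even_part x c)"
    have mz: "zlin E m" using evp odp by (auto simp: m_def zlin_def)
    have cm: "X ^ pI c * Ecoord (c, False) x = m x" if "x \<in> carrier E" for x
      using Ecoord_eq[OF that i(2)] by (simp add: m_def)
    have "zlin E (Ecoord (c, False))"
      unfolding zlin_def
    proof (intro conjI ballI allI)
      fix x y assume xy: "x \<in> carrier E" "y \<in> carrier E"
      have "X ^ pI c * Ecoord (c, False) (x \<oplus>\<^bsub>E\<^esub> y) = X ^ pI c * (Ecoord (c, False) x + Ecoord (c, False) y)"
        using xy mz cm by (simp add: zlin_def distrib_left)
      then show "Ecoord (c, False) (x \<oplus>\<^bsub>E\<^esub> y) = Ecoord (c, False) x + Ecoord (c, False) y" by simp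
    next
      fix z x assume x: "x \<in> carrier E"
      have "X ^ pI c * Ecoord (c, False) (zs E z x) = X ^ pI c * (z * Ecoord (c, False) x)"
        using x mz cm zs_in[OF E_module x] by (simp add: zlin_def mult.left_commute[of _ z])
      then show "Ecoord (c, False) (zs E z x) = z * Ecoord (c, False) x" by simp
    qed
    then show ?thesis using gz i by (cases l) (auto simp: Ecoord_def)
  qed
  show "Ecoord i (Ebasis j) = (if i = j then 1 else 0)" if ij0: "i \<in> V \<times> UNIV" "j \<in> V \<times> UNIV" for i j
  proof -
    obtain c l d l' where ij: "i = (c, l)" "j = (d, l')" "c \<in> V" "d \<in> V" using ij0 by (cases i; cases j) auto
    have b: "Ebasis (d, l') \<in> carrier E" by (rule Ebasis_in[OF ij(4)])
    have e: "even_part (Ebasis (d, l')) c = (if c = d then (if l' then (if p1 c \<le> pJ c then X ^ pJ c else 0) else X ^ pI c) else 0)"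
      "odd_part (Ebasis (d, l')) c = (if c = d then (if l' then (if p1 c \<le> pJ c then 0 else X ^ pJ c) else - (X ^ pI c)) else 0)"
      using Ebasis_parts[OF ij(4), of 1 l'] zs_one[OF E_module b] by (auto simp: single_def)
    have "X ^ pJ c * Ecoord (c, True) (Ebasis (d, l')) = X ^ pJ c * (if (c, True) = (d, l') then 1 else 0)"
      using gE_eq[OF b, of c] e by (auto simp: Ecoord_def)
    moreover have "X ^ pI c * Ecoord (c, False) (Ebasis (d, l')) = X ^ pI c * (if (c, False) = (d, l') then 1 else 0)"
      using Ecoord_eq[OF b ij(3)] e by (auto split: if_splits)
    ultimately show ?thesis unfolding ij(1,2) by (cases l) auto
  qed
qed

lemma E_CM: "CM n k E"
  by (rule zbasis_CM[OF E_module E_zbasis])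

lemma E_qa_parts:
  assumes "c \<in> V" "d \<in> V"
  shows "qa E c d x = interleave (single d (X ^ wt S c d * even_part x c)) (single d (X ^ wt S c d * odd_part x c))"
  using assms by (simp add: E_ops L_qa_eq[OF kS])

lemma E_rank: "has_rank n k E 2"
proof (rule zbasis_has_rank[OF E_module E_zbasis, of fst])
  fix i assume "i \<in> V \<times> (UNIV :: bool set)"
  then obtain c l where i: "i = (c, l)" "c \<in> V" by (cases i) auto
  have b: "Ebasis (c, l) \<in> carrier E" by (rule Ebasis_in[OF i(2)])
  note e = Ebasis_parts[OF i(2), of 1 l, unfolded zs_one[OF E_module b]]
  have "qa E c c (Ebasis (c, l)) = Ebasis (c, l)"
    unfolding E_qa_parts[OF i(2) i(2)] using i(2) e by - (rule interleave_eqI; simp; simp add: single_def fun_eq_iff)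
  then show "fst i \<in> V \<and> qa E (fst i) (fst i) (Ebasis i) = Ebasis i" using i by simp
next
  fix c assume "c \<in> V"
  then have "{i \<in> V \<times> (UNIV :: bool set). fst i = c} = {(c, True), (c, False)}" by auto
  then show "card {i \<in> V \<times> (UNIV :: bool set). fst i = c} = 2" by simp
qed

end


section \<open>The almost split property\<close>

context ar_data
begin

section \<open>Neither map of the sequence splits\<close>

lemma pI_i: "pI i = Suc (pJ i)" and pI_v: "pI v = Suc (pJ v)"
  using pI_max[of i] pI_max[of v] at_i at_v by simp_all

lemma iv_neq: "i \<noteq> v" using at_i at_v by auto

lemma wt_iv: "wt J i v = 1"
  using wt_profile[OF profJ iV vV] val2[OF iV] at_i at_v by simp

lemma wt_vi: "1 \<le> wt J v i" "wt J v i + pJ i = wt S v i + pJ v"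
  using wt_profile[OF profJ vV iV] val1[OF vV] at_i at_v by linarith+

lemma p1_v: "p1 v + wt J v i = p2 v"
  using wt_vi val1[OF vV] at_i at_v by linarith

text \<open>For a section, the odd entry at \<open>v\<close> is divisible by
  \<open>X ^ Suc (pJ v)\<close>. Comparison along the path from \<open>i\<close> to \<open>v\<close>
  makes the odd entry at \<open>i\<close> divisible by \<open>X ^ Suc (pJ i)\<close>, and so is the
  even one because \<open>p1 i = Suc (pJ i)\<close>. Their sum, however, is
  \<open>X ^ pJ i\<close>.\<close>

lemma not_split_epi: "\<not> split_epi B E gE (L J)"
proof
  assume "split_epi B E gE (L J)"
  then obtain s where s: "s \<in> mod_hom B (L J) E" "\<And>x. x \<in> carrier (L J) \<Longrightarrow> gE (s x) = x"
    by (auto simp: split_epi_def)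
  note LJ = L_module[OF kJ]
  have hom: "(\<lambda>x. odd_part (s x)) \<in> mod_hom B (L J) (L S)" by (rule hom_comp[OF s(1) E_odd])
  have sv: "s (single c 1) \<in> carrier E" if "c \<in> V" for c using hom_in[OF s(1)] that by simp
  let ?b = "\<lambda>c. odd_part (s (single c 1)) c"
  have "X ^ wt S i v * ?b i = odd_part (s (qa (L J) i v (single i 1))) v"
    using hom_to_L_apply(3)[OF kS LJ hom, of "single i 1" i v v] by simp
  also have "qa (L J) i v (single i 1) = zs (L J) (X ^ wt J i v) (single v 1)"
    by (simp add: L_qa_single[OF kJ] L_zs_single[OF kJ])
  also have "odd_part (s \<dots>) v = X ^ wt J i v * ?b v"
    using hom_to_L_apply(2)[OF kS LJ hom, of "single v 1"] by simp
  finally have 1: "X ^ wt S i v * ?b i = X ^ wt J i v * ?b v" .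
  obtain b' where b': "?b v = X ^ p2 v * b'" using E_D(4)[OF sv[OF vV] vV] by (auto simp: dvd_def)
  have "X ^ wt S i v * ?b i = X ^ wt S i v * (X ^ Suc (pJ i) * b')"
    unfolding 1 b' using wt_profile[OF profJ iV vV] at_v
    by (simp add: mult.assoc[symmetric] power_add[symmetric] flip: power_Suc)
  then have "?b i = X ^ Suc (pJ i) * b'" by simp
  moreover have "X ^ Suc (pJ i) dvd even_part (s (single i 1)) i"
    using E_D(3)[OF sv[OF iV] iV] at_i by simp
  ultimately have "X ^ Suc (pJ i) dvd even_part (s (single i 1)) i + ?b i" by (simp del: power_Suc)
  also have "\<dots> = X ^ pJ i" using gE_eq[OF sv[OF iV], of i] s(2)[OF single_in[OF iV]] by (simp add: single_def)
  finally have "\<forall>m<Suc (pJ i). (X ^ pJ i) $ m = 0" unfolding fps_X_power_dvd_iff .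
  then have "(X ^ pJ i) $ pJ i = 0" by blast
  then show False by (simp add: fps_X_power_iff)
qed

lemma not_split_mono: "\<not> split_mono B (L I) fE E"
proof
  assume "split_mono B (L I) fE E"
  then obtain r where r: "r \<in> mod_hom B E (L I)" "\<And>x. x \<in> carrier (L I) \<Longrightarrow> r (fE x) = x"
    by (auto simp: split_mono_def)
  \<comment> \<open>\<open>fE (single i 1)\<close> is \<open>e1\<close> minus X times
    \<open>e2\<close>, and \<open>X ^ (wt J v i - 1)\<close> times \<open>e1\<close> is the image of
    \<open>e3\<close> under the path from \<open>v\<close> to \<open>i\<close>. That path has the
    same weight in \<open>L I\<close> as in \<open>L J\<close>, so a retraction sends
    \<open>e1\<close> to a multiple of X, and 1 would be divisible by X.\<close>
  define e1 where "e1 = interleave (single i (X ^ Suc (pJ i))) (single i 0)"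
  define e2 where "e2 = interleave (single i 0) (single i (X ^ pJ i))"
  define e3 where "e3 = interleave (single v (X ^ pJ v)) (single v 0)"
  have e: "e1 \<in> carrier E" "e2 \<in> carrier E" "e3 \<in> carrier E"
    unfolding e1_def e2_def e3_def using at_i at_v
    by (auto intro!: E_pairI simp: le_imp_power_dvd)
  have "fE (single i 1) = e1 \<oplus>\<^bsub>E\<^esub> zs E (- X) e2"
    unfolding fE_single E_ops e1_def e2_def
    by (rule interleave_eqI) (auto simp: L_zs_single[OF kS] pI_i, auto simp: single_def)
  then have "1 = r (e1 \<oplus>\<^bsub>E\<^esub> zs E (- X) e2) i"
    using r(2)[OF single_in[OF iV], of 1] by (simp add: single_def)
  also have "\<dots> = r e1 i - X * r e2 i"
    using hom_to_L_apply(1)[OF kI E_module r(1) e(1) zs_in[OF E_module e(2)]]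
      hom_to_L_apply(2)[OF kI E_module r(1) e(2)] by simp
  finally have 1: "1 = r e1 i - X * r e2 i" .
  have q: "qa E v i e3 = zs E (X ^ (wt J v i - 1)) e1"
  proof -
    have "wt S v i + pJ v = (wt J v i - 1) + Suc (pJ i)" using wt_vi by linarith
    then have "X ^ wt S v i * X ^ pJ v = X ^ (wt J v i - 1) * X ^ Suc (pJ i)" by (simp only: power_add[symmetric])
    then show ?thesis
      unfolding E_ops e1_def e3_def interleave_simps
      by (simp add: L_qa_single[OF kS] L_zs_single[OF kS] del: power_Suc)
  qed
  have "wt I v i = wt J v i" using wt_profile[OF profI vV iV] wt_vi pI_i pI_v by simp
  then have "X ^ (wt J v i - 1) * r e1 i = X ^ wt J v i * r e3 v"
    using hom_to_L_apply(3)[OF kI E_module r(1) e(3) vV iV, of i]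
      hom_to_L_apply(2)[OF kI E_module r(1) e(1), of "X ^ (wt J v i - 1)" i] q by simp
  also have "X ^ wt J v i = X ^ (wt J v i - 1) * X" using wt_vi(1) by (metis Suc_diff_1 less_eq_Suc_le One_nat_def power_Suc2)
  finally have "r e1 i = X * r e3 v" by simp
  then have "1 = X * (r e3 v - r e2 i)" using 1 by (simp add: algebra_simps)
  then have "(1 :: complex fps) $ 0 = (X * (r e3 v - r e2 i)) $ 0" by simp
  then show False by simp
qed

text \<open>The homomorphisms from the module of \<open>J\<close> to \<open>W\<close>, each given by the images of the generators
  at the two peaks \<open>i\<close> and \<open>v\<close>; the dual description applies to maps into the module of \<open>I\<close>, which
  has its valleys at \<open>i\<close> and \<open>v\<close>.\<close>

definition peak_pairs :: "'m B_module \<Rightarrow> 'm set" where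
  "peak_pairs W = {x \<in> carrier W. qa W i i x \<oplus>\<^bsub>W\<^esub> qa W v v x = x \<and> qa W i v x = zs W X (qa W v v x)}"

lemma peak_pairs_facts:
  assumes W: "left_module B W" and t: "tfree W"
  shows "peak_pairs W \<subseteq> carrier W" "\<zero>\<^bsub>W\<^esub> \<in> peak_pairs W"
    "\<And>x y. x \<in> peak_pairs W \<Longrightarrow> y \<in> peak_pairs W \<Longrightarrow> x \<oplus>\<^bsub>W\<^esub> y \<in> peak_pairs W"
    "\<And>z x. x \<in> peak_pairs W \<Longrightarrow> zs W z x \<in> peak_pairs W"
    "\<And>x. x \<in> carrier W \<Longrightarrow> zs W X x \<in> peak_pairs W \<Longrightarrow> x \<in> peak_pairs W"
proof -
  interpret W: left_module B W by fact
  show "peak_pairs W \<subseteq> carrier W" by (auto simp: peak_pairs_def)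
  show "\<zero>\<^bsub>W\<^esub> \<in> peak_pairs W" by (simp add: peak_pairs_def qa_zero[OF W] zs_zero_right[OF W])
  show "x \<oplus>\<^bsub>W\<^esub> y \<in> peak_pairs W" if xy: "x \<in> peak_pairs W" "y \<in> peak_pairs W" for x y
  proof -
    have c: "x \<in> carrier W" "y \<in> carrier W" using xy by (auto simp: peak_pairs_def)
    have "qa W i i (x \<oplus>\<^bsub>W\<^esub> y) \<oplus>\<^bsub>W\<^esub> qa W v v (x \<oplus>\<^bsub>W\<^esub> y) = (qa W i i x \<oplus>\<^bsub>W\<^esub> qa W v v x) \<oplus>\<^bsub>W\<^esub> (qa W i i y \<oplus>\<^bsub>W\<^esub> qa W v v y)"
      using c by (simp add: qa_add[OF W] qa_in[OF W] W.a_ac)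
    then show ?thesis using xy c by (simp add: peak_pairs_def qa_add[OF W] zs_add[OF W] qa_in[OF W])
  qed
  show "zs W z x \<in> peak_pairs W" if x: "x \<in> peak_pairs W" for z x
  proof -
    have c: "x \<in> carrier W" using x by (auto simp: peak_pairs_def)
    have "qa W i i (zs W z x) \<oplus>\<^bsub>W\<^esub> qa W v v (zs W z x) = zs W z (qa W i i x \<oplus>\<^bsub>W\<^esub> qa W v v x)"
      using c by (simp add: qa_zs[OF W] zs_add[OF W] qa_in[OF W])
    moreover have "qa W i v (zs W z x) = zs W X (qa W v v (zs W z x))"
    proof -
      have "qa W i v (zs W z x) = zs W z (qa W i v x)" using c by (simp add: qa_zs[OF W])
      also have "\<dots> = zs W z (zs W X (qa W v v x))" using x by (simp add: peak_pairs_def)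
      also have "\<dots> = zs W X (qa W v v (zs W z x))" using c by (simp add: qa_zs[OF W] zs_zs[OF W] qa_in[OF W] mult.commute)
      finally show ?thesis .
    qed
    ultimately show ?thesis using x c by (simp add: peak_pairs_def zs_in[OF W])
  qed
  show "x \<in> peak_pairs W" if c: "x \<in> carrier W" and x: "zs W X x \<in> peak_pairs W" for x
  proof -
    have X0: "X \<noteq> 0" by simp
    have "zs W X (qa W i i x \<oplus>\<^bsub>W\<^esub> qa W v v x) = zs W X x"
      using x c by (simp add: peak_pairs_def zs_add[OF W] qa_in[OF W] qa_zs[OF W])
    then have 1: "qa W i i x \<oplus>\<^bsub>W\<^esub> qa W v v x = x"
      by (rule tfree_cancel[OF W t _ _ X0, rotated 2]) (use c in \<open>auto simp: qa_in[OF W]\<close>)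
    have "zs W X (qa W i v x) = zs W X (zs W X (qa W v v x))"
      using x c by (simp add: peak_pairs_def qa_zs[OF W])
    then have "qa W i v x = zs W X (qa W v v x)"
      by (rule tfree_cancel[OF W t _ _ X0, rotated 2]) (use c in \<open>auto simp: qa_in[OF W] zs_in[OF W]\<close>)
    then show ?thesis using 1 c by (simp add: peak_pairs_def)
  qed
qed

lemma peak_projection:
  assumes W: "left_module B W" and b: "zbasis W S0 bs \<kappa>"
  obtains \<pi> where "\<And>x. x \<in> carrier W \<Longrightarrow> \<pi> x \<in> peak_pairs W"
    "\<And>x y. x \<in> carrier W \<Longrightarrow> y \<in> carrier W \<Longrightarrow> \<pi> (x \<oplus>\<^bsub>W\<^esub> y) = \<pi> x \<oplus>\<^bsub>W\<^esub> \<pi> y"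
    "\<And>z x. x \<in> carrier W \<Longrightarrow> \<pi> (zs W z x) = zs W z (\<pi> x)" "\<And>x. x \<in> peak_pairs W \<Longrightarrow> \<pi> x = x"
proof (rule pure_projection[OF W b peak_pairs_facts(1,2)[OF W zbasis_tfree[OF W b]]])
  note N = peak_pairs_facts[OF W zbasis_tfree[OF W b]]
  show "x \<oplus>\<^bsub>W\<^esub> y \<in> peak_pairs W" if "x \<in> peak_pairs W" "y \<in> peak_pairs W" for x y
    using that by (rule N(3))
  show "zs W z x \<in> peak_pairs W" if "x \<in> peak_pairs W" for z x using that by (rule N(4))
  show "x \<in> peak_pairs W" if "x \<in> carrier W" "zs W X x \<in> peak_pairs W" for x using that by (rule N(5))
qed (rule that)

lemma tri_ivi: "tri i v i = Suc (wt J v i)" "tri v i v = Suc (wt J v i)"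
  using wt_tri[OF kJ iV vV iV] wt_tri[OF kJ vV iV vV] wt_iv by simp_all

text \<open>The pairs come from maps of \<open>L J\<close> into the projectives generated at
  \<open>i\<close> and at \<open>v\<close>, followed by evaluation at \<open>y\<close>. In each, the
  part at \<open>i\<close> moved to \<open>v\<close> is X times the part at
  \<open>v\<close>.\<close>

lemma peak_pairs_of:
  assumes W: "left_module B W" and y: "y \<in> carrier W"
  shows "zs W X (qa W i i y) \<oplus>\<^bsub>W\<^esub> qa W i v y \<in> peak_pairs W"
    and "qa W v i y \<oplus>\<^bsub>W\<^esub> zs W (X ^ wt J v i) (qa W v v y) \<in> peak_pairs W"
proof -
  interpret W: left_module B W by fact
  note qin = qa_in[OF W] zs_in[OF W]
  show "zs W X (qa W i i y) \<oplus>\<^bsub>W\<^esub> qa W i v y \<in> peak_pairs W"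
    using y iv_neq iv_neq[symmetric]
    by (simp add: peak_pairs_def qa_add[OF W] qa_zs[OF W] qin qa_qa[OF W] qa_qa_zero[OF W] zs_one[OF W] zs_zero_right[OF W])
  show "qa W v i y \<oplus>\<^bsub>W\<^esub> zs W (X ^ wt J v i) (qa W v v y) \<in> peak_pairs W"
    using y iv_neq iv_neq[symmetric]
    by (simp add: peak_pairs_def qa_add[OF W] qa_zs[OF W] qin qa_qa[OF W] qa_qa_zero[OF W] zs_one[OF W] zs_zero_right[OF W]
        zs_zs[OF W] tri_ivi)
qed

text \<open>The compatibility from \<open>i\<close> to \<open>v\<close> gives the one from
  \<open>v\<close> to \<open>i\<close> after multiplication by X, because the round trip at
  \<open>i\<close> is \<open>X ^ Suc (wt J v i)\<close>; then X cancels.\<close>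

lemma peak_pairs_vi:
  assumes W: "left_module B W" and t: "tfree W" and x: "x \<in> peak_pairs W"
  shows "qa W v i x = zs W (X ^ wt J v i) (qa W i i x)"
proof -
  have c: "x \<in> carrier W" using x by (auto simp: peak_pairs_def)
  note qin = qa_in[OF W] zs_in[OF W]
  have "zs W X (qa W v i x) = qa W v i (zs W X (qa W v v x))"
    using c by (simp add: qa_zs[OF W] qin qa_qa[OF W] zs_one[OF W])
  also have "\<dots> = qa W v i (qa W i v x)" using x by (simp add: peak_pairs_def)
  also have "\<dots> = zs W X (zs W (X ^ wt J v i) (qa W i i x))" using c by (simp add: qa_qa[OF W] tri_ivi zs_zs[OF W] qin)
  finally show ?thesis by (rule tfree_cancel[OF W t _ _ _, rotated 3]) (use c in \<open>auto simp: qin\<close>)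
qed

text \<open>\<open>hom_from_L_exists\<close> provides the wanted map times \<open>X ^ N\<close>.
  Every vertex is reached with weight zero from one of the two peaks of \<open>J\<close>, so the
  image at that vertex is indeed divisible by \<open>X ^ N\<close>.\<close>

lemma peak_pairs_hom:
  assumes W: "left_module B W" and t: "tfree W" and x: "x \<in> peak_pairs W"
  obtains s where "s \<in> mod_hom B (L J) W" "s (single i 1) = qa W i i x"
proof -
  interpret W: left_module B W by fact
  have c: "x \<in> carrier W" using x by (auto simp: peak_pairs_def)
  note qin = qa_in[OF W] zs_in[OF W]
  define N where "N = (\<Sum>u\<in>V. wt J i u)"
  have N: "wt J i u \<le> N" if "u \<in> V" for u unfolding N_def using that by (intro member_le_sum) auto
  obtain h where h: "h \<in> mod_hom B (L J) W"
    "\<And>c z. c \<in> V \<Longrightarrow> h (single c z) = zs W (z * X ^ (N - wt J i c)) (qa W i c x)"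
    using hom_from_L_exists[OF kJ W iV c N] by metis
  have "\<exists>y\<in>carrier W. h z = zs W (X ^ N) y" if z: "z \<in> carrier (L J)" for z
  proof (rule mod_divisibleI[OF W hom_in[OF h(1) z]])
    fix d assume d: "d \<in> V"
    have e: "qa W d d (h z) = zs W (z d * X ^ (N - wt J i d)) (qa W i d x)"
      using d z by (simp add: hom_qa[OF h(1), symmetric] L_qa_eq[OF kJ] h(2))
    show "\<exists>y\<in>carrier W. qa W d d (h z) = zs W (X ^ N) y"
    proof (cases "wt J i d = 0")
      case True
      then show ?thesis using c d
        by (intro bexI[of _ "zs W (z d) (qa W i d x)"]) (auto simp: e zs_zs[OF W] qin mult.commute)
    next
      case False
      \<comment> \<open>Here the vertex is reached with weight zero from \<open>v\<close> instead of
        \<open>i\<close>; the pair condition trades the path from \<open>i\<close> for the one from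
        \<open>v\<close>.\<close>
      then have vd: "wt J v d = 0" using peaks[OF d] by simp
      have tr: "tri i v d + wt J i d = 1" using wt_tri[OF kJ iV vV d] vd wt_iv by simp
      have "zs W (X ^ tri i v d) (qa W i d x) = qa W v d (qa W i v x)"
        using c d by (simp add: qa_qa[OF W])
      also have "\<dots> = qa W v d (zs W X (qa W v v x))" using x by (simp add: peak_pairs_def)
      also have "\<dots> = zs W (X ^ tri i v d) (zs W (X ^ wt J i d) (qa W v d x))"
        using c d tr by (simp add: qa_zs[OF W] qin qa_qa[OF W] zs_one[OF W] zs_zs[OF W] power_add[symmetric])
      finally have "qa W i d x = zs W (X ^ wt J i d) (qa W v d x)"
        by (rule tfree_cancel[OF W t _ _ _, rotated 3]) (use c d in \<open>auto simp: qin\<close>)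
      then have "qa W d d (h z) = zs W (X ^ N) (zs W (z d) (qa W v d x))"
        using c d N[OF d] by (simp add: e zs_zs[OF W] qin mult.assoc power_add[symmetric] mult.commute[of _ "z d"])
      then show ?thesis using c d by (intro bexI[of _ "zs W (z d) (qa W v d x)"]) (auto simp: qin)
    qed
  qed
  then obtain s where s: "s \<in> mod_hom B (L J) W" "\<And>z. z \<in> carrier (L J) \<Longrightarrow> h z = zs W (X ^ N) (s z)"
    using hom_divide_scalar[OF L_module[OF kJ] W t h(1), of "X ^ N"] by auto
  have "zs W (X ^ N) (s (single i 1)) = zs W (X ^ N) (qa W i i x)"
    using s(2)[of "single i 1"] h(2)[OF iV, of 1] by simp
  then have "s (single i 1) = qa W i i x"
    by (rule tfree_cancel[OF W t _ _ _, rotated 3]) (use c hom_in[OF s(1)] in \<open>auto simp: qin\<close>)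
  then show ?thesis using s(1) that by blast
qed

section \<open>Lifting along \<open>gE\<close> and extending along \<open>fE\<close>\<close>

lemma fps_X_dvd_iff: "X dvd f \<longleftrightarrow> f $ 0 = 0"
  using fps_X_power_dvd_iff[of 1 f] by simp

lemma right_lift:
  assumes CMW: "CM n k W" and h: "h \<in> mod_hom B W (L J)" and ns: "\<not> split_epi B W h (L J)"
  shows "\<exists>u\<in>mod_hom B W E. \<forall>x\<in>carrier W. gE (u x) = h x"
proof -
  have W: "left_module B W" using CMW by (simp add: CM_def)
  interpret W: left_module B W by fact
  note qin = qa_in[OF W] zs_in[OF W]
  obtain S0 \<kappa> where b: "zbasis W S0 (\<lambda>s. s) \<kappa>" using CM_zbasis[OF CMW] by blast
  have t: "tfree W" by (rule zbasis_tfree[OF W b])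
  note N = peak_pairs_facts[OF W t]
  \<comment> \<open>A pair whose image has a unit entry at \<open>i\<close> would give a map from
    \<open>L J\<close> to \<open>W\<close> which, rescaled by the inverse of that entry, is a
    section of \<open>h\<close>.\<close>
  have X_h: "X dvd h x i" if x: "x \<in> peak_pairs W" for x
  proof (rule ccontr)
    assume "\<not> X dvd h x i"
    then have u: "h x i $ 0 \<noteq> 0" by (simp add: fps_X_dvd_iff)
    have c: "x \<in> carrier W" using x N(1) by blast
    obtain s where s: "s \<in> mod_hom B (L J) W" "s (single i 1) = qa W i i x"
      using peak_pairs_hom[OF W t x] by blast
    let ?s = "\<lambda>y. zs W (inverse (h x i)) (s y)"
    have s': "?s \<in> mod_hom B (L J) W" by (rule hom_zs_comp[OF W s(1)])
    have "h (?s (single i 1)) = single i 1"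
      using c u by (simp add: s(2) hom_zs[OF h] qin hom_qa[OF h] L_qa_eq[OF kJ] L_zs_single[OF kJ] inverse_mult_eq_1)
    then have "h (?s y) = y" if "y \<in> carrier (L J)" for y
      using hom_from_L_unique[OF kJ L_module[OF kJ] L_tfree[OF kJ] hom_comp[OF s' h] hom_id iV _ that] by simp
    then show False using ns s' by (auto simp: split_epi_def)
  qed
  obtain \<pi> where p: "\<And>x. x \<in> carrier W \<Longrightarrow> \<pi> x \<in> peak_pairs W"
    "\<And>x y. x \<in> carrier W \<Longrightarrow> y \<in> carrier W \<Longrightarrow> \<pi> (x \<oplus>\<^bsub>W\<^esub> y) = \<pi> x \<oplus>\<^bsub>W\<^esub> \<pi> y"
    "\<And>z x. x \<in> carrier W \<Longrightarrow> \<pi> (zs W z x) = zs W z (\<pi> x)" "\<And>x. x \<in> peak_pairs W \<Longrightarrow> \<pi> x = x"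
    by (rule peak_projection[OF W b]) (rule that)
  have pc: "\<pi> x \<in> carrier W" if "x \<in> carrier W" for x using p(1)[OF that] N(1) by blast
  \<comment> \<open>Division by X makes sense on the images of pairs only; the projection turns it
    into a functional on all of \<open>W\<close>.\<close>
  define l where "l = (\<lambda>x. fps_shift 1 (h (\<pi> x) i))"
  have Xl: "X * l x = h (\<pi> x) i" if "x \<in> carrier W" for x
    using X_h[OF p(1)[OF that]] fps_X_power_shift[of 1 "h (\<pi> x) i"] by (simp add: l_def)
  have l: "zlin W l"
    unfolding zlin_def
  proof (intro conjI ballI allI)
    fix x y assume xy: "x \<in> carrier W" "y \<in> carrier W"
    have "X * l (x \<oplus>\<^bsub>W\<^esub> y) = X * (l x + l y)"
      using xy pc hom_to_L_apply(1)[OF kJ W h pc[OF xy(1)] pc[OF xy(2)]] by (simp add: Xl p(2) distrib_left)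
    then show "l (x \<oplus>\<^bsub>W\<^esub> y) = l x + l y" by simp
  next
    fix z x assume x: "x \<in> carrier W"
    have "X * l (zs W z x) = X * (z * l x)"
      using x hom_to_L_apply(2)[OF kJ W h pc[OF x]] by (simp add: Xl qin p(3) mult.left_commute[of X])
    then show "l (zs W z x) = z * l x" by simp
  qed
  define a where "a = (\<lambda>w c. if c \<in> V then X ^ p1 c * l (qa W c i w) else 0)"
  define a' where "a' = (\<lambda>w c. if c \<in> V then X ^ p2 c * l (qa W c v w) else 0)"
  have ah: "a \<in> mod_hom B W (L S)" unfolding a_def by (rule functional_hom[OF kS W l iV val1])
  have a'h: "a' \<in> mod_hom B W (L S)" unfolding a'_def by (rule functional_hom[OF kS W l vV val2])
  \<comment> \<open>It suffices to compare after the path from \<open>c\<close> to \<open>i\<close>.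
    Evaluating \<open>l\<close> on the pair built from the image of \<open>w\<close> at
    \<open>i\<close>, which the projection fixes, gives \<open>star\<close>; the exponents match by
    \<open>n1\<close>, \<open>n2\<close> and \<open>n3\<close>.\<close>
  have key: "a w c + a' w c = X ^ pJ c * h w c" if w: "w \<in> carrier W" and c: "c \<in> V" for w c
  proof -
    let ?y = "qa W c i w"
    have y: "?y \<in> carrier W" using w c by (simp add: qin)
    have eqs: "qa W i i ?y = ?y" "qa W i v ?y = zs W (X ^ tri c i v) (qa W c v w)"
      using w c by (simp_all add: qa_qa[OF W] zs_one[OF W qa_in[OF W]])
    let ?x = "zs W X (qa W i i ?y) \<oplus>\<^bsub>W\<^esub> qa W i v ?y"
    have x: "?x \<in> peak_pairs W" by (rule peak_pairs_of(1)[OF W y])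
    have xc: "?x \<in> carrier W" using x N(1) by blast
    have "X * l ?x = h ?x i" using Xl[OF xc] p(4)[OF x] by simp
    moreover have "l ?x = X * l ?y + X ^ tri c i v * l (qa W c v w)"
      using l w c y eqs by (simp add: zlin_def qin)
    moreover have "h ?x i = X * (X ^ wt J c i * h w c)"
    proof -
      have "h ?x i = h (zs W X ?y) i + h (qa W i v ?y) i"
        unfolding eqs(1) using y by (intro hom_to_L_apply(1)[OF kJ W h]) (auto simp: qin)
      then show ?thesis
        using hom_to_L_apply(2)[OF kJ W h y] hom_to_L_apply(3)[OF kJ W h y iV vV, of i]
          hom_to_L_apply(3)[OF kJ W h w c iV, of i] iv_neq by simp
    qed
    ultimately have "X * (X * l ?y + X ^ tri c i v * l (qa W c v w)) = X * (X ^ wt J c i * h w c)" by simp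
    then have star: "X * l ?y + X ^ tri c i v * l (qa W c v w) = X ^ wt J c i * h w c" by simp
    have n1: "wt S c i + p1 c = Suc (pJ i)" using val1[OF c] at_i by simp
    have n2: "wt S c i + p2 c = pJ i + tri c i v"
      using val2[OF c] val2[OF iV] wt_tri[OF kS c iV vV] at_i by linarith
    have n3: "wt S c i + pJ c = pJ i + wt J c i" using wt_profile[OF profJ c iV] by simp
    have "X ^ wt S c i * (a w c + a' w c) = X ^ (wt S c i + p1 c) * l ?y + X ^ (wt S c i + p2 c) * l (qa W c v w)"
      using c by (simp add: a_def a'_def power_add algebra_simps)
    also have "\<dots> = X ^ pJ i * (X * l ?y + X ^ tri c i v * l (qa W c v w))"
      unfolding n1 n2 by (simp add: power_add algebra_simps)
    also have "\<dots> = X ^ (wt S c i + pJ c) * h w c" unfolding star n3 by (simp add: power_add algebra_simps)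
    finally have "X ^ wt S c i * (a w c + a' w c) = X ^ wt S c i * (X ^ pJ c * h w c)" by (simp add: power_add algebra_simps)
    then show ?thesis by simp
  qed
  have u: "(\<lambda>w. interleave (a w) (a' w)) \<in> mod_hom B W E"
    by (rule hom_to_E[OF ah a'h]) (auto simp: key, auto simp: a_def a'_def)
  have "gE (interleave (a w) (a' w)) = h w" if w: "w \<in> carrier W" for w
  proof
    fix c
    show "gE (interleave (a w) (a' w)) c = h w c"
    proof (cases "c \<in> V")
      case True
      have "X ^ pJ c * gE (interleave (a w) (a' w)) c = X ^ pJ c * h w c"
        using gE_eq[OF hom_in[OF u w], of c] key[OF w True] by simp
      then show ?thesis by simp
    next
      case False
      then show ?thesis
        using hom_to_L_apply(4)[OF kJ W h w] hom_to_L_apply(4)[OF kJ E_module gE_hom hom_in[OF u w]] by simp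
    qed
  qed
  then show ?thesis by (intro bexI[OF _ u] ballI)
qed

text \<open>Consider the vectors of the middle term with the only entry \<open>X ^ pJ i\<close>
  (odd, at \<open>i\<close>) or \<open>X ^ pJ v\<close> (even, at \<open>v\<close>). If an extension
  of \<open>h\<close> sends them to - w1 and w2 at those vertices, the relation between them and
  \<open>fE (single i 1)\<close> becomes the displayed equation. \<open>left_extend\<close> shows
  that solving it is also sufficient.\<close>

lemma left_generators:
  assumes CMW: "CM n k W" and h: "h \<in> mod_hom B (L I) W" and ns: "\<not> split_mono B (L I) h W"
  obtains w1 w2 where "w1 \<in> carrier W" "w2 \<in> carrier W"
    "zs W (X ^ (wt J v i - 1)) (h (single i 1)) = zs W (X ^ wt J v i) (qa W i i w1) \<oplus>\<^bsub>W\<^esub> qa W v i w2"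
proof -
  have W: "left_module B W" using CMW by (simp add: CM_def)
  interpret W: left_module B W by fact
  note qin = qa_in[OF W] zs_in[OF W]
  obtain S0 \<kappa> where b: "zbasis W S0 (\<lambda>s. s) \<kappa>" using CM_zbasis[OF CMW] by blast
  have t: "tfree W" by (rule zbasis_tfree[OF W b])
  note N = peak_pairs_facts[OF W t]
  obtain \<pi> where p: "\<And>x. x \<in> carrier W \<Longrightarrow> \<pi> x \<in> peak_pairs W"
    "\<And>x y. x \<in> carrier W \<Longrightarrow> y \<in> carrier W \<Longrightarrow> \<pi> (x \<oplus>\<^bsub>W\<^esub> y) = \<pi> x \<oplus>\<^bsub>W\<^esub> \<pi> y"
    "\<And>z x. x \<in> carrier W \<Longrightarrow> \<pi> (zs W z x) = zs W z (\<pi> x)" "\<And>x. x \<in> peak_pairs W \<Longrightarrow> \<pi> x = x"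
    by (rule peak_projection[OF W b]) (rule that)
  have pc: "\<pi> x \<in> carrier W" if "x \<in> carrier W" for x using p(1)[OF that] N(1) by blast
  let ?h = "h (single i 1)"
  have hc: "?h \<in> carrier W" using hom_in[OF h] by simp
  have hi: "qa W i i ?h = ?h" "qa W v i ?h = \<zero>\<^bsub>W\<^esub>" "qa W v v ?h = \<zero>\<^bsub>W\<^esub>"
    using iv_neq hom_zero[OF L_module[OF kI] W h] by (simp_all add: hom_qa[OF h, symmetric] L_qa_single[OF kI])
  let ?x = "?h \<ominus>\<^bsub>W\<^esub> \<pi> ?h"
  have xc: "?x \<in> carrier W" using hc pc by simp
  show ?thesis
  proof (cases "\<exists>y\<in>carrier W. ?x = zs W X y")
    case True
    then obtain y where y: "y \<in> carrier W" "?x = zs W X y" by blast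
    let ?n = "\<pi> ?h"
    have nP: "?n \<in> peak_pairs W" and nc: "?n \<in> carrier W" using p(1) pc hc by auto
    have hx: "?h = zs W X y \<oplus>\<^bsub>W\<^esub> ?n"
      using hc nc by (simp add: y(2)[symmetric] W.minus_eq W.a_assoc W.l_neg)
    have 1: "?h = zs W X (qa W i i y) \<oplus>\<^bsub>W\<^esub> qa W i i ?n"
      using arg_cong[OF hx, of "\<lambda>z. qa W i i z"] hi(1) y(1) nc by (simp add: qa_add[OF W] qin qa_zs[OF W])
    have 2: "\<zero>\<^bsub>W\<^esub> = zs W X (qa W v i y) \<oplus>\<^bsub>W\<^esub> zs W (X ^ wt J v i) (qa W i i ?n)"
      using arg_cong[OF hx, of "\<lambda>z. qa W v i z"] hi(2) y(1) nc peak_pairs_vi[OF W t nP]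
      by (simp add: qa_add[OF W] qin qa_zs[OF W])
    have Xw: "X ^ wt J v i = X * X ^ (wt J v i - 1)" using wt_vi(1)
      by (metis Suc_diff_1 less_eq_Suc_le One_nat_def power_Suc)
    let ?q = "qa W v i (\<ominus>\<^bsub>W\<^esub> y)"
    have q: "?q = \<ominus>\<^bsub>W\<^esub> qa W v i y" using y by (simp add: smult_minus_right[OF W])
    have 3: "zs W (X ^ wt J v i) (qa W i i ?n) = zs W X ?q"
    proof -
      have "\<ominus>\<^bsub>W\<^esub> zs W X (qa W v i y) = zs W (X ^ wt J v i) (qa W i i ?n)"
        using 2 y nc by (intro W.minus_equality) (auto simp: qin W.a_comm)
      then show ?thesis using y by (simp add: q smult_minus_right[OF W] qin)
    qed
    have "zs W X (zs W (X ^ (wt J v i - 1)) ?h) = zs W (X ^ wt J v i) ?h"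
      using hc by (simp add: zs_zs[OF W] Xw)
    also have "\<dots> = zs W (X ^ wt J v i) (zs W X (qa W i i y)) \<oplus>\<^bsub>W\<^esub> zs W (X ^ wt J v i) (qa W i i ?n)"
      by (subst 1) (use y nc in \<open>simp add: zs_add[OF W] qin\<close>)
    also have "\<dots> = zs W X (zs W (X ^ wt J v i) (qa W i i y) \<oplus>\<^bsub>W\<^esub> ?q)"
      unfolding 3 using y by (simp add: zs_add[OF W] qin zs_zs[OF W] mult.commute)
    finally have "zs W (X ^ (wt J v i - 1)) ?h = zs W (X ^ wt J v i) (qa W i i y) \<oplus>\<^bsub>W\<^esub> ?q"
      by (rule tfree_cancel[OF W t _ _ _, rotated 3]) (use hc y in \<open>auto simp: qin\<close>)
    then show ?thesis using that[of y "\<ominus>\<^bsub>W\<^esub> y"] y by simp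
  next
    case False
    then obtain s where s: "s \<in> S0" "\<kappa> s ?x $ 0 \<noteq> 0"
      using zbasis_dvd[OF W b xc, of X] by (auto simp: fps_X_dvd_iff)
    have ks: "zlin W (\<kappa> s)" using b s by (simp add: zbasis_def)
    \<comment> \<open>A coordinate that is a unit on \<open>?x\<close>, normalised: it vanishes on
      all pairs and is 1 on the image of the generator. Vanishing on the second kind of pairs in
      \<open>peak_pairs_of\<close> is what makes the induced map \<open>R\<close> satisfy the
      exponent \<open>p2\<close> at \<open>v\<close>, hence land in \<open>L I\<close>; it then
      splits \<open>h\<close>.\<close>
    define \<psi> where "\<psi> = (\<lambda>w. inverse (\<kappa> s ?x) * (\<kappa> s w - \<kappa> s (\<pi> w)))"
    have psi: "zlin W \<psi>"
      using ks pc p(2,3) by (auto simp: \<psi>_def zlin_def algebra_simps)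
    have psi0: "\<psi> x = 0" if "x \<in> peak_pairs W" for x using p(4)[OF that] by (simp add: \<psi>_def)
    have psi1: "\<psi> ?h = 1"
      using s(2) zlin_minus[OF W ks hc pc[OF hc]] by (simp add: \<psi>_def inverse_mult_eq_1)
    define R where "R = (\<lambda>w c. if c \<in> V then X ^ p1 c * \<psi> (qa W c i w) else 0)"
    have R: "R \<in> mod_hom B W (L S)" unfolding R_def by (rule functional_hom[OF kS W psi iV val1])
    have d2: "X ^ p2 c dvd R w c" if "w \<in> carrier W" "c \<in> V" for w c
    proof (rule valley_dvd[OF kS W R vV val2 _ that])
      fix w assume w: "w \<in> carrier W"
      have "\<psi> (qa W v i w \<oplus>\<^bsub>W\<^esub> zs W (X ^ wt J v i) (qa W v v w)) = 0"
        by (rule psi0[OF peak_pairs_of(2)[OF W w]])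
      then have "\<psi> (qa W v i w) = - (X ^ wt J v i * \<psi> (qa W v v w))"
        using psi w by (simp add: zlin_def qin add_eq_0_iff2)
      then have "R w v = X ^ (p1 v + wt J v i) * - \<psi> (qa W v v w)"
        by (simp add: R_def power_add)
      then show "X ^ p2 v dvd R w v" unfolding p1_v by simp
    qed
    have "X ^ pI c dvd R w c" if "w \<in> carrier W" "c \<in> V" for w c
      using d2[OF that] that(2) by (intro dvd_pI) (auto simp: R_def)
    then obtain r where r: "r \<in> mod_hom B W (L I)" "\<And>x c. x \<in> carrier W \<Longrightarrow> X ^ pI c * r x c = R x c"
      using profile_divide[OF kI kS profI W R] by metis
    have "X ^ pI i * r ?h i = X ^ pI i * 1"
      using r(2)[OF hc, of i] hi(1) psi1 pI_i at_i by (simp add: R_def)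
    then have "r ?h i = 1" by simp
    then have "r ?h = single i 1"
      using hom_qa[OF r(1) iV hc, of i] hi(1) by (simp add: L_qa_eq[OF kI])
    then have "r (h y) = y" if "y \<in> carrier (L I)" for y
      using hom_from_L_unique[OF kI L_module[OF kI] L_tfree[OF kI] hom_comp[OF h r(1)] hom_id iV _ that] by simp
    then have "split_mono B (L I) h W" using r(1) by (auto simp: split_mono_def)
    then show ?thesis using ns by simp
  qed
qed

text \<open>Up to a power of the variable, the even entry acts on w2 from \<open>v\<close> and the
  odd entry on - w1 from \<open>i\<close>. The equation between w1 and w2 makes this restrict to the
  right multiple of \<open>h\<close>, and the common power is divided out vertex by vertex.\<close>

lemma left_extend:
  assumes CMW: "CM n k W" and h: "h \<in> mod_hom B (L I) W" and ns: "\<not> split_mono B (L I) h W"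
  shows "\<exists>u\<in>mod_hom B E W. \<forall>x\<in>carrier (L I). u (fE x) = h x"
proof -
  have W: "left_module B W" using CMW by (simp add: CM_def)
  interpret W: left_module B W by fact
  note qin = qa_in[OF W] zs_in[OF W]
  obtain S0 \<kappa> where b: "zbasis W S0 (\<lambda>s. s) \<kappa>" using CM_zbasis[OF CMW] by blast
  have t: "tfree W" by (rule zbasis_tfree[OF W b])
  obtain w1 w2 where w: "w1 \<in> carrier W" "w2 \<in> carrier W"
    and eq: "zs W (X ^ (wt J v i - 1)) (h (single i 1)) = zs W (X ^ wt J v i) (qa W i i w1) \<oplus>\<^bsub>W\<^esub> qa W v i w2"
    using left_generators[OF CMW h ns] by blast
  define N where "N = (\<Sum>u\<in>V. wt S i u + wt S v u)"
  have N: "wt S i u + wt S v u \<le> N" if "u \<in> V" for u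
    unfolding N_def using that by (intro member_le_sum) auto
  obtain h1 where h1: "h1 \<in> mod_hom B (L S) W"
    "\<And>c z. c \<in> V \<Longrightarrow> h1 (single c z) = zs W (z * X ^ (N - wt S i c)) (qa W i c w1)"
    using hom_from_L_exists[OF kS W iV w(1), of N] N by (metis add_leD1)
  obtain h2 where h2: "h2 \<in> mod_hom B (L S) W"
    "\<And>c z. c \<in> V \<Longrightarrow> h2 (single c z) = zs W (z * X ^ (N - wt S v c)) (qa W v c w2)"
    using hom_from_L_exists[OF kS W vV w(2), of N] N by (metis add_leD2)
  \<comment> \<open>\<open>N\<close> clears the weights of the paths from \<open>i\<close> and
    \<open>v\<close>; \<open>pJ i\<close> and \<open>pJ v\<close> are the exponents of the two
    generators, which \<open>U\<close> multiplies crosswise to give both the same total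
    power.\<close>
  define K where "K = N + pJ i + pJ v"
  define U where "U = (\<lambda>x. zs W (X ^ pJ i) (h2 (even_part x)) \<oplus>\<^bsub>W\<^esub> zs W (- (X ^ pJ v)) (h1 (odd_part x)))"
  have U: "U \<in> mod_hom B E W"
    unfolding U_def by (intro hom_plus[OF W] hom_zs_comp[OF W] hom_comp[OF E_even h2(1)] hom_comp[OF E_odd h1(1)])
  have s0: "(\<lambda>_. 0) = single c 0" for c by (auto simp: single_def)
  have Up: "U (interleave (single c a) (single c a')) =
      zs W (X ^ pJ i * (a * X ^ (N - wt S v c))) (qa W v c w2) \<oplus>\<^bsub>W\<^esub>
      zs W (- (X ^ pJ v) * (a' * X ^ (N - wt S i c))) (qa W i c w1)" if "c \<in> V" for c a a'
    using that w by (simp add: U_def h1(2) h2(2) zs_zs[OF W] qin)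
  have UfE: "U (fE x) = zs W (X ^ K) (h x)" if x: "x \<in> carrier (L I)" for x
  proof (rule hom_from_L_unique[OF kI W t hom_comp[OF fE_hom U] hom_zs_comp[OF W h] iV _ x])
    let ?m = "Suc (pJ i) + pJ i + (N - wt S v i)"
    have m1: "?m + (wt J v i - 1) = K" and m2: "?m + wt J v i = pJ v + (Suc (pJ i) + N)"
      using wt_vi N[OF iV] unfolding K_def by linarith+
    have "U (fE (single i 1)) = zs W (X ^ ?m) (qa W v i w2) \<oplus>\<^bsub>W\<^esub> zs W (X ^ (?m + wt J v i)) (qa W i i w1)"
      unfolding fE_single Up[OF iV] m2 by (simp add: pI_i power_add algebra_simps)
    also have "\<dots> = zs W (X ^ ?m) (zs W (X ^ wt J v i) (qa W i i w1) \<oplus>\<^bsub>W\<^esub> qa W v i w2)"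
      using w by (simp add: zs_add[OF W] qin zs_zs[OF W] power_add mult.assoc W.a_comm)
    also have "\<dots> = zs W (X ^ (?m + (wt J v i - 1))) (h (single i 1))"
      unfolding eq[symmetric] using hom_in[OF h] by (simp add: zs_zs[OF W] power_add mult.assoc)
    finally show "U (fE (single i 1)) = zs W (X ^ K) (h (single i 1))" unfolding m1 .
  qed
  have div: "\<exists>y\<in>carrier W. U x = zs W (X ^ K) y" if x: "x \<in> carrier E" for x
  proof (rule mod_divisibleI[OF W hom_in[OF U x]])
    fix c assume c: "c \<in> V"
    let ?a = "even_part x c" and ?b = "odd_part x c"
    have e: "qa W c c (U x) = U (interleave (single c ?a) (single c ?b))"
      using c x by (simp add: hom_qa[OF U, symmetric] E_qa_parts)
    obtain s where s: "?a + ?b = X ^ pJ c * s" using E_D(5)[OF x c] by (auto simp: dvd_def)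
    have fc: "fE (single c y) \<in> carrier E" for y using hom_in[OF fE_hom] c by simp
    have split: "U (x1 \<oplus>\<^bsub>E\<^esub> fE (single c y)) = zs W (X ^ K) (y' \<oplus>\<^bsub>W\<^esub> h (single c y))"
      if "x1 \<in> carrier E" "U x1 = zs W (X ^ K) y'" "y' \<in> carrier W" for x1 y y'
      using that fc c hom_in[OF h] by (simp add: hom_add[OF U] UfE zs_add[OF W])
    show "\<exists>y\<in>carrier W. qa W c c (U x) = zs W (X ^ K) y"
    \<comment> \<open>At \<open>c\<close> an element of the middle term is a lift of its sum into
      one entry plus something from \<open>fE\<close>. The entry is chosen according to the peak
      from which \<open>c\<close> is reached with weight zero.\<close>
    proof (cases "wt J v c = 0")
      case True
      then have pc: "pJ c = wt S v c + pJ v" using wt_profile[OF profJ vV c] by simp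
      then have le: "p1 c \<le> pJ c" using lip1[OF vV c] at_v by simp
      obtain b' where b': "?b = X ^ pI c * b'" using E_dvd_pI(1)[OF x c le] by (auto simp: dvd_def)
      let ?x1 = "interleave (single c (X ^ pJ c * s)) (single c 0)"
      have x1: "?x1 \<in> carrier E" using c le by (intro E_pairI) (auto intro: dvd_mult2 le_imp_power_dvd)
      have x1e: "interleave (single c ?a) (single c ?b) = ?x1 \<oplus>\<^bsub>E\<^esub> fE (single c (- b'))"
        unfolding E_ops fE_single using s b'
        by - (rule interleave_eqI, auto simp: single_def fun_eq_iff algebra_simps eq_diff_eq)
      have "pJ i + (pJ c + (N - wt S v c)) = K" using pc N[OF c] unfolding K_def by simp
      then have p: "X ^ pJ i * (X ^ pJ c * s * X ^ (N - wt S v c)) = X ^ K * s"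
        by (simp add: power_add[symmetric] mult.assoc mult.left_commute[of s] mult.commute[of s])
      have "U ?x1 = zs W (X ^ K) (zs W s (qa W v c w2))"
        unfolding Up[OF c] p using w c by (simp add: zs_zs[OF W] qin zs_zero_left[OF W])
      then have "qa W c c (U x) = zs W (X ^ K) (zs W s (qa W v c w2) \<oplus>\<^bsub>W\<^esub> h (single c (- b')))"
        unfolding e x1e using w c x1 by (intro split) (auto simp: qin)
      then show ?thesis using w c hom_in[OF h]
        by (intro bexI[of _ "zs W s (qa W v c w2) \<oplus>\<^bsub>W\<^esub> h (single c (- b'))"]) (auto simp: qin)
    next
      case False
      then have "wt J i c = 0" using peaks[OF c] by simp
      then have pc: "pJ c = wt S i c + pJ i" using wt_profile[OF profJ iV c] by simp
      then have le: "p2 c \<le> pJ c" using lip2[OF iV c] at_i by simp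
      obtain a' where a': "?a = X ^ pI c * a'" using E_dvd_pI(2)[OF x c le] by (auto simp: dvd_def)
      let ?x1 = "interleave (single c 0) (single c (X ^ pJ c * s))"
      have x1: "?x1 \<in> carrier E" using c le by (intro E_pairI) (auto intro: dvd_mult2 le_imp_power_dvd)
      have x1e: "interleave (single c ?a) (single c ?b) = ?x1 \<oplus>\<^bsub>E\<^esub> fE (single c a')"
        unfolding E_ops fE_single using s a'
        by - (rule interleave_eqI, auto simp: single_def fun_eq_iff algebra_simps eq_diff_eq)
      have "pJ v + (pJ c + (N - wt S i c)) = K" using pc N[OF c] unfolding K_def by simp
      then have p: "- (X ^ pJ v) * (X ^ pJ c * s * X ^ (N - wt S i c)) = X ^ K * - s"
        by (simp add: power_add[symmetric] mult.assoc mult.left_commute[of s] mult.commute[of s])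
      have "U ?x1 = zs W (X ^ K) (zs W (- s) (qa W i c w1))"
        unfolding Up[OF c] p using w c by (simp add: zs_zs[OF W] qin zs_zero_left[OF W])
      then have "qa W c c (U x) = zs W (X ^ K) (zs W (- s) (qa W i c w1) \<oplus>\<^bsub>W\<^esub> h (single c a'))"
        unfolding e x1e using w c x1 by (intro split) (auto simp: qin)
      then show ?thesis using w c hom_in[OF h]
        by (intro bexI[of _ "zs W (- s) (qa W i c w1) \<oplus>\<^bsub>W\<^esub> h (single c a')"]) (auto simp: qin)
    qed
  qed
  obtain u where u: "u \<in> mod_hom B E W" "\<And>x. x \<in> carrier E \<Longrightarrow> U x = zs W (X ^ K) (u x)"
    using hom_divide_scalar[OF E_module W t U, of "X ^ K"] div by auto
  have "u (fE x) = h x" if x: "x \<in> carrier (L I)" for x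
  proof -
    have "zs W (X ^ K) (u (fE x)) = zs W (X ^ K) (h x)" using u(2)[OF hom_in[OF fE_hom x]] UfE[OF x] by simp
    then show ?thesis
      by (rule tfree_cancel[OF W t _ _ _, rotated 3]) (use x hom_in[OF u(1)] hom_in[OF fE_hom] hom_in[OF h] in auto)
  qed
  then show ?thesis by (intro bexI[OF _ u(1)] ballI)
qed

lemma E_AR: "AR_sequence B (CM n k) (L I) fE E gE (L J)"
  unfolding AR_sequence_def left_almost_split_def right_almost_split_def
  using L_CM[OF kI] L_CM[OF kJ] E_CM E_exact not_split_mono not_split_epi left_extend right_lift by blast

end


section \<open>Rigidity\<close>

context kn
begin

lemma hom_through_epi:
  assumes ex: "short_exact B K f F g M" and N: "left_module B N" and P: "P \<in> mod_hom B F N"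
    and z: "\<And>x. x \<in> carrier K \<Longrightarrow> P (f x) = \<zero>\<^bsub>N\<^esub>"
  shows "\<exists>h. h \<in> mod_hom B M N \<and> (\<forall>y\<in>carrier F. P y = h (g y))"
proof -
  have F: "left_module B F" and M: "left_module B M" and g: "g \<in> mod_hom B F M"
    and im: "f ` carrier K = a_kernel F M g" and surj: "g ` carrier F = carrier M"
    using ex by (auto simp: short_exact_def)
  interpret F: left_module B F by fact
  interpret M: left_module B M by fact
  interpret N: left_module B N by fact
  have wd: "P y = P y'" if "y \<in> carrier F" "y' \<in> carrier F" "g y = g y'" for y y'
  proof -
    have "g (y \<ominus>\<^bsub>F\<^esub> y') = \<zero>\<^bsub>M\<^esub>"
      using that hom_in[OF g] by (simp add: hom_minus[OF F M g] M.minus_eq M.r_neg)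
    then have "y \<ominus>\<^bsub>F\<^esub> y' \<in> f ` carrier K" unfolding im a_kernel_def' using that by simp
    then have "P (y \<ominus>\<^bsub>F\<^esub> y') = \<zero>\<^bsub>N\<^esub>" using z by auto
    then have "P y \<ominus>\<^bsub>N\<^esub> P y' = \<zero>\<^bsub>N\<^esub>" using that by (simp add: hom_minus[OF F N P])
    then show ?thesis using that hom_in[OF P] N.minus_eq_zeroD by simp
  qed
  define pre where "pre = inv_into (carrier F) g"
  have pre: "pre x \<in> carrier F \<and> g (pre x) = x" if "x \<in> carrier M" for x
    using that surj by (simp add: pre_def inv_into_into f_inv_into_f)
  have eq: "P y = P (pre (g y))" if "y \<in> carrier F" for y
    using that pre[OF hom_in[OF g that]] by (intro wd) auto
  have "(\<lambda>x. P (pre x)) \<in> mod_hom B M N"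
    unfolding mod_hom_def
  proof (intro CollectI conjI ballI Pi_I)
    show "P (pre x) \<in> carrier N" if "x \<in> carrier M" for x using pre[OF that] hom_in[OF P] by simp
    fix x y assume xy: "x \<in> carrier M" "y \<in> carrier M"
    have "P (pre (x \<oplus>\<^bsub>M\<^esub> y)) = P (pre x \<oplus>\<^bsub>F\<^esub> pre y)"
      using xy pre[OF xy(1)] pre[OF xy(2)] pre[OF M.a_closed[OF xy]] by (intro wd) (auto simp: hom_add[OF g])
    then show "P (pre (x \<oplus>\<^bsub>M\<^esub> y)) = P (pre x) \<oplus>\<^bsub>N\<^esub> P (pre y)"
      using pre[OF xy(1)] pre[OF xy(2)] by (simp add: hom_add[OF P])
  next
    fix b x assume b: "b \<in> carrier B" and x: "x \<in> carrier M"
    have "P (pre (b \<odot>\<^bsub>M\<^esub> x)) = P (b \<odot>\<^bsub>F\<^esub> pre x)"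
      using b x pre[OF x] pre[OF M.smult_closed[OF b x]]
      by (intro wd) (auto simp: hom_smult[OF g] F.smult_closed)
    then show "P (pre (b \<odot>\<^bsub>M\<^esub> x)) = b \<odot>\<^bsub>N\<^esub> P (pre x)"
      using b pre[OF x] by (simp add: hom_smult[OF P])
  qed
  then show ?thesis using eq by (intro exI conjI ballI)
qed

text \<open>A retraction r' of f' gives a section s of g', because 1 - f' r' factors through g'.
  With a retraction r of f, the map f' r + s g is an equivalence of the two extensions. So all
  extensions form one class, and the direct sum shows that the class exists.\<close>

lemma rigid_of_retractions:
  fixes M :: "(int \<Rightarrow> complex fps) B_module"
  assumes M: "left_module B M"
    and ret: "\<And>F f g. short_exact B M f F g M \<Longrightarrow> \<exists>r\<in>mod_hom B F M. \<forall>x\<in>carrier M. r (f x) = x"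
  shows "rigid B M"
proof -
  interpret M: left_module B M by fact
  have rel: "((F, f, g), (F', f', g')) \<in> ext_equiv B M M"
    if e: "(F, f, g) \<in> extensions B M M" and e': "(F', f', g') \<in> extensions B M M" for F f g F' f' g'
  proof -
    have ex: "short_exact B M f F g M" and ex': "short_exact B M f' F' g' M"
      using e e' by (simp_all add: extensions_def)
    have F: "left_module B F" and g: "g \<in> mod_hom B F M" and f: "f \<in> mod_hom B M F"
      using ex by (auto simp: short_exact_def)
    have F': "left_module B F'" and g': "g' \<in> mod_hom B F' M" and f': "f' \<in> mod_hom B M F'"
      and surj': "g' ` carrier F' = carrier M" using ex' by (auto simp: short_exact_def)
    have gf: "g (f x) = \<zero>\<^bsub>M\<^esub>" "g' (f' x) = \<zero>\<^bsub>M\<^esub>" if "x \<in> carrier M" for x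
      using ex ex' that by (auto simp: short_exact_def a_kernel_def' set_eq_iff image_iff)
    interpret F: left_module B F by fact
    interpret F': left_module B F' by fact
    obtain r where r: "r \<in> mod_hom B F M" "\<And>x. x \<in> carrier M \<Longrightarrow> r (f x) = x" using ret[OF ex] by blast
    obtain r' where r': "r' \<in> mod_hom B F' M" "\<And>x. x \<in> carrier M \<Longrightarrow> r' (f' x) = x" using ret[OF ex'] by blast
    let ?T = "\<lambda>y. y \<oplus>\<^bsub>F'\<^esub> zs F' (- 1) (f' (r' y))"
    have T: "?T \<in> mod_hom B F' F'"
      by (intro hom_plus[OF F'] hom_id hom_zs_comp[OF F'] hom_comp[OF r'(1) f'])
    have "?T (f' x) = \<zero>\<^bsub>F'\<^esub>" if "x \<in> carrier M" for x
      using that hom_in[OF f'] zs_minus[OF F', of "f' x" 1] zs_one[OF F'] by (simp add: r'(2) F'.r_neg)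
    then have "\<exists>h. h \<in> mod_hom B M F' \<and> (\<forall>y\<in>carrier F'. ?T y = h (g' y))"
      by (rule hom_through_epi[OF ex' F' T])
    then obtain s where s: "s \<in> mod_hom B M F'" "\<And>y. y \<in> carrier F' \<Longrightarrow> ?T y = s (g' y)"
      by blast
    have gs: "g' (s x) = x" if xM: "x \<in> carrier M" for x
    proof -
      obtain y where y: "y \<in> carrier F'" "g' y = x" using xM unfolding surj'[symmetric] by blast
      have "g' (?T y) = g' y \<oplus>\<^bsub>M\<^esub> zs M (- 1) \<zero>\<^bsub>M\<^esub>"
        using y hom_in[OF f'] hom_in[OF r'(1)] by (simp add: hom_add[OF g'] zs_in[OF F'] hom_zs[OF g'] gf)
      then show ?thesis using s(2)[OF y(1)] y xM by (simp add: zs_zero_right[OF M])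
    qed
    let ?u = "\<lambda>y. f' (r y) \<oplus>\<^bsub>F'\<^esub> s (g y)"
    have u: "?u \<in> mod_hom B F F'"
      by (intro hom_plus[OF F'] hom_comp[OF r(1) f'] hom_comp[OF g s(1)])
    have "?u (f x) = f' x" if "x \<in> carrier M" for x
      using that hom_in[OF f'] by (simp add: r(2) gf hom_zero[OF M F' s(1)])
    moreover have "g' (?u y) = g y" if "y \<in> carrier F" for y
      using that hom_in[OF f'] hom_in[OF r(1)] hom_in[OF s(1)] hom_in[OF g]
      by (simp add: hom_add[OF g'] gf gs)
    ultimately have "\<exists>u\<in>mod_hom B F F'. (\<forall>x\<in>carrier M. u (f x) = f' x) \<and> (\<forall>y\<in>carrier F. g' (u y) = g y)"
      by (intro bexI[OF _ u] conjI ballI)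
    then show ?thesis using e e' by (simp add: ext_equiv_def)
  qed
  have "short_exact B M (\<lambda>x. interleave x \<zero>\<^bsub>M\<^esub>) (direct_sum M M) odd_part M"
    unfolding short_exact_def
  proof (intro conjI M direct_sum_module)
    show "(\<lambda>x. interleave x \<zero>\<^bsub>M\<^esub>) \<in> mod_hom B M (direct_sum M M)"
      by (auto simp: mod_hom_def direct_sum_simps smult_zero_right[OF M])
    show "odd_part \<in> mod_hom B (direct_sum M M) M" by (auto simp: mod_hom_def direct_sum_simps)
    show "inj_on (\<lambda>x. interleave x \<zero>\<^bsub>M\<^esub>) (carrier M)"
      by (rule inj_onI) (metis interleave_simps(1))
    show "(\<lambda>x. interleave x \<zero>\<^bsub>M\<^esub>) ` carrier M = a_kernel (direct_sum M M) M odd_part"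
      unfolding a_kernel_def'
    proof (intro equalityI subsetI)
      fix x assume x: "x \<in> {x \<in> carrier (direct_sum M M). odd_part x = \<zero>\<^bsub>M\<^esub>}"
      then have "x = interleave (even_part x) \<zero>\<^bsub>M\<^esub>" by - (rule interleave_eqI, auto)
      then show "x \<in> (\<lambda>x. interleave x \<zero>\<^bsub>M\<^esub>) ` carrier M" using x by (auto simp: direct_sum_simps)
    qed (auto simp: direct_sum_simps)
    show "odd_part ` carrier (direct_sum M M) = carrier M"
    proof (intro equalityI subsetI)
      fix x assume x: "x \<in> carrier M"
      then have "interleave \<zero>\<^bsub>M\<^esub> x \<in> carrier (direct_sum M M)" by (simp add: direct_sum_simps)
      then have "odd_part (interleave \<zero>\<^bsub>M\<^esub> x) \<in> odd_part ` carrier (direct_sum M M)" by (rule imageI)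
      then show "x \<in> odd_part ` carrier (direct_sum M M)" by simp
    qed (auto simp: direct_sum_simps)
  qed
  then have ne: "extensions B M M \<noteq> {}" by (auto simp: extensions_def)
  have "Ext1 B M M = {extensions B M M}"
  proof -
    have "ext_equiv B M M `` {e} = extensions B M M" if "e \<in> extensions B M M" for e
    proof (intro equalityI subsetI)
      fix e' assume "e' \<in> ext_equiv B M M `` {e}"
      then show "e' \<in> extensions B M M" by (auto simp: ext_equiv_def)
    next
      fix e' assume "e' \<in> extensions B M M"
      then show "e' \<in> ext_equiv B M M `` {e}" using rel that by (cases e; cases e') auto
    qed
    then show ?thesis using ne unfolding Ext1_def quotient_def by auto
  qed
  then show ?thesis by (simp add: rigid_def)
qed

end

context ar_data
begin

section \<open>Matrices of homomorphisms and the retraction of a self-extension\<close>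

definition big :: nat where "big = (\<Sum>c\<in>V. p1 c + p2 c + pJ c)"

lemma big_ge: "c \<in> V \<Longrightarrow> p1 c \<le> big" "c \<in> V \<Longrightarrow> p2 c \<le> big" "c \<in> V \<Longrightarrow> pJ c \<le> big"
proof -
  assume c: "c \<in> V"
  have "p1 c + p2 c + pJ c \<le> big" unfolding big_def using c by (intro member_le_sum) auto
  then show "p1 c \<le> big" "p2 c \<le> big" "pJ c \<le> big" by simp_all
qed

text \<open>Rationally, a map from the middle term to a rank one module is a linear form in the two
  coordinates.\<close>

lemma hom_E_matrix:
  assumes f: "f \<in> mod_hom B E (L S)"
  obtains r s where "\<And>x c. x \<in> carrier E \<Longrightarrow> c \<in> V \<Longrightarrow> X ^ big * f x c = r * even_part x c + s * odd_part x c"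
proof -
  let ?e1 = "\<lambda>c. interleave (single c (X ^ big)) (single c 0)"
  let ?e2 = "\<lambda>c. interleave (single c 0) (single c (X ^ big))"
  have e: "?e1 c \<in> carrier E" "?e2 c \<in> carrier E" if "c \<in> V" for c
    using big_ge[OF that] by (auto intro!: E_pairI[OF that] simp: le_imp_power_dvd)
  have q: "qa E c d (?e1 c) = zs E (X ^ wt S c d) (?e1 d)" "qa E c d (?e2 c) = zs E (X ^ wt S c d) (?e2 d)"
    if "c \<in> V" "d \<in> V" for c d
    unfolding E_ops interleave_simps using that by (simp_all add: L_qa_single[OF kS] L_zs_single[OF kS])
  \<comment> \<open>The paths to \<open>i\<close> identify the unit vectors at all vertices up to
    powers of the variable, which cancel; so one pair of coefficients serves all vertices.\<close>
  have const: "f (?e1 c) c = f (?e1 i) i" "f (?e2 c) c = f (?e2 i) i" if c: "c \<in> V" for c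
  proof -
    have "X ^ wt S c i * f (?e1 c) c = X ^ wt S c i * f (?e1 i) i"
      using hom_to_L_apply(3)[OF kS E_module f e(1)[OF c] c iV, of i]
        hom_to_L_apply(2)[OF kS E_module f e(1)[OF iV]] q(1)[OF c iV] by simp
    then show "f (?e1 c) c = f (?e1 i) i" by simp
    have "X ^ wt S c i * f (?e2 c) c = X ^ wt S c i * f (?e2 i) i"
      using hom_to_L_apply(3)[OF kS E_module f e(2)[OF c] c iV, of i]
        hom_to_L_apply(2)[OF kS E_module f e(2)[OF iV]] q(2)[OF c iV] by simp
    then show "f (?e2 c) c = f (?e2 i) i" by simp
  qed
  have "X ^ big * f x c = f (?e1 i) i * even_part x c + f (?e2 i) i * odd_part x c"
    if x: "x \<in> carrier E" and c: "c \<in> V" for x c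
  proof -
    have "zs E (X ^ big) (qa E c c x) = zs E (even_part x c) (?e1 c) \<oplus>\<^bsub>E\<^esub> zs E (odd_part x c) (?e2 c)"
      unfolding E_ops interleave_simps using c
      by (simp add: L_zs_single[OF kS] L_qa_eq[OF kS]) (simp add: single_def mult.commute cong: if_cong)
    then have "f (zs E (X ^ big) (qa E c c x)) c = even_part x c * f (?e1 c) c + odd_part x c * f (?e2 c) c"
      using e[OF c] by (simp add: hom_to_L_apply(1,2)[OF kS E_module f] zs_in[OF E_module])
    moreover have "f (zs E (X ^ big) (qa E c c x)) c = X ^ big * f x c"
      using x c by (simp add: hom_to_L_apply(2,3)[OF kS E_module f] qa_in[OF E_module])
    ultimately show ?thesis using const[OF c] by (simp add: mult.commute)
  qed
  then show ?thesis using that by blast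
qed

text \<open>The quotient is free over the power series ring, so the sequence has a linear retraction
  \<open>r\<close>, which need not commute with paths. Composing the functional at the valley
  \<open>w\<close> with \<open>r\<close> and applying \<open>functional_hom\<close> restores
  B-linearity.\<close>

lemma extend_to_injective:
  assumes ex: "short_exact B E \<iota> F p E" and a: "a \<in> mod_hom B E (L S)" and w: "w \<in> V"
    and pr: "\<And>c. c \<in> V \<Longrightarrow> p' c + wt S c w = p' w"
    and d: "\<And>x. x \<in> carrier E \<Longrightarrow> X ^ p' w dvd a x w"
  obtains a' where "a' \<in> mod_hom B F (L S)" "\<And>x. x \<in> carrier E \<Longrightarrow> a' (\<iota> x) = a x"
    "\<And>y c. y \<in> carrier F \<Longrightarrow> c \<in> V \<Longrightarrow> X ^ p' c dvd a' y c"
proof -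
  have F: "left_module B F" and p: "p \<in> mod_hom B F E" and i: "\<iota> \<in> mod_hom B E F"
    and inj: "inj_on \<iota> (carrier E)" and im: "\<iota> ` carrier E = a_kernel F E p" and surj: "p ` carrier F = carrier E"
    using ex by (auto simp: short_exact_def)
  interpret F: left_module B F by fact
  define pre where "pre = inv_into (carrier F) p"
  have pre: "pre x \<in> carrier F \<and> p (pre x) = x" if "x \<in> carrier E" for x
    using that surj by (simp add: pre_def inv_into_into f_inv_into_f)
  have Eb: "Ebasis j \<in> carrier E" if "j \<in> V \<times> UNIV" for j using that Ebasis_in by (cases j) auto
  obtain l where l: "\<And>x. x \<in> carrier E \<Longrightarrow> l x \<in> carrier F" "\<And>x. x \<in> carrier E \<Longrightarrow> p (l x) = x"
    "\<And>x x'. x \<in> carrier E \<Longrightarrow> x' \<in> carrier E \<Longrightarrow> l (x \<oplus>\<^bsub>E\<^esub> x') = l x \<oplus>\<^bsub>F\<^esub> l x'"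
    "\<And>x z. x \<in> carrier E \<Longrightarrow> l (zs E z x) = zs F z (l x)"
  proof (rule zbasis_lift[OF E_module E_zbasis F _ p])
    show "pre (Ebasis j) \<in> carrier F" "p (pre (Ebasis j)) = Ebasis j" if "j \<in> V \<times> UNIV" for j
      using pre[OF Eb[OF that]] by simp_all
  qed (rule that)
  have pi: "p (\<iota> x) = \<zero>\<^bsub>E\<^esub>" if "x \<in> carrier E" for x
    using im that by (auto simp: a_kernel_def' set_eq_iff image_iff)
  have l0: "l \<zero>\<^bsub>E\<^esub> = \<zero>\<^bsub>F\<^esub>"
    using l(4)[of "\<zero>\<^bsub>E\<^esub>" 0] zs_zero_right[OF E_module] zs_zero_left[OF F l(1)] by simp
  have "\<exists>x\<in>carrier E. \<iota> x = y \<ominus>\<^bsub>F\<^esub> l (p y)" if y: "y \<in> carrier F" for y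
  proof -
    have py: "p y \<in> carrier E" by (rule hom_in[OF p y])
    then have "p (y \<ominus>\<^bsub>F\<^esub> l (p y)) = \<zero>\<^bsub>E\<^esub>"
      using y l by (simp add: hom_minus[OF F E_module p] E.minus_eq E.r_neg)
    then have "y \<ominus>\<^bsub>F\<^esub> l (p y) \<in> \<iota> ` carrier E" unfolding im a_kernel_def' using y l(1)[OF py] by simp
    then show ?thesis by auto
  qed
  then obtain r where r: "\<And>y. y \<in> carrier F \<Longrightarrow> r y \<in> carrier E" "\<And>y. y \<in> carrier F \<Longrightarrow> \<iota> (r y) = y \<ominus>\<^bsub>F\<^esub> l (p y)"
    by metis
  have injD: "x = x'" if "x \<in> carrier E" "x' \<in> carrier E" "\<iota> x = \<iota> x'" for x x'
    using inj that by (auto simp: inj_on_def)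
  have r_add: "r (y \<oplus>\<^bsub>F\<^esub> y') = r y \<oplus>\<^bsub>E\<^esub> r y'" if "y \<in> carrier F" "y' \<in> carrier F" for y y'
  proof (rule injD)
    show "\<iota> (r (y \<oplus>\<^bsub>F\<^esub> y')) = \<iota> (r y \<oplus>\<^bsub>E\<^esub> r y')"
      using that l(1)[OF hom_in[OF p]] r by (simp add: hom_add[OF i] hom_add[OF p] l(3) hom_in[OF p] F.minus_eq F.minus_add F.a_ac)
  qed (use that r in auto)
  have r_zs: "r (zs F z y) = zs E z (r y)" if "y \<in> carrier F" for z y
  proof (rule injD)
    show "\<iota> (r (zs F z y)) = \<iota> (zs E z (r y))"
      using that l(1)[OF hom_in[OF p]] r
      by (simp add: hom_zs[OF i] hom_zs[OF p] l(4) hom_in[OF p] F.minus_eq zs_in[OF F] zs_add[OF F] smult_minus_right[OF F])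
  qed (use that r zs_in[OF F] zs_in[OF E_module] in auto)
  have r_i: "r (\<iota> x) = x" if "x \<in> carrier E" for x
  proof (rule injD)
    show "\<iota> (r (\<iota> x)) = \<iota> x" using that r hom_in[OF i] by (simp add: pi l0 F.minus_eq)
  qed (use that r hom_in[OF i] in auto)
  define m where "m = (\<lambda>x. fps_shift (p' w) (a x w))"
  have m: "X ^ p' w * m x = a x w" if "x \<in> carrier E" for x using fps_X_power_shift[OF d[OF that]] by (simp add: m_def)
  have mz: "zlin E m"
    unfolding zlin_def
  proof (intro conjI ballI allI)
    fix x y assume xy: "x \<in> carrier E" "y \<in> carrier E"
    have "X ^ p' w * m (x \<oplus>\<^bsub>E\<^esub> y) = X ^ p' w * (m x + m y)"
      using xy hom_to_L_apply(1)[OF kS E_module a xy] by (simp add: m distrib_left)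
    then show "m (x \<oplus>\<^bsub>E\<^esub> y) = m x + m y" by simp
  next
    fix z x assume x: "x \<in> carrier E"
    have "X ^ p' w * m (zs E z x) = X ^ p' w * (z * m x)"
      using x hom_to_L_apply(2)[OF kS E_module a x] zs_in[OF E_module x]
      by (simp only: m mult.left_commute[of _ z])
    then show "m (zs E z x) = z * m x" by simp
  qed
  have mr: "zlin F (\<lambda>y. m (r y))" using mz r r_add r_zs by (auto simp: zlin_def)
  define a' where "a' = (\<lambda>y c. if c \<in> V then X ^ p' c * m (r (qa F c w y)) else 0)"
  have a': "a' \<in> mod_hom B F (L S)"
    unfolding a'_def using functional_hom[OF kS F mr w pr] by simp
  have "a' (\<iota> x) c = a x c" if x: "x \<in> carrier E" for x c
  proof (cases "c \<in> V")
    case True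
    have qx: "qa E c w x \<in> carrier E" by (rule qa_in[OF E_module True x])
    have "X ^ p' w * a' (\<iota> x) c = X ^ p' c * (X ^ p' w * m (qa E c w x))"
      using True x hom_qa[OF i True x, of w] r_i[OF qx] by (simp add: a'_def mult.left_commute)
    also have "\<dots> = X ^ (p' c + wt S c w) * a x c"
      using hom_to_L_apply(3)[OF kS E_module a x True w, of w] m[OF qx] by (simp add: power_add mult.assoc)
    finally show ?thesis unfolding pr[OF True] by simp
  next
    case False
    then show ?thesis using hom_to_L_apply(4)[OF kS E_module a x] by (simp add: a'_def)
  qed
  then have "a' (\<iota> x) = a x" if "x \<in> carrier E" for x using that by (simp add: fun_eq_iff)
  moreover have "X ^ p' c dvd a' y c" if "c \<in> V" for y c using that by (simp add: a'_def)
  ultimately show ?thesis using that[OF a'] by simp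
qed

text \<open>Bounds the order of a matrix entry \<open>g\<close> from one test vector with entry
  \<open>X ^ e\<close>: if the image is divisible by \<open>X ^ e'\<close>, then \<open>g\<close> is
  divisible by the denominator \<open>X ^ m\<close> and up to e' - e further powers.\<close>

lemma dvd_cancel_power:
  assumes "X ^ m * f = g * X ^ e" "X ^ e' dvd f" "e + d \<le> e'"
  shows "X ^ (m + d) dvd (g :: complex fps)"
proof -
  obtain y where y: "f = X ^ e' * y" using assms(2) by (auto simp: dvd_def)
  have "e' = e + (d + (e' - (e + d)))" using assms(3) by simp
  then have "f = X ^ e * (X ^ d * (X ^ (e' - (e + d)) * y))" unfolding y by (metis power_add mult.assoc)
  then have "X ^ e * g = X ^ e * (X ^ (m + d) * (X ^ (e' - (e + d)) * y))"
    using assms(1) by (simp add: power_add algebra_simps)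
  then have "g = X ^ (m + d) * (X ^ (e' - (e + d)) * y)" by simp
  then show ?thesis by (rule dvdI)
qed

text \<open>\<open>gen_i\<close> and \<open>gen_v\<close> have a single nonzero entry each, so they
  isolate one coefficient of the linear forms in \<open>hom_E_matrix\<close>.\<close>

definition gen_i :: "int \<Rightarrow> complex fps" where
  "gen_i = interleave (single i 0) (single i (X ^ pJ i))"

definition gen_v :: "int \<Rightarrow> complex fps" where
  "gen_v = interleave (single v (X ^ pJ v)) (single v 0)"

lemma gen_in: "gen_i \<in> carrier E" "gen_v \<in> carrier E"
  unfolding gen_i_def gen_v_def using at_i at_v by (auto intro!: E_pairI simp: le_imp_power_dvd)

lemma gen_parts [simp]: "even_part gen_i i = 0" "odd_part gen_i i = X ^ pJ i"
  "even_part gen_v v = X ^ pJ v" "odd_part gen_v v = 0"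
  by (simp_all add: gen_i_def gen_v_def single_def)

lemma retraction:
  assumes ex: "short_exact B E \<iota> F p E"
  shows "\<exists>r\<in>mod_hom B F E. \<forall>x\<in>carrier E. r (\<iota> x) = x"
proof -
  have F: "left_module B F" and p: "p \<in> mod_hom B F E" and surj: "p ` carrier F = carrier E"
    and im: "\<iota> ` carrier E = a_kernel F E p"
    using ex by (auto simp: short_exact_def)
  have pi: "p (\<iota> x) = \<zero>\<^bsub>E\<^esub>" if "x \<in> carrier E" for x
    using im that by (auto simp: a_kernel_def' set_eq_iff image_iff)
  note LS = L_module[OF kS]
  obtain a1 where a1: "a1 \<in> mod_hom B F (L S)" "\<And>x. x \<in> carrier E \<Longrightarrow> a1 (\<iota> x) = even_part x"
    "\<And>y c. y \<in> carrier F \<Longrightarrow> c \<in> V \<Longrightarrow> X ^ p1 c dvd a1 y c"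
    using extend_to_injective[OF ex E_even iV val1 E_D(3)[OF _ iV]] by blast
  obtain a2 where a2: "a2 \<in> mod_hom B F (L S)" "\<And>x. x \<in> carrier E \<Longrightarrow> a2 (\<iota> x) = odd_part x"
    "\<And>y c. y \<in> carrier F \<Longrightarrow> c \<in> V \<Longrightarrow> X ^ p2 c dvd a2 y c"
    using extend_to_injective[OF ex E_odd vV val2 E_D(4)[OF _ vV]] by blast
  have dJ: "X ^ p3 c dvd even_part x c + odd_part x c" "X ^ p4 c dvd even_part x c + odd_part x c"
    if "x \<in> carrier E" "c \<in> V" for x c
    by (rule dvd_trans[OF le_imp_power_dvd E_D(5)[OF that]], simp add: pJ_max[OF that(2)])+
  obtain a3 where a3: "a3 \<in> mod_hom B F (L S)" "\<And>x. x \<in> carrier E \<Longrightarrow> a3 (\<iota> x) = (\<lambda>c. even_part x c + odd_part x c)"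
    "\<And>y c. y \<in> carrier F \<Longrightarrow> c \<in> V \<Longrightarrow> X ^ p3 c dvd a3 y c"
    using extend_to_injective[OF ex E_sum v3V val3 dJ(1)[OF _ v3V]] by blast
  obtain a4 where a4: "a4 \<in> mod_hom B F (L S)" "\<And>x. x \<in> carrier E \<Longrightarrow> a4 (\<iota> x) = (\<lambda>c. even_part x c + odd_part x c)"
    "\<And>y c. y \<in> carrier F \<Longrightarrow> c \<in> V \<Longrightarrow> X ^ p4 c dvd a4 y c"
    using extend_to_injective[OF ex E_sum v4V val4 dJ(2)[OF _ v4V]] by blast
  have lin: "\<exists>r s. \<forall>x\<in>carrier E. \<forall>c\<in>V. f x c = r * even_part x c + s * odd_part x c"
    if rs: "\<And>x c. x \<in> carrier E \<Longrightarrow> c \<in> V \<Longrightarrow> X ^ big * f x c = r * even_part x c + s * odd_part x c"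
      and rd: "X ^ big dvd r" and sd: "X ^ big dvd s" for f r s
  proof -
    obtain r' s' where "r = X ^ big * r'" "s = X ^ big * s'" using rd sd by (auto simp: dvd_def)
    then have "X ^ big * f x c = X ^ big * (r' * even_part x c + s' * odd_part x c)"
      if "x \<in> carrier E" "c \<in> V" for x c using rs[OF that] by (simp add: algebra_simps)
    then show ?thesis by auto
  qed
  \<comment> \<open>\<open>a3\<close> and \<open>a4\<close> extend the same map, so they differ by a
    map from the quotient. Its coefficients turn out integral, and at \<open>v4\<close> both entries
    of an element of the middle term are divisible by \<open>X ^ pJ v4\<close>. Hence
    \<open>a3\<close> also meets the condition of \<open>p4\<close> at its valley and lands in the
    intersection of the two projectives, which is \<open>L J\<close>.\<close>
  have a3_4: "X ^ pJ c dvd a3 y c" if y: "y \<in> carrier F" and c: "c \<in> V" for y c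
  proof -
    have D: "(\<lambda>y c. a3 y c - a4 y c) \<in> mod_hom B F (L S)" by (rule hom_L_minus(1)[OF kS F a3(1) a4(1)])
    have "\<exists>h. h \<in> mod_hom B E (L S) \<and> (\<forall>y\<in>carrier F. (\<lambda>c. a3 y c - a4 y c) = h (p y))"
      by (rule hom_through_epi[OF ex LS D]) (simp add: a3(2) a4(2) L_simps)
    then obtain h where h: "h \<in> mod_hom B E (L S)" "\<And>y. y \<in> carrier F \<Longrightarrow> (\<lambda>c. a3 y c - a4 y c) = h (p y)"
      by blast
    have dh: "X ^ min (p3 c) (p4 c) dvd h x c" if x: "x \<in> carrier E" and c: "c \<in> V" for x c
    proof -
      obtain y where y: "y \<in> carrier F" "p y = x" using x unfolding surj[symmetric] by blast
      have "X ^ min (p3 c) (p4 c) dvd a3 y c - a4 y c"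
        by (rule dvd_diff[OF dvd_trans[OF le_imp_power_dvd[OF min.cobounded1] a3(3)[OF y(1) c]]
              dvd_trans[OF le_imp_power_dvd[OF min.cobounded2] a4(3)[OF y(1) c]]])
      then show ?thesis using fun_cong[OF h(2)[OF y(1)], of c] y(2) by simp
    qed
    obtain r s where rs: "\<And>x c. x \<in> carrier E \<Longrightarrow> c \<in> V \<Longrightarrow> X ^ big * h x c = r * even_part x c + s * odd_part x c"
      using hom_E_matrix[OF h(1)] by blast
    have "X ^ (big + 0) dvd s"
      using rs[OF gen_in(1) iV] dh[OF gen_in(1) iV] at_i by (intro dvd_cancel_power[of big "h gen_i i" s "pJ i" "pJ i"]) auto
    moreover have "X ^ (big + 0) dvd r"
      using rs[OF gen_in(2) vV] dh[OF gen_in(2) vV] at_v by (intro dvd_cancel_power[of big "h gen_v v" r "pJ v" "pJ v"]) auto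
    ultimately obtain r' s' where rs': "\<And>x c. x \<in> carrier E \<Longrightarrow> c \<in> V \<Longrightarrow> h x c = r' * even_part x c + s' * odd_part x c"
      using lin[OF rs] by auto
    have h4: "X ^ p4 v4 dvd h x v4" if x: "x \<in> carrier E" for x
    proof -
      have s: "X ^ pJ v4 dvd even_part x v4 + odd_part x v4" by (rule E_D(5)[OF x v4V])
      have "X ^ pJ v4 dvd even_part x v4 \<or> X ^ pJ v4 dvd odd_part x v4"
        using pJ_min[OF v4V] E_dvd_pI[OF x v4V] at_v4 by auto
      then have "X ^ pJ v4 dvd even_part x v4" "X ^ pJ v4 dvd odd_part x v4"
        using s dvd_add_right_iff dvd_add_left_iff by blast+
      then show ?thesis unfolding rs'[OF x v4V] at_v4 by (intro dvd_add dvd_mult)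
    qed
    have "X ^ p4 c dvd a3 y c" if y: "y \<in> carrier F" and c: "c \<in> V" for y c
    proof (rule valley_dvd[OF kS F a3(1) v4V val4 _ y c])
      fix y assume y: "y \<in> carrier F"
      have "a3 y v4 - a4 y v4 = h (p y) v4" using fun_cong[OF h(2)[OF y], of v4] by simp
      then have "a3 y v4 = a4 y v4 + h (p y) v4" by (simp add: algebra_simps)
      then show "X ^ p4 v4 dvd a3 y v4" using a4(3)[OF y v4V] h4[OF hom_in[OF p y]] by (simp add: dvd_add)
    qed
    then show ?thesis using a3(3)[OF y c] y c pJ_max[OF c] by (simp add: max_def)
  qed
  \<comment> \<open>The failure of \<open>a1 + a2 = a3\<close> again factors through
    \<open>p\<close>. Once its coefficients are integral, the two multiples can be absorbed into
    \<open>a1\<close> and \<open>a2\<close> without losing divisibility.\<close>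
  let ?D = "\<lambda>y c. (a1 y c + a2 y c) - a3 y c"
  have D: "?D \<in> mod_hom B F (L S)"
    by (rule hom_L_minus(1)[OF kS F hom_L_minus(2)[OF kS F a1(1) a2(1)] a3(1)])
  have "\<exists>h. h \<in> mod_hom B E (L S) \<and> (\<forall>y\<in>carrier F. ?D y = h (p y))"
    by (rule hom_through_epi[OF ex LS D]) (simp add: a1(2) a2(2) a3(2) L_simps)
  then obtain h where h: "h \<in> mod_hom B E (L S)" "\<And>y. y \<in> carrier F \<Longrightarrow> ?D y = h (p y)"
    by blast
  have dh: "X ^ min (p1 c) (p2 c) dvd h x c" if x: "x \<in> carrier E" and c: "c \<in> V" for x c
  proof -
    obtain y where y: "y \<in> carrier F" "p y = x" using x unfolding surj[symmetric] by blast
    have m: "min (p1 c) (p2 c) \<le> pJ c" using pJ_min[OF c] by auto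
    have "X ^ min (p1 c) (p2 c) dvd (a1 y c + a2 y c) - a3 y c"
      by (rule dvd_diff[OF dvd_add[OF dvd_trans[OF le_imp_power_dvd[OF min.cobounded1] a1(3)[OF y(1) c]]
            dvd_trans[OF le_imp_power_dvd[OF min.cobounded2] a2(3)[OF y(1) c]]]
            dvd_trans[OF le_imp_power_dvd[OF m] a3_4[OF y(1) c]]])
    then show ?thesis using fun_cong[OF h(2)[OF y(1)], of c] y(2) by simp
  qed
  obtain r s where rs: "\<And>x c. x \<in> carrier E \<Longrightarrow> c \<in> V \<Longrightarrow> X ^ big * h x c = r * even_part x c + s * odd_part x c"
    using hom_E_matrix[OF h(1)] by blast
  have sd: "X ^ (big + 0) dvd s"
    using rs[OF gen_in(1) iV] dh[OF gen_in(1) iV] at_i by (intro dvd_cancel_power[of big "h gen_i i" s "pJ i" "pJ i"]) auto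
  \<comment> \<open>\<open>gen_v\<close> gives too little here, as \<open>p1 v\<close> may be
    smaller than \<open>pJ v\<close>. At \<open>v0\<close> the exponents \<open>p1\<close> and
    \<open>p2\<close> agree, and a pair with sum zero controls r - s.\<close>
  let ?x0 = "interleave (single v0 (X ^ p1 v0)) (single v0 (- (X ^ p1 v0)))"
  have x0: "?x0 \<in> carrier E" using at_v0 by (intro E_pairI) auto
  have "X ^ big * h ?x0 v0 = (r - s) * X ^ p1 v0" using rs[OF x0 v0V] by (simp add: single_def algebra_simps)
  then have "X ^ (big + 0) dvd r - s"
    using dh[OF x0 v0V] at_v0 by (intro dvd_cancel_power[of big "h ?x0 v0" "r - s" "p1 v0" "p1 v0"]) auto
  then have "X ^ (big + 0) dvd (r - s) + s" using sd by (rule dvd_add)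
  then obtain r' s' where rs': "\<And>x c. x \<in> carrier E \<Longrightarrow> c \<in> V \<Longrightarrow> h x c = r' * even_part x c + s' * odd_part x c"
    using lin[OF rs] sd by auto
  let ?a = "\<lambda>y c. a1 y c - r' * even_part (p y) c" and ?b = "\<lambda>y c. a2 y c - s' * odd_part (p y) c"
  have ha: "?a \<in> mod_hom B F (L S)"
    by (rule hom_L_minus(1)[OF kS F a1(1) hom_L_minus(3)[OF kS F hom_comp[OF p E_even] hom_comp[OF p E_even]]])
  have hb: "?b \<in> mod_hom B F (L S)"
    by (rule hom_L_minus(1)[OF kS F a2(1) hom_L_minus(3)[OF kS F hom_comp[OF p E_odd] hom_comp[OF p E_odd]]])
  have sum: "?a y c + ?b y c = a3 y c" if y: "y \<in> carrier F" and c: "c \<in> V" for y c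
    using fun_cong[OF h(2)[OF y], of c] rs'[OF hom_in[OF p y] c] by (simp add: algebra_simps)
  have R: "(\<lambda>y. interleave (?a y) (?b y)) \<in> mod_hom B F E"
  proof (rule hom_to_E[OF ha hb])
    fix y c assume y: "y \<in> carrier F" and c: "c \<in> V"
    show "X ^ p1 c dvd ?a y c" using a1(3)[OF y c] E_D(3)[OF hom_in[OF p y] c] by (intro dvd_diff dvd_mult)
    show "X ^ p2 c dvd ?b y c" using a2(3)[OF y c] E_D(4)[OF hom_in[OF p y] c] by (intro dvd_diff dvd_mult)
    show "X ^ pJ c dvd ?a y c + ?b y c" unfolding sum[OF y c] by (rule a3_4[OF y c])
  qed
  have "interleave (?a (\<iota> x)) (?b (\<iota> x)) = x" if x: "x \<in> carrier E" for x
    using x by (simp add: a1(2) a2(2) pi E_ops)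
  then show ?thesis by (intro bexI[OF _ R] ballI)
qed

lemma E_rigid: "rigid B E"
  by (rule rigid_of_retractions[OF E_module retraction])

section \<open>Decomposability\<close>

text \<open>Now \<open>L I\<close> lies in \<open>L J\<close>. One entry meets the condition of
  \<open>L I\<close>, hence that of \<open>L J\<close>, and the sum passes it on to the other entry;
  so the even and odd parts split off separately.\<close>

lemma E_decomposable:
  assumes le: "\<And>c. c \<in> V \<Longrightarrow> pJ c \<le> pI c"
  shows "\<not> indecomposable B E"
proof -
  let ?H = "{x \<in> carrier E. odd_part x = (\<lambda>_. 0)}" and ?K = "{x \<in> carrier E. even_part x = (\<lambda>_. 0)}"
  interpret LS: left_module B "L S" by (rule L_module[OF kS])
  have z: "b \<odot>\<^bsub>L S\<^esub> (\<lambda>_. 0) = (\<lambda>_. 0)" if "b \<in> carrier B" for b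
    using smult_zero_right[OF L_module[OF kS] that] by (simp add: L_simps)
  have H: "submodule ?H B E"
    by (rule submodule_of_closed[OF E_module]) (auto simp: hom_smult[OF E_odd] hom_add[OF E_odd] z E.smult_closed L_simps, simp add: E_ops)
  have K: "submodule ?K B E"
    by (rule submodule_of_closed[OF E_module]) (auto simp: hom_smult[OF E_even] hom_add[OF E_even] z E.smult_closed L_simps, simp add: E_ops)
  have "x \<in> ?H <+>\<^bsub>E\<^esub> ?K" if x: "x \<in> carrier E" for x
  proof -
    have d: "X ^ pJ c dvd even_part x c" "X ^ pJ c dvd odd_part x c" if c: "c \<in> V" for c
    proof -
      have "X ^ pJ c dvd even_part x c \<or> X ^ pJ c dvd odd_part x c"
        using pJ_min[OF c] E_dvd_pI[OF x c] dvd_trans[OF le_imp_power_dvd[OF le[OF c]]] by blast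
      then show "X ^ pJ c dvd even_part x c" "X ^ pJ c dvd odd_part x c"
        using E_D(5)[OF x c] dvd_add_right_iff dvd_add_left_iff by blast+
    qed
    have "interleave (even_part x) (\<lambda>_. 0) \<in> ?H" "interleave (\<lambda>_. 0) (odd_part x) \<in> ?K"
      using E_D(1-4)[OF x] d by (auto simp: E_carrier Ecarrier_def L_simps)
    moreover have "x = interleave (even_part x) (\<lambda>_. 0) \<oplus>\<^bsub>E\<^esub> interleave (\<lambda>_. 0) (odd_part x)"
      by (simp add: E_ops)
    ultimately show ?thesis unfolding set_add_def' by blast
  qed
  then have sum: "?H <+>\<^bsub>E\<^esub> ?K = carrier E" unfolding set_add_def' by auto
  have int: "?H \<inter> ?K = {\<zero>\<^bsub>E\<^esub>}"
  proof (intro equalityI subsetI)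
    fix x assume "x \<in> ?H \<inter> ?K"
    then have "x = interleave (\<lambda>_. 0) (\<lambda>_. 0)" by - (rule interleave_eqI, auto)
    then show "x \<in> {\<zero>\<^bsub>E\<^esub>}" by (simp add: E_ops)
  qed (use E.zero_closed in \<open>auto simp: E_ops\<close>)
  have "gen_v \<in> ?H" "gen_i \<in> ?K" using gen_in by (auto simp: gen_v_def gen_i_def single_def)
  moreover have "gen_v \<noteq> \<zero>\<^bsub>E\<^esub>"
  proof
    assume "gen_v = \<zero>\<^bsub>E\<^esub>"
    then have "even_part gen_v v = 0" by (simp only: E_ops interleave_simps)
    then show False by simp
  qed
  moreover have "gen_i \<noteq> \<zero>\<^bsub>E\<^esub>"
  proof
    assume "gen_i = \<zero>\<^bsub>E\<^esub>"
    then have "odd_part gen_i i = 0" by (simp only: E_ops interleave_simps)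
    then show False by simp
  qed
  ultimately have "?H \<noteq> {\<zero>\<^bsub>E\<^esub>}" "?K \<noteq> {\<zero>\<^bsub>E\<^esub>}" by blast+
  then show ?thesis using H K sum int unfolding indecomposable_def by blast
qed

text \<open>The vertices \<open>i\<close>, \<open>v\<close> and \<open>c0\<close> force the matrix of an endomorphism to be scalar modulo the
  variable.\<close>

lemma E_indecomposable:
  assumes c0: "c0 \<in> V" "pI c0 < pJ c0"
  shows "indecomposable B E"
  unfolding indecomposable_def
proof (intro conjI allI impI)
  show "carrier E \<noteq> {\<zero>\<^bsub>E\<^esub>}"
  proof
    assume "carrier E = {\<zero>\<^bsub>E\<^esub>}"
    then have "gen_v = \<zero>\<^bsub>E\<^esub>" using gen_in by blast
    then have "even_part gen_v v = 0" by (simp only: E_ops interleave_simps)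
    then show False by simp
  qed
  fix H K assume HK: "submodule H B E \<and> submodule K B E \<and> H <+>\<^bsub>E\<^esub> K = carrier E \<and> H \<inter> K = {\<zero>\<^bsub>E\<^esub>}"
  then have sH: "submodule H B E" and sK: "submodule K B E" by auto
  note Hf = submodule_facts[OF sH] and Kf = submodule_facts[OF sK]
  have neg: "\<ominus>\<^bsub>E\<^esub> x \<in> U" if "submodule U B E" "x \<in> U" for x U
  proof -
    have "x \<in> carrier E" using submodule_facts(1)[OF that(1)] that(2) by blast
    then have "zs E (- 1) x = \<ominus>\<^bsub>E\<^esub> x" using zs_minus[OF E_module, of x 1] zs_one[OF E_module] by simp
    then show ?thesis using submodule_facts(4)[OF that(1), of "Zb (- 1)" x] that(2) by simp
  qed
  have uniq: "h = h'" if h: "h \<in> H" "h' \<in> H" "k \<in> K" "k' \<in> K" "h \<oplus>\<^bsub>E\<^esub> k = h' \<oplus>\<^bsub>E\<^esub> k'" for h h' k k'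
  proof -
    have c: "h \<in> carrier E" "h' \<in> carrier E" "k \<in> carrier E" "k' \<in> carrier E" using h Hf(1) Kf(1) by auto
    have "h \<ominus>\<^bsub>E\<^esub> h' = (h \<oplus>\<^bsub>E\<^esub> k) \<oplus>\<^bsub>E\<^esub> (\<ominus>\<^bsub>E\<^esub> k \<oplus>\<^bsub>E\<^esub> \<ominus>\<^bsub>E\<^esub> h')"
      using c by (simp add: E.minus_eq E.a_assoc E.r_neg1 E.r_neg2)
    also have "\<dots> = k' \<oplus>\<^bsub>E\<^esub> (h' \<oplus>\<^bsub>E\<^esub> (\<ominus>\<^bsub>E\<^esub> h' \<oplus>\<^bsub>E\<^esub> \<ominus>\<^bsub>E\<^esub> k))"
      unfolding h(5) using c by (simp add: E.a_ac)
    also have "\<dots> = k' \<ominus>\<^bsub>E\<^esub> k" using c by (simp add: E.minus_eq E.r_neg2)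
    finally have e: "h \<ominus>\<^bsub>E\<^esub> h' = k' \<ominus>\<^bsub>E\<^esub> k" .
    have "h \<ominus>\<^bsub>E\<^esub> h' \<in> H" unfolding E.minus_eq using h Hf(3) neg[OF sH] by blast
    moreover have "h \<ominus>\<^bsub>E\<^esub> h' \<in> K" unfolding e unfolding E.minus_eq using h Kf(3) neg[OF sK] by blast
    ultimately have "h \<ominus>\<^bsub>E\<^esub> h' = \<zero>\<^bsub>E\<^esub>" using HK by blast
    then show ?thesis using c E.minus_eq_zeroD by blast
  qed
  have "\<exists>h\<in>H. \<exists>k\<in>K. x = h \<oplus>\<^bsub>E\<^esub> k" if "x \<in> carrier E" for x
    using HK that unfolding set_add_def' by blast
  then obtain e k where ek: "\<And>x. x \<in> carrier E \<Longrightarrow> e x \<in> H" "\<And>x. x \<in> carrier E \<Longrightarrow> k x \<in> K"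
    "\<And>x. x \<in> carrier E \<Longrightarrow> x = e x \<oplus>\<^bsub>E\<^esub> k x" by metis
  have ec: "e x \<in> carrier E" "k x \<in> carrier E" if "x \<in> carrier E" for x using ek[OF that] Hf(1) Kf(1) by auto
  have eI: "e x = h" if "h \<in> H" "k' \<in> K" "x = h \<oplus>\<^bsub>E\<^esub> k'" for x h k'
  proof -
    have x: "x \<in> carrier E" using that Hf(1) Kf(1) by auto
    show ?thesis using uniq[OF ek(1)[OF x] that(1) ek(2)[OF x] that(2)] ek(3)[OF x] that(3) by simp
  qed
  have e: "e \<in> mod_hom B E E"
    unfolding mod_hom_def
  proof (intro CollectI conjI ballI Pi_I ec)
    fix x y assume xy: "x \<in> carrier E" "y \<in> carrier E"
    have "x \<oplus>\<^bsub>E\<^esub> y = (e x \<oplus>\<^bsub>E\<^esub> k x) \<oplus>\<^bsub>E\<^esub> (e y \<oplus>\<^bsub>E\<^esub> k y)" using ek(3)[OF xy(1)] ek(3)[OF xy(2)] by simp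
    also have "\<dots> = (e x \<oplus>\<^bsub>E\<^esub> e y) \<oplus>\<^bsub>E\<^esub> (k x \<oplus>\<^bsub>E\<^esub> k y)" using ec xy by (simp add: E.a_ac)
    finally show "e (x \<oplus>\<^bsub>E\<^esub> y) = e x \<oplus>\<^bsub>E\<^esub> e y" using ek xy by (intro eI) (auto intro: Hf(3) Kf(3))
  next
    fix b x assume b: "b \<in> carrier B" and x: "x \<in> carrier E"
    have "b \<odot>\<^bsub>E\<^esub> x = b \<odot>\<^bsub>E\<^esub> (e x \<oplus>\<^bsub>E\<^esub> k x)" using ek(3)[OF x] by simp
    also have "\<dots> = b \<odot>\<^bsub>E\<^esub> e x \<oplus>\<^bsub>E\<^esub> b \<odot>\<^bsub>E\<^esub> k x" using b ec[OF x] by (simp add: E.smult_r_distr)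
    finally show "e (b \<odot>\<^bsub>E\<^esub> x) = b \<odot>\<^bsub>E\<^esub> e x" using ek x b by (intro eI) (auto intro: Hf(4) Kf(4))
  qed simp_all
  have eH: "e x = x" if "x \<in> H" for x
    using that Kf(2) Hf(1) by (intro eI[of x "\<zero>\<^bsub>E\<^esub>"]) auto
  have eK: "e x = \<zero>\<^bsub>E\<^esub>" if "x \<in> K" for x
    using that Hf(2) Kf(1) by (intro eI[of "\<zero>\<^bsub>E\<^esub>" x]) auto
  obtain \<alpha> \<beta> where ab: "\<And>x c. x \<in> carrier E \<Longrightarrow> c \<in> V \<Longrightarrow> X ^ big * even_part (e x) c = \<alpha> * even_part x c + \<beta> * odd_part x c"
    using hom_E_matrix[OF hom_comp[OF e E_even]] by blast
  obtain \<gamma> \<delta> where cd: "\<And>x c. x \<in> carrier E \<Longrightarrow> c \<in> V \<Longrightarrow> X ^ big * odd_part (e x) c = \<gamma> * even_part x c + \<delta> * odd_part x c"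
    using hom_E_matrix[OF hom_comp[OF e E_odd]] by blast
  note gi = ec(1)[OF gen_in(1)] and gv = ec(1)[OF gen_in(2)]
  \<comment> \<open>At \<open>i\<close> the even entry must have one power more than
    \<open>gen_i\<close> carries, at \<open>v\<close> the odd entry one more than
    \<open>gen_v\<close>. So the off-diagonal coefficients vanish modulo X, while the diagonal ones
    are integral.\<close>
  have b: "X ^ (big + 1) dvd \<beta>"
    using ab[OF gen_in(1) iV] E_D(3)[OF gi iV] at_i
    by (intro dvd_cancel_power[of big "even_part (e gen_i) i" \<beta> "pJ i" "p1 i"]) auto
  have d: "X ^ (big + 0) dvd \<delta>"
    using cd[OF gen_in(1) iV] E_D(4)[OF gi iV] at_i
    by (intro dvd_cancel_power[of big "odd_part (e gen_i) i" \<delta> "pJ i" "p2 i"]) auto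
  have c: "X ^ (big + 1) dvd \<gamma>"
    using cd[OF gen_in(2) vV] E_D(4)[OF gv vV] at_v
    by (intro dvd_cancel_power[of big "odd_part (e gen_v) v" \<gamma> "pJ v" "p2 v"]) auto
  have "X ^ pJ v dvd odd_part (e gen_v) v"
    using E_D(4)[OF gv vV] at_v by (auto intro: dvd_trans[OF le_imp_power_dvd])
  then have "X ^ pJ v dvd even_part (e gen_v) v" using E_D(5)[OF gv vV] by (simp add: dvd_add_left_iff)
  then have a: "X ^ (big + 0) dvd \<alpha>"
    using ab[OF gen_in(2) vV]
    by (intro dvd_cancel_power[of big "even_part (e gen_v) v" \<alpha> "pJ v" "pJ v"]) auto
  obtain a' b' c' d' where abcd: "\<alpha> = X ^ big * a'" "\<beta> = X ^ big * (X * b')" "\<gamma> = X ^ big * (X * c')" "\<delta> = X ^ big * d'"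
    using a b c d by (auto simp: dvd_def power_add mult.assoc)
  have ev: "even_part (e x) c = a' * even_part x c + X * b' * odd_part x c"
    and od: "odd_part (e x) c = X * c' * even_part x c + d' * odd_part x c" if "x \<in> carrier E" "c \<in> V" for x c
  proof -
    have "X ^ big * even_part (e x) c = X ^ big * (a' * even_part x c + X * b' * odd_part x c)"
      using ab[OF that] by (simp add: abcd algebra_simps)
    then show "even_part (e x) c = a' * even_part x c + X * b' * odd_part x c" by simp
    have "X ^ big * odd_part (e x) c = X ^ big * (X * c' * even_part x c + d' * odd_part x c)"
      using cd[OF that] by (simp add: abcd algebra_simps)
    then show "odd_part (e x) c = X * c' * even_part x c + d' * odd_part x c" by simp
  qed
  \<comment> \<open>The sum of the entries is zero while their exponent \<open>pI c0\<close> is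
    below \<open>pJ c0\<close>. The sum of the entries of the image must be divisible by the higher
    power, so the two diagonal coefficients agree modulo X.\<close>
  let ?x0 = "interleave (single c0 (X ^ pI c0)) (single c0 (- (X ^ pI c0)))"
  have x0: "?x0 \<in> carrier E" using pI_ge[OF c0(1)] by (intro E_pairI[OF c0(1)]) (auto simp: le_imp_power_dvd)
  have "X ^ 0 * (even_part (e ?x0) c0 + odd_part (e ?x0) c0) = (a' - d' + X * (c' - b')) * X ^ pI c0"
  proof -
    have "even_part ?x0 c0 = X ^ pI c0" "odd_part ?x0 c0 = - (X ^ pI c0)" by (simp_all add: single_def)
    then show ?thesis unfolding ev[OF x0 c0(1)] od[OF x0 c0(1)] by (simp only:) (simp add: algebra_simps)
  qed
  then have "X ^ (0 + 1) dvd a' - d' + X * (c' - b')"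
    by (rule dvd_cancel_power[OF _ E_D(5)[OF ec(1)[OF x0] c0(1)]]) (use c0(2) in simp)
  then have "(a' - d' + X * (c' - b')) $ 0 = 0" by (simp add: fps_X_dvd_iff)
  then have ad: "a' $ 0 = d' $ 0" by simp
  have "e (e gen_v) = e gen_v" using eH ek(1)[OF gen_in(2)] by simp
  then have "even_part (e (e gen_v)) v = even_part (e gen_v) v" by simp
  then have "X ^ pJ v * (a' * a' + X * b' * (X * c')) = X ^ pJ v * a'"
    using ev[OF gv vV] ev[OF gen_in(2) vV] od[OF gen_in(2) vV] by (simp add: algebra_simps)
  then have "(a' * a' + X * b' * (X * c')) $ 0 = a' $ 0" by simp
  then have "a' $ 0 * a' $ 0 = a' $ 0" by (simp add: mult.assoc)
  then have cases: "a' $ 0 = 0 \<or> a' $ 0 = 1" by (metis mult_cancel_right1)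
  \<comment> \<open>Each entry of such an \<open>x\<close> is X times a combination of its entries,
    so by iteration all entries are divisible by every power of X.\<close>
  have zero: "x = \<zero>\<^bsub>E\<^esub>"
    if x: "x \<in> carrier E" and s: "\<And>c. c \<in> V \<Longrightarrow> even_part x c = X * (y1 * even_part x c + y2 * odd_part x c)"
      "\<And>c. c \<in> V \<Longrightarrow> odd_part x c = X * (y3 * even_part x c + y4 * odd_part x c)" for x y1 y2 y3 y4
  proof -
    have "X ^ m dvd even_part x c \<and> X ^ m dvd odd_part x c" if c: "c \<in> V" for m c
    proof (induction m)
      case (Suc m)
      then have "X ^ m dvd y1 * even_part x c + y2 * odd_part x c" "X ^ m dvd y3 * even_part x c + y4 * odd_part x c"
        by (auto intro: dvd_add dvd_mult)
      then have "X * X ^ m dvd X * (y1 * even_part x c + y2 * odd_part x c)"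
        "X * X ^ m dvd X * (y3 * even_part x c + y4 * odd_part x c)" by (simp_all only: mult_dvd_mono dvd_refl)
      then show ?case unfolding power_Suc using s[OF c] by metis
    qed simp
    then have "even_part x c $ m = 0 \<and> odd_part x c $ m = 0" if "c \<in> V" for c m
      using that fps_X_power_dvd_iff[of "Suc m"] lessI by blast
    then have "even_part x c = 0 \<and> odd_part x c = 0" for c
      using E_D(6,7)[OF x, of c] by (cases "c \<in> V") (auto intro: fps_ext)
    then have "x = interleave (\<lambda>_. 0) (\<lambda>_. 0)" by - (rule interleave_eqI, auto)
    then show ?thesis by (simp add: E_ops)
  qed
  show "H = {\<zero>\<^bsub>E\<^esub>} \<or> K = {\<zero>\<^bsub>E\<^esub>}"
    using cases
  proof
    assume "a' $ 0 = 0"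
    then obtain a1 d1 where ad1: "a' = X * a1" "d' = X * d1"
      using ad fps_X_dvd_iff[of a'] fps_X_dvd_iff[of d'] by (auto simp: dvd_def)
    have "x = \<zero>\<^bsub>E\<^esub>" if x: "x \<in> H" for x
    proof (rule zero[of x a1 b' c' d1])
      show xc: "x \<in> carrier E" using x Hf(1) by blast
      show "even_part x c = X * (a1 * even_part x c + b' * odd_part x c)" if "c \<in> V" for c
        using ev[OF xc that] eH[OF x] by (simp add: ad1 algebra_simps)
      show "odd_part x c = X * (c' * even_part x c + d1 * odd_part x c)" if "c \<in> V" for c
        using od[OF xc that] eH[OF x] by (simp add: ad1 algebra_simps)
    qed
    then show ?thesis using Hf(2) by blast
  next
    assume "a' $ 0 = 1"
    then have "(1 - a') $ 0 = 0" "(1 - d') $ 0 = 0" using ad by simp_all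
    then obtain a1 d1 where ad1: "1 - a' = X * a1" "1 - d' = X * d1"
      using fps_X_dvd_iff[of "1 - a'"] fps_X_dvd_iff[of "1 - d'"] by (auto simp: dvd_def)
    have "x = \<zero>\<^bsub>E\<^esub>" if x: "x \<in> K" for x
    proof (rule zero[of x a1 "- b'" "- c'" d1])
      show xc: "x \<in> carrier E" using x Kf(1) by blast
      show "even_part x c = X * (a1 * even_part x c + - b' * odd_part x c)" if "c \<in> V" for c
      proof -
        have z: "a' * even_part x c + X * b' * odd_part x c = 0"
          using ev[OF xc that] eK[OF x] by (simp add: E_ops)
        have "X * (a1 * even_part x c + - b' * odd_part x c) = (X * a1) * even_part x c - X * b' * odd_part x c"
          by (simp add: algebra_simps)
        also have "\<dots> = even_part x c - (a' * even_part x c + X * b' * odd_part x c)"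
          unfolding ad1(1)[symmetric] by (simp add: algebra_simps)
        finally show ?thesis unfolding z by simp
      qed
      show "odd_part x c = X * (- c' * even_part x c + d1 * odd_part x c)" if "c \<in> V" for c
      proof -
        have z: "X * c' * even_part x c + d' * odd_part x c = 0"
          using od[OF xc that] eK[OF x] by (simp add: E_ops)
        have "X * (- c' * even_part x c + d1 * odd_part x c) = (X * d1) * odd_part x c - X * c' * even_part x c"
          by (simp add: algebra_simps)
        also have "\<dots> = odd_part x c - (X * c' * even_part x c + d' * odd_part x c)"
          unfolding ad1(2)[symmetric] by (simp add: algebra_simps)
        finally show ?thesis unfolding z by simp
      qed
    qed
    then show ?thesis using Kf(2) by blast
  qed
qed

end


section \<open>Syzygies\<close>

context kn
begin

text \<open>Between two idempotents only one matrix entry survives, and it is a multiple of the one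
  belonging to the shortest path.\<close>

lemma corner:
  assumes b: "b \<in> carrier B" and V: "c \<in> V" "d \<in> V"
  obtains z where "q d d \<otimes>\<^bsub>B\<^esub> (b \<otimes>\<^bsub>B\<^esub> q c c) = Zb z \<otimes>\<^bsub>B\<^esub> q c d"
proof -
  let ?T = "{0..<int k}"
  obtain z where z: "mb ?T b c d = X ^ wt ?T c d * z"
    using mb_dvd[OF kset_std b V] by (auto simp: dvd_def)
  have "q d d \<otimes>\<^bsub>B\<^esub> (b \<otimes>\<^bsub>B\<^esub> q c c) = Zb z \<otimes>\<^bsub>B\<^esub> q c d"
    by (rule mb_eqI[OF kset_std])
      (use b V z in \<open>auto simp: mb_q_mult[OF kset_std] mb_Z_mult[OF kset_std] mb_q[OF kset_std] mb_Z[OF kset_std]\<close>)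
  then show ?thesis using that by blast
qed

text \<open>If \<open>a\<close> and \<open>b\<close> are the tops of the module of \<open>I\<close> then its projective cover is generated by two
  elements at \<open>a\<close> and \<open>b\<close>, and each component of the kernel by a single relation between them. This
  determines how the paths act on the kernel.\<close>

lemma syzygy_weight:
  assumes kI: "kset I" and kJ: "kset J" and syz: "is_syzygy B (L J) (L I)"
    and aV: "a \<in> V" and bV: "b \<in> V" and tops: "\<And>c. c \<in> V \<Longrightarrow> wt I a c = 0 \<or> wt I b c = 0"
    and cV: "c \<in> V" and dV: "d \<in> V"
  shows "wt J c d + (wt I a d + wt I b d) = wt I c d + (wt I a c + wt I b c)"
proof -
  obtain P p f where pc: "projective_cover B P p (L I)" and ex: "short_exact B (L J) f P p (L I)"
    using syz by (auto simp: is_syzygy_def)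
  have P: "left_module B P" and p: "p \<in> mod_hom B P (L I)" and f: "f \<in> mod_hom B (L J) P"
    and inj: "inj_on f (carrier (L J))" and im: "f ` carrier (L J) = a_kernel P (L I) p"
    and surj: "p ` carrier P = carrier (L I)"
    using ex by (auto simp: short_exact_def)
  have sup: "H = carrier P" if "submodule H B P" "H <+>\<^bsub>P\<^esub> a_kernel P (L I) p = carrier P" for H
    using pc that by (auto simp: projective_cover_def)
  interpret P: left_module B P by fact
  note LI = L_module[OF kI] and LJ = L_module[OF kJ] and Pin = qa_in[OF P] zs_in[OF P]
  have gen: "\<exists>y\<in>carrier P. qa P e e y = y \<and> p y = single e 1" if e: "e \<in> V" for e
  proof -
    have "single e 1 \<in> p ` carrier P" unfolding surj using e by simp
    then obtain y where y: "y \<in> carrier P" "p y = single e 1" by auto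
    show ?thesis
    proof (intro bexI[of _ "qa P e e y"] conjI)
      show "qa P e e (qa P e e y) = qa P e e y" by (rule qa_idem(1)[OF P e e y(1)])
      show "p (qa P e e y) = single e 1"
        using y e by (simp add: hom_qa[OF p] L_qa_single[OF kI])
    qed (rule qa_in[OF P e y(1)])
  qed
  obtain y1 where y1: "y1 \<in> carrier P" "qa P a a y1 = y1" "p y1 = single a 1" using gen[OF aV] by blast
  obtain y2 where y2: "y2 \<in> carrier P" "qa P b b y2 = y2" "p y2 = single b 1" using gen[OF bV] by blast
  define H where "H = {b1 \<odot>\<^bsub>P\<^esub> y1 \<oplus>\<^bsub>P\<^esub> b2 \<odot>\<^bsub>P\<^esub> y2 | b1 b2. b1 \<in> carrier B \<and> b2 \<in> carrier B}"
  have sH: "submodule H B P"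
  proof (rule submodule_of_closed[OF P])
    show HP: "H \<subseteq> carrier P" using y1 y2 by (auto simp: H_def P.smult_closed)
    have "\<zero>\<^bsub>P\<^esub> = \<zero>\<^bsub>B\<^esub> \<odot>\<^bsub>P\<^esub> y1 \<oplus>\<^bsub>P\<^esub> \<zero>\<^bsub>B\<^esub> \<odot>\<^bsub>P\<^esub> y2"
      using y1 y2 by (simp add: smult_zero_left[OF P])
    then show "\<zero>\<^bsub>P\<^esub> \<in> H" unfolding H_def using B.zero_closed by blast
    show "x \<oplus>\<^bsub>P\<^esub> y \<in> H" if xy: "x \<in> H" "y \<in> H" for x y
    proof -
      obtain b1 b2 c1 c2 where bc: "b1 \<in> carrier B" "b2 \<in> carrier B" "c1 \<in> carrier B" "c2 \<in> carrier B"
        "x = b1 \<odot>\<^bsub>P\<^esub> y1 \<oplus>\<^bsub>P\<^esub> b2 \<odot>\<^bsub>P\<^esub> y2" "y = c1 \<odot>\<^bsub>P\<^esub> y1 \<oplus>\<^bsub>P\<^esub> c2 \<odot>\<^bsub>P\<^esub> y2"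
        using xy unfolding H_def by blast
      have "x \<oplus>\<^bsub>P\<^esub> y = (b1 \<oplus>\<^bsub>B\<^esub> c1) \<odot>\<^bsub>P\<^esub> y1 \<oplus>\<^bsub>P\<^esub> (b2 \<oplus>\<^bsub>B\<^esub> c2) \<odot>\<^bsub>P\<^esub> y2"
        using bc y1(1) y2(1) by (simp add: P.smult_l_distr P.smult_closed P.a_ac)
      then show ?thesis unfolding H_def using bc B.a_closed by blast
    qed
    show "e \<odot>\<^bsub>P\<^esub> x \<in> H" if e: "e \<in> carrier B" and x: "x \<in> H" for e x
    proof -
      obtain b1 b2 where bc: "b1 \<in> carrier B" "b2 \<in> carrier B" "x = b1 \<odot>\<^bsub>P\<^esub> y1 \<oplus>\<^bsub>P\<^esub> b2 \<odot>\<^bsub>P\<^esub> y2"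
        using x unfolding H_def by blast
      have "e \<odot>\<^bsub>P\<^esub> x = (e \<otimes>\<^bsub>B\<^esub> b1) \<odot>\<^bsub>P\<^esub> y1 \<oplus>\<^bsub>P\<^esub> (e \<otimes>\<^bsub>B\<^esub> b2) \<odot>\<^bsub>P\<^esub> y2"
        using bc e y1(1) y2(1) by (simp add: P.smult_r_distr P.smult_closed P.smult_assoc1)
      then show ?thesis unfolding H_def using bc e B.m_closed by blast
    qed
  qed
  have onto: "\<exists>h\<in>H. p h = z" if z: "z \<in> carrier (L I)" for z
  proof -
    obtain b1 where b1: "b1 \<in> carrier B"
      "\<And>e v. e \<in> V \<Longrightarrow> v \<in> V \<Longrightarrow> mb I b1 e v = X ^ wt I e v * (if wt I a v = 0 then z v else 0)"
      using B_element[of "\<lambda>e v. if wt I a v = 0 then z v else 0"] kI by blast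
    obtain b2 where b2: "b2 \<in> carrier B"
      "\<And>e v. e \<in> V \<Longrightarrow> v \<in> V \<Longrightarrow> mb I b2 e v = X ^ wt I e v * (if wt I a v = 0 then 0 else z v)"
      using B_element[of "\<lambda>e v. if wt I a v = 0 then 0 else z v"] kI by blast
    have act: "(e \<odot>\<^bsub>L I\<^esub> single u 1) v = (if v \<in> V then mb I e u v else 0)" if "e \<in> carrier B" "u \<in> V" for e u v
      using that by (simp add: L_smult[OF kI] single_def if_distrib[of "(*) x" for x] cong: if_cong)
    have "p (b1 \<odot>\<^bsub>P\<^esub> y1 \<oplus>\<^bsub>P\<^esub> b2 \<odot>\<^bsub>P\<^esub> y2) = b1 \<odot>\<^bsub>L I\<^esub> single a 1 \<oplus>\<^bsub>L I\<^esub> b2 \<odot>\<^bsub>L I\<^esub> single b 1"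
      using b1(1) b2(1) y1 y2 by (simp add: hom_add[OF p] hom_smult[OF p] P.smult_closed)
    also have "\<dots> = z"
    proof
      fix v
      show "(b1 \<odot>\<^bsub>L I\<^esub> single a 1 \<oplus>\<^bsub>L I\<^esub> b2 \<odot>\<^bsub>L I\<^esub> single b 1) v = z v"
        using z tops[of v] aV bV by (cases "v \<in> V") (auto simp: L_simps act b1 b2)
    qed
    finally show ?thesis unfolding H_def using b1(1) b2(1) by blast
  qed
  have HP: "H \<subseteq> carrier P" by (rule submodule_facts(1)[OF sH])
  have ker: "x \<in> a_kernel P (L I) p \<longleftrightarrow> x \<in> carrier P \<and> p x = \<zero>\<^bsub>L I\<^esub>" for x by (simp add: a_kernel_def')
  have "x \<in> H <+>\<^bsub>P\<^esub> a_kernel P (L I) p" if x: "x \<in> carrier P" for x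
  proof -
    obtain h where h: "h \<in> H" "p h = p x" using onto[OF hom_in[OF p x]] by blast
    have hc: "h \<in> carrier P" using h HP by blast
    have "p (x \<ominus>\<^bsub>P\<^esub> h) = \<zero>\<^bsub>L I\<^esub>"
    proof -
      interpret LI: left_module B "L I" by (rule LI)
      show ?thesis using x hc h(2) hom_in[OF p] by (simp add: hom_minus[OF P LI p] LI.minus_eq LI.r_neg)
    qed
    then have "x \<ominus>\<^bsub>P\<^esub> h \<in> a_kernel P (L I) p" unfolding ker using x hc by simp
    moreover have "x = h \<oplus>\<^bsub>P\<^esub> (x \<ominus>\<^bsub>P\<^esub> h)" using x hc by (simp add: P.minus_eq P.a_comm[of x] P.r_neg2)
    ultimately show ?thesis unfolding set_add_def' using h(1) by blast
  qed
  moreover have "H <+>\<^bsub>P\<^esub> a_kernel P (L I) p \<subseteq> carrier P"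
    using HP ker unfolding set_add_def' by auto
  \<comment> \<open>\<open>H\<close> maps onto \<open>L I\<close>, hence fills \<open>P\<close> up
    to the kernel; since \<open>P\<close> is a projective cover, \<open>H\<close> is all of
    it.\<close>
  ultimately have HeqP: "H = carrier P" using sup[OF sH] by blast
  have comp: "\<exists>\<alpha> \<beta>. x = zs P \<alpha> (qa P a e y1) \<oplus>\<^bsub>P\<^esub> zs P \<beta> (qa P b e y2)"
    if x: "x \<in> carrier P" "qa P e e x = x" and e: "e \<in> V" for x e
  proof -
    obtain b1 b2 where bc: "b1 \<in> carrier B" "b2 \<in> carrier B" "x = b1 \<odot>\<^bsub>P\<^esub> y1 \<oplus>\<^bsub>P\<^esub> b2 \<odot>\<^bsub>P\<^esub> y2"
      using x(1) unfolding HeqP[symmetric] H_def by blast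
    obtain \<alpha> where \<alpha>: "q e e \<otimes>\<^bsub>B\<^esub> (b1 \<otimes>\<^bsub>B\<^esub> q a a) = Zb \<alpha> \<otimes>\<^bsub>B\<^esub> q a e" by (rule corner[OF bc(1) aV e])
    obtain \<beta> where \<beta>: "q e e \<otimes>\<^bsub>B\<^esub> (b2 \<otimes>\<^bsub>B\<^esub> q b b) = Zb \<beta> \<otimes>\<^bsub>B\<^esub> q b e" by (rule corner[OF bc(2) bV e])
    have "qa P e e (b1 \<odot>\<^bsub>P\<^esub> y1) = (q e e \<otimes>\<^bsub>B\<^esub> (b1 \<otimes>\<^bsub>B\<^esub> q a a)) \<odot>\<^bsub>P\<^esub> y1"
      using bc y1 e aV by (simp add: P.smult_assoc1 P.smult_closed)
    also have "\<dots> = zs P \<alpha> (qa P a e y1)" unfolding \<alpha> using y1 e aV by (simp add: P.smult_assoc1)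
    finally have 1: "qa P e e (b1 \<odot>\<^bsub>P\<^esub> y1) = zs P \<alpha> (qa P a e y1)" .
    have "qa P e e (b2 \<odot>\<^bsub>P\<^esub> y2) = (q e e \<otimes>\<^bsub>B\<^esub> (b2 \<otimes>\<^bsub>B\<^esub> q b b)) \<odot>\<^bsub>P\<^esub> y2"
      using bc y2 e bV by (simp add: P.smult_assoc1 P.smult_closed)
    also have "\<dots> = zs P \<beta> (qa P b e y2)" unfolding \<beta> using y2 e bV by (simp add: P.smult_assoc1)
    finally have 2: "qa P e e (b2 \<odot>\<^bsub>P\<^esub> y2) = zs P \<beta> (qa P b e y2)" .
    have "x = qa P e e (b1 \<odot>\<^bsub>P\<^esub> y1 \<oplus>\<^bsub>P\<^esub> b2 \<odot>\<^bsub>P\<^esub> y2)" using x(2) unfolding bc(3) by simp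
    also have "\<dots> = zs P \<alpha> (qa P a e y1) \<oplus>\<^bsub>P\<^esub> zs P \<beta> (qa P b e y2)"
      using bc y1(1) y2(1) e 1 2 by (simp add: qa_add[OF P] P.smult_closed)
    finally show ?thesis by blast
  qed
  \<comment> \<open>At \<open>e\<close> the images of \<open>y1\<close> and \<open>y2\<close> under
    the paths from \<open>a\<close> and \<open>b\<close> are the powers with exponents
    \<open>wt I a e\<close> and \<open>wt I b e\<close>; exchanging these powers gives a relation.
    By \<open>tops\<close> one exponent is zero, so this relation generates all others at
    \<open>e\<close>.\<close>
  define \<kappa> where "\<kappa> = (\<lambda>e. zs P (X ^ wt I b e) (qa P a e y1) \<oplus>\<^bsub>P\<^esub> zs P (- (X ^ wt I a e)) (qa P b e y2))"
  have pz: "p (zs P \<alpha> (qa P a e y1) \<oplus>\<^bsub>P\<^esub> zs P \<beta> (qa P b e y2)) = single e (\<alpha> * X ^ wt I a e + \<beta> * X ^ wt I b e)"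
    if "e \<in> V" for e \<alpha> \<beta>
    using that aV bV y1 y2
    by (simp add: hom_add[OF p] hom_zs[OF p] hom_qa[OF p] Pin L_qa_single[OF kI] L_zs_single[OF kI])
      (simp add: L_simps single_def fun_eq_iff)
  have kc: "\<kappa> e \<in> carrier P" if "e \<in> V" for e using that y1(1) y2(1) aV bV by (simp add: \<kappa>_def Pin)
  have single0: "single e 0 = \<zero>\<^bsub>L T\<^esub>" for e T by (auto simp: single_def L_simps)
  have pk: "p (\<kappa> e) = \<zero>\<^bsub>L I\<^esub>" if "e \<in> V" for e
    unfolding \<kappa>_def pz[OF that] by (simp add: mult.commute single0)
  have kq: "qa P e d (\<kappa> e) = zs P (X ^ (wt I b e + tri a e d)) (qa P a d y1) \<oplus>\<^bsub>P\<^esub> zs P (- (X ^ (wt I a e + tri b e d))) (qa P b d y2)"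
    if "e \<in> V" "d \<in> V" for e d
    using that y1(1) y2(1) aV bV
    by (simp add: \<kappa>_def qa_add[OF P] Pin qa_zs[OF P] qa_qa[OF P] zs_zs[OF P] power_add)
  have kk: "qa P e e (\<kappa> e) = \<kappa> e" if "e \<in> V" for e
    using kq[OF that that] that aV bV by (simp add: \<kappa>_def)
  have gen_ker: "\<exists>z. x = zs P z (\<kappa> e)" if x: "x \<in> carrier P" "qa P e e x = x" "p x = \<zero>\<^bsub>L I\<^esub>" and e: "e \<in> V" for x e
  proof -
    obtain \<alpha> \<beta> where ab: "x = zs P \<alpha> (qa P a e y1) \<oplus>\<^bsub>P\<^esub> zs P \<beta> (qa P b e y2)" using comp[OF x(1,2) e] by blast
    have "single e (\<alpha> * X ^ wt I a e + \<beta> * X ^ wt I b e) = \<zero>\<^bsub>L I\<^esub>" using x(3) unfolding ab pz[OF e] .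
    then have "single e (\<alpha> * X ^ wt I a e + \<beta> * X ^ wt I b e) e = 0" by (simp add: L_simps)
    then have s: "\<alpha> * X ^ wt I a e + \<beta> * X ^ wt I b e = 0" by (simp add: single_def)
    have zk: "zs P z (\<kappa> e) = zs P (z * X ^ wt I b e) (qa P a e y1) \<oplus>\<^bsub>P\<^esub> zs P (z * - (X ^ wt I a e)) (qa P b e y2)" for z
      using y1(1) y2(1) aV bV e by (simp add: \<kappa>_def zs_add[OF P] Pin zs_zs[OF P])
    show ?thesis
    proof (cases "wt I a e = 0")
      case True
      then have "\<alpha> = - \<beta> * X ^ wt I b e" using s by (simp add: add_eq_0_iff2)
      then have "x = zs P (- \<beta>) (\<kappa> e)" unfolding zk ab using True by simp
      then show ?thesis by blast
    next
      case False
      then have b0: "wt I b e = 0" using tops[OF e] by simp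
      then have "\<beta> = \<alpha> * - (X ^ wt I a e)" using s by (simp add: add_eq_0_iff)
      then have "x = zs P \<alpha> (\<kappa> e)" unfolding zk ab using b0 by simp
      then show ?thesis by blast
    qed
  qed
  have injD: "z = z'" if e: "e \<in> V" and eq: "f (single e z) = f (single e z')" for e z z'
  proof -
    have "single e z = single e z'" using inj e eq by (auto simp: inj_on_def)
    then have "single e z e = single e z' e" by simp
    then show ?thesis by (simp add: single_def)
  qed
  have fz: "f (single e (z * z')) = zs P z (f (single e z'))" if "e \<in> V" for e z z'
    using that by (simp add: hom_zs[OF f, symmetric] L_zs_single[OF kJ])
  \<comment> \<open>The relation and the image of \<open>single e 1\<close> both generate the
    component of the kernel at \<open>e\<close>, so they differ by a unit, which cannot influence
    the orders compared at the end.\<close>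
  have unit: "\<exists>u. \<kappa> e = f (single e u) \<and> u $ 0 \<noteq> 0" if e: "e \<in> V" for e
  proof -
    have "\<kappa> e \<in> f ` carrier (L J)" unfolding im ker using kc[OF e] pk[OF e] by simp
    then obtain x where x: "x \<in> carrier (L J)" "\<kappa> e = f x" by blast
    have "\<kappa> e = qa P e e (f x)" using kk[OF e] x(2) by simp
    also have "\<dots> = f (single e (x e))" using x(1) e by (simp add: hom_qa[OF f, symmetric] L_qa_eq[OF kJ])
    finally have u: "\<kappa> e = f (single e (x e))" .
    have fe: "f (single e 1) \<in> carrier P" using hom_in[OF f] e by simp
    have "f (single e 1) \<in> a_kernel P (L I) p" unfolding im[symmetric] using e by simp
    then have "p (f (single e 1)) = \<zero>\<^bsub>L I\<^esub>" by (simp add: ker)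
    moreover have "qa P e e (f (single e 1)) = f (single e 1)"
      using e by (simp add: hom_qa[OF f, symmetric] L_qa_single[OF kJ])
    ultimately obtain z where z: "f (single e 1) = zs P z (\<kappa> e)" using gen_ker[OF fe _ _ e] by blast
    have "f (single e 1) = f (single e (z * x e))" unfolding fz[OF e] using z u by simp
    then have "1 = z * x e" by (rule injD[OF e])
    then have "(z * x e) $ 0 = 1" by simp
    then have "x e $ 0 \<noteq> 0" by auto
    then show ?thesis using u by blast
  qed
  obtain u where u: "\<kappa> c = f (single c u)" "u $ 0 \<noteq> 0" using unit[OF cV] by blast
  obtain u' where u': "\<kappa> d = f (single d u')" "u' $ 0 \<noteq> 0" using unit[OF dV] by blast
  let ?A = "wt I a" and ?B = "wt I b"
  \<comment> \<open>The path from \<open>c\<close> to \<open>d\<close> takes the relation at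
    \<open>c\<close> to a multiple of the one at \<open>d\<close>. The extra power on the left
    avoids a negative exponent.\<close>
  have "zs P (X ^ (?A d + ?B d)) (qa P c d (\<kappa> c)) = zs P (X ^ (?A c + ?B c + wt I c d)) (\<kappa> d)"
  proof -
    have e1: "?A d + ?B d + (?B c + tri a c d) = ?A c + ?B c + wt I c d + ?B d"
      using wt_tri[OF kI aV cV dV] by simp
    have e2: "?A d + ?B d + (?A c + tri b c d) = ?A c + ?B c + wt I c d + ?A d"
      using wt_tri[OF kI bV cV dV] by simp
    have "zs P (X ^ (?A d + ?B d)) (qa P c d (\<kappa> c)) =
      zs P (X ^ (?A d + ?B d + (?B c + tri a c d))) (qa P a d y1) \<oplus>\<^bsub>P\<^esub> zs P (- (X ^ (?A d + ?B d + (?A c + tri b c d)))) (qa P b d y2)"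
      unfolding kq[OF cV dV] using y1(1) y2(1) aV bV by (simp add: zs_add[OF P] Pin zs_zs[OF P] power_add)
    also have "\<dots> = zs P (X ^ (?A c + ?B c + wt I c d)) (\<kappa> d)"
      unfolding e1 e2 \<kappa>_def using y1(1) y2(1) aV bV by (simp add: zs_add[OF P] Pin zs_zs[OF P] power_add)
    finally show ?thesis .
  qed
  moreover have "qa P c d (\<kappa> c) = f (single d (X ^ wt J c d * u))"
    unfolding u(1) using cV dV by (simp add: hom_qa[OF f, symmetric] L_qa_single[OF kJ])
  ultimately have "f (single d (X ^ (?A d + ?B d) * (X ^ wt J c d * u))) = f (single d (X ^ (?A c + ?B c + wt I c d) * u'))"
    unfolding fz[OF dV] using u'(1) fz[OF dV, of "X ^ wt J c d" u] by simp
  then have "X ^ (?A d + ?B d) * (X ^ wt J c d * u) = X ^ (?A c + ?B c + wt I c d) * u'" by (rule injD[OF dV])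
  then have "X ^ (wt J c d + (?A d + ?B d)) * u = X ^ (wt I c d + (?A c + ?B c)) * u'"
    by (simp add: power_add mult_ac)
  moreover have "subdegree (X ^ m * y) = m" if "y $ 0 \<noteq> 0" for m and y :: "complex fps"
    using that by (intro subdegreeI) (simp_all add: fps_X_power_mult_nth)
  ultimately show ?thesis using u(2) u'(2) by metis
qed

text \<open>The weight of a single forward step tells whether its target lies in \<open>T\<close>,
  so the weights determine the subset.\<close>

lemma wt_step: "1 < n \<Longrightarrow> c \<in> V \<Longrightarrow> wt T ((c - 1) mod int n) c = (if c \<in> T then 0 else 1)"
proof -
  assume n: "1 < n" and c: "c \<in> V"
  have "(c - (c - 1) mod int n) mod int n = 1" using n by (simp add: mod_simps)
  then have "qword ((c - 1) mod int n) c = [Fwd]" using k_pos by (simp add: canonical_word_def)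
  moreover have "((c - 1) mod int n + 1) mod int n = c" using c by (simp add: mod_simps V_mod)
  ultimately show ?thesis by (simp add: canonical_weight_def)
qed

end


section \<open>Numerical data of the subsets\<close>

text \<open>An element whose predecessor is missing starts one of the two intervals. So three such
  elements rule out that a set is almost consecutive.\<close>

lemma almost_consecutive_left_ends:
  assumes "almost_consecutive n T"
  shows "\<exists>a b. \<forall>c\<in>T. (c - 1) mod int n \<notin> T \<longrightarrow> c = a \<or> c = b"
proof -
  obtain i j m where T: "T = mod_set n ({i} \<union> {j..j + int m - 1})"
    using assms by (auto simp: almost_consecutive_def)
  have ends: "c = i mod int n \<or> c = j mod int n" if c: "c \<in> T" "(c - 1) mod int n \<notin> T" for c
  proof -
    obtain x where x: "x \<in> {i} \<union> {j..j + int m - 1}" "c = x mod int n" using c(1) unfolding T mod_set_def by blast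
    have "(x - 1) mod int n \<notin> T" using c(2) x(2) by (simp add: mod_simps)
    then have "x - 1 \<notin> {i} \<union> {j..j + int m - 1}" unfolding T mod_set_def by blast
    then have "x = i \<or> x = j" using x(1) by auto
    then show ?thesis using x(2) by blast
  qed
  show ?thesis by (intro exI[of _ "i mod int n"] exI[of _ "j mod int n"] ballI impI) (rule ends)
qed

text \<open>The vertex \<open>i + s\<close> is represented by \<open>s\<close>; a gauge counts the elements of a subset up to \<open>s\<close>.\<close>

locale ar_numbers = kn +
  fixes i r :: int
  assumes k2: "1 < k" and nk: "2 * k \<le> n" and r2: "2 \<le> r" and rn: "r \<le> int n - int k"
begin

section \<open>Cyclic coordinates relative to the isolated element of I\<close>

definition nd :: "int \<Rightarrow> int" where "nd s = (i + s) mod int n"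
definition idx :: "int \<Rightarrow> int" where "idx c = (c - i) mod int n"

lemma nd_in [simp]: "nd s \<in> V" by (simp add: nd_def)

lemma idx_bounds: "0 \<le> idx c" "idx c < int n" using n_pos by (simp_all add: idx_def)

lemma nd_idx: "c \<in> V \<Longrightarrow> nd (idx c) = c"
  by (simp add: nd_def idx_def mod_simps V_mod)

lemma idx_nd: "idx (nd s) = s mod int n"
  by (simp add: nd_def idx_def mod_simps)

lemma nd_periodic: "nd (s + int n) = nd s" "nd (s - int n) = nd s"
  using mod_add_self2[of "i + s" "int n"] minus_mod_self2[of "i + s" "int n"]
  by (simp_all add: nd_def add_diff_eq add.assoc)

lemma nd_pred: "(nd s - 1) mod int n = nd (s - 1)"
  by (simp add: nd_def mod_simps add_diff_eq)

lemma nd_inj: "nd s = nd t \<Longrightarrow> \<bar>s - t\<bar> < int n \<Longrightarrow> s = t"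
proof -
  assume e: "nd s = nd t" and l: "\<bar>s - t\<bar> < int n"
  have "int n dvd (i + s) - (i + t)" using e unfolding nd_def by (simp add: mod_eq_dvd_iff)
  then have "int n dvd s - t" by simp
  then show "s = t" using l zdvd_imp_le[of "int n" "\<bar>s - t\<bar>"] by (cases "s = t") auto
qed

lemma nd_mem:
  assumes D: "D \<subseteq> {0..<int n}"
  shows "0 \<le> s \<Longrightarrow> s < int n \<Longrightarrow> nd s \<in> nd ` D \<longleftrightarrow> s \<in> D"
    and "int n \<le> s \<Longrightarrow> s < 2 * int n \<Longrightarrow> nd s \<in> nd ` D \<longleftrightarrow> s - int n \<in> D"
    and "- int n \<le> s \<Longrightarrow> s < 0 \<Longrightarrow> nd s \<in> nd ` D \<longleftrightarrow> s + int n \<in> D"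
proof -
  have 1: "nd s \<in> nd ` D \<longleftrightarrow> s \<in> D" if "0 \<le> s" "s < int n" for s
  proof
    assume "nd s \<in> nd ` D"
    then obtain t where t: "t \<in> D" "nd s = nd t" by blast
    then have "\<bar>s - t\<bar> < int n" using that D by (auto simp: abs_less_iff)
    then show "s \<in> D" using nd_inj[OF t(2)] t(1) by simp
  qed simp
  show "0 \<le> s \<Longrightarrow> s < int n \<Longrightarrow> nd s \<in> nd ` D \<longleftrightarrow> s \<in> D" by (rule 1)
  show "int n \<le> s \<Longrightarrow> s < 2 * int n \<Longrightarrow> nd s \<in> nd ` D \<longleftrightarrow> s - int n \<in> D"
    using 1[of "s - int n"] by (simp add: nd_periodic)
  show "- int n \<le> s \<Longrightarrow> s < 0 \<Longrightarrow> nd s \<in> nd ` D \<longleftrightarrow> s + int n \<in> D"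
    using 1[of "s + int n"] by (simp add: nd_periodic)
qed

lemma nd_notin: "D \<subseteq> {0..<int n} \<Longrightarrow> 0 \<le> s \<Longrightarrow> s < int n \<Longrightarrow> s \<notin> D \<Longrightarrow> nd s \<notin> nd ` D"
  by (simp add: nd_mem(1))

lemma nd_kset:
  assumes D: "D \<subseteq> {0..<int n}" and c: "card D = k"
  shows "kset (nd ` D)"
proof -
  have "inj_on nd D"
  proof (rule inj_onI)
    fix s t assume st: "s \<in> D" "t \<in> D" and e: "nd s = nd t"
    have "0 \<le> s" "s < int n" "0 \<le> t" "t < int n" using st D by auto
    then have "\<bar>s - t\<bar> < int n" by linarith
    then show "s = t" by (rule nd_inj[OF e])
  qed
  then show ?thesis using c by (auto simp: kset_def card_image)
qed

section \<open>Gauges and profiles of the subsets\<close>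

definition gauge :: "int set \<Rightarrow> (int \<Rightarrow> int) \<Rightarrow> bool" where
  "gauge D g \<longleftrightarrow> (\<forall>s. 1 \<le> s \<and> s < int n \<longrightarrow> g s = g (s - 1) + (if s \<in> D then 1 else 0)) \<and>
     g 0 + int k = g (int n - 1) + (if 0 \<in> D then 1 else 0)"

text \<open>Closed forms of the counting functions. The additive constants position the modules
  inside \<open>L S\<close>: with them \<open>gI\<close> is the maximum of \<open>g1\<close> and
  \<open>g2\<close>, \<open>gJ\<close> that of \<open>g3\<close> and \<open>g4\<close>, and
  \<open>g1\<close> exceeds \<open>gJ\<close> by one at 0, as does \<open>g2\<close> at r + k -
  2.\<close>

definition g1 :: "int \<Rightarrow> int" where "g1 s = max (s - (int n - int k)) 0"
definition g2 :: "int \<Rightarrow> int" where "g2 s = min (max (s - r + 2) 0) (int k) - 1"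
definition g3 :: "int \<Rightarrow> int" where "g3 s = min s (int k - 1) - 1"
definition g4 :: "int \<Rightarrow> int" where "g4 s = min (max (s - r + 1) 0) (int k) - 1"
definition gI :: "int \<Rightarrow> int" where "gI s = min (max (s - r + 1) 0) (int k - 1)"
definition gJ :: "int \<Rightarrow> int" where "gJ s = min s (int k - 1) - 1 + (if r + int k - 1 \<le> s then 1 else 0)"

text \<open>\<open>D1\<close> and \<open>D2\<close> are the cyclic intervals ending at the valleys 0
  and r + k - 2 of I. \<open>D3\<close> and \<open>D4\<close> begin right after the peaks - 1 and r
  - 1 of I and end at the valleys k - 1 and r + k - 1 of J, so their projectives serve both as a
  cover of \<open>L I\<close> and as a hull of \<open>L J\<close>.\<close>

definition D1 :: "int set" where "D1 = {0} \<union> {int n - int k + 1..int n - 1}"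
definition D2 :: "int set" where "D2 = {r - 1..r + int k - 2}"
definition D3 :: "int set" where "D3 = {0..int k - 1}"
definition D4 :: "int set" where "D4 = {r..r + int k - 1}"
definition DI :: "int set" where "DI = {0} \<union> {r..r + int k - 2}"
definition DJ :: "int set" where "DJ = {1..int k - 1} \<union> {r + int k - 1}"
definition DX :: "int set" where "DX = {1} \<union> {r..r + int k - 3} \<union> {r + int k - 1}"
definition DY :: "int set" where "DY = {0} \<union> {2..int k - 1} \<union> {r + int k - 2}"

lemmas D_defs = D1_def D2_def D3_def D4_def DI_def DJ_def DX_def DY_def
lemmas g_defs = g1_def g2_def g3_def g4_def gI_def gJ_def

lemma bounds: "2 \<le> int k" "2 * int k \<le> int n" "2 \<le> r" "r + int k \<le> int n"
  using k2 nk r2 rn by linarith+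

lemma D_sub: "D1 \<subseteq> {0..<int n}" "D2 \<subseteq> {0..<int n}" "D3 \<subseteq> {0..<int n}" "D4 \<subseteq> {0..<int n}"
  "DI \<subseteq> {0..<int n}" "DJ \<subseteq> {0..<int n}" "DX \<subseteq> {0..<int n}" "DY \<subseteq> {0..<int n}"
  using bounds by (auto simp: D_defs)

lemma D_card: "card D1 = k" "card D2 = k" "card D3 = k" "card D4 = k" "card DI = k" "card DJ = k" "card DX = k" "card DY = k"
proof -
  show "card D2 = k" "card D3 = k" "card D4 = k" by (simp_all add: D_defs)
  have "card D1 = Suc (card {int n - int k + 1..int n - 1})"
    unfolding D1_def using bounds by (simp add: card_insert_if)
  then show "card D1 = k" using bounds by simp
  have "card DI = Suc (card {r..r + int k - 2})" unfolding DI_def using bounds by (simp add: card_insert_if)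
  then show "card DI = k" using bounds by simp
  have "DJ = insert (r + int k - 1) {1..int k - 1}" by (auto simp: DJ_def)
  then have "card DJ = Suc (card {1..int k - 1})" using bounds by (simp add: card_insert_if)
  then show "card DJ = k" using bounds by simp
  have "DX = insert 1 (insert (r + int k - 1) {r..r + int k - 3})" by (auto simp: DX_def)
  then have "card DX = Suc (Suc (card {r..r + int k - 3}))" using bounds by (simp add: card_insert_if)
  then show "card DX = k" using bounds by simp
  have "DY = insert 0 (insert (r + int k - 2) {2..int k - 1})" by (auto simp: DY_def)
  then have "card DY = Suc (Suc (card {2..int k - 1}))" using bounds by (simp add: card_insert_if)
  then show "card DY = k" using bounds by simp
qed

lemma gauges: "gauge D1 g1" "gauge D2 g2" "gauge D3 g3" "gauge D4 g4" "gauge DI gI" "gauge DJ gJ"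
  "gauge DX (\<lambda>s. min (gI s) (gJ s))" "gauge DY (\<lambda>s. max (gI s) (gJ s))"
  using bounds unfolding gauge_def D_defs g_defs
  by (auto simp: min_def max_def)

lemma g_bounds: "0 \<le> s \<Longrightarrow> s < int n \<Longrightarrow> 0 \<le> g1 s \<and> g1 s \<le> int k - 1"
  "0 \<le> s \<Longrightarrow> - 1 \<le> g2 s" "0 \<le> s \<Longrightarrow> - 1 \<le> g3 s" "0 \<le> s \<Longrightarrow> - 1 \<le> g4 s" "0 \<le> s \<Longrightarrow> 0 \<le> gI s" "0 \<le> s \<Longrightarrow> - 1 \<le> gJ s"
  using bounds unfolding g_defs by (auto simp: min_def max_def)

text \<open>The difference of two gauges is a profile up to a constant. The summand k + 1 keeps it a
  natural number, as \<open>g1\<close> is at most k - 1 and the gauges in use are at least -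
  1.\<close>

definition pr :: "(int \<Rightarrow> int) \<Rightarrow> int \<Rightarrow> nat" where
  "pr g c = nat (int k + 1 + g (idx c) - g1 (idx c))"

lemma pr_int:
  assumes "- 1 \<le> g (idx c)"
  shows "int (pr g c) = int k + 1 + g (idx c) - g1 (idx c)"
  using assms g_bounds(1)[OF idx_bounds, of c] by (simp add: pr_def)

lemma pr_profile:
  assumes D: "D \<subseteq> {0..<int n}" and g: "gauge D g" and b: "\<And>s. 0 \<le> s \<Longrightarrow> - 1 \<le> g s"
  shows "profile n (nd ` D) (nd ` D1) (pr g)"
  unfolding profile_def
proof
  fix c assume c: "c \<in> V"
  let ?s = "idx c"
  have sb: "0 \<le> ?s" "?s < int n" by (rule idx_bounds)+
  have mem: "c \<in> nd ` D \<longleftrightarrow> ?s \<in> D" "c \<in> nd ` D1 \<longleftrightarrow> ?s \<in> D1"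
    using nd_mem(1)[OF D sb] nd_mem(1)[OF D_sub(1) sb] nd_idx[OF c] by simp_all
  have pred: "(c - 1) mod int n = nd (?s - 1)" using nd_pred[of ?s] nd_idx[OF c] by simp
  have ip: "idx ((c - 1) mod int n) = (if 1 \<le> ?s then ?s - 1 else int n - 1)"
  proof (cases "1 \<le> ?s")
    case True
    then show ?thesis using sb by (simp add: pred idx_nd)
  next
    case False
    then have "?s = 0" using sb by simp
    then have "idx ((c - 1) mod int n) = (- 1) mod int n" by (simp add: pred idx_nd)
    also have "\<dots> = int n - 1" using n_pos by (simp add: zmod_minus1)
    finally show ?thesis using False by simp
  qed
  \<comment> \<open>Every gauge drops by the same k at index 0, so the drop cancels in the
    difference.\<close>
  have step: "h ?s = h (idx ((c - 1) mod int n)) + (if ?s \<in> D' then 1 else 0) - (if 1 \<le> ?s then 0 else int k)"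
    if "gauge D' h" for D' h
  proof (cases "1 \<le> ?s")
    case True
    then show ?thesis using that sb unfolding gauge_def ip by simp
  next
    case False
    then have "?s = 0" using sb by simp
    then show ?thesis using that unfolding gauge_def ip by simp
  qed
  have "int (pr g c + (if c \<in> nd ` D1 then 1 else 0)) = int (pr g ((c - 1) mod int n) + (if c \<in> nd ` D then 1 else 0))"
    using step[OF g] step[OF gauges(1)] mem pr_int[of g c, OF b[OF idx_bounds(1)]] pr_int[of g "(c - 1) mod int n", OF b[OF idx_bounds(1)]]
    by simp
  then show "pr g c + (if c \<in> nd ` D1 then 1 else 0) = pr g ((c - 1) mod int n) + (if c \<in> nd ` D then 1 else 0)"
    by (simp only: of_nat_eq_iff)
qed

section \<open>Paths of weight zero to valleys and from peaks\<close>

lemma wt_zero_forward: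
  assumes T: "kset T" and le: "s \<le> t" and m: "\<And>m. s < m \<Longrightarrow> m \<le> t \<Longrightarrow> nd m \<in> T"
  shows "wt T (nd s) (nd t) = 0"
proof -
  have "pw T (nd s) (replicate d Fwd) = 0 \<and> pt (nd s) (replicate d Fwd) = nd (s + int d)"
    if "\<And>m. s < m \<Longrightarrow> m \<le> s + int d \<Longrightarrow> nd m \<in> T" for d s
    using that
  proof (induction d arbitrary: s)
    case (Suc d)
    have e: "(nd s + 1) mod int n = nd (s + 1)" by (simp add: nd_def mod_simps add.assoc)
    have "nd (s + 1) \<in> T" using Suc.prems by simp
    then show ?case using Suc.IH[of "s + 1"] Suc.prems e by (simp add: add.assoc)
  qed simp
  from this[of s "nat (t - s)"] have "pw T (nd s) (replicate (nat (t - s)) Fwd) = 0"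
    "pt (nd s) (replicate (nat (t - s)) Fwd) = nd t" using le m by auto
  then show ?thesis using wt_le[OF T nd_in nd_in, of s "replicate (nat (t - s)) Fwd" t] by simp
qed

lemma wt_zero_backward:
  assumes T: "kset T" and le: "t \<le> s" and m: "\<And>m. t < m \<Longrightarrow> m \<le> s \<Longrightarrow> nd m \<notin> T"
  shows "wt T (nd s) (nd t) = 0"
proof -
  have *: "pw T (nd s) (replicate d Bwd) = 0 \<and> pt (nd s) (replicate d Bwd) = nd (s - int d)"
    if "\<And>m. s - int d < m \<Longrightarrow> m \<le> s \<Longrightarrow> nd m \<notin> T" for d s
    using that
  proof (induction d arbitrary: s)
    case (Suc d)
    have "nd s \<notin> T" using Suc.prems by simp
    then show ?case using Suc.IH[of "s - 1"] Suc.prems nd_pred[of s] by (simp add: diff_diff_eq add.commute)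
  qed simp
  from *[of s "nat (s - t)"] have "pw T (nd s) (replicate (nat (s - t)) Bwd) = 0"
    "pt (nd s) (replicate (nat (s - t)) Bwd) = nd t" using le m by auto
  then show ?thesis using wt_le[OF T nd_in nd_in, of s "replicate (nat (s - t)) Bwd" t] by simp
qed

lemma ksets: "kset (nd ` D1)" "kset (nd ` D2)" "kset (nd ` D3)" "kset (nd ` D4)" "kset (nd ` DI)" "kset (nd ` DJ)"
  "kset (nd ` DX)" "kset (nd ` DY)"
  by (rule nd_kset[OF D_sub(1) D_card(1)] nd_kset[OF D_sub(2) D_card(2)] nd_kset[OF D_sub(3) D_card(3)]
      nd_kset[OF D_sub(4) D_card(4)] nd_kset[OF D_sub(5) D_card(5)] nd_kset[OF D_sub(6) D_card(6)]
      nd_kset[OF D_sub(7) D_card(7)] nd_kset[OF D_sub(8) D_card(8)])+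

lemma range_mem:
  assumes "D \<subseteq> {0..<int n}" "0 \<le> m" "m < 2 * int n"
  shows "nd m \<in> nd ` D \<longleftrightarrow> (if m < int n then m \<in> D else m - int n \<in> D)"
  using nd_mem(1,2)[OF assms(1), of m] assms by auto

lemma wt_D_forward:
  assumes "D \<subseteq> {0..<int n}" "card D = k" and "- 1 \<le> s" "s \<le> t" "t < 2 * int n"
    and m: "\<And>m. s < m \<Longrightarrow> m \<le> t \<Longrightarrow> if m < int n then m \<in> D else m - int n \<in> D"
  shows "wt (nd ` D) (nd s) (nd t) = 0"
proof (rule wt_zero_forward[OF nd_kset[OF assms(1,2)] assms(4)])
  fix m assume "s < m" "m \<le> t"
  then show "nd m \<in> nd ` D" using m[of m] assms(3,5) range_mem[OF assms(1), of m] by simp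
qed

lemma wt_D_backward:
  assumes "D \<subseteq> {0..<int n}" "card D = k" and "- 1 \<le> t" "t \<le> s" "s < 2 * int n"
    and m: "\<And>m. t < m \<Longrightarrow> m \<le> s \<Longrightarrow> if m < int n then m \<notin> D else m - int n \<notin> D"
  shows "wt (nd ` D) (nd s) (nd t) = 0"
proof (rule wt_zero_backward[OF nd_kset[OF assms(1,2)] assms(4)])
  fix m assume "t < m" "m \<le> s"
  then show "nd m \<notin> nd ` D" using m[of m] assms(3,5) range_mem[OF assms(1), of m] by (simp split: if_splits)
qed

lemma valley_D1: "c \<in> V \<Longrightarrow> wt (nd ` D1) c (nd 0) = 0"
proof -
  assume c: "c \<in> V"
  let ?s = "idx c"
  have sb: "0 \<le> ?s" "?s < int n" by (rule idx_bounds)+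
  have "wt (nd ` D1) (nd ?s) (nd 0) = 0"
  proof (cases "int n - int k \<le> ?s")
    case True
    have "wt (nd ` D1) (nd ?s) (nd (int n)) = 0"
      using True sb bounds by (intro wt_D_forward D_sub D_card) (auto simp: D1_def)
    then show ?thesis using nd_periodic(1)[of 0] by simp
  next
    case False
    then show ?thesis
      using sb bounds by (intro wt_D_backward D_sub D_card) (auto simp: D1_def)
  qed
  then show "wt (nd ` D1) c (nd 0) = 0" using nd_idx[OF c] by simp
qed

text \<open>From the interval and the vertex just before it one walks forward through elements of
  \<open>D\<close>, from everywhere else backward through non-elements. Indices further to the left
  are first raised by n.\<close>

lemma valley_interval:
  assumes D: "D = {a..a + int k - 1}" "0 \<le> a" "a + int k \<le> int n" and c: "c \<in> V"
  shows "wt (nd ` D) c (nd (a + int k - 1)) = 0"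
proof -
  have Ds: "D \<subseteq> {0..<int n}" using D by auto
  have Dc: "card D = k" by (simp add: D)
  let ?s = "idx c"
  have sb: "0 \<le> ?s" "?s < int n" by (rule idx_bounds)+
  have "wt (nd ` D) (nd ?s) (nd (a + int k - 1)) = 0"
  proof (cases "a - 1 \<le> ?s")
    case True
    show ?thesis
    proof (cases "?s \<le> a + int k - 1")
      case le: True
      show ?thesis using le True sb D by (intro wt_D_forward Ds Dc) auto
    next
      case False
      then show ?thesis using sb D by (intro wt_D_backward Ds Dc) auto
    qed
  next
    case False
    have "wt (nd ` D) (nd (?s + int n)) (nd (a + int k - 1)) = 0"
      using False sb D by (intro wt_D_backward Ds Dc) auto
    then show ?thesis by (simp add: nd_periodic)
  qed
  then show ?thesis using nd_idx[OF c] by simp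
qed

lemma peak_interval:
  assumes D: "D = {a..a + int k - 1}" "0 \<le> a" "a + int k \<le> int n" and c: "c \<in> V"
  shows "wt (nd ` D) (nd (a - 1)) c = 0"
proof -
  have Ds: "D \<subseteq> {0..<int n}" using D by auto
  have Dc: "card D = k" by (simp add: D)
  let ?s = "idx c"
  have sb: "0 \<le> ?s" "?s < int n" by (rule idx_bounds)+
  have "wt (nd ` D) (nd (a - 1)) (nd ?s) = 0"
  proof (cases "a - 1 \<le> ?s")
    case True
    show ?thesis
    proof (cases "?s \<le> a + int k - 1")
      case le: True
      show ?thesis using le True sb D by (intro wt_D_forward Ds Dc) auto
    next
      case False
      have "wt (nd ` D) (nd (a - 1 + int n)) (nd ?s) = 0"
        using False sb D by (intro wt_D_backward Ds Dc) auto
      then show ?thesis by (simp only: nd_periodic)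
    qed
  next
    case False
    then show ?thesis using sb D by (intro wt_D_backward Ds Dc) auto
  qed
  then show ?thesis using nd_idx[OF c] by simp
qed

lemma peaks_J:
  assumes c: "c \<in> V"
  shows "wt (nd ` DJ) (nd 0) c = 0 \<or> wt (nd ` DJ) (nd (r + int k - 2)) c = 0"
proof -
  let ?s = "idx c"
  have sb: "0 \<le> ?s" "?s < int n" by (rule idx_bounds)+
  consider "?s \<le> int k - 1" | "int k - 1 < ?s" "?s \<le> r + int k - 2" | "r + int k - 2 < ?s" by linarith
  then have "wt (nd ` DJ) (nd 0) (nd ?s) = 0 \<or> wt (nd ` DJ) (nd (r + int k - 2)) (nd ?s) = 0"
  proof cases
    case 1
    then have "wt (nd ` DJ) (nd 0) (nd ?s) = 0"
      using sb bounds by (intro wt_D_forward D_sub D_card) (auto simp: DJ_def)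
    then show ?thesis ..
  next
    case 2
    then have "wt (nd ` DJ) (nd (r + int k - 2)) (nd ?s) = 0"
      using sb bounds by (intro wt_D_backward D_sub D_card) (auto simp: DJ_def)
    then show ?thesis ..
  next
    case 3
    then have "wt (nd ` DJ) (nd (int n)) (nd ?s) = 0"
      using sb bounds by (intro wt_D_backward D_sub D_card) (auto simp: DJ_def)
    then show ?thesis using nd_periodic(1)[of 0] by simp
  qed
  then show ?thesis using nd_idx[OF c] by simp
qed

lemma tops_I:
  assumes c: "c \<in> V"
  shows "wt (nd ` DI) (nd (- 1)) c = 0 \<or> wt (nd ` DI) (nd (r - 1)) c = 0"
proof -
  let ?s = "idx c"
  have sb: "0 \<le> ?s" "?s < int n" by (rule idx_bounds)+
  consider "?s = 0" | "1 \<le> ?s" "?s \<le> r - 1" | "r - 1 < ?s" "?s \<le> r + int k - 2" | "r + int k - 2 < ?s"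
    using sb by linarith
  then have "wt (nd ` DI) (nd (- 1)) (nd ?s) = 0 \<or> wt (nd ` DI) (nd (r - 1)) (nd ?s) = 0"
  proof cases
    case 1
    then have "wt (nd ` DI) (nd (- 1)) (nd ?s) = 0"
      using bounds by (intro wt_D_forward D_sub D_card) (auto simp: DI_def)
    then show ?thesis ..
  next
    case 2
    then have "wt (nd ` DI) (nd (r - 1)) (nd ?s) = 0"
      using sb bounds by (intro wt_D_backward D_sub D_card) (auto simp: DI_def)
    then show ?thesis ..
  next
    case 3
    then have "wt (nd ` DI) (nd (r - 1)) (nd ?s) = 0"
      using sb bounds by (intro wt_D_forward D_sub D_card) (auto simp: DI_def)
    then show ?thesis ..
  next
    case 4
    then have "wt (nd ` DI) (nd (- 1 + int n)) (nd ?s) = 0"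
      using sb bounds by (intro wt_D_backward D_sub D_card) (auto simp: DI_def)
    then show ?thesis using nd_periodic(1)[of "- 1"] by simp
  qed
  then show ?thesis using nd_idx[OF c] by simp
qed

lemma idx_small: "0 \<le> s \<Longrightarrow> s < int n \<Longrightarrow> idx (nd s) = s"
  by (simp add: idx_nd)

abbreviation "SS \<equiv> nd ` D1"

lemma g1_ge: "0 \<le> s \<Longrightarrow> - 1 \<le> g1 s" by (simp add: g1_def)

lemmas prof = pr_profile[OF D_sub(1) gauges(1) g1_ge] pr_profile[OF D_sub(2) gauges(2) g_bounds(2)]
  pr_profile[OF D_sub(3) gauges(3) g_bounds(3)] pr_profile[OF D_sub(4) gauges(4) g_bounds(4)]
  pr_profile[OF D_sub(5) gauges(5) order_trans[OF _ g_bounds(5)]] pr_profile[OF D_sub(6) gauges(6) g_bounds(6)]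

text \<open>The profiles turn the axioms on exponents into statements about maxima and minima of
  linear functions of an index. The vertex \<open>v0\<close> is the peak r - 1 of I, where
  \<open>g1\<close> and \<open>g2\<close> are both 0.\<close>

lemma ar_data: "ar_data n k SS (nd ` DI) (nd ` DJ) (pr g1) (pr g2) (pr g3) (pr g4) (pr gI) (pr gJ)
  (nd 0) (nd (r + int k - 2)) (nd (int k - 1)) (nd (r + int k - 1)) (nd (r - 1))"
proof (unfold_locales)
  have ix: "idx (nd 0) = 0" "idx (nd (r + int k - 2)) = r + int k - 2"
    "idx (nd (r + int k - 1)) = r + int k - 1" "idx (nd (r - 1)) = r - 1"
    using bounds by (simp_all add: idx_small)
  show "kset SS" "kset (nd ` DI)" "kset (nd ` DJ)" by (rule ksets)+
  show "profile n (nd ` DI) SS (pr gI)" "profile n (nd ` DJ) SS (pr gJ)"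
    using prof(5,6) by simp_all
  show "nd 0 \<in> V" "nd (r + int k - 2) \<in> V" "nd (int k - 1) \<in> V" "nd (r + int k - 1) \<in> V" "nd (r - 1) \<in> V" by simp_all
  fix c assume c: "c \<in> V"
  show "pr g1 c + wt SS c (nd 0) = pr g1 (nd 0)"
    using wt_profile[OF prof(1) c nd_in, of 0] valley_D1[OF c] by simp
  have "wt (nd ` D2) c (nd (r + int k - 2)) = 0"
    using valley_interval[of D2 "r - 1", OF _ _ _ c] bounds by (simp add: D2_def)
  then show "pr g2 c + wt SS c (nd (r + int k - 2)) = pr g2 (nd (r + int k - 2))"
    using wt_profile[OF prof(2) c nd_in, of "r + int k - 2"] by simp
  have "wt (nd ` D3) c (nd (int k - 1)) = 0"
    using valley_interval[of D3 0, OF _ _ _ c] bounds by (simp add: D3_def)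
  then show "pr g3 c + wt SS c (nd (int k - 1)) = pr g3 (nd (int k - 1))"
    using wt_profile[OF prof(3) c nd_in, of "int k - 1"] by simp
  have "wt (nd ` D4) c (nd (r + int k - 1)) = 0"
    using valley_interval[of D4 r, OF _ _ _ c] bounds by (simp add: D4_def)
  then show "pr g4 c + wt SS c (nd (r + int k - 1)) = pr g4 (nd (r + int k - 1))"
    using wt_profile[OF prof(4) c nd_in, of "r + int k - 1"] by simp
  have sb: "0 \<le> idx c" "idx c < int n" by (rule idx_bounds)+
  have gmax: "gI (idx c) = max (g1 (idx c)) (g2 (idx c))" "gJ (idx c) = max (g3 (idx c)) (g4 (idx c))"
    "g1 (idx c) \<le> gJ (idx c) \<or> g2 (idx c) \<le> gJ (idx c)"
    using sb bounds unfolding g_defs by (auto simp: min_def max_def)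
  show "pr gI c = max (pr g1 c) (pr g2 c)" "pr gJ c = max (pr g3 c) (pr g4 c)"
    "pr g1 c \<le> pr gJ c \<or> pr g2 c \<le> pr gJ c"
    using gmax unfolding pr_def by (auto simp: max_def)
  show "wt (nd ` DJ) (nd 0) c = 0 \<or> wt (nd ` DJ) (nd (r + int k - 2)) c = 0" by (rule peaks_J[OF c])
next
  have ix: "idx (nd 0) = 0" "idx (nd (r + int k - 2)) = r + int k - 2"
    "idx (nd (r + int k - 1)) = r + int k - 1" "idx (nd (r - 1)) = r - 1"
    using bounds by (simp_all add: idx_small)
  show "pr g1 (nd 0) = Suc (pr gJ (nd 0))" "pr g2 (nd 0) = pr gJ (nd 0)" "pr g3 (nd 0) = pr gJ (nd 0)" "pr g4 (nd 0) = pr gJ (nd 0)"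
    using bounds unfolding pr_def ix g_defs by (auto simp: min_def max_def)
  show "pr g2 (nd (r + int k - 2)) = Suc (pr gJ (nd (r + int k - 2)))"
    "pr g1 (nd (r + int k - 2)) \<le> pr gJ (nd (r + int k - 2))"
    "pr g3 (nd (r + int k - 2)) = pr gJ (nd (r + int k - 2))" "pr g4 (nd (r + int k - 2)) = pr gJ (nd (r + int k - 2))"
    using bounds unfolding pr_def ix g_defs by (auto simp: min_def max_def)
  show "pr g4 (nd (r + int k - 1)) = pr gJ (nd (r + int k - 1))" "pr gI (nd (r + int k - 1)) = pr gJ (nd (r + int k - 1))"
    using bounds unfolding pr_def ix g_defs by (auto simp: min_def max_def)
  show "pr g1 (nd (r - 1)) = pr g2 (nd (r - 1))" "pr g1 (nd (r - 1)) \<le> pr gJ (nd (r - 1))"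
    using bounds unfolding pr_def ix g_defs by (auto simp: min_def max_def)
qed

text \<open>By \<open>syzygy_weight\<close> for the tops - 1 and r - 1, the weights of
  \<open>J\<close> are those of the exponent \<open>p3 + p4 - pI\<close>. By \<open>g34\<close> this
  is \<open>pJ\<close> up to a constant, so \<open>J\<close> has the weights of \<open>DJ\<close>,
  and these determine the set.\<close>

lemma J_unique:
  assumes kJ: "kset J" and syz: "is_syzygy B (L J) (L (nd ` DI))"
  shows "J = nd ` DJ"
proof -
  have n1: "1 < n" using bounds by simp
  have pI: "wt (nd ` DI) a c + pr gI c = wt SS a c + pr gI a" if "a \<in> V" "c \<in> V" for a c
    using wt_profile[OF prof(5) that] by simp
  have pJ: "wt (nd ` DJ) a c + pr gJ c = wt SS a c + pr gJ a" if "a \<in> V" "c \<in> V" for a c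
    using wt_profile[OF prof(6) that] by simp
  have p3: "pr g3 c = wt SS (nd (- 1)) c + pr g3 (nd (- 1))" if "c \<in> V" for c
    using wt_profile[OF prof(3) nd_in that, of "- 1"] peak_interval[of D3 0, OF _ _ _ that] bounds
    by (simp add: D3_def)
  have p4: "pr g4 c = wt SS (nd (r - 1)) c + pr g4 (nd (r - 1))" if "c \<in> V" for c
    using wt_profile[OF prof(4) nd_in that, of "r - 1"] peak_interval[of D4 r, OF _ _ _ that] bounds
    by (simp add: D4_def)
  have g34: "int (pr g3 c) + int (pr g4 c) + 1 = int (pr gI c) + int (pr gJ c)" for c
  proof -
    have sb: "0 \<le> idx c" "idx c < int n" by (rule idx_bounds)+
    have "g3 (idx c) + g4 (idx c) + 1 = gI (idx c) + gJ (idx c)"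
      using sb bounds unfolding g_defs by (auto simp: min_def max_def)
    then show ?thesis
      using pr_int[of g3 c, OF g_bounds(3)[OF sb(1)]] pr_int[of g4 c, OF g_bounds(4)[OF sb(1)]]
        pr_int[of gJ c, OF g_bounds(6)[OF sb(1)]] pr_int[of gI c, OF order_trans[OF _ g_bounds(5)[OF sb(1)]]]
      by simp
  qed
  have wt: "wt J c d = wt (nd ` DJ) c d" if c: "c \<in> V" and d: "d \<in> V" for c d
  proof -
    have "wt J c d + (wt (nd ` DI) (nd (- 1)) d + wt (nd ` DI) (nd (r - 1)) d)
      = wt (nd ` DI) c d + (wt (nd ` DI) (nd (- 1)) c + wt (nd ` DI) (nd (r - 1)) c)"
      by (rule syzygy_weight[OF ksets(5) kJ syz nd_in nd_in tops_I c d])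
    then show ?thesis
      using pI[OF nd_in c, of "- 1"] pI[OF nd_in d, of "- 1"] pI[OF nd_in c, of "r - 1"] pI[OF nd_in d, of "r - 1"]
        pI[OF c d] pJ[OF c d] p3[OF c] p3[OF d] p4[OF c] p4[OF d] g34[of c] g34[of d]
      by linarith
  qed
  have "c \<in> J \<longleftrightarrow> c \<in> nd ` DJ" if c: "c \<in> V" for c
  proof -
    have "wt J ((c - 1) mod int n) c = wt (nd ` DJ) ((c - 1) mod int n) c" by (rule wt[OF _ c]) simp
    then show ?thesis unfolding wt_step[OF n1 c] by (simp split: if_splits)
  qed
  then show ?thesis using kJ ksets(6) unfolding kset_def by blast
qed

section \<open>Almost consecutive sets and the shape of X and Y\<close>

lemma almost_consecutiveI:
  assumes m: "1 \<le> m" and T: "T = nd ` ({s} \<union> {a..a + int m - 1})"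
    and sep: "\<And>t. a - 1 \<le> t \<Longrightarrow> t \<le> a + int m \<Longrightarrow> t \<noteq> s \<and> \<bar>t - s\<bar> < int n"
  shows "almost_consecutive n T"
  unfolding almost_consecutive_def
proof (intro exI conjI)
  show "1 \<le> m" by fact
  have "(i + s) mod int n \<noteq> x mod int n" if x: "x \<in> {i + a - 1..i + a + int m}" for x
  proof
    assume e: "(i + s) mod int n = x mod int n"
    have "a - 1 \<le> x - i" "x - i \<le> a + int m" using x by auto
    then have "x - i \<noteq> s" "\<bar>(x - i) - s\<bar> < int n" using sep by blast+
    moreover have "nd (x - i) = nd s" using e by (simp add: nd_def)
    ultimately show False using nd_inj by blast
  qed
  then show "separated n (i + s) (i + a) m" unfolding separated_def mod_set_def by blast
  have "(\<lambda>x. i + x) ` ({s} \<union> {a..a + int m - 1}) = {i + s} \<union> {i + a..i + a + int m - 1}"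
    by (simp add: image_Un algebra_simps)
  from this[symmetric]
  show "T = mod_set n ({i + s} \<union> {i + a..i + a + int m - 1})"
    unfolding T mod_set_def by (simp only: image_image nd_def[abs_def])
qed

lemma not_almost_consecutiveI:
  assumes D: "D \<subseteq> {0..<int n}" and s: "s1 \<in> D" "s2 \<in> D" "s3 \<in> D" "s1 < s2" "s2 < s3"
    and p: "nd (s1 - 1) \<notin> nd ` D" "nd (s2 - 1) \<notin> nd ` D" "nd (s3 - 1) \<notin> nd ` D"
  shows "\<not> almost_consecutive n (nd ` D)"
proof
  assume "almost_consecutive n (nd ` D)"
  then obtain a b where ab: "\<forall>c\<in>nd ` D. (c - 1) mod int n \<notin> nd ` D \<longrightarrow> c = a \<or> c = b"
    using almost_consecutive_left_ends by meson
  have e: "nd s1 = a \<or> nd s1 = b" "nd s2 = a \<or> nd s2 = b" "nd s3 = a \<or> nd s3 = b"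
    using ab[rule_format, OF imageI[OF s(1)]] ab[rule_format, OF imageI[OF s(2)]]
      ab[rule_format, OF imageI[OF s(3)]] p by (simp_all add: nd_pred)
  have l: "0 \<le> s1" "s3 < int n" using s D by auto
  have "nd s1 \<noteq> nd s2" using nd_inj[of s1 s2] s l by linarith
  moreover have "nd s1 \<noteq> nd s3" using nd_inj[of s1 s3] s l by linarith
  moreover have "nd s2 \<noteq> nd s3" using nd_inj[of s2 s3] s l by linarith
  ultimately show False using e by metis
qed

text \<open>For k, r >= 3 the set X has the three left ends 1, r, r + k - 1, and Y has 0, 2, r + k -
  2. For k = 2 both sets are two separate points, and for r = 2 two of the three pieces
  merge.\<close>

lemma almost_X: "almost_consecutive n (nd ` DX) \<longleftrightarrow> k = 2 \<or> r = 2"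
  and almost_Y: "almost_consecutive n (nd ` DY) \<longleftrightarrow> k = 2 \<or> r = 2"
proof -
  have pos: "almost_consecutive n (nd ` DX)" "almost_consecutive n (nd ` DY)" if "k = 2 \<or> r = 2"
  proof -
    show "almost_consecutive n (nd ` DX)"
    proof (cases "k = 2")
      case True
      have "DX = {1} \<union> {r + 1..r + 1 + int 1 - 1}" unfolding DX_def using True bounds by auto
      then show ?thesis
        by (intro almost_consecutiveI[of 1 _ 1 "r + 1"]) (use bounds in \<open>auto simp: abs_less_iff\<close>)
    next
      case False
      then have r: "r = 2" and k3: "3 \<le> int k" using that bounds by auto
      have "DX = {int k + 1} \<union> {1..1 + int (k - 1) - 1}" unfolding DX_def using r k3 by (auto simp: of_nat_diff)
      then show ?thesis
        by (intro almost_consecutiveI[of "k - 1" _ "int k + 1" 1]) (use k3 bounds in \<open>auto simp: abs_less_iff of_nat_diff\<close>)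
    qed
    show "almost_consecutive n (nd ` DY)"
    proof (cases "k = 2")
      case True
      have "DY = {0} \<union> {r..r + int 1 - 1}" unfolding DY_def using True bounds by auto
      then show ?thesis
        by (intro almost_consecutiveI[of 1 _ 0 "r"]) (use bounds in \<open>auto simp: abs_less_iff\<close>)
    next
      case False
      then have r: "r = 2" and k3: "3 \<le> int k" using that bounds by auto
      have "DY = {0} \<union> {2..2 + int (k - 1) - 1}" unfolding DY_def using r k3 by (auto simp: of_nat_diff)
      then show ?thesis
        by (intro almost_consecutiveI[of "k - 1" _ 0 2]) (use k3 bounds in \<open>auto simp: abs_less_iff of_nat_diff\<close>)
    qed
  qed
  have neg: "\<not> almost_consecutive n (nd ` DX)" "\<not> almost_consecutive n (nd ` DY)" if kr: "\<not> (k = 2 \<or> r = 2)"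
  proof -
    have b: "3 \<le> int k" "3 \<le> r" using kr bounds by auto
    show "\<not> almost_consecutive n (nd ` DX)"
      by (rule not_almost_consecutiveI[OF D_sub(7), of 1 r "r + int k - 1"]; (rule nd_notin[OF D_sub(7)])?)
        (use b bounds in \<open>auto simp: DX_def\<close>)
    have "nd (0 - 1) \<notin> nd ` DY"
      using nd_mem(3)[OF D_sub(8), of "0 - 1"] b bounds by (auto simp: DY_def)
    then show "\<not> almost_consecutive n (nd ` DY)"
      by - (rule not_almost_consecutiveI[OF D_sub(8), of 0 2 "r + int k - 2"]; assumption?; (rule nd_notin[OF D_sub(8)])?,
        (use b bounds in \<open>auto simp: DY_def\<close>))
  qed
  show "almost_consecutive n (nd ` DX) \<longleftrightarrow> k = 2 \<or> r = 2" "almost_consecutive n (nd ` DY) \<longleftrightarrow> k = 2 \<or> r = 2"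
    using pos neg by blast+
qed

lemma mset_eq: "mset_set (nd ` DX) + mset_set (nd ` DY) = mset_set (nd ` DI) + mset_set (nd ` DJ)"
proof (rule multiset_eqI)
  fix c
  have fin: "finite DX" "finite DY" "finite DI" "finite DJ" by (simp_all add: D_defs)
  show "count (mset_set (nd ` DX) + mset_set (nd ` DY)) c = count (mset_set (nd ` DI) + mset_set (nd ` DJ)) c"
  proof (cases "c \<in> V")
    case True
    have sb: "0 \<le> idx c" "idx c < int n" by (rule idx_bounds)+
    have mem: "c \<in> nd ` D \<longleftrightarrow> idx c \<in> D" if "D \<subseteq> {0..<int n}" for D
      using nd_mem(1)[OF that sb] nd_idx[OF True] by simp
    show ?thesis using bounds
      by (simp add: count_mset_set' fin mem D_sub) (auto simp: D_defs)
  next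
    case False
    then have "c \<notin> nd ` D" for D by auto
    then show ?thesis by (simp add: count_mset_set')
  qed
qed

section \<open>The theorem in cyclic coordinates\<close>

lemma main:
  assumes kJ: "kset J" and syz: "is_syzygy B (L J) (L (nd ` DI))"
  shows "mset_set (nd ` DX) + mset_set (nd ` DY) = mset_set (nd ` DI) + mset_set J \<and>
    (\<exists>E f g.
       AR_sequence B (CM n k) (L (nd ` DI)) f E g (L J) \<and>
       has_rank n k E 2 \<and>
       (\<exists>u v. short_exact B (L (nd ` DY)) u E v (L (nd ` DX))) \<and>
       rigid B E \<and>
       (indecomposable B E \<longleftrightarrow> \<not> almost_consecutive n (nd ` DX)) \<and>
       (indecomposable B E \<longleftrightarrow> \<not> almost_consecutive n (nd ` DY)))"
proof -
  have J: "J = nd ` DJ" by (rule J_unique[OF kJ syz])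
  interpret ar: ar_data n k SS "nd ` DI" "nd ` DJ" "pr g1" "pr g2" "pr g3" "pr g4" "pr gI" "pr gJ"
    "nd 0" "nd (r + int k - 2)" "nd (int k - 1)" "nd (r + int k - 1)" "nd (r - 1)"
    by (rule ar_data)
  have mm: "(\<lambda>c. min (pr gI c) (pr gJ c)) = pr (\<lambda>s. min (gI s) (gJ s))"
    "(\<lambda>c. max (pr gI c) (pr gJ c)) = pr (\<lambda>s. max (gI s) (gJ s))"
    by (auto simp: pr_def fun_eq_iff min_def max_def)
  have bX: "- 1 \<le> min (gI s) (gJ s)" and bY: "- 1 \<le> max (gI s) (gJ s)" if "0 \<le> s" for s
    using g_bounds(5,6)[OF that] by auto
  have XY: "\<exists>u v. short_exact B (L (nd ` DY)) u ar.E v (L (nd ` DX))"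
    by (rule ar.E_exact_XY[OF ksets(7,8)]; unfold mm)
      (rule pr_profile[OF D_sub(7) gauges(7) bX], simp, rule pr_profile[OF D_sub(8) gauges(8) bY], simp)
  have ind: "indecomposable B ar.E \<longleftrightarrow> \<not> (k = 2 \<or> r = 2)"
  proof
    assume ind: "indecomposable B ar.E"
    show "\<not> (k = 2 \<or> r = 2)"
    proof
      assume kr: "k = 2 \<or> r = 2"
      have "pr gJ c \<le> pr gI c" for c
      proof -
        have sb: "0 \<le> idx c" "idx c < int n" by (rule idx_bounds)+
        have "gJ (idx c) \<le> gI (idx c)" using kr sb bounds unfolding g_defs by (auto simp: min_def max_def)
        then show ?thesis by (simp add: pr_def nat_mono)
      qed
      then show False using ar.E_decomposable ind by blast
    qed
  next
    assume kr: "\<not> (k = 2 \<or> r = 2)"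
    \<comment> \<open>Index 2 witnesses that \<open>L I\<close> is not contained in
      \<open>L J\<close>: for k, r >= 3 one has \<open>gI 2 = 0\<close> and
      \<open>gJ 2 = 1\<close>.\<close>
    have ix: "idx (nd 2) = 2" using bounds by (simp add: idx_small)
    have "pr gI (nd 2) < pr gJ (nd 2)"
      using kr bounds unfolding pr_def ix g_defs by (auto simp: min_def max_def)
    then show "indecomposable B ar.E" using ar.E_indecomposable[OF nd_in] by blast
  qed
  show ?thesis
    unfolding J almost_X almost_Y
    by (rule conjI[OF mset_eq], rule exI[of _ ar.E], rule exI[of _ ar.fE], rule exI[of _ ar.gE])
      (intro conjI; rule ar.E_AR ar.E_rank XY ar.E_rigid ind)
qed

lemma mod_set_nd:
  assumes "(d - i) mod int n = e mod int n"
  shows "mod_set n {d + a..d + b} = nd ` {e + a..e + b}"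
proof -
  have "(x + (d - e)) mod int n = nd x" for x
  proof -
    have "int n dvd (d - i) - e" using assms by (simp add: mod_eq_dvd_iff)
    then have "int n dvd (x + (d - e)) - (i + x)" by (simp add: algebra_simps)
    then show ?thesis by (simp only: nd_def mod_eq_dvd_iff)
  qed
  moreover have "{d + a..d + b} = (\<lambda>x. x + (d - e)) ` {e + a..e + b}" by simp
  ultimately show ?thesis unfolding mod_set_def by (simp only: image_image)
qed

end

theorem theorem1:
  fixes n k :: nat and i j :: int and I J X Y :: "int set"
  assumes "1 < k" and "2 * k \<le> n"
    and "separated n i j (k - 1)"
    and "I = mod_set n ({i} \<union> {j..j + int k - 2})"
    and "J \<subseteq> vertices n" and "card J = k"
    and "is_syzygy (B_alg n k) (L_mod n J) (L_mod n I)"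
    and "X = mod_set n ({i + 1} \<union> {j..j + int k - 3} \<union> {j + int k - 1})"
    and "Y = mod_set n ({i} \<union> {i + 2..i + int k - 1} \<union> {j + int k - 2})"
  shows "mset_set X + mset_set Y = mset_set I + mset_set J \<and>
    (\<exists>E f g.
       AR_sequence (B_alg n k) (CM n k) (L_mod n I) f E g (L_mod n J) \<and>
       has_rank n k E 2 \<and>
       (\<exists>u v. short_exact (B_alg n k) (L_mod n Y) u E v (L_mod n X)) \<and>
       rigid (B_alg n k) E \<and>
       (indecomposable (B_alg n k) E \<longleftrightarrow> \<not> almost_consecutive n X) \<and>
       (indecomposable (B_alg n k) E \<longleftrightarrow> \<not> almost_consecutive n Y))"
proof -
  define r where "r = (j - i) mod int n"
  have n: "0 < int n" using assms(1,2) by simp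
  \<comment> \<open>Separation keeps i away from the residues of j - 1, ..., j + k - 1. The choices
    l = - r and l = n - r then leave exactly 2 <= r <= n - k.\<close>
  have sep: "\<not> int n dvd r + l" if "- 1 \<le> l" "l \<le> int k - 1" for l
  proof
    assume "int n dvd r + l"
    then have "(r + l) mod int n = 0" by simp
    then have "(j - i + l) mod int n = 0" by (simp add: r_def mod_simps)
    then have "int n dvd (j + l) - i" by (simp add: mod_eq_0_iff_dvd algebra_simps)
    then have "i mod int n = (j + l) mod int n" by (simp only: mod_eq_dvd_iff dvd_diff_commute)
    moreover have "j + l \<in> {j - 1..j + int (k - 1)}" using that assms(1) by (simp add: of_nat_diff)
    ultimately show False using assms(3) unfolding separated_def mod_set_def by blast
  qed
  have rb: "0 \<le> r" "r < int n" using n by (simp_all add: r_def)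
  have "2 \<le> r"
  proof (rule ccontr)
    assume "\<not> 2 \<le> r"
    then show False using sep[of "- r"] rb assms(1) by simp
  qed
  moreover have "r \<le> int n - int k"
  proof (rule ccontr)
    assume "\<not> r \<le> int n - int k"
    then show False using sep[of "int n - r"] rb by simp
  qed
  ultimately interpret ar_numbers n k i r
    using assms(1,2) by unfold_locales simp_all
  have shi: "mod_set n {i + a..i + b} = nd ` {a..b}" for a b
    using mod_set_nd[of i 0 a b] by simp
  have shj: "mod_set n {j + a..j + b} = nd ` {r + a..r + b}" for a b
    by (rule mod_set_nd) (simp add: r_def)
  have un: "mod_set n (S \<union> T) = mod_set n S \<union> mod_set n T" for S T by (simp add: mod_set_def image_Un)
  have I: "I = nd ` DI"
    using shi[of 0 0] shj[of 0 "int k - 2"] unfolding assms(4) DI_def un image_Un by (simp add: add_diff_eq)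
  have X: "X = nd ` DX"
    using shi[of 1 1] shj[of 0 "int k - 3"] shj[of "int k - 1" "int k - 1"]
    unfolding assms(8) DX_def un image_Un by (simp add: add_diff_eq)
  have Y: "Y = nd ` DY"
    using shi[of 0 0] shi[of 2 "int k - 1"] shj[of "int k - 2" "int k - 2"]
    unfolding assms(9) DY_def un image_Un by (simp add: add_diff_eq)
  have "kset J" using assms(5,6) by (simp add: kset_def)
  then show ?thesis using main[of J] assms(7) unfolding I X Y by blast
qed


end
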